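(* Let $T>0$, let $b:[0,T]\times\mathbb{R}^d\to\mathbb{R}^d$ be measurable, and suppose there are nonnegative $C_0,C_1\in L^1([0,T])$ such that for all $t\in[0,T]$ and $x,y\in\mathbb{R}^d$, $|b(t,x)|\le C_0(t)(1+|x|)$ and $(b(t,x)-b(t,y))\cdot(x-y)\ge -C_1(t)|x-y|^2$. Let $1\le p\le\infty$, $u_T\in L^p_{\mathrm{loc}}(\mathbb{R}^d)$, and let $u\in C([0,T],L^p_{\mathrm{loc}}(\mathbb{R}^d))$ be the duality solution of $$\partial_tu+b(t,x)\cdot\nabla u=0\ \text{ in }(0,T)\times\mathbb{R}^d,\qquad u(T,\cdot)=u_T .$$ Assume $\beta:\mathbb{R}\to\mathbb{R}$ is smooth and satisfies $|\beta(r)|\le 1+|r|^\alpha$ for all $r\in\mathbb{R}$, for some $\alpha>0$ with $p/\alpha\ge1$. Then $\beta\circ u\in C([0,T],L^{p/\alpha}_{\mathrm{loc}}(\mathbb{R}^d))$ is the duality solution of the same equation with terminal value $\beta\circ u_T$.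
   Context: Continuity in time with values in $L^\infty_{\mathrm{loc}}$ (the case $p=\infty$) is understood for the weak-$\star$ topology; $p/\alpha=\infty$ if $p=\infty$. Backward Filippov flow: let $\hat b(t,x)$ be the convex hull of all limit points of $b(t,y)$ as $y\to x$. For every $(s,x)$ there is a unique absolutely continuous $[0,s]\ni t\mapsto\phi_{t,s}(x)$ with $\partial_t\phi_{t,s}(x)\in\hat b(t,\phi_{t,s}(x))$ for a.e. $t$ and $\phi_{s,s}(x)=x$; it is Lipschitz in $x$. Set $J_{t,s}(x)=\det(\nabla_x\phi_{t,s}(x))$ for a.e. $x$, $t\le s$. The good solution of $\partial_tf+\operatorname{div}(bf)=0$ on $(s,T)$ with $f(s,\cdot)=f_s$ is $f(t,x)=f_s(\phi_{s,t}(x))J_{s,t}(x)$ (zero where $J_{s,t}=0$). Duality solution with terminal value $u_T\in L^q_{\mathrm{loc}}$, $1\le q\le\infty$: the unique $u\in C([0,T],L^q_{\mathrm{loc}}(\mathbb{R}^d))$ such that for every $s\in[0,T)$ and every compactly supported $f_s\in L^{q'}(\mathbb{R}^d)$ ($1/q+1/q'=1$), $\int u(s,x)f_s(x)dx=\int u_T(x)f(T,x)dx$, where $f$ is the good solution started from $f_s$ at time $s$. Equivalently, it is the limit of the solutions $u^\varepsilon$ with velocity $b^\varepsilon$ for any family $(b^\varepsilon)\subset L^1([0,T],C^{0,1}(\mathbb{R}^d))$ converging a.e. to $b$ and satisfying the same inequalities as $b$ with $C_0,C_1$ independent of $\varepsilon$. *)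

theory Defs
  imports "HOL-Analysis.Analysis"
begin

section \<open>Lebesgue spaces\<close>

text \<open>Exponents are extended nonnegative reals, used in \<open>[1, \<infinity>]\<close>, so that \<open>1 / \<infinity> = 0\<close> in the
  relation between conjugate exponents and \<open>\<infinity> / \<alpha> = \<infinity>\<close> for finite \<open>\<alpha> > 0\<close>.
  Elements of the spaces are represented by total functions.\<close>

definition mem_Lp :: "ennreal \<Rightarrow> 'a measure \<Rightarrow> ('a \<Rightarrow> real) \<Rightarrow> bool" where
  "mem_Lp p M f \<longleftrightarrow> f \<in> borel_measurable M \<and>
     (if p = \<infinity> then \<exists>C. AE x in M. \<bar>f x\<bar> \<le> C
      else integrable M (\<lambda>x. \<bar>f x\<bar> powr enn2real p))"

definition mem_Lp_loc :: "ennreal \<Rightarrow> ('a::euclidean_space \<Rightarrow> real) \<Rightarrow> bool" where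
  "mem_Lp_loc p f \<longleftrightarrow> (\<forall>K. compact K \<longrightarrow> mem_Lp p (lebesgue_on K) f)"

definition compactly_supported :: "('a::euclidean_space \<Rightarrow> real) \<Rightarrow> bool" where
  "compactly_supported f \<longleftrightarrow> (\<exists>K. compact K \<and> (\<forall>x. x \<notin> K \<longrightarrow> f x = 0))"

text \<open>The space \<open>C([0,T], L\<^sup>p\<^sub>l\<^sub>o\<^sub>c)\<close>: for finite \<open>p\<close> with the strong topology, and for
  \<open>p = \<infinity>\<close> with the weak-star topology, the predual of \<open>L\<^sup>\<infinity>\<^sub>l\<^sub>o\<^sub>c\<close> being the space of
  compactly supported integrable functions.\<close>

definition cont_Lp_loc :: "real \<Rightarrow> ennreal \<Rightarrow> (real \<Rightarrow> 'a::euclidean_space \<Rightarrow> real) \<Rightarrow> bool" where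
  "cont_Lp_loc T p u \<longleftrightarrow> (\<forall>t\<in>{0..T}. mem_Lp_loc p (u t)) \<and>
     (if p = \<infinity>
      then \<forall>g. mem_Lp 1 lebesgue g \<and> compactly_supported g \<longrightarrow>
             continuous_on {0..T} (\<lambda>t. LINT x|lebesgue. u t x * g x)
      else \<forall>t\<in>{0..T}. \<forall>K. compact K \<longrightarrow>
             ((\<lambda>s. LINT x|lebesgue_on K. \<bar>u s x - u t x\<bar> powr enn2real p) \<longlongrightarrow> 0)
               (at t within {0..T}))"


section \<open>The backward Filippov flow\<close>

definition absolutely_cont_on :: "real \<Rightarrow> real \<Rightarrow> (real \<Rightarrow> 'a::real_normed_vector) \<Rightarrow> bool" where
  "absolutely_cont_on a b \<gamma> \<longleftrightarrow>
     (\<forall>\<epsilon>>0. \<exists>\<delta>>0. \<forall>(n::nat) l r.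
        (\<forall>i<n. a \<le> l i \<and> l i \<le> r i \<and> r i \<le> b) \<and>
        disjoint_family_on (\<lambda>i. {l i<..<r i}) {..<n} \<and>
        (\<Sum>i<n. r i - l i) < \<delta> \<longrightarrow>
        (\<Sum>i<n. norm (\<gamma> (r i) - \<gamma> (l i))) < \<epsilon>)"

text \<open>The convex hull of all limit points of \<open>b t y\<close> as \<open>y \<rightarrow> x\<close>, \<open>y \<noteq> x\<close>.\<close>

definition filippov_hull ::
    "(real \<Rightarrow> 'a::euclidean_space \<Rightarrow> 'a) \<Rightarrow> real \<Rightarrow> 'a \<Rightarrow> 'a set" where
  "filippov_hull b t x =
     convex hull {z. \<exists>y :: nat \<Rightarrow> 'a. (\<forall>n. y n \<noteq> x) \<and> y \<longlonglongrightarrow> x \<and> (\<lambda>n. b t (y n)) \<longlonglongrightarrow> z}"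

definition filippov_curve ::
    "(real \<Rightarrow> 'a::euclidean_space \<Rightarrow> 'a) \<Rightarrow> real \<Rightarrow> 'a \<Rightarrow> (real \<Rightarrow> 'a) \<Rightarrow> bool" where
  "filippov_curve b s x \<gamma> \<longleftrightarrow>
     absolutely_cont_on 0 s \<gamma> \<and>
     (AE t in lebesgue_on {0..s}.
        \<exists>v\<in>filippov_hull b t (\<gamma> t). (\<gamma> has_vector_derivative v) (at t)) \<and>
     \<gamma> s = x"

text \<open>\<open>filippov_flow b t s x\<close> is \<open>\<phi>\<^sub>t\<^sub>,\<^sub>s(x)\<close>, meaningful for \<open>0 \<le> t \<le> s\<close>: the position at the
  earlier time \<open>t\<close> of the unique curve that is at \<open>x\<close> at time \<open>s\<close>. The description is over
  the position, since a curve is determined on \<open>[0,s]\<close> only.\<close>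

definition filippov_flow ::
    "(real \<Rightarrow> 'a::euclidean_space \<Rightarrow> 'a) \<Rightarrow> real \<Rightarrow> real \<Rightarrow> 'a \<Rightarrow> 'a" where
  "filippov_flow b t s x = (THE y. \<exists>\<gamma>. filippov_curve b s x \<gamma> \<and> \<gamma> t = y)"

text \<open>The flow is Lipschitz in \<open>x\<close>, so the Jacobian is meaningful for almost every \<open>x\<close>;
  its value elsewhere is irrelevant.\<close>

definition flow_jacobian ::
    "(real \<Rightarrow> real ^ 'n \<Rightarrow> real ^ 'n) \<Rightarrow> real \<Rightarrow> real \<Rightarrow> real ^ 'n \<Rightarrow> real" where
  "flow_jacobian b t s x = det (jacobian (filippov_flow b t s) (at x))"


section \<open>Good solutions and duality solutions\<close>

definition good_solution ::
    "(real \<Rightarrow> real ^ 'n \<Rightarrow> real ^ 'n) \<Rightarrow> real \<Rightarrow> (real ^ 'n \<Rightarrow> real) \<Rightarrow>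
     real \<Rightarrow> real ^ 'n \<Rightarrow> real" where
  "good_solution b s f t x = f (filippov_flow b s t x) * flow_jacobian b s t x"

definition is_duality_solution ::
    "real \<Rightarrow> (real \<Rightarrow> real ^ 'n \<Rightarrow> real ^ 'n) \<Rightarrow> ennreal \<Rightarrow> (real ^ 'n \<Rightarrow> real) \<Rightarrow>
     (real \<Rightarrow> real ^ 'n \<Rightarrow> real) \<Rightarrow> bool" where
  "is_duality_solution T b q u\<^sub>T u \<longleftrightarrow>
     mem_Lp_loc q u\<^sub>T \<and> cont_Lp_loc T q u \<and>
     (\<forall>s\<in>{0..<T}. \<forall>q' f. 1 / q + 1 / q' = 1 \<and> mem_Lp q' lebesgue f \<and> compactly_supported f \<longrightarrow>
        (LINT x|lebesgue. u s x * f x) = (LINT x|lebesgue. u\<^sub>T x * good_solution b s f T x))"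


section \<open>Smooth functions\<close>

definition smooth_real :: "(real \<Rightarrow> real) \<Rightarrow> bool" where
  "smooth_real \<beta> \<longleftrightarrow> (\<forall>n x. (deriv ^^ n) \<beta> differentiable (at x))"

end

theory Submission
  imports Defs "HOL-Homology.Homology" "HOL-Complex_Analysis.Great_Picard"
begin

text \<open>Let \<open>\<phi>\<^sub>t\<close> be the backward flow from time \<open>T\<close> to time \<open>t\<close>. It is a limit of implicit Euler
  schemes, whose steps are resolvents of the one-sided Lipschitz field averaged in time; hence, besides
  being Lipschitz, it is onto and has connected fibres. By the theorems of Rademacher and Sard, almost
  every \<open>z\<close> only has preimages at which \<open>\<phi>\<^sub>t\<close> has a nonsingular derivative. Such a preimage is isolated
  in its fibre, so it is the whole fibre, and the Jacobian \<open>J\<^sub>t\<close> is positive there, because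
  \<open>\<bar>\<phi>\<^sub>t(x) - \<phi>\<^sub>t(y)\<bar> \<le> L \<bar>\<phi>\<^sub>s(x) - \<phi>\<^sub>s(y)\<bar>\<close> for \<open>t \<le> s\<close> allows one to deform \<open>\<phi>\<^sub>t\<close> to the identity near the
  preimage. With the almost everywhere defined inverse \<open>\<psi>\<^sub>t\<close>, the change of variables
  \<open>\<integral> w f(\<phi>\<^sub>t) J\<^sub>t = \<integral> w(\<psi>\<^sub>t) f\<close> turns the duality identity into \<open>u\<^sub>t = u\<^sub>T(\<psi>\<^sub>t)\<close> almost everywhere, a
  property inherited by \<open>\<beta>(u)\<close>. Continuity in time of \<open>\<beta>(u)\<close> is that of a Nemytskii operator if
  \<open>p < \<infinity>\<close>, and follows from \<open>\<psi>\<^sub>s \<rightarrow> \<psi>\<^sub>t\<close> almost everywhere if \<open>p = \<infinity>\<close>.\<close>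

section \<open>Homotopy and the sign of the determinant\<close>

text \<open>The nonlinearity is what forces the study of fibres. A Lipschitz map whose derivative is
  nonsingular almost everywhere can still be many-to-one; the change of variables would then express
  \<open>u t\<close> through sums over preimages, and \<open>\<beta>\<close> does not commute with
  sums. Injectivity cannot be read off the approximations: a single implicit step already collapses
  sets where \<open>b\<close> jumps, and limits of injective maps need not be injective. Being onto
  with connected preimages, however, is stable under composition, and together with properness it is
  enough in the limit. The sign of the Jacobian needs a separate argument because good solutions
  carry \<open>det\<close>, whereas the area formula produces its absolute value. The field has no
  regularity beyond the one-sided bound, and its time slices at fixed \<open>x\<close> are
  measurable only for almost every \<open>x\<close>. Hence it is tested on a dense set only, and
  equations for the scheme are replaced by one-sided inequalities against these test points. For
  \<open>p = \<infinity>\<close> weak-star continuity does not pass through \<open>\<beta>\<close>;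
  the representation of \<open>u t\<close> is then needed at every time, including \<open>T\<close>,
  where duality itself gives no information.\<close>

definition nsphere_points :: "nat \<Rightarrow> (nat \<Rightarrow> real) set" where
  "nsphere_points p = {x. (\<Sum>i\<le>p. (x i)\<^sup>2) = 1 \<and> (\<forall>i>p. x i = 0)}"

text \<open>\<open>nsphere\<close> lives in the space of sequences with the product topology; an
  explicit carrier lets continuity of maps of the sphere be proved with
  \<open>continuous_on\<close>.\<close>

lemma nsphere_eq_top_of_set: "nsphere p = top_of_set (nsphere_points p)"
  unfolding nsphere nsphere_points_def euclidean_product_topology ..

section \<open>Coordinates on the unit sphere and the degree of a nonvanishing map\<close>

definition coord_index :: "'n::finite \<Rightarrow> nat" where
  "coord_index = (SOME e. bij_betw e UNIV {..<CARD('n)})"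

lemma coord_index: "bij_betw (coord_index :: 'n::finite \<Rightarrow> nat) UNIV {..<CARD('n)}"
  unfolding coord_index_def
  using ex_bij_betw_finite_nat[OF finite, of "UNIV :: 'n set"]
  unfolding atLeast0LessThan by (rule someI_ex)

definition vec_of_seq :: "(nat \<Rightarrow> real) \<Rightarrow> real ^ 'n" where
  "vec_of_seq x = (\<chi> i. x (coord_index i))"

text \<open>The entries from \<open>CARD('n)\<close> on vanish, as membership in
  \<open>nsphere_points\<close> demands.\<close>

definition seq_of_vec :: "real ^ 'n \<Rightarrow> nat \<Rightarrow> real" where
  "seq_of_vec v j = (if j < CARD('n) then v $ inv_into UNIV coord_index j else 0)"

definition sphere_map :: "(real ^ 'n \<Rightarrow> real ^ 'n) \<Rightarrow> (nat \<Rightarrow> real) \<Rightarrow> nat \<Rightarrow> real" where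
  "sphere_map f x = seq_of_vec (f (vec_of_seq x) /\<^sub>R norm (f (vec_of_seq x)))"

text \<open>\<open>CARD('n) - 1\<close> is the dimension of the unit sphere of
  \<open>real ^ 'n\<close>; in dimension one the sphere has two points, and no separate treatment is
  necessary.\<close>

definition sphere_degree :: "(real ^ 'n \<Rightarrow> real ^ 'n) \<Rightarrow> int" where
  "sphere_degree f = Brouwer_degree2 (CARD('n) - 1) (sphere_map f)"

lemma inj_coord_index: "inj (coord_index :: 'n::finite \<Rightarrow> nat)"
  using coord_index by (rule bij_betw_imp_inj_on)

lemma coord_index_less: "coord_index (i :: 'n::finite) < CARD('n)"
  using coord_index[where 'n='n] bij_betwE by fastforce

lemma vec_of_seq_of_vec [simp]: "vec_of_seq (seq_of_vec v) = (v :: real ^ 'n)"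
  by (simp add: vec_eq_iff vec_of_seq_def seq_of_vec_def coord_index_less inj_coord_index)

lemma coord_index_inv: "j < CARD('n) \<Longrightarrow> coord_index (inv_into UNIV coord_index j :: 'n::finite) = j"
  using coord_index[where 'n='n] by (metis bij_betw_imp_surj_on f_inv_into_f lessThan_iff)

lemma seq_of_vec_of_seq:
  assumes "x \<in> nsphere_points (CARD('n) - 1)"
  shows "seq_of_vec (vec_of_seq x :: real ^ 'n) = x"
proof
  fix j
  have "x j = 0" if "\<not> j < CARD('n)"
    using assms that zero_less_card_finite[where 'a='n] unfolding nsphere_points_def
    by (auto simp del: zero_less_card_finite)
  then show "seq_of_vec (vec_of_seq x :: real ^ 'n) j = x j"
    by (auto simp: vec_of_seq_def seq_of_vec_def coord_index_inv)
qed

lemma card_minus1_atMost: "{..CARD('n::finite) - 1} = {..<CARD('n)}"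
  using zero_less_card_finite[where 'a='n] lessThan_Suc_atMost[of "CARD('n) - 1"] by (simp del: zero_less_card_finite)

lemma sum_seq_of_vec: "(\<Sum>j\<le>CARD('n) - 1. (x j)\<^sup>2) = (norm (vec_of_seq x :: real ^ 'n))\<^sup>2"
proof -
  have "(\<Sum>j\<le>CARD('n) - 1. (x j)\<^sup>2) = (\<Sum>j<CARD('n). (x j)\<^sup>2)"
    by (simp only: card_minus1_atMost)
  also have "\<dots> = (\<Sum>i\<in>(UNIV::'n set). (x (coord_index i))\<^sup>2)"
    by (rule sum.reindex_bij_betw[symmetric], rule coord_index)
  also have "\<dots> = (norm (vec_of_seq x :: real ^ 'n))\<^sup>2"
    by (simp add: norm_vec_def L2_set_def vec_of_seq_def sum_nonneg)
  finally show ?thesis .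
qed

lemma vec_of_seq_sphere:
  assumes "x \<in> nsphere_points (CARD('n) - 1)" shows "norm (vec_of_seq x :: real ^ 'n) = 1"
proof -
  have "(norm (vec_of_seq x :: real ^ 'n))\<^sup>2 = 1"
    using assms sum_seq_of_vec[of x, where 'n='n] by (simp add: nsphere_points_def)
  then show ?thesis using norm_ge_zero[of "vec_of_seq x :: real ^ 'n"]
    by (auto simp: power2_eq_1_iff simp del: norm_ge_zero)
qed

lemma seq_of_vec_sphere:
  assumes "norm (v :: real ^ 'n) = 1" shows "seq_of_vec v \<in> nsphere_points (CARD('n) - 1)"
  using sum_seq_of_vec[of "seq_of_vec v", where 'n='n] assms
  by (auto simp: nsphere_points_def seq_of_vec_def)

lemma continuous_vec_of_seq: "continuous_on S (vec_of_seq :: _ \<Rightarrow> real ^ 'n)"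
  unfolding vec_of_seq_def
  by (intro continuous_on_vec_lambda continuous_on_product_coordinates[THEN continuous_on_subset]) auto

lemma continuous_seq_of_vec: "continuous_on S (seq_of_vec :: real ^ 'n \<Rightarrow> _)"
  unfolding seq_of_vec_def[abs_def]
proof (rule continuous_on_coordinatewise_then_product)
  fix i
  show "continuous_on S (\<lambda>v :: real ^ 'n. if i < CARD('n) then v $ inv_into UNIV coord_index i else 0)"
    by (cases "i < CARD('n)") (auto intro!: continuous_intros)
qed

text \<open>As \<open>H\<close> has no zero on the sphere, it can be normalised at every time. The
  maps need not be linear: the homotopy used for the Jacobian is built from increments of the
  flow.\<close>

lemma homotopic_sphere_map:
  fixes H :: "real \<Rightarrow> real ^ 'n \<Rightarrow> real ^ 'n"
  assumes cont: "continuous_on ({0..1} \<times> sphere 0 1) (\<lambda>(t, v). H t v)"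
    and nz: "\<And>t v. t \<in> {0..1} \<Longrightarrow> norm v = 1 \<Longrightarrow> H t v \<noteq> 0"
  shows "homotopic_with (\<lambda>_. True) (nsphere (CARD('n) - 1)) (nsphere (CARD('n) - 1))
           (sphere_map (H 0)) (sphere_map (H 1))"
proof -
  let ?S = "nsphere_points (CARD('n) - 1)"
  define K where "K = (\<lambda>(t::real, x::nat \<Rightarrow> real). (t, vec_of_seq x :: real ^ 'n))"
  have K: "continuous_on ({0..1} \<times> ?S) K"
    unfolding K_def case_prod_unfold
    by (intro continuous_intros continuous_on_compose2[OF continuous_vec_of_seq[of UNIV]]) auto
  have KS: "K ` ({0..1} \<times> ?S) \<subseteq> {0..1} \<times> sphere 0 1"
    by (auto simp: K_def vec_of_seq_sphere)
  have HK: "continuous_on ({0..1} \<times> ?S) (\<lambda>z. H (fst z) (vec_of_seq (snd z)))"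
    using continuous_on_compose2[OF cont K KS] by (simp add: K_def case_prod_unfold)
  have nzK: "H (fst z) (vec_of_seq (snd z)) \<noteq> 0" if "z \<in> {0..1} \<times> ?S" for z
    using that nz[of "fst z"] vec_of_seq_sphere[of "snd z", where 'n='n] by auto
  have "continuous_on ({0..1} \<times> ?S) (\<lambda>z. sphere_map (H (fst z)) (snd z))"
    unfolding sphere_map_def
    by (rule continuous_on_compose2[OF continuous_seq_of_vec[of UNIV]])
       (use nzK in \<open>auto intro!: continuous_on_scaleR continuous_on_inverse continuous_on_norm HK simp del: One_nat_def\<close>)
  moreover have "sphere_map (H t) x \<in> ?S" if "t \<in> {0..1}" "x \<in> ?S" for t x
    unfolding sphere_map_def
    using nz[of t "vec_of_seq x"] that vec_of_seq_sphere[of x, where 'n='n]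
    by (intro seq_of_vec_sphere) auto
  ultimately have "continuous_map (top_of_set ({0..1} \<times> ?S)) (top_of_set ?S)
      (\<lambda>z. sphere_map (H (fst z)) (snd z))"
    by (auto simp: image_subset_iff)
  then show ?thesis
    unfolding nsphere_eq_top_of_set homotopic_with_def
    by (intro exI[of _ "\<lambda>z. sphere_map (H (fst z)) (snd z)"]) auto
qed

lemma sphere_degree_homotopy:
  fixes H :: "real \<Rightarrow> real ^ 'n \<Rightarrow> real ^ 'n"
  assumes "continuous_on ({0..1} \<times> sphere 0 1) (\<lambda>(t, v). H t v)"
    and "\<And>t v. t \<in> {0..1} \<Longrightarrow> norm v = 1 \<Longrightarrow> H t v \<noteq> 0"
  shows "sphere_degree (H 0) = sphere_degree (H 1)"
  unfolding sphere_degree_def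
  by (intro Brouwer_degree2_homotopic homotopic_sphere_map assms)

lemma sphere_degree_id: "sphere_degree (\<lambda>v :: real ^ 'n. v) = 1"
proof -
  have "Brouwer_degree2 (CARD('n) - 1) (sphere_map (\<lambda>v :: real ^ 'n. v)) = Brouwer_degree2 (CARD('n) - 1) id"
    by (rule Brouwer_degree2_eq)
       (auto simp: nsphere_eq_top_of_set sphere_map_def vec_of_seq_sphere seq_of_vec_of_seq)
  then show ?thesis by (simp add: sphere_degree_def)
qed

lemma continuous_map_sphere_map:
  fixes f :: "real ^ 'n \<Rightarrow> real ^ 'n"
  assumes "linear f" "\<And>v. f v = 0 \<Longrightarrow> v = 0"
  shows "continuous_map (nsphere (CARD('n) - 1)) (nsphere (CARD('n) - 1)) (sphere_map f)"
proof -
  have "homotopic_with (\<lambda>_. True) (nsphere (CARD('n) - 1)) (nsphere (CARD('n) - 1))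
      (sphere_map f) (sphere_map f)"
    using assms(2)
    by (intro homotopic_sphere_map[where H="\<lambda>_. f"])
       (force simp: case_prod_unfold intro!: continuous_intros linear_continuous_on_compose[OF _ assms(1)])+
  then show ?thesis using homotopic_with_imp_continuous_maps by blast
qed

text \<open>A linear \<open>g\<close> commutes with positive scaling, so normalising before
  \<open>g\<close> is applied does not change the direction of the result, and degrees
  multiply.\<close>

lemma sphere_degree_compose:
  fixes f g :: "real ^ 'n \<Rightarrow> real ^ 'n"
  assumes f: "linear f" "\<And>v. f v = 0 \<Longrightarrow> v = 0" and g: "linear g" "\<And>v. g v = 0 \<Longrightarrow> v = 0"
  shows "sphere_degree (g \<circ> f) = sphere_degree g * sphere_degree f"
proof -
  have "sphere_map (g \<circ> f) x = (sphere_map g \<circ> sphere_map f) x"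
    if "x \<in> nsphere_points (CARD('n) - 1)" for x
  proof -
    have "f (vec_of_seq x) \<noteq> 0"
      using f(2)[of "vec_of_seq x"] vec_of_seq_sphere[OF that] by auto
    then show ?thesis
      by (simp add: sphere_map_def linear_cmul[OF g(1)] field_simps)
  qed
  then have "sphere_degree (g \<circ> f) = Brouwer_degree2 (CARD('n) - 1) (sphere_map g \<circ> sphere_map f)"
    unfolding sphere_degree_def by (intro Brouwer_degree2_eq) (auto simp: nsphere_eq_top_of_set)
  also have "\<dots> = sphere_degree g * sphere_degree f"
    unfolding sphere_degree_def
    by (rule Brouwer_degree2_compose[OF continuous_map_sphere_map[OF f] continuous_map_sphere_map[OF g]])
  finally show ?thesis .
qed

section \<open>Degrees of reflections, diagonal maps and invertible matrices\<close>

definition reflect_along :: "'a::real_inner \<Rightarrow> 'a \<Rightarrow> 'a" where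
  "reflect_along a v = v - (2 * (a \<bullet> v) / (a \<bullet> a)) *\<^sub>R a"

lemma linear_reflect_along: "linear (reflect_along a)"
  by (intro linearI) (simp_all add: reflect_along_def algebra_simps add_divide_distrib)

lemma reflect_along_reflect: "a \<noteq> 0 \<Longrightarrow> reflect_along a (reflect_along a v) = v"
  by (simp add: reflect_along_def inner_diff_right algebra_simps)

lemma reflect_along_nonzero: "a \<noteq> 0 \<Longrightarrow> reflect_along a v = 0 \<Longrightarrow> v = 0"
  by (metis linear_0 linear_reflect_along reflect_along_reflect)

text \<open>The normal vector moves along the segment from \<open>a\<close> to \<open>c\<close>; all
  reflections on the way are invertible because the segment avoids 0.\<close>

lemma sphere_degree_reflect_cong:
  fixes a c :: "real ^ 'n"
  assumes "\<And>t. t \<in> {0..1} \<Longrightarrow> (1 - t) *\<^sub>R a + t *\<^sub>R c \<noteq> 0"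
  shows "sphere_degree (reflect_along a) = sphere_degree (reflect_along c)"
proof -
  let ?H = "\<lambda>t. reflect_along ((1 - t) *\<^sub>R a + t *\<^sub>R c)"
  have "sphere_degree (?H 0) = sphere_degree (?H 1)"
  proof (rule sphere_degree_homotopy)
    show "continuous_on ({0..1} \<times> sphere 0 1) (\<lambda>(t, v). ?H t v)"
      unfolding reflect_along_def case_prod_unfold
      by (intro continuous_intros ballI) (use assms in \<open>auto simp del: inner_add_left inner_add_right\<close>)
    show "?H t v \<noteq> 0" if "t \<in> {0..1}" "norm v = 1" for t v
      using reflect_along_nonzero[OF assms[OF that(1)], of v] that(2) by auto
  qed
  then show ?thesis by simp
qed

lemma reflect_along_axis: "reflect_along (axis k 1) (v :: real ^ 'n) = (\<chi> i. if i = k then - v $ i else v $ i)"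
proof -
  have "axis k 1 \<bullet> v = v $ k" for v :: "real ^ 'n"
    by (simp add: inner_axis')
  moreover have "axis k 1 \<bullet> (axis k 1 :: real ^ 'n) = 1"
    by (simp add: inner_axis_axis)
  ultimately show ?thesis by (auto simp: reflect_along_def vec_eq_iff axis_def)
qed

text \<open>The known degree -1 is that of the sign change of the coordinate numbered 0, which
  belongs to the axis \<open>k0\<close>; every other axis is deformed to this one.\<close>

lemma sphere_degree_reflect_axis: "sphere_degree (reflect_along (axis k 1 :: real ^ 'n)) = -1"
proof -
  define k0 where "k0 = (inv_into UNIV coord_index 0 :: 'n)"
  have ck0: "coord_index k0 = 0"
    unfolding k0_def by (rule coord_index_inv) simp
  have ck0': "coord_index i = 0 \<longleftrightarrow> i = k0" for i :: 'n
    using ck0 inj_coord_index by (metis injD)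
  have "sphere_map (reflect_along (axis k0 1 :: real ^ 'n)) x = (\<lambda>i. if i = 0 then - x i else x i)"
    if x: "x \<in> nsphere_points (CARD('n) - 1)" for x
  proof -
    let ?y = "\<lambda>i. if i = 0 then - x i else x i"
    have "(\<Sum>i\<le>CARD('n) - 1. (?y i)\<^sup>2) = (\<Sum>i\<le>CARD('n) - 1. (x i)\<^sup>2)"
      by (intro sum.cong) auto
    then have y: "?y \<in> nsphere_points (CARD('n) - 1)"
      using x by (auto simp: nsphere_points_def)
    have "reflect_along (axis k0 1 :: real ^ 'n) (vec_of_seq x) = vec_of_seq ?y"
      by (auto simp: reflect_along_axis vec_of_seq_def vec_eq_iff ck0')
    with y show ?thesis
      by (simp add: sphere_map_def vec_of_seq_sphere seq_of_vec_of_seq)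
  qed
  then have 1: "sphere_degree (reflect_along (axis k0 1 :: real ^ 'n)) = -1"
    unfolding sphere_degree_def Brouwer_degree2_reflection[of "CARD('n) - 1", symmetric]
    by (intro Brouwer_degree2_eq) (auto simp: nsphere_eq_top_of_set)
  have "(1 - t) *\<^sub>R axis k 1 + t *\<^sub>R axis k0 1 \<noteq> (0 :: real ^ 'n)" if "t \<in> {0..1}" for t :: real
  proof
    assume eq: "(1 - t) *\<^sub>R axis k 1 + t *\<^sub>R axis k0 1 = (0 :: real ^ 'n)"
    have "((1 - t) *\<^sub>R axis k 1 + t *\<^sub>R axis k0 1 :: real ^ 'n) $ k = 0"
      "((1 - t) *\<^sub>R axis k 1 + t *\<^sub>R axis k0 1 :: real ^ 'n) $ k0 = 0"
      by (simp_all only: eq zero_index)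
    then show False using that by (auto simp: axis_def split: if_splits)
  qed
  from sphere_degree_reflect_cong[OF this] 1 show ?thesis by simp
qed

lemma det_idplus:
  fixes m n :: "'n::finite" and c :: real
  assumes "m \<noteq> n"
  shows "det (\<chi> i j. if i = m \<and> j = n then c else of_bool (i = j)) = 1"
proof -
  have "(\<chi> i j. if i = m \<and> j = n then c else of_bool (i = j)) =
    (\<chi> k. if k = m then row m (mat 1) + c *s row n (mat 1) else row k (mat 1 :: real^'n^'n))"
    using assms by (auto simp: vec_eq_iff row_def mat_def)
  then show ?thesis using det_row_operation[OF assms, of "mat 1" c] by simp
qed

text \<open>Each entry is deformed to its sign without meeting 0, and the resulting sign change is a
  composition of \<open>card N\<close> reflections.\<close>

lemma sphere_degree_diagonal:
  fixes d :: "'n::finite \<Rightarrow> real"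
  assumes "\<And>i. d i \<noteq> 0"
  shows "sphere_degree (\<lambda>v :: real ^ 'n. \<chi> i. d i * v $ i) = (if (\<Prod>i\<in>UNIV. d i) > 0 then 1 else -1)"
proof -
  define D where "D = (\<lambda>S (v :: real ^ 'n). \<chi> i. if i \<in> S then - v $ i else v $ i)"
  have lin: "linear (D S)" for S
    by (intro linearI) (auto simp: D_def vec_eq_iff)
  have nz: "v = 0" if "D S v = 0" for S v
    using that by (auto simp: D_def vec_eq_iff split: if_splits)
  have D1: "D {k} = reflect_along (axis k 1)" for k
    by (auto simp: D_def fun_eq_iff reflect_along_axis)
  have deg: "sphere_degree (D S) = (-1) ^ card S" if "finite S" for S
    using that
  proof induction
    case empty
    then show ?case by (simp add: D_def sphere_degree_id)
  next
    case (insert k S)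
    have "D (insert k S) = D {k} \<circ> D S"
      using insert by (auto simp: D_def fun_eq_iff vec_eq_iff)
    then have "sphere_degree (D (insert k S)) = sphere_degree (D {k}) * sphere_degree (D S)"
      by (simp add: sphere_degree_compose lin nz)
    then show ?case using insert by (simp add: D1 sphere_degree_reflect_axis)
  qed
  define N where "N = {i. d i < 0}"
  let ?H = "\<lambda>t (v :: real ^ 'n). \<chi> i. ((1 - t) * d i + t * (if i \<in> N then -1 else 1)) * v $ i"
  have nz': "(1 - t) * d i + t * (if i \<in> N then -1 else 1) \<noteq> 0" if "t \<in> {0..1}" for t i
  proof (cases "i \<in> N")
    case True
    then have "(1 - t) * d i \<le> 0" "t = 0 \<Longrightarrow> (1 - t) * d i < 0"
      using that by (auto simp: N_def mult_le_0_iff)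
    then show ?thesis using True that by (cases "t = 0") auto
  next
    case False
    then have "(1 - t) * d i \<ge> 0" "t = 0 \<Longrightarrow> (1 - t) * d i > 0"
      using that assms[of i] by (auto simp: N_def)
    then show ?thesis using False that by (cases "t = 0") auto
  qed
  have "sphere_degree (?H 0) = sphere_degree (?H 1)"
  proof (rule sphere_degree_homotopy)
    show "continuous_on ({0..1} \<times> sphere 0 1) (\<lambda>(t, v). ?H t v)"
      by (auto simp: case_prod_unfold intro!: continuous_intros)
    show "?H t v \<noteq> 0" if "t \<in> {0..1}" "norm v = 1" for t v
    proof
      assume "?H t v = 0"
      then have "v $ i = 0" for i
        using nz'[OF that(1), of i] by (auto simp: vec_eq_iff)
      then have "v = 0" by (simp add: vec_eq_iff)
      then show False using that by simp
    qed
  qed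
  moreover have "?H 1 = D N"
    by (auto simp: D_def fun_eq_iff vec_eq_iff)
  ultimately have "sphere_degree (\<lambda>v :: real ^ 'n. \<chi> i. d i * v $ i) = (-1) ^ card N"
    using deg[of N] by simp
  moreover have "(\<Prod>i\<in>UNIV. d i) = (-1) ^ card N * (\<Prod>i\<in>UNIV. \<bar>d i\<bar>)"
  proof -
    have "(\<Prod>i\<in>UNIV. d i) = (\<Prod>i\<in>UNIV. (if i \<in> N then -1 else 1) * \<bar>d i\<bar>)"
      by (intro prod.cong) (auto simp: N_def)
    also have "\<dots> = (\<Prod>i\<in>UNIV. if i \<in> N then -1 else 1) * (\<Prod>i\<in>UNIV. \<bar>d i\<bar>)"
      by (rule prod.distrib)
    also have "(\<Prod>i\<in>UNIV. if i \<in> N then -1 else (1::real)) = (-1) ^ card N"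
      by (simp add: prod.If_cases)
    finally show ?thesis .
  qed
  moreover have "(\<Prod>i\<in>UNIV. \<bar>d i\<bar>) > 0"
    using assms by (intro prod_pos) auto
  ultimately show ?thesis
    by (cases "even (card N)") auto
qed

lemma matrix_mult_nonzero:
  fixes A :: "real ^ 'n ^ 'n"
  assumes "det A \<noteq> 0" "A *v v = 0" shows "v = 0"
  using assms by (metis invertible_det_nz matrix_left_invertible_ker invertible_left_inverse)

text \<open>Degree and sign of the determinant are both multiplicative, so elementary matrices
  suffice. A transposition is the reflection along a difference of two axes; a shear is deformed to
  the identity by shrinking its off-diagonal entry; a zero row contradicts
  \<open>det A \<noteq> 0\<close>.\<close>

lemma sphere_degree_matrix:
  fixes A :: "real ^ 'n ^ 'n"
  shows "det A \<noteq> 0 \<Longrightarrow> sphere_degree ((*v) A) = (if det A > 0 then 1 else -1)"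
proof (induction A rule: induct_matrix_elementary)
  case (1 A B)
  have "sphere_degree ((*v) (A ** B)) = sphere_degree ((*v) A) * sphere_degree ((*v) B)"
    unfolding matrix_vector_mult_matrix_matrix_mult_compose
    using "1.prems" by (intro sphere_degree_compose) (auto simp: det_mul dest: matrix_mult_nonzero)
  then show ?case using 1
    by (auto simp: det_mul zero_less_mult_iff)
next
  case (2 A i)
  then show ?case by (simp add: det_zero_row)
next
  case (3 A)
  have det: "det A = (\<Prod>i\<in>UNIV. A $ i $ i)" using "3.hyps" by (rule det_diagonal)
  then have nz: "A $ i $ i \<noteq> 0" for i using "3.prems" by simp
  have "A *v v = (\<chi> i. A $ i $ i * v $ i)" for v
  proof -
    have "(\<Sum>j\<in>UNIV. A $ i $ j * v $ j) = (\<Sum>j\<in>UNIV. if j = i then A $ i $ i * v $ i else 0)" for i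
      using "3.hyps" by (intro sum.cong) auto
    then show ?thesis by (simp add: matrix_vector_mult_def)
  qed
  then have "(*v) A = (\<lambda>v. \<chi> i. A $ i $ i * v $ i)" by auto
  then show ?case using sphere_degree_diagonal[of "\<lambda>i. A $ i $ i"] nz det by simp
next
  case (4 m n)
  let ?A = "\<chi> i j. mat 1 $ i $ Transposition.transpose m n j :: real^'n^'n"
  let ?a = "axis m 1 - axis n 1 :: real ^ 'n"
  have "det ?A = of_int (sign (Transposition.transpose m n)) * det (mat 1 :: real^'n^'n)"
    by (rule det_permute_columns) (simp add: permutes_swap_id)
  then have det: "det ?A = -1" using 4 by (simp add: sign_swap_id)
  have aa: "?a \<bullet> ?a = 2" using 4 by (simp add: inner_diff inner_axis_axis)
  have "?A *v v = reflect_along ?a v" for v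
  proof -
    have "(?A *v v) $ i = v $ (Transposition.transpose m n i)" for i
    proof -
      have "(\<Sum>j\<in>UNIV. of_bool (i = Transposition.transpose m n j) * v $ j) =
         (\<Sum>j\<in>UNIV. if j = Transposition.transpose m n i then v $ j else 0)"
        by (intro sum.cong) auto
      then show ?thesis by (simp add: matrix_vector_mult_def mat_def of_bool_def)
    qed
    moreover have "reflect_along ?a v $ i = v $ (Transposition.transpose m n i)" for i
    proof -
      have "?a \<bullet> v = v $ m - v $ n" by (simp add: inner_diff_left inner_axis')
      then show ?thesis
        using 4 unfolding reflect_along_def aa by (auto simp: axis_def Transposition.transpose_def field_simps)
    qed
    ultimately show ?thesis by (simp add: vec_eq_iff)
  qed
  then have "(*v) ?A = reflect_along ?a" by auto
  moreover have "sphere_degree (reflect_along ?a) = sphere_degree (reflect_along (axis m 1))"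
  proof (rule sphere_degree_reflect_cong)
    fix t :: real
    have "((1 - t) *\<^sub>R ?a + t *\<^sub>R axis m 1) $ m = 1"
      using 4 by (simp add: axis_def)
    then show "(1 - t) *\<^sub>R ?a + t *\<^sub>R axis m 1 \<noteq> 0" by (metis zero_index zero_neq_one)
  qed
  ultimately show ?case using det by (simp add: sphere_degree_reflect_axis)
next
  case (5 m n c)
  let ?A = "\<lambda>c. \<chi> i j. if i = m \<and> j = n then c else of_bool (i = j) :: real^'n^'n"
  have A: "?A c *v v = v + (c * v $ n) *\<^sub>R axis m 1" for c v
  proof -
    have "(\<Sum>j\<in>UNIV. (if i = m \<and> j = n then c else of_bool (i = j)) * v $ j) =
       (\<Sum>j\<in>UNIV. (if j = i then v $ j else 0) + (if j = n then if i = m then c * v $ n else 0 else 0))" for i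
      using 5 by (intro sum.cong) auto
    then show ?thesis
      by (auto simp: vec_eq_iff matrix_vector_mult_def axis_def sum.distrib)
  qed
  let ?H = "\<lambda>t v. v + ((t * c) * v $ n) *\<^sub>R axis m 1 :: real ^ 'n"
  have "sphere_degree (?H 0) = sphere_degree (?H 1)"
  proof (rule sphere_degree_homotopy)
    show "continuous_on ({0..1} \<times> sphere 0 1) (\<lambda>(t, v). ?H t v)"
      by (auto simp: case_prod_unfold intro!: continuous_intros)
    show "?H t v \<noteq> 0" if "t \<in> {0..1}" "norm v = 1" for t v
    proof
      assume H: "?H t v = 0"
      then have "?H t v $ n = 0" by simp
      then have "v $ n = 0" using 5 by (simp add: axis_def)
      with H have "v = 0" by simp
      then show False using that by simp
    qed
  qed
  moreover have "(*v) (?A c) = ?H 1" using A by auto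
  ultimately have "sphere_degree ((*v) (?A c)) = 1" by (simp add: sphere_degree_id)
  then show ?case using det_idplus[OF "5.hyps", of c] by simp
qed

lemma det_pos_of_homotopic_id:
  fixes A :: "real ^ 'n ^ 'n" and H :: "real \<Rightarrow> real ^ 'n \<Rightarrow> real ^ 'n"
  assumes "continuous_on ({0..1} \<times> sphere 0 1) (\<lambda>(t, v). H t v)"
    and "\<And>t v. t \<in> {0..1} \<Longrightarrow> norm v = 1 \<Longrightarrow> H t v \<noteq> 0"
    and "H 0 = (\<lambda>v. v)" and "H 1 = (*v) A" and "det A \<noteq> 0"
  shows "det A > 0"
  using sphere_degree_homotopy[OF assms(1,2)] sphere_degree_matrix[OF assms(5)] assms(3,4)
  by (auto simp: sphere_degree_id split: if_splits)

section \<open>Absolutely continuous functions\<close>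

text \<open>Averages over \<open>cbox x (x + h)\<close> only give right derivatives; the left ones
  come from the same theorem for the reflected function. The null set works for all lower endpoints
  \<open>a\<close> at once.\<close>

lemma lebesgue_differentiation_real:
  fixes f :: "real \<Rightarrow> 'b::euclidean_space"
  assumes f: "\<And>a b. f integrable_on {a..b}"
  obtains N where "negligible N"
    "\<And>a x. x \<notin> N \<Longrightarrow> a < x \<Longrightarrow> ((\<lambda>t. integral {a..t} f) has_vector_derivative f x) (at x)"
proof -
  have f': "(\<lambda>x. f (- x)) integrable_on {a..b}" for a b
  proof -
    have "(\<lambda>x. f (- x)) integrable_on {- (- a)..- (- b)}" by (rule iffD2[OF Henstock_Kurzweil_Integration.integrable_reflect_real f])
    then show ?thesis by (simp only: minus_minus)
  qed
  obtain N1 where N1: "negligible N1" "\<And>x e. x \<notin> N1 \<Longrightarrow> 0 < e \<Longrightarrow>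
      \<exists>d>0. \<forall>h. 0 < h \<and> h < d \<longrightarrow> norm (integral (cbox x (x + h *\<^sub>R One)) f /\<^sub>R h ^ DIM(real) - f x) < e"
    by (rule integrable_ccontinuous_explicit[of f]) (use f in \<open>simp add: cbox_interval\<close>, blast)
  obtain N2 where N2: "negligible N2" "\<And>x e. x \<notin> N2 \<Longrightarrow> 0 < e \<Longrightarrow>
      \<exists>d>0. \<forall>h. 0 < h \<and> h < d \<longrightarrow> norm (integral (cbox x (x + h *\<^sub>R One)) (\<lambda>x. f (- x)) /\<^sub>R h ^ DIM(real) - f (- x)) < e"
    by (rule integrable_ccontinuous_explicit[of "\<lambda>x. f (- x)"]) (use f' in \<open>simp add: cbox_interval\<close>, blast)
  have "negligible (uminus ` N2)"
  proof (rule negligible_locally_Lipschitz_image[OF order_refl N2(1)])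
    fix x :: real
    show "\<exists>T B. open T \<and> x \<in> T \<and> (\<forall>y\<in>N2 \<inter> T. norm (- y - - x) \<le> B * norm (y - x))"
      by (rule exI[of _ UNIV], rule exI[of _ 1]) auto
  qed
  then have "negligible (N1 \<union> uminus ` N2)" using N1(1) by simp
  moreover have "((\<lambda>t. integral {a..t} f) has_vector_derivative f x) (at x)"
    if x: "x \<notin> N1 \<union> uminus ` N2" "a < x" for a x
    unfolding has_vector_derivative_def has_derivative_at_alt
  proof (intro conjI allI impI)
    show "bounded_linear (\<lambda>h. h *\<^sub>R f x)" by (rule bounded_linear_scaleR_left)
    fix e :: real assume e: "0 < e"
    have "- x \<notin> N2" using x(1) by force
    from N1(2)[OF _ e, of x] N2(2)[OF this e] x(1) obtain d1 d2 where
      d1: "d1 > 0" "\<And>h. 0 < h \<Longrightarrow> h < d1 \<Longrightarrow> norm (integral {x..x + h} f /\<^sub>R h - f x) < e" and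
      d2: "d2 > 0" "\<And>h. 0 < h \<Longrightarrow> h < d2 \<Longrightarrow> norm (integral {-x..-x + h} (\<lambda>x. f (- x)) /\<^sub>R h - f x) < e"
      by auto
    have scale: "norm (v - h *\<^sub>R w) \<le> e * h" if "norm (v /\<^sub>R h - w) < e" "h > 0" for v w :: 'b and h
    proof -
      have "v - h *\<^sub>R w = h *\<^sub>R (v /\<^sub>R h - w)" using that(2) by (simp add: algebra_simps)
      then have "norm (v - h *\<^sub>R w) = h * norm (v /\<^sub>R h - w)" using that(2) by simp
      then show ?thesis using that by (simp add: mult.commute mult_left_mono)
    qed
    define d where "d = min (min d1 d2) (x - a)"
    have "norm (integral {a..y} f - integral {a..x} f - (y - x) *\<^sub>R f x) \<le> e * norm (y - x)"
      if y: "norm (y - x) < d" for y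
    proof (cases "y = x")
      case False
      show ?thesis
      proof (cases "x < y")
        case True
        have "integral {a..x} f + integral {x..y} f = integral {a..y} f"
          using True x(2) by (intro Henstock_Kurzweil_Integration.integral_combine f) auto
        then have "integral {a..y} f - integral {a..x} f = integral {x..x + (y - x)} f"
          by (simp add: algebra_simps)
        then show ?thesis using scale[OF d1(2)[of "y - x"]] True y by (simp add: d_def)
      next
        case less: False
        have "a \<le> y" using y less by (auto simp: d_def)
        then have A: "integral {a..y} f + integral {y..x} f = integral {a..x} f"
          using less by (intro Henstock_Kurzweil_Integration.integral_combine f) auto
        define J where "J = integral {-x..-x + (x - y)} (\<lambda>x. f (- x))"
        have B: "integral {y..x} f = J"
          using Henstock_Kurzweil_Integration.integral_reflect_real[where f=f and a=y and b=x]
          by (simp add: J_def)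
        have "integral {a..y} f - integral {a..x} f - (y - x) *\<^sub>R f x = - (J - (x - y) *\<^sub>R f x)"
          unfolding A[symmetric] B by (simp add: algebra_simps)
        then have "norm (integral {a..y} f - integral {a..x} f - (y - x) *\<^sub>R f x) =
          norm (integral {-x..-x + (x - y)} (\<lambda>x. f (- x)) - (x - y) *\<^sub>R f x)"
          by (simp only: norm_minus_cancel J_def)
        also have "\<dots> \<le> e * (x - y)"
          using scale[OF d2(2)[of "x - y"]] less False y by (simp add: d_def)
        finally show ?thesis using less by simp
      qed
    qed simp
    moreover have "d > 0" using d1 d2 x(2) by (simp add: d_def)
    ultimately show "\<exists>d>0. \<forall>y. norm (y - x) < d \<longrightarrow>
        norm (integral {a..y} f - integral {a..x} f - (y - x) *\<^sub>R f x) \<le> e * norm (y - x)" by blast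
  qed
  ultimately show thesis using that by blast
qed

text \<open>Serves to prove absolute continuity of differences and products from one increment
  estimate against two functions already known to be absolutely continuous.\<close>

lemma absolutely_cont_on_dominated:
  fixes f :: "real \<Rightarrow> 'a::real_normed_vector" and g :: "real \<Rightarrow> 'b::real_normed_vector"
    and h :: "real \<Rightarrow> 'c::real_normed_vector"
  assumes g: "absolutely_cont_on a b g" and h: "absolutely_cont_on a b h" and "0 \<le> K"
    and le: "\<And>l r. a \<le> l \<Longrightarrow> l \<le> r \<Longrightarrow> r \<le> b \<Longrightarrow>
      norm (f r - f l) \<le> K * (norm (g r - g l) + norm (h r - h l))"
  shows "absolutely_cont_on a b f"
  unfolding absolutely_cont_on_def
proof (intro allI impI)
  fix \<epsilon> :: real assume "\<epsilon> > 0"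
  \<comment> \<open>The factor 2 serves the two dominating functions; \<open>K + 1\<close> covers
    \<open>K = 0\<close> and makes the final inequality strict.\<close>
  define \<epsilon>' where "\<epsilon>' = \<epsilon> / (K + 1) / 2"
  have \<epsilon>': "\<epsilon>' > 0" using \<open>\<epsilon> > 0\<close> \<open>0 \<le> K\<close> by (simp add: \<epsilon>'_def)
  obtain d1 where d1: "d1 > 0" "\<And>(n::nat) l r. (\<forall>i<n. a \<le> l i \<and> l i \<le> r i \<and> r i \<le> b) \<and>
      disjoint_family_on (\<lambda>i. {l i<..<r i}) {..<n} \<and> (\<Sum>i<n. r i - l i) < d1 \<Longrightarrow>
      (\<Sum>i<n. norm (g (r i) - g (l i))) < \<epsilon>'"
    using g \<epsilon>' unfolding absolutely_cont_on_def by meson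
  obtain d2 where d2: "d2 > 0" "\<And>(n::nat) l r. (\<forall>i<n. a \<le> l i \<and> l i \<le> r i \<and> r i \<le> b) \<and>
      disjoint_family_on (\<lambda>i. {l i<..<r i}) {..<n} \<and> (\<Sum>i<n. r i - l i) < d2 \<Longrightarrow>
      (\<Sum>i<n. norm (h (r i) - h (l i))) < \<epsilon>'"
    using h \<epsilon>' unfolding absolutely_cont_on_def by meson
  show "\<exists>\<delta>>0. \<forall>(n::nat) l r. (\<forall>i<n. a \<le> l i \<and> l i \<le> r i \<and> r i \<le> b) \<and>
      disjoint_family_on (\<lambda>i. {l i<..<r i}) {..<n} \<and> (\<Sum>i<n. r i - l i) < \<delta> \<longrightarrow>
      (\<Sum>i<n. norm (f (r i) - f (l i))) < \<epsilon>"
  proof (intro exI[of _ "min d1 d2"] conjI allI impI)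
    fix n :: nat and l r :: "nat \<Rightarrow> real"
    assume A: "(\<forall>i<n. a \<le> l i \<and> l i \<le> r i \<and> r i \<le> b) \<and>
      disjoint_family_on (\<lambda>i. {l i<..<r i}) {..<n} \<and> (\<Sum>i<n. r i - l i) < min d1 d2"
    have "(\<Sum>i<n. norm (f (r i) - f (l i))) \<le>
        (\<Sum>i<n. K * (norm (g (r i) - g (l i)) + norm (h (r i) - h (l i))))"
      using A by (intro sum_mono le) auto
    also have "\<dots> = K * ((\<Sum>i<n. norm (g (r i) - g (l i))) + (\<Sum>i<n. norm (h (r i) - h (l i))))"
      by (simp only: sum_distrib_left[symmetric] sum.distrib)
    also have "\<dots> \<le> K * (\<epsilon>' + \<epsilon>')"
      using d1(2)[of n l r] d2(2)[of n l r] A \<open>0 \<le> K\<close> by (intro mult_left_mono add_mono) auto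
    also have "\<dots> < (K + 1) * (\<epsilon>' + \<epsilon>')" using \<epsilon>' by (simp add: algebra_simps)
    also have "\<epsilon>' + \<epsilon>' = \<epsilon> / (K + 1)" by (simp only: \<epsilon>'_def field_sum_of_halves)
    also have "(K + 1) * (\<epsilon> / (K + 1)) = \<epsilon>" using \<open>0 \<le> K\<close> by simp
    finally show "(\<Sum>i<n. norm (f (r i) - f (l i))) < \<epsilon>" .
  qed (use d1 d2 in auto)
qed

lemma absolutely_cont_on_mono_arg:
  assumes "absolutely_cont_on a b f" "a \<le> a'" "b' \<le> b"
  shows "absolutely_cont_on a' b' f"
  unfolding absolutely_cont_on_def
proof (intro allI impI)
  fix \<epsilon> :: real assume "\<epsilon> > 0"
  then obtain d where d: "d > 0" "\<And>(n::nat) l r. (\<forall>i<n. a \<le> l i \<and> l i \<le> r i \<and> r i \<le> b) \<and>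
      disjoint_family_on (\<lambda>i. {l i<..<r i}) {..<n} \<and> (\<Sum>i<n. r i - l i) < d \<Longrightarrow>
      (\<Sum>i<n. norm (f (r i) - f (l i))) < \<epsilon>"
    using assms(1) unfolding absolutely_cont_on_def by meson
  show "\<exists>\<delta>>0. \<forall>(n::nat) l r. (\<forall>i<n. a' \<le> l i \<and> l i \<le> r i \<and> r i \<le> b') \<and>
      disjoint_family_on (\<lambda>i. {l i<..<r i}) {..<n} \<and> (\<Sum>i<n. r i - l i) < \<delta> \<longrightarrow>
      (\<Sum>i<n. norm (f (r i) - f (l i))) < \<epsilon>"
    using assms(2,3) by (intro exI[of _ d] conjI d(1) allI impI d(2)) fastforce+
qed

lemma absolutely_cont_on_imp_continuous_on:
  fixes f :: "real \<Rightarrow> 'a::real_normed_vector"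
  assumes "absolutely_cont_on a b f"
  shows "continuous_on {a..b} f"
  unfolding continuous_on_iff
proof (intro ballI allI impI)
  fix x e :: real assume x: "x \<in> {a..b}" and "e > 0"
  then obtain d where d: "d > 0" "\<And>(n::nat) l r. (\<forall>i<n. a \<le> l i \<and> l i \<le> r i \<and> r i \<le> b) \<and>
      disjoint_family_on (\<lambda>i. {l i<..<r i}) {..<n} \<and> (\<Sum>i<n. r i - l i) < d \<Longrightarrow>
      (\<Sum>i<n. norm (f (r i) - f (l i))) < e"
    using assms unfolding absolutely_cont_on_def by meson
  have step: "norm (f v - f u) < e" if "a \<le> u" "u \<le> v" "v \<le> b" "v - u < d" for u v
    using d(2)[of 1 "\<lambda>_. u" "\<lambda>_. v"] that by (simp add: disjoint_family_on_def)
  have "dist (f y) (f x) < e" if y: "y \<in> {a..b}" "dist y x < d" for y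
    using step[of x y] step[of y x] x y by (cases "x \<le> y") (auto simp: dist_norm norm_minus_commute)
  then show "\<exists>d>0. \<forall>x'\<in>{a..b}. dist x' x < d \<longrightarrow> dist (f x') (f x) < e" using d(1) by blast
qed

text \<open>Tags in the exceptional null set are confined to an open set of small measure, where absolute
  continuity controls the increments.\<close>

lemma absolutely_cont_on_nondecreasing:
  fixes H :: "real \<Rightarrow> real"
  assumes "a \<le> b" and ac: "absolutely_cont_on a b H" and N: "negligible N"
    and deriv: "\<And>t. t \<in> {a..b} - N \<Longrightarrow> \<exists>v\<ge>0. (H has_vector_derivative v) (at t)"
  shows "H a \<le> H b"
proof (rule field_le_epsilon)
  fix \<epsilon> :: real assume "\<epsilon> > 0"
  \<comment> \<open>\<open>e\<close> is spent once on the tags in \<open>N\<close> and at rate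
    \<open>e\<close> per unit length on the other tags.\<close>
  define e where "e = \<epsilon> / (2 * (1 + (b - a)))"
  have e: "e > 0" using \<open>\<epsilon> > 0\<close> \<open>a \<le> b\<close> by (simp add: e_def)
  obtain d where d: "d > 0" "\<And>(n::nat) l r. (\<forall>i<n. a \<le> l i \<and> l i \<le> r i \<and> r i \<le> b) \<and>
      disjoint_family_on (\<lambda>i. {l i<..<r i}) {..<n} \<and> (\<Sum>i<n. r i - l i) < d \<Longrightarrow>
      (\<Sum>i<n. norm (H (r i) - H (l i))) < e"
    using ac e unfolding absolutely_cont_on_def by meson
  have Nnull: "N \<in> null_sets lebesgue" using N by (simp add: negligible_iff_null_sets)
  obtain U where U: "open U" "N \<subseteq> U" "emeasure lebesgue (U - N) < ennreal d"
    by (rule sets_lebesgue_outer_open[of N d]) (use Nnull d(1) in \<open>auto simp: null_sets_def\<close>)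
  then have "emeasure lebesgue U < ennreal d"
    using emeasure_Diff_null_set[OF Nnull, of U] by simp
  then have "emeasure lebesgue U < \<infinity>" using ennreal_less_top by (metis infinity_ennreal_def less_trans)
  then have U': "U \<in> lmeasurable"
    using U(1) by (intro fmeasurableI) auto
  have U'': "measure lebesgue U < d"
    using U' \<open>emeasure lebesgue U < ennreal d\<close> d(1) by (simp add: emeasure_eq_measure2 ennreal_less_iff)
  have "\<exists>\<rho>>0. \<forall>u v. u \<le> t \<longrightarrow> t \<le> v \<longrightarrow> u \<in> ball t \<rho> \<longrightarrow> v \<in> ball t \<rho> \<longrightarrow> H v - H u \<ge> - e * (v - u)"
    if t: "t \<in> {a..b} - N" for t
  proof -
    obtain w where w: "w \<ge> 0" "(H has_vector_derivative w) (at t)" using deriv[OF t] by blast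
    then obtain \<rho> where \<rho>: "\<rho> > 0"
      "\<And>y. \<bar>y - t\<bar> < \<rho> \<Longrightarrow> \<bar>H y - H t - (y - t) * w\<bar> \<le> e * \<bar>y - t\<bar>"
      using e unfolding has_vector_derivative_def has_derivative_at_alt by auto
    have "H v - H u \<ge> - e * (v - u)" if "u \<le> t" "t \<le> v" "u \<in> ball t \<rho>" "v \<in> ball t \<rho>" for u v
    proof -
      have "(v - t) * w \<ge> 0" "(u - t) * w \<le> 0" using that w(1) by (auto simp: mult_le_0_iff)
      then have "H v - H t \<ge> - e * (v - t)" "H u - H t \<le> e * (t - u)"
        using \<rho>(2)[of v] \<rho>(2)[of u] that by (auto simp: dist_real_def)
      then show ?thesis by (simp add: algebra_simps)
    qed
    then show ?thesis using \<rho>(1) by blast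
  qed
  then obtain \<rho> where \<rho>: "\<And>t. t \<in> {a..b} - N \<Longrightarrow> \<rho> t > 0"
    "\<And>t u v. t \<in> {a..b} - N \<Longrightarrow> u \<le> t \<Longrightarrow> t \<le> v \<Longrightarrow> u \<in> ball t (\<rho> t) \<Longrightarrow> v \<in> ball t (\<rho> t) \<Longrightarrow>
      H v - H u \<ge> - e * (v - u)"
    by metis
  \<comment> \<open>Outside \<open>{a..b}\<close> the value is immaterial: the unit ball only
    completes \<open>\<gamma>\<close> to a gauge on the whole line.\<close>
  define \<gamma> where "\<gamma> = (\<lambda>t. if t \<in> N then U else if t \<in> {a..b} then ball t (\<rho> t) else ball t 1)"
  have "gauge \<gamma>" unfolding gauge_def using U(1,2) \<rho>(1) by (auto simp: \<gamma>_def)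
  then obtain p where p: "p tagged_division_of {a..b}" "\<gamma> fine p"
    by (rule fine_division_exists_real)
  note pD = tagged_division_ofD[OF p(1)]
  have pK: "\<exists>l r. K = {l..r} \<and> a \<le> l \<and> l \<le> x \<and> x \<le> r \<and> r \<le> b" if xK: "(x, K) \<in> p" for x K
  proof -
    obtain l r where "K = {l..r}" using pD(4)[OF xK] by auto
    then show ?thesis using pD(2,3)[OF xK] by auto
  qed
  define p1 where "p1 = {z \<in> p. fst z \<in> N}"
  define p2 where "p2 = {z \<in> p. fst z \<notin> N}"
  have fin: "finite p1" "finite p2" using pD(1) by (auto simp: p1_def p2_def)
  have split: "p = p1 \<union> p2" "p1 \<inter> p2 = {}" by (auto simp: p1_def p2_def)
  have cont: "(\<Sum>(x,K)\<in>p. Sup K - Inf K) = b - a"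
    using additive_tagged_division_1[OF \<open>a \<le> b\<close> p(1), of "\<lambda>x. x"] by simp
  have nonneg: "Sup K - Inf K \<ge> 0" if "(x, K) \<in> p" for x K
    using pK[OF that] by auto
  have 2: "(\<Sum>(x,K)\<in>p2. H (Sup K) - H (Inf K)) \<ge> - e * (b - a)"
  proof -
    have "- e * (b - a) \<le> - e * (\<Sum>(x,K)\<in>p2. Sup K - Inf K)"
    proof -
      have "(\<Sum>(x,K)\<in>p2. Sup K - Inf K) \<le> (\<Sum>(x,K)\<in>p. Sup K - Inf K)"
        using pD(1) nonneg by (intro sum_mono2) (auto simp: p2_def)
      then show ?thesis using e unfolding cont by simp
    qed
    also have "\<dots> = (\<Sum>(x,K)\<in>p2. - e * (Sup K - Inf K))" by (simp add: sum_distrib_left case_prod_unfold)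
    also have "\<dots> \<le> (\<Sum>(x,K)\<in>p2. H (Sup K) - H (Inf K))"
    proof (rule sum_mono, clarify)
      fix x K assume "(x, K) \<in> p2"
      then have xK: "(x, K) \<in> p" "x \<notin> N" by (auto simp: p2_def)
      obtain l r where lr: "K = {l..r}" "a \<le> l" "l \<le> x" "x \<le> r" "r \<le> b" using pK[OF xK(1)] by blast
      have "K \<subseteq> \<gamma> x" using p(2) xK(1) by (auto simp: fine_def)
      moreover have "\<gamma> x = ball x (\<rho> x)" using lr xK(2) by (simp add: \<gamma>_def)
      moreover have "l \<in> K" "r \<in> K" using lr by auto
      ultimately have "l \<in> ball x (\<rho> x)" "r \<in> ball x (\<rho> x)" by auto
      then show "- e * (Sup K - Inf K) \<le> H (Sup K) - H (Inf K)"
        using \<rho>(2)[of x l r] lr xK(2) by auto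
    qed
    finally show ?thesis .
  qed
  have 1: "(\<Sum>(x,K)\<in>p1. norm (H (Sup K) - H (Inf K))) < e"
  proof -
    obtain h where h: "bij_betw h {..<card p1} p1"
      using ex_bij_betw_nat_finite[OF fin(1)] by (auto simp: atLeast0LessThan)
    let ?l = "\<lambda>i. Inf (snd (h i))" and ?r = "\<lambda>i. Sup (snd (h i))"
    have hp: "h i \<in> p1" if "i < card p1" for i using h that by (auto dest: bij_betwE)
    have ep: "\<exists>x l r. h i = (x, {l..r}) \<and> (x, {l..r}) \<in> p \<and> x \<in> N \<and> a \<le> l \<and> l \<le> r \<and> r \<le> b" if "i < card p1" for i
    proof -
      obtain x K where xK: "h i = (x, K)" by (cases "h i")
      then have "(x, K) \<in> p" "x \<in> N" using hp[OF that] by (auto simp: p1_def)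
      then show ?thesis using pK[of x K] xK by fastforce
    qed
    have disj: "disjoint_family_on (\<lambda>i. {?l i<..<?r i}) {..<card p1}"
      unfolding disjoint_family_on_def
    proof (intro ballI impI)
      fix i j assume ij: "i \<in> {..<card p1}" "j \<in> {..<card p1}" "i \<noteq> j"
      obtain x l r where i: "h i = (x, {l..r})" "(x, {l..r}) \<in> p" "l \<le> r" using ep[of i] ij by auto
      obtain y l' r' where j: "h j = (y, {l'..r'})" "(y, {l'..r'}) \<in> p" "l' \<le> r'" using ep[of j] ij by auto
      have "h i \<noteq> h j" using h ij by (auto simp: bij_betw_def inj_on_def)
      then have "interior {l..r} \<inter> interior {l'..r'} = {}" using pD(5)[OF i(2) j(2)] i j by auto
      then show "{?l i<..<?r i} \<inter> {?l j<..<?r j} = {}" using i j by auto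
    qed
    have "(\<Sum>i<card p1. ?r i - ?l i) = (\<Sum>z\<in>p1. Sup (snd z) - Inf (snd z))"
      using sum.reindex_bij_betw[OF h, of "\<lambda>z. Sup (snd z) - Inf (snd z)"] .
    also have "\<dots> < d"
    proof -
      have meas: "measure lebesgue (\<Union>i<card p1. {?l i<..<?r i}) = (\<Sum>i<card p1. measure lebesgue {?l i<..<?r i})"
      proof (intro measure_finite_Union disj)
        show "emeasure lebesgue {?l i<..<?r i} \<noteq> \<infinity>" for i
          using fmeasurableD2[OF lmeasurable_box[of "?l i" "?r i"]] by (simp add: box_real)
      qed auto
      have "(\<Sum>i<card p1. measure lebesgue {?l i<..<?r i}) = (\<Sum>i<card p1. ?r i - ?l i)"
        using ep by (intro sum.cong) fastforce+
      moreover have "measure lebesgue (\<Union>i<card p1. {?l i<..<?r i}) \<le> measure lebesgue U"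
      proof (rule measure_mono_fmeasurable[OF _ _ U'])
        show "(\<Union>i<card p1. {?l i<..<?r i}) \<subseteq> U"
        proof
          fix y assume "y \<in> (\<Union>i<card p1. {?l i<..<?r i})"
          then obtain i where i: "i < card p1" "y \<in> {?l i<..<?r i}" by auto
          obtain x l r where xlr: "h i = (x, {l..r})" "(x, {l..r}) \<in> p" "x \<in> N" "l \<le> r" using ep[OF i(1)] by auto
          have "{l..r} \<subseteq> \<gamma> x" using p(2) xlr(2) by (auto simp: fine_def)
          then show "y \<in> U" using xlr i by (auto simp: \<gamma>_def)
        qed
      qed auto
      ultimately show ?thesis
        using meas U'' sum.reindex_bij_betw[OF h, of "\<lambda>z. Sup (snd z) - Inf (snd z)"] by linarith
    qed
    finally have small: "(\<Sum>i<card p1. ?r i - ?l i) < d" .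
    have "(\<Sum>i<card p1. norm (H (?r i) - H (?l i))) < e"
      using ep small disj by (intro d(2)) fastforce
    then show ?thesis
      using sum.reindex_bij_betw[OF h, of "\<lambda>z. norm (H (Sup (snd z)) - H (Inf (snd z)))"]
      by (simp add: case_prod_unfold)
  qed
  have "H b - H a = (\<Sum>(x,K)\<in>p. H (Sup K) - H (Inf K))"
    using additive_tagged_division_1[OF \<open>a \<le> b\<close> p(1), of H] by simp
  also have "\<dots> = (\<Sum>(x,K)\<in>p1. H (Sup K) - H (Inf K)) + (\<Sum>(x,K)\<in>p2. H (Sup K) - H (Inf K))"
    using sum.union_disjoint[OF fin split(2)] split(1) by simp
  also have "\<dots> \<ge> - e - e * (b - a)"
  proof -
    have "- norm (H (Sup K) - H (Inf K)) \<le> H (Sup K) - H (Inf K)" for K by simp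
    then have "(\<Sum>(x,K)\<in>p1. - norm (H (Sup K) - H (Inf K))) \<le> (\<Sum>(x,K)\<in>p1. H (Sup K) - H (Inf K))"
      by (intro sum_mono) (auto simp del: real_norm_def)
    then show ?thesis using 1 2 by (simp add: case_prod_unfold sum_negf)
  qed
  finally have "H a \<le> H b + e * (1 + (b - a))" by (simp add: algebra_simps)
  also have "e * (1 + (b - a)) = \<epsilon> / 2" using \<open>a \<le> b\<close> by (simp add: e_def field_simps)
  finally show "H a \<le> H b + \<epsilon>" using \<open>\<epsilon> > 0\<close> by simp
qed

text \<open>Cutting \<open>g\<close> at a height \<open>n\<close> leaves a remainder whose integral
  is below \<open>\<epsilon> / 2\<close> on any union of intervals, while the bounded part
  contributes at most \<open>n\<close> times the total length.\<close>

lemma absolutely_cont_on_integral: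
  fixes g :: "real \<Rightarrow> real"
  assumes g: "integrable (lebesgue_on {a..b}) g" and pos: "\<And>t. t \<in> {a..b} \<Longrightarrow> 0 \<le> g t"
  shows "absolutely_cont_on a b (\<lambda>t. integral {a..t} g)"
  unfolding absolutely_cont_on_def
proof (intro allI impI)
  fix \<epsilon> :: real assume "\<epsilon> > 0"
  let ?M = "lebesgue_on {a..b}"
  have gm[measurable]: "g \<in> borel_measurable ?M" using g by auto
  have "(\<lambda>n. LINT t|?M. g t - min (g t) (real n)) \<longlonglongrightarrow> (LINT t|?M. 0)"
  proof (rule integral_dominated_convergence[where w="\<lambda>t. \<bar>g t\<bar>"])
    show "AE t in ?M. (\<lambda>n. g t - min (g t) (real n)) \<longlonglongrightarrow> 0"
    proof (rule AE_I2)
      fix t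
      obtain m where m: "g t \<le> real m" using real_arch_simple by blast
      have "\<forall>\<^sub>F n in sequentially. g t - min (g t) (real n) = 0"
        using eventually_ge_at_top[of m] by eventually_elim (use m in auto)
      then show "(\<lambda>n. g t - min (g t) (real n)) \<longlonglongrightarrow> 0" by (rule tendsto_eventually)
    qed
    show "AE t in ?M. norm (g t - min (g t) (real n)) \<le> \<bar>g t\<bar>" for n
      using pos by (intro AE_I2) (auto simp: space_restrict_space)
  qed (use g in auto)
  then have "\<forall>\<^sub>F n in sequentially. (LINT t|?M. g t - min (g t) (real n)) < \<epsilon> / 2"
    using \<open>\<epsilon> > 0\<close> by (intro order_tendstoD(2)) auto
  then obtain n where n: "(LINT t|?M. g t - min (g t) (real n)) < \<epsilon> / 2"
    unfolding eventually_sequentially by blast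
  let ?k = "\<lambda>t. g t - min (g t) (real n)"
  have kint: "integrable ?M ?k"
    using pos g by (intro Bochner_Integration.integrable_bound[OF g]) (auto simp: space_restrict_space)
  have indint: "integrable ?M (\<lambda>t. indicator {l<..<r} t * f t)"
    if "integrable ?M f" "a \<le> l" "r \<le> b" for f :: "real \<Rightarrow> real" and l r
  proof -
    have "{l<..<r} \<in> sets ?M" using that by (subst sets_restrict_space_iff) auto
    from integrable_mult_indicator[OF this that(1)] show ?thesis by simp
  qed
  have incr: "integral {a..r} g - integral {a..l} g \<le> (LINT t|?M. indicator {l<..<r} t * ?k t) + n * (r - l)"
    if lr: "a \<le> l" "l \<le> r" "r \<le> b" for l r :: real
  proof -
    have gi: "g integrable_on {a..b}" by (rule integrable_on_lebesgue_on[OF g]) simp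
    have "integral {a..l} g + integral {l..r} g = integral {a..r} g"
      using lr by (intro Henstock_Kurzweil_Integration.integral_combine integrable_on_subinterval[OF gi]) auto
    moreover have "integral {l..r} g = (LINT t|?M. indicator {l<..<r} t * g t)"
    proof -
      have i: "integrable ?M (\<lambda>t. indicator {l<..<r} t * g t)"
        using indint[OF g] lr by simp
      have "(LINT t|?M. indicator {l<..<r} t * g t) = integral {a..b} (\<lambda>t. indicator {l<..<r} t * g t)"
        by (rule lebesgue_integral_eq_integral[OF i]) simp
      also have "\<dots> = integral {a..b} (\<lambda>t. if t \<in> {l<..<r} then g t else 0)"
        by (intro Henstock_Kurzweil_Integration.integral_cong) (auto simp: indicator_def)
      also have "\<dots> = integral ({l<..<r} \<inter> {a..b}) g" by (rule integral_restrict_Int)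
      also have "{l<..<r} \<inter> {a..b} = {l<..<r}" using lr by auto
      also have "integral {l<..<r} g = integral {l..r} g" by (simp add: integral_open_interval_real)
      finally show ?thesis by simp
    qed
    moreover have "(LINT t|?M. indicator {l<..<r} t * g t) \<le> (LINT t|?M. indicator {l<..<r} t * ?k t + real n * indicator {l<..<r} t)"
    proof (rule integral_mono)
      show "integrable ?M (\<lambda>t. indicator {l<..<r} t * g t)"
        using indint[OF g] lr by simp
      have 1: "integrable ?M (\<lambda>t. indicator {l<..<r} t * ?k t)"
        using indint[OF kint] lr by simp
      have 2: "integrable ?M (\<lambda>t. indicator {l<..<r} t :: real)"
        using indint[of "\<lambda>_. 1" l r] lr by simp
      show "integrable ?M (\<lambda>t. indicator {l<..<r} t * ?k t + real n * indicator {l<..<r} t)"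
        using 1 2 by auto
    qed (auto simp: indicator_def)
    moreover have "(LINT t|?M. indicator {l<..<r} t * ?k t + real n * indicator {l<..<r} t) =
       (LINT t|?M. indicator {l<..<r} t * ?k t) + n * (r - l)"
    proof -
      have 1: "integrable ?M (\<lambda>t. indicator {l<..<r} t * ?k t)"
        using indint[OF kint] lr by simp
      have 2: "integrable ?M (\<lambda>t. indicator {l<..<r} t :: real)"
        using indint[of "\<lambda>_. 1" l r] lr by simp
      have "measure ?M {l<..<r} = r - l"
        using lr by (subst measure_restrict_space) auto
      then have 3: "(LINT t|?M. indicator {l<..<r} t :: real) = r - l"
        using lr by (simp add: space_restrict_space Int_absorb2 subset_iff)
      show ?thesis using 1 2 3 by simp
    qed
    ultimately show ?thesis by linarith
  qed
  show "\<exists>\<delta>>0. \<forall>(m::nat) l r. (\<forall>i<m. a \<le> l i \<and> l i \<le> r i \<and> r i \<le> b) \<and>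
      disjoint_family_on (\<lambda>i. {l i<..<r i}) {..<m} \<and> (\<Sum>i<m. r i - l i) < \<delta> \<longrightarrow>
      (\<Sum>i<m. norm (integral {a..r i} g - integral {a..l i} g)) < \<epsilon>"
  proof (intro exI[of _ "\<epsilon> / (2 * (real n + 1))"] conjI allI impI)
    show "0 < \<epsilon> / (2 * (real n + 1))" using \<open>\<epsilon> > 0\<close> by simp
    fix m :: nat and l r :: "nat \<Rightarrow> real"
    assume A: "(\<forall>i<m. a \<le> l i \<and> l i \<le> r i \<and> r i \<le> b) \<and>
      disjoint_family_on (\<lambda>i. {l i<..<r i}) {..<m} \<and> (\<Sum>i<m. r i - l i) < \<epsilon> / (2 * (real n + 1))"
    have ind: "integrable ?M (\<lambda>t. indicator {l i<..<r i} t * ?k t)" if "i < m" for i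
      using indint[OF kint] A that by simp
    have pos': "norm (integral {a..r i} g - integral {a..l i} g) = integral {a..r i} g - integral {a..l i} g" if "i < m" for i
    proof -
      have gi: "g integrable_on {a..b}" by (rule integrable_on_lebesgue_on[OF g]) simp
      have "integral {a..l i} g \<le> integral {a..r i} g"
        using A that pos by (intro integral_subset_le integrable_on_subinterval[OF gi]) auto
      then show ?thesis by simp
    qed
    have "(\<Sum>i<m. norm (integral {a..r i} g - integral {a..l i} g)) \<le>
        (\<Sum>i<m. (LINT t|?M. indicator {l i<..<r i} t * ?k t) + n * (r i - l i))"
      using A pos' incr by (intro sum_mono) auto
    also have "\<dots> = (LINT t|?M. (\<Sum>i<m. indicator {l i<..<r i} t * ?k t)) + n * (\<Sum>i<m. r i - l i)"
    proof -
      have "(LINT t|?M. (\<Sum>i<m. indicator {l i<..<r i} t * ?k t)) = (\<Sum>i<m. LINT t|?M. indicator {l i<..<r i} t * ?k t)"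
        by (rule Bochner_Integration.integral_sum) (use ind in auto)
      then show ?thesis by (simp only: sum.distrib sum_distrib_left)
    qed
    also have "(LINT t|?M. (\<Sum>i<m. indicator {l i<..<r i} t * ?k t)) \<le> (LINT t|?M. ?k t)"
    proof (rule integral_mono)
      show "integrable ?M (\<lambda>t. \<Sum>i<m. indicator {l i<..<r i} t * ?k t)"
        by (rule Bochner_Integration.integrable_sum) (use ind in auto)
      show "(\<Sum>i<m. indicator {l i<..<r i} t * ?k t) \<le> ?k t" for t
      proof -
        have "(\<Sum>i<m. indicator {l i<..<r i} t) = (indicator (\<Union>i<m. {l i<..<r i}) t :: real)"
          using indicator_UN_disjoint[of "{..<m}" "\<lambda>i. {l i<..<r i}" t, where 'c=real] A by simp
        moreover have "indicator (\<Union>i<m. {l i<..<r i}) t \<le> (1::real)" by (simp add: indicator_def)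
        moreover have "?k t \<ge> 0" by simp
        ultimately show ?thesis by (simp only: sum_distrib_right[symmetric] mult_left_le_one_le) (metis indicator_pos_le mult_left_le_one_le)
      qed
    qed (use kint in auto)
    also have "(LINT t|?M. ?k t) + n * (\<Sum>i<m. r i - l i) < \<epsilon> / 2 + \<epsilon> / 2"
    proof (rule add_less_le_mono)
      have "n * (\<Sum>i<m. r i - l i) \<le> (real n + 1) * (\<epsilon> / (2 * (real n + 1)))"
        using A by (intro mult_mono sum_nonneg) auto
      also have "\<dots> = \<epsilon> / 2" by (simp add: field_simps)
      finally show "n * (\<Sum>i<m. r i - l i) \<le> \<epsilon> / 2" .
    qed (use n in auto)
    finally show "(\<Sum>i<m. norm (integral {a..r i} g - integral {a..l i} g)) < \<epsilon>" by simp
  qed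
qed

text \<open>The interval measures of \<open>m + F\<close> and \<open>m - F\<close> add up to an absolutely continuous measure, so
  the first of them has a density.\<close>

lemma interval_measure_dominated_null:
  fixes F1 F2 :: "real \<Rightarrow> real" and g :: "real \<Rightarrow> real"
  assumes mono1: "\<And>x y. x \<le> y \<Longrightarrow> F1 x \<le> F1 y" and mono2: "\<And>x y. x \<le> y \<Longrightarrow> F2 x \<le> F2 y"
    and cont1: "continuous_on UNIV F1" and cont2: "continuous_on UNIV F2"
    and g[measurable]: "g \<in> borel_measurable borel"
    and sum: "\<And>x y. x \<le> y \<Longrightarrow> (\<integral>\<^sup>+t. ennreal (g t) * indicator {x<..y} t \<partial>lborel) = ennreal (F1 y - F1 x + (F2 y - F2 x))"
  shows "absolutely_continuous lborel (interval_measure F1)"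
proof -
  have em: "emeasure (interval_measure F) {x<..y} = ennreal (F y - F x)"
    if "x \<le> y" "\<And>x y. x \<le> y \<Longrightarrow> F x \<le> F y" "continuous_on UNIV F" for F :: "real \<Rightarrow> real" and x y
    using that by (intro emeasure_interval_measure_Ioc)
      (auto simp: continuous_on_eq_continuous_within continuous_at_imp_continuous_at_within)
  let ?\<nu> = "\<lambda>A. emeasure (interval_measure F1) A + emeasure (interval_measure F2) A"
  \<comment> \<open>The sum of the two interval measures, specified by its values on Borel sets. It
    agrees with the measure of density \<open>g\<close> on half-open intervals, hence on all Borel
    sets.\<close>
  define \<nu> where "\<nu> = measure_of UNIV (sets borel) ?\<nu>"
  have sets\<nu>: "sets \<nu> = sets borel" "space \<nu> = UNIV"
    unfolding \<nu>_def using sets.sigma_sets_eq[of "borel::real measure"] by (auto simp: sets_measure_of_conv space_measure_of_conv)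
  have em\<nu>: "emeasure \<nu> A = ?\<nu> A" if "A \<in> sets borel" for A
    unfolding \<nu>_def
  proof (rule emeasure_measure_of_sigma)
    show "sigma_algebra UNIV (sets (borel::real measure))"
      using sets.sigma_algebra_axioms[of "borel::real measure"] by simp
    show "positive (sets borel) ?\<nu>" by (simp add: positive_def)
    show "countably_additive (sets borel) ?\<nu>"
    proof (rule countably_additiveI)
      fix A :: "nat \<Rightarrow> real set" assume A: "range A \<subseteq> sets borel" "disjoint_family A"
      then have "suminf (\<lambda>i. ?\<nu> (A i)) = suminf (\<lambda>i. emeasure (interval_measure F1) (A i)) + suminf (\<lambda>i. emeasure (interval_measure F2) (A i))"
        by (intro suminf_add[symmetric]) auto
      also have "\<dots> = ?\<nu> (\<Union>i. A i)"
        using A by (simp add: suminf_emeasure)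
      finally show "suminf (\<lambda>i. ?\<nu> (A i)) = ?\<nu> (\<Union>i. A i)" .
    qed
  qed (use that in auto)
  have eq: "density lborel (\<lambda>t. ennreal (g t)) = \<nu>"
  proof (rule measure_eqI_generator_eq[where \<Omega>=UNIV and E="range (\<lambda>(x, y). {x<..y::real})" and A="\<lambda>i. {- real i<..real i}"])
    show "Int_stable (range (\<lambda>(x, y). {x<..y::real}))"
      by (auto simp: Int_stable_def)
    show "sets (density lborel (\<lambda>t. ennreal (g t))) = sigma_sets UNIV (range (\<lambda>(x, y). {x<..y::real}))"
      by (simp add: borel_sigma_sets_Ioc)
    show "sets \<nu> = sigma_sets UNIV (range (\<lambda>(x, y). {x<..y::real}))"
      by (simp add: sets\<nu> borel_sigma_sets_Ioc)
    show "(\<Union>i. {- real i<..real i}) = UNIV"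
    proof -
      have "x \<in> (\<Union>i. {- real i<..real i})" for x :: real
      proof -
        obtain n where "\<bar>x\<bar> < real n" using reals_Archimedean2 by blast
        then show ?thesis by (intro UN_I[of n]) auto
      qed
      then show ?thesis by blast
    qed
    fix X assume "X \<in> range (\<lambda>(x, y). {x<..y::real})"
    then obtain x y where X: "X = {x<..y}" by auto
    show "emeasure (density lborel (\<lambda>t. ennreal (g t))) X = emeasure \<nu> X"
    proof (cases "x \<le> y")
      case True
      then show ?thesis
        using mono1[OF True] mono2[OF True]
        by (simp add: X em\<nu> emeasure_density em[OF _ mono1 cont1] em[OF _ mono2 cont2] sum flip: ennreal_plus)
    qed (simp add: X)
  next
    show "emeasure (density lborel (\<lambda>t. ennreal (g t))) {- real i<..real i} \<noteq> \<infinity>" for i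
      by (simp add: emeasure_density sum)
  qed auto
  show ?thesis
    unfolding absolutely_continuous_def
  proof
    fix A assume A: "A \<in> null_sets (lborel :: real measure)"
    then have "A \<in> null_sets (density lborel (\<lambda>t. ennreal (g t)))"
      by (subst null_sets_density_iff) (auto dest: AE_not_in)
    then have "emeasure \<nu> A = 0" "A \<in> sets borel" unfolding eq by (auto simp: null_sets_def sets\<nu>)
    then show "A \<in> null_sets (interval_measure F1)" using em\<nu> by auto
  qed
qed

text \<open>The Radon-Nikodym density is finite almost everywhere on bounded intervals since these
  have finite mass, so it can be replaced by a real function, to which differentiation of integrals
  applies.\<close>

lemma interval_measure_has_density:
  fixes F1 :: "real \<Rightarrow> real"
  assumes mono1: "\<And>x y. x \<le> y \<Longrightarrow> F1 x \<le> F1 y" and cont1: "continuous_on UNIV F1"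
    and bdd: "\<And>x. \<bar>F1 x\<bar> \<le> K"
    and ac: "absolutely_continuous lborel (interval_measure F1)"
  obtains h where "\<And>a b. h integrable_on {a..b}" "\<And>a b. a \<le> b \<Longrightarrow> integral {a..b} h = F1 b - F1 a"
proof -
  have em: "emeasure (interval_measure F1) {x<..y} = ennreal (F1 y - F1 x)" if "x \<le> y" for x y
    using that mono1 cont1 by (intro emeasure_interval_measure_Ioc)
      (auto simp: continuous_on_eq_continuous_within continuous_at_imp_continuous_at_within)
  obtain f where f[measurable]: "f \<in> borel_measurable lborel" and fd: "density lborel f = interval_measure F1"
    using sigma_finite_measure.Radon_Nikodym[OF _ ac] sigma_finite_lborel by auto
  have nn: "(\<integral>\<^sup>+t. f t * indicator {x<..y} t \<partial>lborel) = ennreal (F1 y - F1 x)" if "x \<le> y" for x y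
    using em[OF that] unfolding fd[symmetric] by (simp add: emeasure_density)
  have fin: "AE t in lborel. t \<in> {x<..y} \<longrightarrow> f t \<noteq> \<infinity>" if "x \<le> y" for x y
  proof -
    have "AE t in lborel. f t * indicator {x<..y} t \<noteq> \<infinity>"
      using nn[OF that] by (intro nn_integral_PInf_AE) auto
    then show ?thesis by eventually_elim (auto simp: indicator_def)
  qed
  define h where "h = (\<lambda>t. enn2real (f t))"
  have hm[measurable]: "h \<in> borel_measurable borel" unfolding h_def by simp
  have "((h has_integral (F1 b - F1 a)) {a..b})" if "a \<le> b" for a b
  proof -
    have "(\<integral>\<^sup>+t. ennreal (h t * indicator {a<..b} t) \<partial>lborel) = ennreal (F1 b - F1 a)"
      unfolding nn[OF that, symmetric]
    proof (rule nn_integral_cong_AE)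
      show "AE t in lborel. ennreal (h t * indicator {a<..b} t) = f t * indicator {a<..b} t"
        using fin[OF that] by eventually_elim (auto simp: h_def indicator_def less_top)
    qed
    then have "((\<lambda>t. h t * indicator {a<..b} t) has_integral (F1 b - F1 a)) UNIV"
      using mono1[OF that] by (intro nn_integral_has_integral) (auto simp: h_def)
    then have "((\<lambda>t. if t \<in> {a<..b} then h t else 0) has_integral (F1 b - F1 a)) UNIV"
      by (rule has_integral_eq[rotated]) (simp add: indicator_def)
    then have "(h has_integral (F1 b - F1 a)) {a<..b}" by (simp only: has_integral_restrict_UNIV)
    moreover have n1: "negligible {t \<in> {a<..b} - {a..b}. h t \<noteq> 0}" and n2: "negligible {t \<in> {a..b} - {a<..b}. h t \<noteq> 0}"
      by (rule negligible_subset[of "{a}"]; auto)+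
    ultimately show ?thesis using has_integral_spike_set_eq[OF n1 n2] by simp
  qed
  then have hi: "a \<le> b \<Longrightarrow> (h has_integral (F1 b - F1 a)) {a..b}" for a b .
  have "h integrable_on {a..b}" for a b
  proof (cases "a \<le> b")
    case True
    then show ?thesis using hi by (auto simp: integrable_on_def)
  qed (simp add: integrable_on_empty)
  moreover have "a \<le> b \<Longrightarrow> integral {a..b} h = F1 b - F1 a" for a b
    using hi by (rule integral_unique)
  ultimately show thesis using that by blast

qed

section \<open>One-sided values and resolvents\<close>

text \<open>The condition says that \<open>w + c *\<^sub>R z\<close> is monotonically related to the
  graph over \<open>G\<close> of \<open>B\<close> plus \<open>c\<close> times the identity. If
  \<open>G\<close> is dense and \<open>B\<close> has linear growth and satisfies the same inequality
  on \<open>G\<close>, these \<open>w\<close> are the values of a maximal monotone extension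
  (shifted back by \<open>c\<close>), which exist at every \<open>z\<close> although
  \<open>B\<close> is only known on \<open>G\<close>.\<close>

definition one_sided_value :: "'a::real_inner set \<Rightarrow> ('a \<Rightarrow> 'a) \<Rightarrow> real \<Rightarrow> 'a \<Rightarrow> 'a \<Rightarrow> bool" where
  "one_sided_value G B c z w \<longleftrightarrow> (\<forall>y\<in>G. (w - B y) \<bullet> (z - y) \<ge> - c * (norm (z - y))\<^sup>2)"

lemma dense_sequence:
  fixes G :: "'a::metric_space set"
  assumes "closure G = UNIV"
  obtains y where "\<And>n::nat. y n \<in> G" "y \<longlonglongrightarrow> z"
  using assms closure_sequential[of z G] by auto

text \<open>Testing a one-sided inequality at points that approach \<open>z\<close> from a
  prescribed direction isolates the component of a value in this direction.\<close>

lemma dense_direction: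
  fixes G :: "'a::euclidean_space set" and z e :: 'a
  assumes "closure G = UNIV" and "e \<noteq> 0"
  obtains y and h :: "nat \<Rightarrow> real"
  where "\<And>n. y n \<in> G" "\<And>n. y n \<noteq> z" "\<And>n. h n > 0" "h \<longlonglongrightarrow> 0" "y \<longlonglongrightarrow> z"
    "(\<lambda>n. (y n - z) /\<^sub>R h n) \<longlonglongrightarrow> e"
proof -
  define h where "h = (\<lambda>n. inverse (real (Suc n)))"
  have hpos: "h n > 0" for n by (simp add: h_def)
  have h0: "h \<longlonglongrightarrow> 0" unfolding h_def by (rule LIMSEQ_inverse_real_of_nat)
  \<comment> \<open>Relative error below \<open>h n\<close> yields convergence of the quotients to
    \<open>e\<close>; relative error below \<open>norm e\<close> keeps the points different from
    \<open>z\<close>.\<close>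
  have "\<exists>y\<in>G. dist y (z + h n *\<^sub>R e) < h n * min (h n) (norm e)" for n
    using assms hpos[of n] closure_approachable[of "z + h n *\<^sub>R e" G] by auto
  then obtain y where y: "\<And>n. y n \<in> G"
    "\<And>n. dist (y n) (z + h n *\<^sub>R e) < h n * min (h n) (norm e)" by metis
  have close: "norm ((y n - z) /\<^sub>R h n - e) < min (h n) (norm e)" for n
  proof -
    have "(y n - z) /\<^sub>R h n - e = (y n - (z + h n *\<^sub>R e)) /\<^sub>R h n"
      using hpos[of n] by (simp add: algebra_simps)
    then have "norm ((y n - z) /\<^sub>R h n - e) = dist (y n) (z + h n *\<^sub>R e) / h n"
      using hpos[of n] by (simp add: dist_norm divide_inverse mult.commute)
    also have "\<dots> < min (h n) (norm e)"
      using y(2)[of n] hpos[of n] by (simp only: pos_divide_less_eq mult.commute)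
    finally show ?thesis .
  qed
  have lim: "(\<lambda>n. (y n - z) /\<^sub>R h n) \<longlonglongrightarrow> e"
  proof (rule LIM_zero_cancel, rule tendsto_norm_zero_cancel, rule tendsto_sandwich[OF _ _ tendsto_const h0])
    show "\<forall>\<^sub>F n in sequentially. norm ((y n - z) /\<^sub>R h n - e) \<le> h n"
      using close by (intro always_eventually allI) (smt (verit) min_less_iff_conj)
  qed auto
  have "y n \<noteq> z" for n
    using close[of n] by auto
  moreover have "y \<longlonglongrightarrow> z"
  proof -
    have "(\<lambda>n. h n *\<^sub>R ((y n - z) /\<^sub>R h n) + z) \<longlonglongrightarrow> 0 *\<^sub>R e + z"
      by (intro tendsto_intros h0 lim)
    moreover have "h n *\<^sub>R ((y n - z) /\<^sub>R h n) + z = y n" for n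
      using hpos[of n] by simp
    ultimately show ?thesis by simp
  qed
  ultimately show thesis using that y(1) hpos h0 lim by blast
qed

lemma tendsto_bounded_inner_0:
  fixes f g :: "nat \<Rightarrow> 'a::real_inner"
  assumes "\<And>n. norm (f n) \<le> K" and "g \<longlonglongrightarrow> 0"
  shows "(\<lambda>n. f n \<bullet> g n) \<longlonglongrightarrow> 0"
proof (rule Lim_null_comparison)
  show "\<forall>\<^sub>F n in sequentially. norm (f n \<bullet> g n) \<le> K * norm (g n)"
    using assms(1)
    by (intro always_eventually allI)
       (metis Cauchy_Schwarz_ineq2 mult_right_mono norm_ge_zero order_trans real_norm_def)
  show "(\<lambda>n. K * norm (g n)) \<longlonglongrightarrow> 0"
    using assms(2) by (intro tendsto_mult_right_zero tendsto_norm_zero)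
qed

context
  fixes G :: "'a::euclidean_space set" and B :: "'a \<Rightarrow> 'a" and c c0 :: real
  assumes dense: "closure G = UNIV"
    and growth: "\<And>y. y \<in> G \<Longrightarrow> norm (B y) \<le> c0 * (1 + norm y)"
    and c0_nonneg: "0 \<le> c0"
begin

lemma bounded_along_sequence:
  assumes "\<And>n::nat. y n \<in> G" "y \<longlonglongrightarrow> z"
  obtains K where "\<And>n. norm (B (y n)) \<le> K" "K \<ge> 0"
proof -
  obtain L where L: "\<And>n. norm (y n) \<le> L"
    using convergent_imp_bounded[OF assms(2)] by (auto simp: bounded_iff)
  have "norm (B (y n)) \<le> c0 * (1 + L)" for n
    using growth[OF assms(1)[of n]] L[of n] c0_nonneg
    by (smt (verit) mult_left_mono)
  then show thesis using that[of "c0 * (1 + L)"] norm_ge_zero order_trans by blast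
qed

text \<open>Both inequalities are tested near the midpoint of \<open>z\<close> and
  \<open>z'\<close>. There the terms with \<open>B\<close> add up to an inner product with
  \<open>z + z' - 2 *\<^sub>R y n\<close>, which vanishes in the limit, and the two quarter squares
  reproduce the constant \<open>c\<close> without loss.\<close>

lemma one_sided_value_mono:
  assumes "one_sided_value G B c z w" "one_sided_value G B c z' w'"
  shows "(w - w') \<bullet> (z - z') \<ge> - c * (norm (z - z'))\<^sup>2"
proof -
  define m where "m = (1/2) *\<^sub>R (z + z')"
  obtain y where y: "\<And>n::nat. y n \<in> G" "y \<longlonglongrightarrow> m" using dense_sequence[OF dense] by blast
  obtain K where K: "\<And>n. norm (B (y n)) \<le> K" using bounded_along_sequence[OF y] by blast
  have ineq: "w \<bullet> (z - y n) + w' \<bullet> (z' - y n) - B (y n) \<bullet> (z + z' - 2 *\<^sub>R y n)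
      \<ge> - c * (norm (z - y n))\<^sup>2 - c * (norm (z' - y n))\<^sup>2" for n
  proof -
    have "(w - B (y n)) \<bullet> (z - y n) + (w' - B (y n)) \<bullet> (z' - y n) =
        w \<bullet> (z - y n) + w' \<bullet> (z' - y n) - B (y n) \<bullet> (z + z' - 2 *\<^sub>R y n)"
      by (simp add: inner_diff_left inner_diff_right inner_add_right)
    then show ?thesis using assms y(1)[of n] unfolding one_sided_value_def by fastforce
  qed
  have 2: "(\<lambda>n. z + z' - 2 *\<^sub>R y n) \<longlonglongrightarrow> 0"
  proof -
    have "(\<lambda>n. z + z' - 2 *\<^sub>R y n) \<longlonglongrightarrow> z + z' - 2 *\<^sub>R m" by (intro tendsto_intros y(2))
    then show ?thesis by (simp add: m_def)
  qed
  have "(\<lambda>n. w \<bullet> (z - y n) + w' \<bullet> (z' - y n) - B (y n) \<bullet> (z + z' - 2 *\<^sub>R y n))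
      \<longlonglongrightarrow> w \<bullet> (z - m) + w' \<bullet> (z' - m) - 0"
    by (intro tendsto_intros y(2) tendsto_bounded_inner_0[OF K 2])
  moreover have "(\<lambda>n. - c * (norm (z - y n))\<^sup>2 - c * (norm (z' - y n))\<^sup>2)
      \<longlonglongrightarrow> - c * (norm (z - m))\<^sup>2 - c * (norm (z' - m))\<^sup>2"
    by (intro tendsto_intros y(2))
  ultimately have "w \<bullet> (z - m) + w' \<bullet> (z' - m) \<ge> - c * (norm (z - m))\<^sup>2 - c * (norm (z' - m))\<^sup>2"
    using LIMSEQ_le ineq by fastforce
  moreover obtain d where d: "d = z - z'" by blast
  then have "z - m = (1/2) *\<^sub>R d" "z' - m = - ((1/2) *\<^sub>R d)"
    by (simp_all add: m_def d scaleR_diff_right scaleR_add_right)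
       (simp_all add: field_simps flip: scaleR_add_left)
  ultimately show ?thesis unfolding d[symmetric]
    by (simp add: inner_diff_left power2_eq_square)
qed

text \<open>Test points approaching \<open>z\<close> from the direction of \<open>w\<close> bound
  the square of \<open>norm w\<close> by the limit of \<open>B y \<bullet> w\<close>; the quadratic
  term disappears because it carries an additional factor \<open>h n\<close>.\<close>

lemma one_sided_value_bound:
  assumes w: "one_sided_value G B c z w"
  shows "norm w \<le> c0 * (1 + norm z)"
proof (cases "w = 0")
  case False
  obtain y h where y: "\<And>n. y n \<in> G" "\<And>n. y n \<noteq> z" and h: "\<And>n. h n > 0" "h \<longlonglongrightarrow> (0::real)"
    and yz: "y \<longlonglongrightarrow> z" and e: "(\<lambda>n. (y n - z) /\<^sub>R h n) \<longlonglongrightarrow> w" by (rule dense_direction[OF dense False, of z]) blast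
  let ?e = "\<lambda>n. (y n - z) /\<^sub>R h n"
  have "w \<bullet> ?e n \<le> c0 * (1 + norm (y n)) * norm (?e n) + c * h n * (norm (?e n))\<^sup>2" for n
  proof -
    have "(w - B (y n)) \<bullet> (z - y n) \<ge> - c * (norm (z - y n))\<^sup>2"
      using w y(1) by (simp add: one_sided_value_def)
    moreover obtain E where E: "E = ?e n" by blast
    then have zy: "z - y n = - (h n *\<^sub>R E)" using h(1)[of n] by simp
    ultimately have "h n * ((w - B (y n)) \<bullet> E) \<le> c * (h n * norm E)\<^sup>2"
      using h(1)[of n] unfolding zy by simp
    also have "\<dots> = h n * (c * h n * (norm E)\<^sup>2)"
      by (simp add: power_mult_distrib power2_eq_square)
    finally have "w \<bullet> ?e n \<le> B (y n) \<bullet> ?e n + c * h n * (norm (?e n))\<^sup>2"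
      using h(1)[of n] unfolding E[symmetric] by (simp add: inner_diff_left)
    moreover have "B (y n) \<bullet> ?e n \<le> c0 * (1 + norm (y n)) * norm (?e n)"
      using norm_cauchy_schwarz[of "B (y n)" "?e n"] mult_right_mono[OF growth[OF y(1)[of n]] norm_ge_zero[of "?e n"]]
      by linarith
    ultimately show ?thesis by linarith
  qed
  moreover have "(\<lambda>n. w \<bullet> ?e n) \<longlonglongrightarrow> w \<bullet> w" by (intro tendsto_intros e)
  moreover have "(\<lambda>n. c0 * (1 + norm (y n)) * norm (?e n) + c * h n * (norm (?e n))\<^sup>2)
      \<longlonglongrightarrow> c0 * (1 + norm z) * norm w + c * 0 * (norm w)\<^sup>2"
    by (intro tendsto_intros yz e h(2))
  ultimately have "w \<bullet> w \<le> c0 * (1 + norm z) * norm w"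
    using LIMSEQ_le by fastforce
  then show ?thesis using False by (simp add: dot_square_norm power2_eq_square)
qed (use c0_nonneg in auto)

lemma one_sided_value_limit:
  assumes one_sided: "\<And>x y. x \<in> G \<Longrightarrow> y \<in> G \<Longrightarrow> (B x - B y) \<bullet> (x - y) \<ge> - c * (norm (x - y))\<^sup>2"
    and y: "\<And>n::nat. y n \<in> G" "y \<longlonglongrightarrow> z" "(\<lambda>n. B (y n)) \<longlonglongrightarrow> w"
  shows "one_sided_value G B c z w"
  unfolding one_sided_value_def
proof
  fix x assume x: "x \<in> G"
  have "(\<lambda>n. (B (y n) - B x) \<bullet> (y n - x)) \<longlonglongrightarrow> (w - B x) \<bullet> (z - x)"
    "(\<lambda>n. - c * (norm (y n - x))\<^sup>2) \<longlonglongrightarrow> - c * (norm (z - x))\<^sup>2"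
    by (intro tendsto_intros y)+
  then show "(w - B x) \<bullet> (z - x) \<ge> - c * (norm (z - x))\<^sup>2"
    using LIMSEQ_le one_sided[OF y(1) x] by fastforce
qed

text \<open>Cluster points of \<open>B\<close> along a sequence in \<open>G\<close> tending to
  \<open>z\<close> qualify, and linear growth provides one.\<close>

lemma one_sided_value_exists:
  assumes one_sided: "\<And>x y. x \<in> G \<Longrightarrow> y \<in> G \<Longrightarrow> (B x - B y) \<bullet> (x - y) \<ge> - c * (norm (x - y))\<^sup>2"
  obtains w where "one_sided_value G B c z w"
proof -
  obtain y where y: "\<And>n::nat. y n \<in> G" "y \<longlonglongrightarrow> z" using dense_sequence[OF dense] by blast
  obtain K where K: "\<And>n. norm (B (y n)) \<le> K" using bounded_along_sequence[OF y] by blast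
  then have "bounded (range (\<lambda>n. B (y n)))" by (auto simp: bounded_iff)
  then obtain w r where r: "strict_mono (r :: nat \<Rightarrow> nat)" "((\<lambda>n. B (y n)) \<circ> r) \<longlonglongrightarrow> w"
    using bounded_imp_convergent_subsequence by blast
  have "one_sided_value G B c z w"
    using r y LIMSEQ_subseq_LIMSEQ[OF y(2) r(1)]
    by (intro one_sided_value_limit[where y="y \<circ> r"] one_sided) (auto simp: o_def)
  then show thesis using that by blast
qed

text \<open>Brouwer's theorem for a partition-of-unity average of \<open>B\<close> at scale \<open>\<delta>\<close>.\<close>

lemma approximate_resolvent:
  assumes one_sided: "\<And>x y. x \<in> G \<Longrightarrow> y \<in> G \<Longrightarrow> (B x - B y) \<bullet> (x - y) \<ge> - c * (norm (x - y))\<^sup>2"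
    and c: "0 \<le> c" and c0: "c0 \<le> 1/2" and \<delta>: "0 < \<delta>" "\<delta> \<le> 1"
    and R: "R = 2 * norm x + 2"
  obtains z where "norm z \<le> R"
    "\<And>y. y \<in> G \<Longrightarrow> (x - z - B y) \<bullet> (z - y) \<ge> - c * (norm (z - y) + \<delta>)\<^sup>2 - (c0 * (2 + R) + norm (B y)) * \<delta>"
proof -
  have "cball 0 R \<subseteq> (\<Union>y\<in>G. ball y \<delta>)"
  proof
    fix v :: 'a assume "v \<in> cball 0 R"
    have "v \<in> closure G" using dense by simp
    then obtain y where "y \<in> G" "dist y v < \<delta>" using \<delta>(1) closure_approachable by blast
    then show "v \<in> (\<Union>y\<in>G. ball y \<delta>)" by (auto simp: dist_commute)
  qed
  then obtain F where F: "F \<subseteq> G" "finite F" "cball 0 R \<subseteq> (\<Union>y\<in>F. ball y \<delta>)"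
    using compactE_image[OF compact_cball[of 0 R], of G "\<lambda>y. ball y \<delta>"] by (metis open_ball)
  define \<psi> where "\<psi> = (\<lambda>y z :: 'a. max 0 (\<delta> - norm (z - y)))"
  define \<Psi> where "\<Psi> = (\<lambda>z. \<Sum>y\<in>F. \<psi> y z)"
  have \<psi>0: "\<psi> y z \<ge> 0" for y z by (simp add: \<psi>_def)
  have \<psi>pos: "norm (z - y) < \<delta>" if "\<psi> y z \<noteq> 0" for y z using that by (auto simp: \<psi>_def max_def split: if_splits)
  have \<Psi>pos: "\<Psi> z > 0" if z: "z \<in> cball 0 R" for z
  proof -
    obtain y where y: "y \<in> F" "z \<in> ball y \<delta>" using F(3) z by blast
    then have "\<psi> y z > 0" by (simp add: \<psi>_def dist_norm norm_minus_commute)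
    then show ?thesis unfolding \<Psi>_def using y(1) F(2) \<psi>0 by (intro sum_pos2) auto
  qed
  define A where "A = (\<lambda>z. (\<Sum>y\<in>F. \<psi> y z *\<^sub>R B y) /\<^sub>R \<Psi> z)"
  have Rpos: "R \<ge> 2" using R by simp
  have Bnear: "norm (B y) \<le> c0 * (2 + R)" if "y \<in> F" "z \<in> cball 0 R" "\<psi> y z \<noteq> 0" for y z
  proof -
    have "norm y \<le> norm z + norm (z - y)" by (metis norm_triangle_sub norm_minus_commute)
    then have "norm y \<le> R + 1" using \<psi>pos[OF that(3)] that(2) \<delta> by simp
    then show ?thesis using growth[of y] F(1) that(1) c0_nonneg
      by (smt (verit) mult_left_mono subsetD)
  qed
  have wsum: "norm (\<Sum>y\<in>F. \<psi> y z *\<^sub>R B y) \<le> \<Psi> z * (c0 * (2 + R))" if "z \<in> cball 0 R" for z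
  proof -
    have "norm (\<psi> y z *\<^sub>R B y) \<le> \<psi> y z * (c0 * (2 + R))" if "y \<in> F" for y
      using Bnear[OF that \<open>z \<in> cball 0 R\<close>] \<psi>0[of y z] by (cases "\<psi> y z = 0") (auto intro: mult_left_mono)
    then have "norm (\<Sum>y\<in>F. \<psi> y z *\<^sub>R B y) \<le> (\<Sum>y\<in>F. \<psi> y z * (c0 * (2 + R)))" by (rule sum_norm_le)
    then show ?thesis by (simp add: \<Psi>_def sum_distrib_right)
  qed
  have A_le: "norm (A z) \<le> c0 * (2 + R)" if "z \<in> cball 0 R" for z :: 'a
  proof -
    have "norm (A z) = norm (\<Sum>y\<in>F. \<psi> y z *\<^sub>R B y) / \<Psi> z"
      using \<Psi>pos[OF that] by (simp add: A_def divide_inverse mult.commute)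
    then show ?thesis using wsum[OF that] \<Psi>pos[OF that] by (simp add: pos_divide_le_eq mult.commute)
  qed
  have contA: "continuous_on (cball 0 R) A"
    unfolding A_def \<psi>_def \<Psi>_def
    by (intro continuous_intros ballI) (use \<Psi>pos in \<open>force simp: \<Psi>_def \<psi>_def\<close>)
  obtain z where z: "z \<in> cball 0 R" "x - A z = z"
  proof (rule brouwer_ball[of R 0 "\<lambda>z. x - A z"])
    show "R > 0" using Rpos by simp
    show "continuous_on (cball 0 R) (\<lambda>z. x - A z)" by (intro continuous_intros contA)
    show "(\<lambda>z. x - A z) \<in> cball 0 R \<rightarrow> cball 0 R"
    proof
      fix z :: 'a assume "z \<in> cball 0 R"
      then have "norm (x - A z) \<le> norm x + c0 * (2 + R)" using A_le norm_triangle_ineq4[of x "A z"] by fastforce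
      \<comment> \<open>The choice \<open>R = 2 * norm x + 2\<close> makes this bound equal to
        \<open>R\<close>; the restriction \<open>c0 \<le> 1/2\<close> is what confines the map to
        the ball.\<close>
      also have "\<dots> \<le> norm x + 1/2 * (2 + R)" using c0 Rpos by (intro add_mono mult_right_mono) auto
      finally show "x - A z \<in> cball 0 R" using R by (simp add: field_simps)
    qed
  qed auto
  have "(x - z - B y) \<bullet> (z - y) \<ge> - c * (norm (z - y) + \<delta>)\<^sup>2 - (c0 * (2 + R) + norm (B y)) * \<delta>" (is "_ \<ge> ?L")
    if y: "y \<in> G" for y
  proof -
    \<comment> \<open>Where its weight is positive, \<open>v\<close> lies within
      \<open>\<delta>\<close> of \<open>z\<close>, so the inequality between \<open>v\<close> and
      \<open>y\<close> carries over to \<open>z\<close> and \<open>y\<close> with errors that vanish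
      with \<open>\<delta>\<close>.\<close>
    have each: "\<psi> v z * ((B v - B y) \<bullet> (z - y)) \<ge> \<psi> v z * ?L" if v: "v \<in> F" for v
    proof (cases "\<psi> v z = 0")
      case False
      have d: "norm (z - v) < \<delta>" using \<psi>pos[OF False] .
      have "norm (v - y) \<le> norm (z - y) + \<delta>"
        using norm_triangle_ineq[of "z - y" "v - z"] d by (simp add: norm_minus_commute)
      then have "(norm (v - y))\<^sup>2 \<le> (norm (z - y) + \<delta>)\<^sup>2" by (intro power_mono) auto
      then have 1: "(B v - B y) \<bullet> (v - y) \<ge> - c * (norm (z - y) + \<delta>)\<^sup>2"
        using one_sided[of v y] v y F(1) c by (smt (verit) mult_left_mono mult_minus_left subsetD)
      have "\<bar>(B v - B y) \<bullet> (z - v)\<bar> \<le> norm (B v - B y) * norm (z - v)" by (rule Cauchy_Schwarz_ineq2)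
      also have "\<dots> \<le> (c0 * (2 + R) + norm (B y)) * \<delta>"
      proof (rule mult_mono)
        show 1: "norm (B v - B y) \<le> c0 * (2 + R) + norm (B y)"
          using Bnear[OF v z(1) False] norm_triangle_ineq4[of "B v" "B y"] by linarith
        show "0 \<le> c0 * (2 + R) + norm (B y)"
          using 1 norm_ge_zero[of "B v - B y"] by linarith
      qed (use d in auto)
      finally have 2: "(B v - B y) \<bullet> (z - v) \<ge> - ((c0 * (2 + R) + norm (B y)) * \<delta>)" by linarith
      have "(B v - B y) \<bullet> (z - y) = (B v - B y) \<bullet> (v - y) + (B v - B y) \<bullet> (z - v)"
        by (simp add: inner_diff_right)
      then have "(B v - B y) \<bullet> (z - y) \<ge> ?L" using 1 2 by linarith
      then show ?thesis by (rule mult_left_mono[OF _ \<psi>0])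
    qed simp
    have "\<Psi> z * ?L = (\<Sum>v\<in>F. \<psi> v z * ?L)" by (simp only: \<Psi>_def sum_distrib_right)
    also have "\<dots> \<le> (\<Sum>v\<in>F. \<psi> v z * ((B v - B y) \<bullet> (z - y)))" by (intro sum_mono each)
    also have "\<dots> = (\<Sum>v\<in>F. \<psi> v z *\<^sub>R B v) \<bullet> (z - y) - \<Psi> z * (B y \<bullet> (z - y))"
      by (simp add: \<Psi>_def inner_sum_left inner_diff_left right_diff_distrib sum_subtractf sum_distrib_right)
    also have "(\<Sum>v\<in>F. \<psi> v z *\<^sub>R B v) = \<Psi> z *\<^sub>R A z" using \<Psi>pos[OF z(1)] by (simp add: A_def)
    also have "\<Psi> z *\<^sub>R A z \<bullet> (z - y) - \<Psi> z * (B y \<bullet> (z - y)) = \<Psi> z * ((A z - B y) \<bullet> (z - y))"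
      by (simp add: inner_diff_left right_diff_distrib)
    finally have "?L \<le> (A z - B y) \<bullet> (z - y)" using \<Psi>pos[OF z(1)] by (simp only: mult_le_cancel_left_pos)
    moreover have "A z = x - z" using z(2) by (simp add: diff_eq_eq eq_diff_eq add.commute)
    ultimately show ?thesis by simp
  qed
  then show thesis using that[of z] z(1) by simp
qed

text \<open>Solves the implicit equation with starting point \<open>x\<close> and increment
  \<open>x - z\<close> a value at \<open>z\<close>: the approximate solutions stay in one ball, and
  at a limit point the inequality holds without error.\<close>

lemma resolvent_exists:
  assumes one_sided: "\<And>x y. x \<in> G \<Longrightarrow> y \<in> G \<Longrightarrow> (B x - B y) \<bullet> (x - y) \<ge> - c * (norm (x - y))\<^sup>2"
    and c: "0 \<le> c" and c0: "c0 \<le> 1/2"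
  obtains z where "one_sided_value G B c z (x - z)"
proof -
  define \<delta> where "\<delta> = (\<lambda>n. inverse (real (Suc n)))"
  define R where "R = 2 * norm x + 2"
  have \<delta>: "0 < \<delta> n" "\<delta> n \<le> 1" for n by (auto simp: \<delta>_def divide_simps)
  have \<delta>0: "\<delta> \<longlonglongrightarrow> 0" unfolding \<delta>_def by (rule LIMSEQ_inverse_real_of_nat)
  have "\<exists>z. norm z \<le> R \<and> (\<forall>y\<in>G. (x - z - B y) \<bullet> (z - y) \<ge>
      - c * (norm (z - y) + \<delta> n)\<^sup>2 - (c0 * (2 + R) + norm (B y)) * \<delta> n)" for n
    using approximate_resolvent[OF one_sided c c0 \<delta>(1)[of n] \<delta>(2)[of n] R_def] by metis
  then obtain z where z: "\<And>n. norm (z n) \<le> R"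
    "\<And>n y. y \<in> G \<Longrightarrow> (x - z n - B y) \<bullet> (z n - y) \<ge>
      - c * (norm (z n - y) + \<delta> n)\<^sup>2 - (c0 * (2 + R) + norm (B y)) * \<delta> n" by metis
  have "bounded (range z)" using z(1) by (auto simp: bounded_iff)
  then obtain l r where r: "strict_mono (r :: nat \<Rightarrow> nat)" "(z \<circ> r) \<longlonglongrightarrow> l"
    using bounded_imp_convergent_subsequence by blast
  have \<delta>r: "(\<delta> \<circ> r) \<longlonglongrightarrow> 0" using LIMSEQ_subseq_LIMSEQ[OF \<delta>0 r(1)] .
  have "one_sided_value G B c l (x - l)"
    unfolding one_sided_value_def
  proof
    fix y assume y: "y \<in> G"
    have "(\<lambda>n. (x - (z \<circ> r) n - B y) \<bullet> ((z \<circ> r) n - y)) \<longlonglongrightarrow> (x - l - B y) \<bullet> (l - y)"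
      "(\<lambda>n. - c * (norm ((z \<circ> r) n - y) + (\<delta> \<circ> r) n)\<^sup>2 - (c0 * (2 + R) + norm (B y)) * (\<delta> \<circ> r) n)
        \<longlonglongrightarrow> - c * (norm (l - y) + 0)\<^sup>2 - (c0 * (2 + R) + norm (B y)) * 0"
      by (intro tendsto_intros r \<delta>r)+
    then show "(x - l - B y) \<bullet> (l - y) \<ge> - c * (norm (l - y))\<^sup>2"
      using LIMSEQ_le z(2)[OF y] by fastforce
  qed
  then show thesis using that by blast
qed

text \<open>Monotonicity of the values gives \<open>(1 - c) * (norm (z - z'))\<^sup>2 \<le> (x - x')
  \<bullet> (z - z')\<close>. For \<open>c < 1\<close> the resolvent point is therefore
  unique.\<close>

lemma resolvent_lipschitz:
  assumes "one_sided_value G B c z (x - z)" "one_sided_value G B c z' (x' - z')"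
  shows "(1 - c) * norm (z - z') \<le> norm (x - x')"
proof (cases "z = z'")
  case False
  have "(x - z - (x' - z')) \<bullet> (z - z') \<ge> - c * (norm (z - z'))\<^sup>2"
    using one_sided_value_mono[OF assms] .
  moreover have "x - z - (x' - z') = (x - x') - (z - z')" by simp
  ultimately have "(1 - c) * (norm (z - z'))\<^sup>2 \<le> (x - x') \<bullet> (z - z')"
    by (simp add: inner_diff_left[of "x - x'" "z - z'"] power2_norm_eq_inner algebra_simps)
  also have "\<dots> \<le> norm (x - x') * norm (z - z')" by (rule norm_cauchy_schwarz)
  finally show ?thesis using False by (simp add: power2_eq_square mult.assoc[symmetric])
qed simp

end

text \<open>The condition on \<open>w\<close> is an intersection of half-spaces. This is the source
  of connected fibres and of compatibility with the convex hull in Filippov's definition.\<close>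

lemma one_sided_value_convex: "convex {w. one_sided_value G B c z w}"
proof -
  have "{w. one_sided_value G B c z w} = (\<Inter>y\<in>G. {w. (z - y) \<bullet> w \<ge> B y \<bullet> (z - y) - c * (norm (z - y))\<^sup>2})"
    by (auto simp: one_sided_value_def inner_diff_left inner_commute algebra_simps)
  then show ?thesis by (auto intro!: convex_INT convex_halfspace_ge)
qed

section \<open>Rademacher's theorem\<close>

text \<open>With \<open>m\<close> the primitive of the dominating function, \<open>m + F\<close> and
  \<open>m - F\<close> are nondecreasing. Once \<open>m + F\<close> is known to be an integral,
  \<open>F\<close> is a difference of two integrals and Lebesgue's differentiation theorem applies
  to both.\<close>

lemma dominated_differentiable_real:
  fixes F :: "real \<Rightarrow> real" and g :: "real \<Rightarrow> real"
  assumes "a < b" and g: "integrable (lebesgue_on {a..b}) g" and pos: "\<And>t. t \<in> {a..b} \<Longrightarrow> 0 \<le> g t"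
    and F: "\<And>s t. a \<le> s \<Longrightarrow> s \<le> t \<Longrightarrow> t \<le> b \<Longrightarrow> \<bar>F t - F s\<bar> \<le> integral {s..t} g"
  obtains N where "negligible N" "\<And>t. t \<in> {a<..<b} - N \<Longrightarrow> F differentiable (at t)"
proof -
  define G where "G = (\<lambda>t. if t \<in> {a..b} then g t else 0)"
  have gi: "g integrable_on {a..b}" by (rule integrable_on_lebesgue_on[OF g]) simp
  have Gind: "G = (\<lambda>t. indicator {a..b} t *\<^sub>R g t)" by (auto simp: G_def fun_eq_iff)
  have Gint: "integrable lebesgue G"
    unfolding Gind using g by (simp add: integrable_restrict_space del: indicator_simps)
  have Gi: "G integrable_on S" if "S \<in> sets lebesgue" for S
  proof -
    have "integrable (lebesgue_on S) G"
      using integrable_mult_indicator[OF that Gint] that by (simp add: integrable_restrict_space)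
    then show ?thesis using that by (rule integrable_on_lebesgue_on)
  qed
  have Gnn: "G t \<ge> 0" for t using pos by (simp add: G_def)
  define m where "m = (\<lambda>t. integral {a..t} G)"
  \<comment> \<open>Clamping extends the functions constantly beyond \<open>{a..b}\<close>, so that
    the interval measures on the line have no mass outside.\<close>
  define cl where "cl = (\<lambda>t. max a (min b t))"
  have cl: "a \<le> cl t" "cl t \<le> b" for t using \<open>a < b\<close> by (auto simp: cl_def)
  have clm: "s \<le> t \<Longrightarrow> cl s \<le> cl t" for s t by (auto simp: cl_def)
  have mdiff: "m t - m s = integral {s..t} G" if "a \<le> s" "s \<le> t" for s t
    using Henstock_Kurzweil_Integration.integral_combine[OF that, of G] Gi by (simp add: m_def)
  have Gg: "integral {s..t} G = integral {s..t} g" if "a \<le> s" "t \<le> b" for s t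
    using that by (intro Henstock_Kurzweil_Integration.integral_cong) (auto simp: G_def)
  have Fm: "\<bar>F t - F s\<bar> \<le> m t - m s" if "a \<le> s" "s \<le> t" "t \<le> b" for s t
    using F[OF that] mdiff[OF that(1,2)] Gg[OF that(1,3)] by simp
  have contm: "continuous_on {a..b} m"
    unfolding m_def using Gi by (intro indefinite_integral_continuous_1) auto
  have contF: "continuous_on {a..b} F"
    unfolding continuous_on_iff
  proof (intro ballI allI impI)
    fix x e :: real assume x: "x \<in> {a..b}" and "e > 0"
    then obtain d where d: "d > 0" "\<And>y. y \<in> {a..b} \<Longrightarrow> dist y x < d \<Longrightarrow> dist (m y) (m x) < e"
      using contm unfolding continuous_on_iff by meson
    have "dist (F y) (F x) < e" if "y \<in> {a..b}" "dist y x < d" for y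
      using d(2)[OF that] Fm[of x y] Fm[of y x] x that(1) by (cases "x \<le> y") (auto simp: dist_real_def)
    then show "\<exists>d>0. \<forall>x'\<in>{a..b}. dist x' x < d \<longrightarrow> dist (F x') (F x) < e" using d(1) by blast
  qed
  have contcl: "continuous_on UNIV cl" unfolding cl_def by (intro continuous_intros)
  have contmc: "continuous_on UNIV (\<lambda>t. m (cl t))" "continuous_on UNIV (\<lambda>t. F (cl t))"
    by (rule continuous_on_compose2[OF contm contcl] continuous_on_compose2[OF contF contcl]; use cl in auto)+
  define F1 F2 where "F1 = (\<lambda>t. m (cl t) + F (cl t))" and "F2 = (\<lambda>t. m (cl t) - F (cl t))"
  have m0: "0 \<le> m (cl t)" "m (cl t) \<le> m b" for t
    using mdiff[of a "cl t"] mdiff[of "cl t" b] cl[of t] Gnn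
      Henstock_Kurzweil_Integration.integral_nonneg[OF Gi[of "{a..cl t}"]]
      Henstock_Kurzweil_Integration.integral_nonneg[OF Gi[of "{cl t..b}"]] by (auto simp: m_def)
  have mono: "F1 s \<le> F1 t" "F2 s \<le> F2 t" if "s \<le> t" for s t
    using Fm[OF cl(1)[of s] clm[OF that] cl(2)[of t]] by (auto simp: F1_def F2_def)
  have cont: "continuous_on UNIV F1" "continuous_on UNIV F2"
    unfolding F1_def F2_def by (intro continuous_intros contmc)+
  have "\<bar>F (cl t) - F a\<bar> \<le> m b" for t
    using Fm[of a "cl t"] cl[of t] m0(2)[of t] by (simp add: m_def)
  then have bdd: "\<bar>F1 t\<bar> \<le> m b + (m b + \<bar>F a\<bar>)" for t
    using m0[of t] unfolding F1_def by (smt (verit))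
  have "G \<in> borel_measurable lebesgue" 
    using Gint by (rule borel_measurable_integrable)
  \<comment> \<open>Interval measures are Borel measures, so the Lebesgue measurable density is
    replaced by a Borel version. The factor 2 appears because \<open>F1\<close> and
    \<open>F2\<close> add up to twice \<open>m\<close> composed with the clamp.\<close>
  then obtain g' where g': "g' \<in> borel_measurable lborel" "AE t in lborel. 2 * G t = g' t"
    using completion_ex_borel_measurable_real[of "\<lambda>t. 2 * G t" lborel] by auto
  have sum: "(\<integral>\<^sup>+t. ennreal (g' t) * indicator {x<..y} t \<partial>lborel) = ennreal (F1 y - F1 x + (F2 y - F2 x))"
    if "x \<le> y" for x y
  proof -
    have m2: "m (cl y) - m (cl x) = integral {x..y} G"
    proof -
      have "m (cl y) - m (cl x) = integral {cl x..cl y} G" by (rule mdiff[OF cl(1) clm[OF that]])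
      also have "\<dots> = integral {x..y} G"
      proof (rule integral_spike_set)
        have "{t \<in> {cl x..cl y} - {x..y}. G t \<noteq> 0} \<subseteq> {a, b}" "{t \<in> {x..y} - {cl x..cl y}. G t \<noteq> 0} \<subseteq> {}"
          by (auto simp: cl_def G_def split: if_splits)
        then show "negligible {t \<in> {cl x..cl y} - {x..y}. G t \<noteq> 0}" "negligible {t \<in> {x..y} - {cl x..cl y}. G t \<noteq> 0}"
          by (auto intro: negligible_subset[of "{a, b}"])
      qed
      finally show ?thesis .
    qed
    have "(\<integral>\<^sup>+t. ennreal (g' t) * indicator {x<..y} t \<partial>lborel) = (\<integral>\<^sup>+t. ennreal (indicator {x..y} t * (2 * G t)) \<partial>lebesgue)"
    proof -
      have "(\<integral>\<^sup>+t. ennreal (indicator {x..y} t * (2 * G t)) \<partial>lebesgue) = (\<integral>\<^sup>+t. ennreal (g' t) * indicator {x<..y} t \<partial>lebesgue)"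
      proof (rule nn_integral_cong_AE)
        have "AE t in lebesgue. 2 * G t = g' t" using g'(2) by (rule AE_completion)
        moreover have "AE t in lebesgue. t \<noteq> x" by (rule AE_completion[OF AE_lborel_singleton])
        ultimately show "AE t in lebesgue. ennreal (indicator {x..y} t * (2 * G t)) = ennreal (g' t) * indicator {x<..y} t"
          by eventually_elim (auto simp: indicator_def)
      qed
      also have "\<dots> = (\<integral>\<^sup>+t. ennreal (g' t) * indicator {x<..y} t \<partial>lborel)"
        by (rule nn_integral_completion)
      finally show ?thesis by simp
    qed
    also have "\<dots> = ennreal (integral {x..y} (\<lambda>t. 2 * G t))"
    proof -
      have "((\<lambda>t. 2 * G t) has_integral integral {x..y} (\<lambda>t. 2 * G t)) {x..y}"
        by (intro integrable_integral integrable_on_mult_right Gi) auto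
      from nn_integral_has_integral_lebesgue[OF _ this] show ?thesis
        using Gnn by (simp add: nn_integral_completion)
    qed
    also have "integral {x..y} (\<lambda>t. 2 * G t) = F1 y - F1 x + (F2 y - F2 x)"
      using m2 by (simp add: F1_def F2_def)
    finally show ?thesis .
  qed
  have "absolutely_continuous lborel (interval_measure F1)"
    using g'(1) by (intro interval_measure_dominated_null[OF mono(1) mono(2) cont _ sum]) auto
  then obtain h where h: "\<And>a b. h integrable_on {a..b}" "\<And>a b. a \<le> b \<Longrightarrow> integral {a..b} h = F1 b - F1 a"
    using interval_measure_has_density[OF mono(1) cont(1) bdd] by metis
  obtain N1 where N1: "negligible N1" "\<And>a x. x \<notin> N1 \<Longrightarrow> a < x \<Longrightarrow> ((\<lambda>t. integral {a..t} h) has_vector_derivative h x) (at x)"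
    using lebesgue_differentiation_real[of h] h(1) by metis
  obtain N2 where N2: "negligible N2" "\<And>a x. x \<notin> N2 \<Longrightarrow> a < x \<Longrightarrow> ((\<lambda>t. integral {a..t} G) has_vector_derivative G x) (at x)"
  proof (rule lebesgue_differentiation_real[of G])
    show "G integrable_on {u..v}" for u v by (rule Gi) simp
  qed blast
  have "F differentiable (at x)" if x: "x \<in> {a<..<b} - (N1 \<union> N2)" for x
  proof -
    have "((\<lambda>t. F1 a + integral {a..t} h - m t) has_vector_derivative 0 + h x - G x) (at x)"
      using N1(2)[of x a] N2(2)[of x a] x unfolding m_def by (intro derivative_intros) auto
    moreover have "F1 a + integral {a..t} h - m t = F t" if "t \<in> {a<..<b}" for t
      using h(2)[of a t] that by (simp add: F1_def cl_def)
    ultimately have "(F has_vector_derivative 0 + h x - G x) (at x)"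
      using x by (intro has_vector_derivative_transform_within_open[where S="{a<..<b}" and f="\<lambda>t. F1 a + integral {a..t} h - m t" and g=F]) auto
    then show ?thesis using differentiableI_vector by blast
  qed
  moreover have "negligible (N1 \<union> N2)" using N1(1) N2(1) by simp
  ultimately show thesis using that by blast
qed

lemma dominated_differentiable:
  fixes \<gamma> :: "real \<Rightarrow> 'a::euclidean_space" and g :: "real \<Rightarrow> real"
  assumes "a < b" and g: "integrable (lebesgue_on {a..b}) g" and pos: "\<And>t. t \<in> {a..b} \<Longrightarrow> 0 \<le> g t"
    and \<gamma>: "\<And>s t. a \<le> s \<Longrightarrow> s \<le> t \<Longrightarrow> t \<le> b \<Longrightarrow> norm (\<gamma> t - \<gamma> s) \<le> integral {s..t} g"
  obtains N where "negligible N" "\<And>t. t \<in> {a<..<b} - N \<Longrightarrow> \<gamma> differentiable (at t)"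
proof -
  have "\<exists>N. negligible N \<and> (\<forall>t\<in>{a<..<b} - N. (\<lambda>t. \<gamma> t \<bullet> i) differentiable (at t))" if i: "i \<in> Basis" for i
  proof (rule dominated_differentiable_real[OF \<open>a < b\<close> g pos])
    show "\<bar>\<gamma> t \<bullet> i - \<gamma> s \<bullet> i\<bar> \<le> integral {s..t} g" if "a \<le> s" "s \<le> t" "t \<le> b" for s t
      using \<gamma>[OF that] Basis_le_norm[OF i, of "\<gamma> t - \<gamma> s"] by (simp add: inner_diff_left)
  qed auto
  then obtain N where N: "\<And>i. i \<in> Basis \<Longrightarrow> negligible (N i)"
    "\<And>i t. i \<in> Basis \<Longrightarrow> t \<in> {a<..<b} - N i \<Longrightarrow> (\<lambda>t. \<gamma> t \<bullet> i) differentiable (at t)" by metis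
  show thesis
  proof (rule that)
    show "negligible (\<Union>i\<in>Basis. N i)" using N(1) by (intro negligible_Union) auto
    show "\<gamma> differentiable (at t)" if "t \<in> {a<..<b} - (\<Union>i\<in>Basis. N i)" for t
      using N(2) that by (subst differentiable_componentwise_within) auto
  qed
qed

lemma lipschitz_differentiable_real:
  fixes F :: "real \<Rightarrow> real"
  assumes F: "\<And>s t. \<bar>F t - F s\<bar> \<le> L * \<bar>t - s\<bar>"
  obtains N where "negligible N" "\<And>t. t \<notin> N \<Longrightarrow> F differentiable (at t)"
proof -
  have L: "L \<ge> 0" using F[of 0 1] by simp
  have "\<exists>N. negligible N \<and> (\<forall>t\<in>{- real (Suc n)<..<real (Suc n)} - N. F differentiable (at t))" for n
  proof (rule dominated_differentiable_real[of "- real (Suc n)" "real (Suc n)" "\<lambda>_. L" F])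
    show "\<bar>F t - F s\<bar> \<le> integral {s..t} (\<lambda>_. L)" if "- real (Suc n) \<le> s" "s \<le> t" "t \<le> real (Suc n)" for s t
      using F[of s t] that by (simp add: mult.commute)
  qed (use L in auto)
  then obtain N where N: "\<And>n. negligible (N n)"
    "\<And>n t. t \<in> {- real (Suc n)<..<real (Suc n)} - N n \<Longrightarrow> F differentiable (at t)" by metis
  show thesis
  proof (rule that)
    show "negligible (\<Union>n. N n)" using N(1) by (intro negligible_countable_Union) auto
    fix t assume t: "t \<notin> (\<Union>n. N n)"
    obtain n where "\<bar>t\<bar> < real n" using reals_Archimedean2 by blast
    then show "F differentiable (at t)" using t by (intro N(2)[of t n]) auto
  qed
qed

section \<open>Directional derivatives of Lipschitz functions\<close>

definition diff_quot :: "('a::real_normed_vector \<Rightarrow> real) \<Rightarrow> 'a \<Rightarrow> 'a \<Rightarrow> real \<Rightarrow> real" where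
  "diff_quot f v x s = (f (x + s *\<^sub>R v) - f x) / s"

text \<open>A limit along one fixed sequence, so that it is measurable for continuous
  \<open>f\<close>; it is the derivative in direction \<open>v\<close> wherever the full limit at 0
  exists.\<close>

definition dir_deriv :: "('a::real_normed_vector \<Rightarrow> real) \<Rightarrow> 'a \<Rightarrow> 'a \<Rightarrow> real" where
  "dir_deriv f v x = lim (\<lambda>n. diff_quot f v x (inverse (real (Suc n))))"

lemma dir_deriv_eq:
  assumes "(diff_quot f v x \<longlongrightarrow> d) (at 0)"
  shows "dir_deriv f v x = d"
proof -
  have "filterlim (\<lambda>n. inverse (real (Suc n))) (at 0) sequentially"
    unfolding filterlim_at using LIMSEQ_inverse_real_of_nat by (auto intro!: always_eventually)
  from filterlim_compose[OF assms this] show ?thesis unfolding dir_deriv_def by (rule limI)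
qed

lemma negligible_of_AE_lborel:
  assumes "AE x in lborel. P x" shows "negligible {x. \<not> P (x :: 'a::euclidean_space)}"
proof -
  have "AE x in lebesgue. P x" using assms by (rule AE_completion)
  then obtain N where "{x \<in> space lebesgue. \<not> P x} \<subseteq> N" "N \<in> null_sets lebesgue"
    unfolding eventually_ae_filter by blast
  then show ?thesis by (auto simp flip: negligible_iff_null_sets intro: negligible_subset)
qed

lemma AE_lborel_of_negligible:
  assumes "negligible N" "{x :: 'a::euclidean_space. P x} \<in> sets borel" "\<And>x. x \<notin> N \<Longrightarrow> P x"
  shows "AE x in lborel. P x"
proof -
  have "AE x in lebesgue. x \<notin> N" using assms(1) by (intro AE_not_in) (simp add: negligible_iff_null_sets)
  then have "AE x in lebesgue. P x" by eventually_elim (rule assms(3))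
  then show ?thesis by (subst (asm) AE_completion_iff) (use assms(2) in auto)
qed

text \<open>By Lebesgue differentiation \<open>H\<close> is almost everywhere the limit of its
  averages over small cubes, all of which vanish.\<close>

lemma AE_zero_of_box_integrals:
  fixes H :: "'a::euclidean_space \<Rightarrow> real"
  assumes H[measurable]: "H \<in> borel_measurable borel"
    and int: "\<And>a b. integrable lborel (\<lambda>x. indicator (cbox a b) x * H x)"
    and zero: "\<And>a b. (LINT x|lborel. indicator (cbox a b) x * H x) = 0"
  shows "AE x in lborel. H x = 0"
proof -
  have HK: "H integrable_on cbox a b" "integral (cbox a b) H = 0" for a b
    using set_borel_integral_eq_integral[of "cbox a b" H] int[of a b] zero[of a b]
    by (simp_all add: set_integrable_def set_lebesgue_integral_def)
  obtain N where N: "negligible N" "\<And>x e. x \<notin> N \<Longrightarrow> 0 < e \<Longrightarrow>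
      \<exists>d>0. \<forall>h. 0 < h \<and> h < d \<longrightarrow> norm (integral (cbox x (x + h *\<^sub>R One)) H /\<^sub>R h ^ DIM('a) - H x) < e"
    by (rule integrable_ccontinuous_explicit[of H, OF HK(1)]) blast
  show ?thesis
  proof (rule AE_lborel_of_negligible[OF N(1)])
    fix x assume x: "x \<notin> N"
    have "\<bar>H x\<bar> < e" if e: "e > 0" for e
    proof -
      obtain d where "d > 0" "\<And>h. 0 < h \<Longrightarrow> h < d \<Longrightarrow> norm (integral (cbox x (x + h *\<^sub>R One)) H /\<^sub>R h ^ DIM('a) - H x) < e"
        using N(2)[OF x e] by blast
      from this(2)[of "d / 2"] this(1) show ?thesis by (simp add: HK(2))
    qed
    then show "H x = 0" by (metis less_irrefl zero_less_abs_iff)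
  qed measurable
qed

context
  fixes f :: "'a::euclidean_space \<Rightarrow> real" and L :: real
  assumes lip: "\<And>x y. \<bar>f x - f y\<bar> \<le> L * norm (x - y)"
begin

lemma lip_continuous: "continuous_on UNIV f"
proof -
  have "L-lipschitz_on UNIV f" if "L \<ge> 0"
    using lip that by (auto simp: lipschitz_on_def dist_real_def dist_norm)
  moreover have "f = (\<lambda>_. f 0)" if "\<not> L \<ge> 0"
  proof
    fix x show "f x = f 0" using lip[of x 0] that
      by (smt (verit) mult_nonneg_nonpos2 norm_ge_zero mult.commute)
  qed
  ultimately show ?thesis
    by (metis continuous_on_const lipschitz_on_continuous_on)
qed

lemma lip_measurable[measurable]: "f \<in> borel_measurable borel"
  using lip_continuous by (rule borel_measurable_continuous_onI)

lemma diff_quot_bound: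
  assumes "s \<noteq> 0" shows "\<bar>diff_quot f v x s\<bar> \<le> L * norm v"
proof -
  have "\<bar>f (x + s *\<^sub>R v) - f x\<bar> \<le> L * norm v * \<bar>s\<bar>" using lip[of "x + s *\<^sub>R v" x] by (simp add: mult_ac)
  then show ?thesis using assms by (simp add: diff_quot_def pos_divide_le_eq)
qed

lemma diff_quot_continuous_x: "continuous_on UNIV (\<lambda>x. diff_quot f v x s)"
  unfolding diff_quot_def divide_inverse
  by (intro continuous_intros continuous_on_compose2[OF lip_continuous]) auto

lemma diff_quot_measurable[measurable]: "(\<lambda>x. diff_quot f v x s) \<in> borel_measurable borel"
  by (rule borel_measurable_continuous_onI, rule diff_quot_continuous_x)

lemma diff_quot_tendsto:
  assumes "s \<noteq> 0" "r \<longlonglongrightarrow> s" shows "(\<lambda>n. diff_quot f v x (r n)) \<longlonglongrightarrow> diff_quot f v x s"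
proof -
  have "(\<lambda>n. f (x + r n *\<^sub>R v)) \<longlonglongrightarrow> f (x + s *\<^sub>R v)"
    by (rule continuous_on_tendsto_compose[OF lip_continuous]) (auto intro!: tendsto_intros assms)
  then show ?thesis unfolding diff_quot_def using assms by (intro tendsto_intros) auto
qed

text \<open>The Cauchy criterion for the difference quotients as the increment tends to 0.
  Restricting increments to the rationals and tolerances to reciprocals leaves countable set
  operations only, which makes the set Borel.\<close>

definition Cauchy_points :: "'a \<Rightarrow> 'a set" where
  "Cauchy_points v = {x. \<forall>k. \<exists>m. \<forall>s\<in>{s\<in>\<rat>. s \<noteq> 0 \<and> \<bar>s\<bar> < inverse (real (Suc m))}.
      \<forall>s'\<in>{s\<in>\<rat>. s \<noteq> 0 \<and> \<bar>s\<bar> < inverse (real (Suc m))}.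
        \<bar>diff_quot f v x s - diff_quot f v x s'\<bar> \<le> inverse (real (Suc k))}"

lemma Cauchy_points_borel: "Cauchy_points v \<in> sets borel"
proof -
  let ?Q = "\<lambda>m. {s\<in>\<rat>. s \<noteq> 0 \<and> \<bar>s\<bar> < inverse (real (Suc m))}"
  have "Cauchy_points v = (\<Inter>k. \<Union>m. \<Inter>s\<in>?Q m. \<Inter>s'\<in>?Q m.
      {x. \<bar>diff_quot f v x s - diff_quot f v x s'\<bar> \<le> inverse (real (Suc k))})"
    unfolding Cauchy_points_def by (simp add: set_eq_iff)
  moreover have "closed {x. \<bar>diff_quot f v x s - diff_quot f v x s'\<bar> \<le> inverse (real (Suc k))}" for s s' k
    by (intro closed_Collect_le continuous_intros diff_quot_continuous_x)
  then have "(\<Inter>s\<in>?Q m. \<Inter>s'\<in>?Q m.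
      {x. \<bar>diff_quot f v x s - diff_quot f v x s'\<bar> \<le> inverse (real (Suc k))}) \<in> sets borel" for m k
    by (intro borel_closed closed_INT ballI) auto
  ultimately show ?thesis by (simp only:) (intro sets.countable_INT sets.countable_UN image_subsetI; simp)
qed

text \<open>Difference quotients depend continuously on a nonzero increment, so the criterion
  extends from rational to real increments, where completeness gives the limit.\<close>

lemma Cauchy_points_limit:
  assumes "x \<in> Cauchy_points v" shows "\<exists>d. (diff_quot f v x \<longlongrightarrow> d) (at 0)"
proof -
  have full: "\<exists>m. \<forall>s s'. s \<noteq> 0 \<and> s' \<noteq> 0 \<and> \<bar>s\<bar> < inverse (real (Suc m)) \<and> \<bar>s'\<bar> < inverse (real (Suc m)) \<longrightarrow>
     \<bar>diff_quot f v x s - diff_quot f v x s'\<bar> \<le> inverse (real (Suc k))" for k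
  proof -
    obtain m where m: "\<And>s s'. s \<in> \<rat> \<Longrightarrow> s' \<in> \<rat> \<Longrightarrow> s \<noteq> 0 \<Longrightarrow> s' \<noteq> 0 \<Longrightarrow> \<bar>s\<bar> < inverse (real (Suc m)) \<Longrightarrow>
        \<bar>s'\<bar> < inverse (real (Suc m)) \<Longrightarrow> \<bar>diff_quot f v x s - diff_quot f v x s'\<bar> \<le> inverse (real (Suc k))"
      using assms unfolding Cauchy_points_def by blast
    have approx: "\<exists>r. (\<forall>n. r n \<in> \<rat> \<and> r n \<noteq> 0 \<and> \<bar>r n\<bar> < inverse (real (Suc m))) \<and> r \<longlonglongrightarrow> s"
      if s: "s \<noteq> 0" "\<bar>s\<bar> < inverse (real (Suc m))" for s
    proof -
      have o: "open ({t. t \<noteq> 0} \<inter> {t. \<bar>t\<bar> < inverse (real (Suc m))})"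
        by (intro open_Int open_Collect_less open_Collect_neq continuous_intros)
      have "s \<in> closure (({t. t \<noteq> 0} \<inter> {t. \<bar>t\<bar> < inverse (real (Suc m))}) \<inter> \<rat>)"
        using open_Int_closure_subset[OF o, of "\<rat>"] s Rats_closure_real by auto
      then show ?thesis unfolding closure_sequential by auto
    qed
    have "\<bar>diff_quot f v x s - diff_quot f v x s'\<bar> \<le> inverse (real (Suc k))"
      if s: "s \<noteq> 0" "s' \<noteq> 0" "\<bar>s\<bar> < inverse (real (Suc m))" "\<bar>s'\<bar> < inverse (real (Suc m))" for s s'
    proof -
      obtain r r' where r: "\<And>n. r n \<in> \<rat>" "\<And>n. r n \<noteq> 0" "\<And>n. \<bar>r n\<bar> < inverse (real (Suc m))" "r \<longlonglongrightarrow> s"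
        and r': "\<And>n. r' n \<in> \<rat>" "\<And>n. r' n \<noteq> 0" "\<And>n. \<bar>r' n\<bar> < inverse (real (Suc m))" "r' \<longlonglongrightarrow> s'"
        using approx[OF s(1,3)] approx[OF s(2,4)] by blast
      have "(\<lambda>n. \<bar>diff_quot f v x (r n) - diff_quot f v x (r' n)\<bar>) \<longlonglongrightarrow> \<bar>diff_quot f v x s - diff_quot f v x s'\<bar>"
        by (intro tendsto_intros diff_quot_tendsto s r r')
      then show ?thesis by (rule LIMSEQ_le_const2) (intro exI[of _ 0] allI impI m r r')
    qed
    then show ?thesis by blast
  qed
  let ?s = "\<lambda>n. inverse (real (Suc n))"
  have small: "\<exists>M. \<forall>n\<ge>M. ?s n < ?s m" for m
  proof (intro exI allI impI)
    fix n assume "n \<ge> Suc m" then show "?s n < ?s m" by simp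
  qed
  have "Cauchy (\<lambda>n. diff_quot f v x (?s n))"
  proof (rule metric_CauchyI)
    fix e :: real assume "e > 0"
    then obtain k where k: "?s k < e" using reals_Archimedean by blast
    obtain m where m: "\<And>s s'. s \<noteq> 0 \<and> s' \<noteq> 0 \<and> \<bar>s\<bar> < ?s m \<and> \<bar>s'\<bar> < ?s m \<Longrightarrow>
        \<bar>diff_quot f v x s - diff_quot f v x s'\<bar> \<le> ?s k" using full[of k] by blast
    obtain M where M: "\<And>n. n \<ge> M \<Longrightarrow> ?s n < ?s m" using small by blast
    have "dist (diff_quot f v x (?s a)) (diff_quot f v x (?s b)) < e" if "a \<ge> M" "b \<ge> M" for a b
      using m[of "?s a" "?s b"] M[OF that(1)] M[OF that(2)] k by (simp add: dist_real_def)
    then show "\<exists>M. \<forall>m\<ge>M. \<forall>n\<ge>M. dist (diff_quot f v x (?s m)) (diff_quot f v x (?s n)) < e" by blast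
  qed
  then obtain d where d: "(\<lambda>n. diff_quot f v x (?s n)) \<longlonglongrightarrow> d" using Cauchy_convergent_iff convergent_def by blast
  have "(diff_quot f v x \<longlongrightarrow> d) (at 0)"
  proof (rule LIM_I)
    fix e :: real assume "e > 0"
    then obtain k where k: "?s k < e" using reals_Archimedean by blast
    obtain m where m: "\<And>s s'. s \<noteq> 0 \<and> s' \<noteq> 0 \<and> \<bar>s\<bar> < ?s m \<and> \<bar>s'\<bar> < ?s m \<Longrightarrow>
        \<bar>diff_quot f v x s - diff_quot f v x s'\<bar> \<le> ?s k" using full[of k] by blast
    obtain M where M: "\<And>n. n \<ge> M \<Longrightarrow> ?s n < ?s m" using small by blast
    have "norm (diff_quot f v x s - d) < e" if s: "s \<noteq> 0" "norm (s - 0) < ?s m" for s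
    proof -
      have "(\<lambda>n. \<bar>diff_quot f v x s - diff_quot f v x (?s n)\<bar>) \<longlonglongrightarrow> \<bar>diff_quot f v x s - d\<bar>"
        by (intro tendsto_intros d)
      then have "\<bar>diff_quot f v x s - d\<bar> \<le> ?s k"
        by (rule LIMSEQ_le_const2) (use m M s in \<open>auto intro!: exI[of _ M]\<close>)
      then show ?thesis using k by simp
    qed
    then show "\<exists>r>0. \<forall>s. s \<noteq> 0 \<and> norm (s - 0) < r \<longrightarrow> norm (diff_quot f v x s - d) < e"
      by (intro exI[of _ "?s m"]) auto
  qed
  then show ?thesis by blast
qed

lemma limit_Cauchy_points:
  assumes "(diff_quot f v x \<longlongrightarrow> d) (at 0)" shows "x \<in> Cauchy_points v"
  unfolding Cauchy_points_def
proof (intro CollectI allI)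
  fix k
  have "inverse (real (Suc k)) / 2 > 0" by simp
  then obtain r where r: "r > 0" "\<And>s. s \<noteq> 0 \<Longrightarrow> \<bar>s\<bar> < r \<Longrightarrow> \<bar>diff_quot f v x s - d\<bar> < inverse (real (Suc k)) / 2"
    using LIM_D[OF assms] by (metis diff_zero real_norm_def)
  obtain m where m: "inverse (real (Suc m)) < r" using reals_Archimedean[OF r(1)] by blast
  have "\<bar>diff_quot f v x s - diff_quot f v x s'\<bar> \<le> inverse (real (Suc k))"
    if "s \<noteq> 0" "s' \<noteq> 0" "\<bar>s\<bar> < inverse (real (Suc m))" "\<bar>s'\<bar> < inverse (real (Suc m))" for s s'
    using r(2)[of s] r(2)[of s'] that m by linarith
  then show "\<exists>m. \<forall>s\<in>{s\<in>\<rat>. s \<noteq> 0 \<and> \<bar>s\<bar> < inverse (real (Suc m))}.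
      \<forall>s'\<in>{s\<in>\<rat>. s \<noteq> 0 \<and> \<bar>s\<bar> < inverse (real (Suc m))}.
        \<bar>diff_quot f v x s - diff_quot f v x s'\<bar> \<le> inverse (real (Suc k))" by blast
qed

text \<open>Averaging the translates of the exceptional set over a segment in direction \<open>v\<close> reduces the
  claim to the one-dimensional case on every line.\<close>

lemma dir_deriv_exists_AE: "AE x in lborel. (diff_quot f v x \<longlongrightarrow> dir_deriv f v x) (at 0)"
proof -
  define B where "B = - Cauchy_points v"
  have B[measurable]: "B \<in> sets borel" unfolding B_def using Cauchy_points_borel by (simp add: Compl_eq_Diff_UNIV)
  have line: "AE s in lborel. x + s *\<^sub>R v \<notin> B" for x
  proof -
    have "\<bar>f (x + t *\<^sub>R v) - f (x + s *\<^sub>R v)\<bar> \<le> (L * norm v) * \<bar>t - s\<bar>" for s t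
      using lip[of "x + t *\<^sub>R v" "x + s *\<^sub>R v"] by (simp add: mult_ac flip: scaleR_diff_left)
    then obtain N where N: "negligible N" "\<And>t. t \<notin> N \<Longrightarrow> (\<lambda>s. f (x + s *\<^sub>R v)) differentiable (at t)"
      by (rule lipschitz_differentiable_real) blast
    have good: "x + t *\<^sub>R v \<notin> B" if t: "t \<notin> N" for t
    proof -
      obtain d where "((\<lambda>s. f (x + s *\<^sub>R v)) has_real_derivative d) (at t)"
        using N(2)[OF t] by (auto simp: real_differentiable_def)
      then have "((\<lambda>h. (f (x + (t + h) *\<^sub>R v) - f (x + t *\<^sub>R v)) / h) \<longlongrightarrow> d) (at 0)"
        by (simp add: DERIV_def)
      then have "(diff_quot f v (x + t *\<^sub>R v) \<longlongrightarrow> d) (at 0)"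
        unfolding diff_quot_def[abs_def] by (simp add: algebra_simps)
      then show ?thesis unfolding B_def using limit_Cauchy_points by blast
    qed
    have "AE t in lebesgue. t \<notin> N" using N(1) by (intro AE_not_in) (simp add: negligible_iff_null_sets)
    then have "AE t in lebesgue. x + t *\<^sub>R v \<notin> B" by eventually_elim (rule good)
    moreover have "{t. x + t *\<^sub>R v \<in> B} \<in> sets borel" by measurable
    ultimately show ?thesis by (subst (asm) AE_completion_iff) auto
  qed
  have "emeasure lborel B = (\<integral>\<^sup>+s. indicator {0..1::real} s * emeasure lborel B \<partial>lborel)"
    by (simp add: nn_integral_multc)
  also have "\<dots> = (\<integral>\<^sup>+s. (\<integral>\<^sup>+x. indicator {0..1::real} s * indicator B (x + s *\<^sub>R v) \<partial>lborel) \<partial>lborel)"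
  proof (rule nn_integral_cong)
    fix s :: real
    have "emeasure lborel B = emeasure (distr lborel borel ((+) (s *\<^sub>R v))) B" by (simp add: lborel_distr_plus)
    also have "\<dots> = (\<integral>\<^sup>+x. indicator B (s *\<^sub>R v + x) \<partial>lborel)"
    proof -
      have "emeasure (distr lborel borel ((+) (s *\<^sub>R v))) B = (\<integral>\<^sup>+x. indicator B x \<partial>distr lborel borel ((+) (s *\<^sub>R v)))"
        by simp
      also have "\<dots> = (\<integral>\<^sup>+x. indicator B (s *\<^sub>R v + x) \<partial>lborel)" by (rule nn_integral_distr) auto
      finally show ?thesis .
    qed
    finally show "indicator {0..1::real} s * emeasure lborel B = (\<integral>\<^sup>+x. indicator {0..1::real} s * indicator B (x + s *\<^sub>R v) \<partial>lborel)"
      by (simp add: nn_integral_cmult add.commute)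
  qed
  also have "\<dots> = (\<integral>\<^sup>+x. (\<integral>\<^sup>+s. indicator {0..1::real} s * indicator B (x + s *\<^sub>R v) \<partial>lborel) \<partial>lborel)"
    by (rule lborel_pair.Fubini') measurable
  also have "\<dots> = (\<integral>\<^sup>+x. 0 \<partial>(lborel :: 'a measure))"
  proof (rule nn_integral_cong)
    fix x :: 'a
    have "(\<integral>\<^sup>+s. indicator {0..1::real} s * indicator B (x + s *\<^sub>R v) \<partial>lborel) = (\<integral>\<^sup>+s. 0 \<partial>(lborel :: real measure))"
      using line[of x] by (intro nn_integral_cong_AE) (auto elim!: eventually_mono)
    then show "(\<integral>\<^sup>+s. indicator {0..1::real} s * indicator B (x + s *\<^sub>R v) \<partial>lborel) = 0" by simp
  qed
  finally have "B \<in> null_sets lborel" by (intro null_setsI) simp_all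
  then have "AE x in lborel. x \<notin> B" by (rule AE_not_in)
  then show ?thesis
  proof eventually_elim
    case (elim x)
    then obtain d where "(diff_quot f v x \<longlongrightarrow> d) (at 0)" using Cauchy_points_limit by (auto simp: B_def)
    then show ?case using dir_deriv_eq by metis
  qed
qed

lemma dir_deriv_measurable[measurable]: "dir_deriv f v \<in> borel_measurable borel"
  unfolding dir_deriv_def[abs_def] by measurable

lemma dir_deriv_limit_seq:
  assumes "(diff_quot f v x \<longlongrightarrow> d) (at 0)"
  shows "(\<lambda>n. diff_quot f v x (inverse (real (Suc n)))) \<longlonglongrightarrow> d"
proof -
  have "filterlim (\<lambda>n. inverse (real (Suc n))) (at 0) sequentially"
    unfolding filterlim_at using LIMSEQ_inverse_real_of_nat by (auto intro!: always_eventually)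
  from filterlim_compose[OF assms this] show ?thesis .
qed

text \<open>The defect of additivity is the limit of \<open>g\<^sub>n(x + v/n) - g\<^sub>n(x)\<close> for bounded \<open>g\<^sub>n\<close>, and its integral
  over a box is controlled by the measure of the symmetric difference of the box with its translate.\<close>

lemma dir_deriv_add:
  "AE x in lborel. dir_deriv f (v + w) x = dir_deriv f v x + dir_deriv f w x"
proof -
  define s where "s = (\<lambda>n. inverse (real (Suc n)))"
  have s: "s n > 0" "s n \<le> 1" for n by (auto simp: s_def divide_simps)
  have s0: "s \<longlonglongrightarrow> 0" unfolding s_def by (rule LIMSEQ_inverse_real_of_nat)
  define E where "E = (\<lambda>n x. diff_quot f w (x + s n *\<^sub>R v) (s n) - diff_quot f w x (s n))"
  define H where "H = (\<lambda>x. dir_deriv f (v + w) x - dir_deriv f v x - dir_deriv f w x)"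
  have E_eq: "E n x = diff_quot f (v + w) x (s n) - diff_quot f v x (s n) - diff_quot f w x (s n)" for n x
    using s[of n] by (simp add: E_def diff_quot_def scaleR_add_right add.assoc diff_divide_distrib)
  have Em[measurable]: "E n \<in> borel_measurable borel" for n unfolding E_def by measurable
  have Hm[measurable]: "H \<in> borel_measurable borel" unfolding H_def by measurable
  have lim: "AE x in lborel. (\<lambda>n. E n x) \<longlonglongrightarrow> H x"
    using dir_deriv_exists_AE[of "v + w"] dir_deriv_exists_AE[of v] dir_deriv_exists_AE[of w]
  proof eventually_elim
    case (elim x)
    show ?case unfolding E_eq H_def s_def by (intro tendsto_intros dir_deriv_limit_seq elim)
  qed
  have Ebd: "\<bar>E n x\<bar> \<le> 2 * (L * norm w)" for n x
    using diff_quot_bound[of "s n" w x] diff_quot_bound[of "s n" w "x + s n *\<^sub>R v"] s[of n] unfolding E_def by linarith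
  have L0: "0 \<le> L * norm w" using diff_quot_bound[of 1 w 0] by linarith
  have "AE x in lborel. H x = 0"
  proof (rule AE_zero_of_box_integrals[OF Hm])
    fix a b :: 'a
    let ?I = "indicator (cbox a b) :: 'a \<Rightarrow> real"
    have box_int: "integrable lborel (\<lambda>x. ?I x * c)" for c
      by (intro integrable_mult_left integrable_real_indicator) (auto simp: emeasure_lborel_cbox_finite[simplified])
    have bd: "AE x in lborel. norm (?I x * E n x) \<le> ?I x * (2 * (L * norm w))" for n
      using Ebd by (auto simp: indicator_def)
    have limI: "AE x in lborel. (\<lambda>n. ?I x * E n x) \<longlonglongrightarrow> ?I x * H x"
      using lim by eventually_elim (intro tendsto_intros)
    note dom = integral_dominated_convergence[OF _ _ box_int limI bd]
      integrable_dominated_convergence[OF _ _ box_int limI bd]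
    show "integrable lborel (\<lambda>x. ?I x * H x)" by (rule dom(2)) measurable
    have conv: "(\<lambda>n. LINT x|lborel. ?I x * E n x) \<longlonglongrightarrow> (LINT x|lborel. ?I x * H x)"
      by (rule dom(1)) measurable
    define R where "R = (SOME R. cbox a b \<subseteq> cball 0 R)"
    have "\<exists>R. cbox a b \<subseteq> cball 0 R" using bounded_cbox[of a b] unfolding bounded_iff by (auto simp: subset_iff)
    then have R: "cbox a b \<subseteq> cball 0 R" unfolding R_def by (rule someI_ex)
    \<comment> \<open>Indicators of the translated boxes converge off the boundary of the box, which
      is negligible; all translates stay in one ball since \<open>s n \<le> 1\<close>.\<close>
    have conv0: "(\<lambda>n. LINT x|lborel. \<bar>?I (x - s n *\<^sub>R v) - ?I x\<bar>) \<longlonglongrightarrow> (LINT (x::'a)|lborel. 0)"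
    proof (rule integral_dominated_convergence[where w="indicator (cball 0 (R + norm v))"])
      show "integrable lborel (indicator (cball 0 (R + norm v)) :: 'a \<Rightarrow> real)"
        by (intro integrable_real_indicator) (auto intro: emeasure_bounded_finite[simplified])
      have fr: "AE x in lborel. x \<notin> cbox a b - box a b"
        by (rule AE_lborel_of_negligible[OF negligible_frontier_interval[of a b]]) auto
      show "AE x in lborel. (\<lambda>n. \<bar>?I (x - s n *\<^sub>R v) - ?I x\<bar>) \<longlonglongrightarrow> 0"
        using fr
      proof eventually_elim
        case (elim x)
        have lx: "(\<lambda>n. x - s n *\<^sub>R v) \<longlonglongrightarrow> x" using tendsto_diff[OF tendsto_const tendsto_scaleR[OF s0 tendsto_const], of x v] by simp
        have "\<forall>\<^sub>F n in sequentially. ?I (x - s n *\<^sub>R v) = ?I x"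
        proof (cases "x \<in> box a b")
          case True
          have "x - s n *\<^sub>R v \<in> box a b \<Longrightarrow> ?I (x - s n *\<^sub>R v) = ?I x" for n
            using subsetD[OF box_subset_cbox, of x a b] subsetD[OF box_subset_cbox, of "x - s n *\<^sub>R v" a b] True
            by (auto simp: indicator_def)
          with topological_tendstoD[OF lx open_box True] show ?thesis by (auto elim!: eventually_mono)
        next
          case False
          then have "x \<in> - cbox a b" using elim by auto
          with topological_tendstoD[OF lx open_Compl[OF closed_cbox] this] show ?thesis
            by (auto elim!: eventually_mono simp: indicator_def)
        qed
        then have "\<forall>\<^sub>F n in sequentially. \<bar>?I (x - s n *\<^sub>R v) - ?I x\<bar> = 0" by eventually_elim simp
        then show ?case by (rule tendsto_eventually)
      qed
      show "AE x in lborel. norm \<bar>?I (x - s n *\<^sub>R v) - ?I x\<bar> \<le> indicator (cball 0 (R + norm v)) x" for n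
      proof (rule AE_I2)
        fix x :: 'a
        have "norm x \<le> R + norm v" if "x - s n *\<^sub>R v \<in> cbox a b"
        proof -
          have "norm (x - s n *\<^sub>R v) \<le> R" using R that by auto
          moreover have "norm x \<le> norm (x - s n *\<^sub>R v) + norm (s n *\<^sub>R v)" by (metis diff_add_cancel norm_triangle_ineq)
          moreover have "norm (s n *\<^sub>R v) \<le> norm v" using s[of n] by (simp add: mult_left_le_one_le)
          ultimately show ?thesis by linarith
        qed
        moreover have "norm x \<le> R + norm v" if "x \<in> cbox a b"
        proof -
          have "norm x \<le> R" using R that by auto
          then show ?thesis by (simp add: add_increasing2)
        qed
        ultimately show "norm \<bar>?I (x - s n *\<^sub>R v) - ?I x\<bar> \<le> indicator (cball 0 (R + norm v)) x"
          by (auto simp: indicator_def)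
      qed
    qed measurable
    \<comment> \<open>A translation of the integration variable moves the shift from the difference
      quotient, which is merely bounded, to the indicator, whose shifts converge in the
      mean.\<close>
    have shift: "\<bar>LINT x|lborel. ?I x * E n x\<bar> \<le> L * norm w * (LINT x|lborel. \<bar>?I (x - s n *\<^sub>R v) - ?I x\<bar>)" for n
    proof -
      let ?g = "\<lambda>x. diff_quot f w x (s n)"
      have gb: "\<bar>?g x\<bar> \<le> L * norm w" for x using diff_quot_bound s[of n] by simp
      have bI: "integrable lborel (\<lambda>x. ?I (x - c) * ?g x)" for c
      proof (rule Bochner_Integration.integrable_bound[where f="\<lambda>x. indicator (cbox (a + c) (b + c)) x * (L * norm w)"])
        show "integrable lborel (\<lambda>x. indicator (cbox (a + c) (b + c)) x * (L * norm w))"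
          by (intro integrable_mult_left integrable_real_indicator) (auto simp: emeasure_lborel_cbox_finite[simplified])
        show "AE x in lborel. norm (?I (x - c) * ?g x) \<le> norm (indicator (cbox (a + c) (b + c)) x * (L * norm w))"
          using gb L0 by (intro AE_I2) (auto simp: indicator_def mem_box inner_diff_left inner_add_left algebra_simps)
      qed measurable
      have bI': "integrable lborel (\<lambda>x. ?I x * ?g (x + c))" for c
        using bI[of c] integrable_distr_eq[of "(+) (- c)" lborel borel "\<lambda>x. ?I x * ?g (x + c)"]
        by (simp add: lborel_distr_plus)
      have "(LINT x|lborel. ?I x * ?g (x + s n *\<^sub>R v)) = (LINT x|distr lborel borel ((+) (- (s n *\<^sub>R v))). ?I x * ?g (x + s n *\<^sub>R v))"
        by (simp only: lborel_distr_plus)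
      also have "\<dots> = (LINT x|lborel. ?I (x - s n *\<^sub>R v) * ?g x)"
        by (subst integral_distr) (auto intro!: Bochner_Integration.integral_cong)
      finally have tr: "(LINT x|lborel. ?I x * ?g (x + s n *\<^sub>R v)) = (LINT x|lborel. ?I (x - s n *\<^sub>R v) * ?g x)" .
      have "(LINT x|lborel. ?I x * E n x) = (LINT x|lborel. ?I x * ?g (x + s n *\<^sub>R v)) - (LINT x|lborel. ?I x * ?g x)"
        using bI'[of "s n *\<^sub>R v"] bI'[of 0] unfolding E_def right_diff_distrib by simp
      also have "\<dots> = (LINT x|lborel. (?I (x - s n *\<^sub>R v) - ?I x) * ?g x)"
        unfolding tr left_diff_distrib using bI[of "s n *\<^sub>R v"] bI[of 0] by simp
      finally have "\<bar>LINT x|lborel. ?I x * E n x\<bar> \<le> (LINT x|lborel. \<bar>(?I (x - s n *\<^sub>R v) - ?I x) * ?g x\<bar>)"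
        by (simp add: integral_abs_bound)
      also have "\<dots> \<le> (LINT x|lborel. L * norm w * \<bar>?I (x - s n *\<^sub>R v) - ?I x\<bar>)"
      proof (rule integral_mono)
        show "integrable lborel (\<lambda>x. \<bar>(?I (x - s n *\<^sub>R v) - ?I x) * ?g x\<bar>)"
          unfolding left_diff_distrib using bI[of "s n *\<^sub>R v"] bI[of 0] by simp
        have "integrable lborel (\<lambda>x. ?I (x - c))" for c
        proof -
          have "(\<lambda>x. ?I (x - c)) = indicator (cbox (a + c) (b + c))"
            by (auto simp: fun_eq_iff indicator_def mem_box inner_diff_left inner_add_left algebra_simps)
          then show ?thesis by (auto intro!: integrable_real_indicator simp: emeasure_lborel_cbox_finite[simplified])
        qed
        from this[of "s n *\<^sub>R v"] this[of 0]
        show "integrable lborel (\<lambda>x. L * norm w * \<bar>?I (x - s n *\<^sub>R v) - ?I x\<bar>)" by simp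
        show "\<bar>(?I (x - s n *\<^sub>R v) - ?I x) * ?g x\<bar> \<le> L * norm w * \<bar>?I (x - s n *\<^sub>R v) - ?I x\<bar>" for x
          unfolding abs_mult using gb[of x] by (subst mult.commute) (intro mult_right_mono; simp)
      qed
      finally show ?thesis by simp
    qed
    have "(\<lambda>n. LINT x|lborel. ?I x * E n x) \<longlonglongrightarrow> 0"
    proof (rule Lim_null_comparison)
      show "\<forall>\<^sub>F n in sequentially. norm (LINT x|lborel. ?I x * E n x) \<le> L * norm w * (LINT x|lborel. \<bar>?I (x - s n *\<^sub>R v) - ?I x\<bar>)"
        using shift by simp
      show "(\<lambda>n. L * norm w * (LINT x|lborel. \<bar>?I (x - s n *\<^sub>R v) - ?I x\<bar>)) \<longlonglongrightarrow> 0"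
        using tendsto_mult_left[OF conv0, of "L * norm w"] by simp
    qed
    with conv show "(LINT x|lborel. ?I x * H x) = 0" using LIMSEQ_unique by blast
  qed
  then show ?thesis by eventually_elim (simp add: H_def)
qed

lemma diff_quot_scale:
  assumes "(diff_quot f v x \<longlongrightarrow> d) (at 0)"
  shows "(diff_quot f (c *\<^sub>R v) x \<longlongrightarrow> c * d) (at 0)"
proof (cases "c = 0")
  case True
  then show ?thesis by (simp add: diff_quot_def[abs_def])
next
  case False
  have "diff_quot f (c *\<^sub>R v) x = (\<lambda>s. c * diff_quot f v x (c * s))"
    using False by (auto simp: diff_quot_def fun_eq_iff mult.commute)
  moreover have "filterlim (\<lambda>s. c * s) (at 0) (at 0)"
    unfolding filterlim_at using False by (auto intro!: tendsto_eq_intros simp: eventually_at_filter)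
  then have "((\<lambda>s. diff_quot f v x (c * s)) \<longlongrightarrow> d) (at 0)" by (rule filterlim_compose[OF assms])
  ultimately show ?thesis by (simp add: tendsto_mult_left)
qed

lemma dir_deriv_linear:
  "AE x in lborel. dir_deriv f v x = (\<Sum>i\<in>Basis. (v \<bullet> i) * dir_deriv f i x)"
proof -
  have "AE x in lborel. dir_deriv f (\<Sum>i\<in>S. (v \<bullet> i) *\<^sub>R i) x = (\<Sum>i\<in>S. (v \<bullet> i) * dir_deriv f i x)"
    if "finite S" for S
    using that
  proof induction
    case empty
    have "dir_deriv f 0 x = 0" for x by (rule dir_deriv_eq) (simp add: diff_quot_def[abs_def])
    then show ?case by simp
  next
    case (insert j S)
    have "AE x in lborel. dir_deriv f ((v \<bullet> j) *\<^sub>R j) x = (v \<bullet> j) * dir_deriv f j x"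
      using dir_deriv_exists_AE[of j] by eventually_elim (rule dir_deriv_eq, rule diff_quot_scale)
    with insert.IH dir_deriv_add[of "(v \<bullet> j) *\<^sub>R j" "\<Sum>i\<in>S. (v \<bullet> i) *\<^sub>R i"]
    show ?case by eventually_elim (use insert.hyps in simp)
  qed
  from this[of Basis] show ?thesis by (simp add: euclidean_representation)
qed

text \<open>Off a null set the derivatives along a countable dense set of directions exist and are
  given by one linear form. The Lipschitz bound makes a finite net of these directions sufficient
  for all directions, hence the convergence uniform.\<close>

theorem Rademacher_real:
  obtains N where "negligible N" "\<And>x. x \<notin> N \<Longrightarrow> f differentiable (at x)"
proof -
  obtain V :: "'a set" where V: "countable V" "\<And>X. open X \<Longrightarrow> X \<noteq> {} \<Longrightarrow> \<exists>d\<in>V. d \<in> X"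
    using countable_dense_exists by blast
  define A where "A = (\<lambda>x v. \<Sum>i\<in>Basis. (v \<bullet> i) * dir_deriv f i x)"
  have "AE x in lborel. \<forall>v\<in>V. (diff_quot f v x \<longlongrightarrow> A x v) (at 0)"
  proof (intro AE_ball_countable' V(1))
    fix v
    show "AE x in lborel. (diff_quot f v x \<longlongrightarrow> A x v) (at 0)"
      using dir_deriv_exists_AE[of v] dir_deriv_linear[of v] by eventually_elim (simp add: A_def)
  qed
  then have N: "negligible {x. \<not> (\<forall>v\<in>V. (diff_quot f v x \<longlongrightarrow> A x v) (at 0))}" by (rule negligible_of_AE_lborel)
  have "f differentiable (at x)" if x: "\<forall>v\<in>V. (diff_quot f v x \<longlongrightarrow> A x v) (at 0)" for x
  proof -
    have bl: "bounded_linear (A x)"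
      unfolding A_def by (intro bounded_linear_sum bounded_linear_intros)
    then obtain K where K: "K > 0" "\<And>h. norm (A x h) \<le> norm h * K" using bounded_linear.pos_bounded by blast
    have L0: "L \<ge> 0"
    proof -
      obtain b :: 'a where "b \<in> Basis" using nonempty_Basis by blast
      then show ?thesis using lip[of b 0] by simp
    qed
    have "(f has_derivative A x) (at x)"
      unfolding has_derivative_at_alt
    proof (intro conjI bl allI impI)
      fix e :: real assume e: "e > 0"
      \<comment> \<open>Replacing a unit vector by a point of the net costs
        \<open>L * \<eta>\<close> for \<open>f\<close> and \<open>K * \<eta>\<close> for the linear
        form, together \<open>e / 2\<close>; the rest is left for the difference quotients.\<close>
      define \<eta> where "\<eta> = e / 2 / (L + K)"
      have LK: "L + K \<noteq> 0" using K(1) L0 by simp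
      have \<eta>: "\<eta> > 0" using e K L0 by (simp add: \<eta>_def)
      have \<eta>2: "(L + K) * \<eta> = e / 2"
        using iffD1[OF nonzero_eq_divide_eq[OF LK] \<eta>_def] by (simp only: mult.commute)
      have "sphere 0 1 \<subseteq> (\<Union>v\<in>V. ball v \<eta>)"
      proof
        fix u :: 'a
        obtain v where "v \<in> V" "v \<in> ball u \<eta>" using V(2)[of "ball u \<eta>"] \<eta> by auto
        then show "u \<in> (\<Union>v\<in>V. ball v \<eta>)" by (auto simp: dist_commute)
      qed
      then obtain F where F: "F \<subseteq> V" "finite F" "sphere 0 1 \<subseteq> (\<Union>v\<in>F. ball v \<eta>)"
        using compactE_image[OF compact_sphere[of 0 1], of V "\<lambda>v. ball v \<eta>"] by (metis open_ball)
      have "\<forall>v\<in>F. \<exists>\<delta>>0. \<forall>s. s \<noteq> 0 \<and> \<bar>s\<bar> < \<delta> \<longrightarrow> \<bar>diff_quot f v x s - A x v\<bar> < e / 2"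
      proof
        fix v assume "v \<in> F"
        then have "(diff_quot f v x \<longlongrightarrow> A x v) (at 0)" using F(1) x by blast
        from LIM_D[OF this, of "e / 2"] e show "\<exists>\<delta>>0. \<forall>s. s \<noteq> 0 \<and> \<bar>s\<bar> < \<delta> \<longrightarrow> \<bar>diff_quot f v x s - A x v\<bar> < e / 2"
          by simp
      qed
      then obtain \<delta> where \<delta>: "\<And>v. v \<in> F \<Longrightarrow> \<delta> v > 0"
        "\<And>v s. v \<in> F \<Longrightarrow> s \<noteq> 0 \<Longrightarrow> \<bar>s\<bar> < \<delta> v \<Longrightarrow> \<bar>diff_quot f v x s - A x v\<bar> < e / 2" by metis
      define D where "D = Min (insert 1 (\<delta> ` F))"
      have D: "D > 0" "\<And>v. v \<in> F \<Longrightarrow> D \<le> \<delta> v"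
        using F(2) \<delta>(1) by (auto simp: D_def)
      have "norm (f y - f x - A x (y - x)) \<le> e * norm (y - x)" if y: "norm (y - x) < D" for y
      proof (cases "y = x")
        case True
        then show ?thesis using bounded_linear.linear[OF bl] by (simp add: linear_0)
      next
        case False
        define s where "s = norm (y - x)"
        define u where "u = (y - x) /\<^sub>R s"
        have s: "s > 0" using False by (simp add: s_def)
        have yx: "y = x + s *\<^sub>R u" using s by (simp add: u_def)
        have "u \<in> sphere 0 1" using s by (simp add: u_def s_def)
        then obtain v where v: "v \<in> F" "norm (u - v) < \<eta>"
          using F(3) by (auto simp: dist_norm norm_minus_commute)
        have 1: "\<bar>f (x + s *\<^sub>R u) - f (x + s *\<^sub>R v)\<bar> \<le> L * (s * \<eta>)"
        proof -
          have "\<bar>f (x + s *\<^sub>R u) - f (x + s *\<^sub>R v)\<bar> \<le> L * norm (s *\<^sub>R (u - v))"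
            using lip[of "x + s *\<^sub>R u" "x + s *\<^sub>R v"] by (simp add: scaleR_diff_right)
          also have "\<dots> \<le> L * (s * \<eta>)" using s v(2) L0 by (intro mult_left_mono) auto
          finally show ?thesis .
        qed
        have 2: "\<bar>f (x + s *\<^sub>R v) - f x - s * A x v\<bar> \<le> s * (e / 2)"
        proof -
          have "\<bar>diff_quot f v x s - A x v\<bar> < e / 2" using \<delta>(2)[OF v(1), of s] D(2)[OF v(1)] y s by (simp add: s_def)
          moreover have "f (x + s *\<^sub>R v) - f x - s * A x v = s * (diff_quot f v x s - A x v)"
            using s by (simp add: diff_quot_def field_simps)
          ultimately show ?thesis using s by (simp add: abs_mult)
        qed
        have 3: "\<bar>s * A x v - s * A x u\<bar> \<le> s * (K * \<eta>)"
        proof -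
          have "A x v - A x u = A x (v - u)" using linear_diff[OF bounded_linear.linear[OF bl]] by metis
          moreover have "\<bar>A x (v - u)\<bar> \<le> \<eta> * K"
            using K(2)[of "v - u"] v(2) K(1) by (smt (verit) mult_right_mono norm_minus_commute real_norm_def)
          ultimately show ?thesis using s by (simp add: abs_mult mult.commute flip: right_diff_distrib)
        qed
        have "A x (y - x) = s * A x u"
          using linear_scale[OF bounded_linear.linear[OF bl], of s u] yx by simp
        then have "f y - f x - A x (y - x) = (f (x + s *\<^sub>R u) - f (x + s *\<^sub>R v)) +
            (f (x + s *\<^sub>R v) - f x - s * A x v) + (s * A x v - s * A x u)"
          using yx by simp
        then have "\<bar>f y - f x - A x (y - x)\<bar> \<le> L * (s * \<eta>) + s * (e / 2) + s * (K * \<eta>)" using 1 2 3 by linarith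
        also have "\<dots> = s * ((L + K) * \<eta> + e / 2)" by (simp add: algebra_simps)
        also have "\<dots> = e * s" by (simp add: \<eta>2)
        finally show ?thesis by (simp add: s_def)
      qed
      then show "\<exists>d>0. \<forall>y. norm (y - x) < d \<longrightarrow> norm (f y - f x - A x (y - x)) \<le> e * norm (y - x)"
        using D(1) by blast
    qed
    then show ?thesis by (rule differentiableI)
  qed
  with N show thesis using that by blast
qed

end

theorem Rademacher:
  fixes \<phi> :: "'a::euclidean_space \<Rightarrow> 'b::euclidean_space"
  assumes "\<And>x y. norm (\<phi> x - \<phi> y) \<le> L * norm (x - y)"
  obtains N where "negligible N" "\<And>x. x \<notin> N \<Longrightarrow> \<phi> differentiable (at x)"
proof -
  have "\<exists>N. negligible N \<and> (\<forall>x. x \<notin> N \<longrightarrow> (\<lambda>x. \<phi> x \<bullet> i) differentiable (at x))" if i: "i \<in> Basis" for i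
  proof -
    have "\<bar>\<phi> x \<bullet> i - \<phi> y \<bullet> i\<bar> \<le> L * norm (x - y)" for x y
      using Basis_le_norm[OF i, of "\<phi> x - \<phi> y"] assms[of x y] by (simp add: inner_diff_left)
    from Rademacher_real[OF this] show ?thesis by metis
  qed
  then obtain N where N: "\<And>i. i \<in> Basis \<Longrightarrow> negligible (N i)"
    "\<And>i x. i \<in> Basis \<Longrightarrow> x \<notin> N i \<Longrightarrow> (\<lambda>x. \<phi> x \<bullet> i) differentiable (at x)" by metis
  show thesis
  proof (rule that)
    show "negligible (\<Union>i\<in>Basis. N i)" using N(1) by (intro negligible_Union) auto
    show "\<phi> differentiable (at x)" if "x \<notin> (\<Union>i\<in>Basis. N i)" for x
      using N(2) that by (subst differentiable_componentwise_within) auto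
  qed
qed

section \<open>Change of variables\<close>

text \<open>The change of variables and Sard theorems of the library are stated for well-ordered index
  types, so they are transferred to arbitrary finite index types by renaming coordinates.\<close>

typedef (overloaded) 'n idx = "{..<CARD('n::finite)}"
  by (metis lessThan_iff zero_less_card_finite)

setup_lifting type_definition_idx

instantiation idx :: (finite) wellorder
begin

lift_definition less_eq_idx :: "'a idx \<Rightarrow> 'a idx \<Rightarrow> bool" is "(\<le>)" .
lift_definition less_idx :: "'a idx \<Rightarrow> 'a idx \<Rightarrow> bool" is "(<)" .

instance
proof
  fix P :: "'a idx \<Rightarrow> bool" and a
  assume step: "\<And>x. (\<And>y. y < x \<Longrightarrow> P y) \<Longrightarrow> P x"
  show "P a"
  proof (induction a rule: measure_induct_rule[of Rep_idx])
    case (less x)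
    show ?case by (rule step, rule less) (simp add: less_idx.rep_eq)
  qed
qed (transfer; auto)+

end

instance idx :: (finite) finite
proof
  have "range (Rep_idx :: 'a idx \<Rightarrow> nat) \<subseteq> {..<CARD('a)}" using Rep_idx by blast
  then have "finite (range (Rep_idx :: 'a idx \<Rightarrow> nat))" by (rule finite_subset) simp
  then show "finite (UNIV :: 'a idx set)"
    by (rule finite_imageD) (simp add: inj_on_def Rep_idx_inject)
qed

lemma card_idx [simp]: "CARD('n idx) = CARD('n::finite)"
  using type_definition.card[OF type_definition_idx] by simp

definition idx_of :: "'n::finite \<Rightarrow> 'n idx" where
  "idx_of = (SOME e. bij e)"

lemma bij_idx_of: "bij (idx_of :: 'n::finite \<Rightarrow> 'n idx)"
proof -
  have "\<exists>e :: 'n \<Rightarrow> 'n idx. bij e"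
    using finite_same_card_bij[of "UNIV :: 'n set" "UNIV :: 'n idx set"] by simp
  then show ?thesis unfolding idx_of_def by (rule someI_ex)
qed

definition to_idx :: "real ^ 'n \<Rightarrow> real ^ 'n idx" where
  "to_idx v = (\<chi> i. v $ inv_into UNIV idx_of i)"

definition of_idx :: "real ^ 'n idx \<Rightarrow> real ^ 'n" where
  "of_idx w = (\<chi> i. w $ idx_of i)"

lemma of_to_idx [simp]: "of_idx (to_idx v) = v"
  by (simp add: of_idx_def to_idx_def vec_eq_iff bij_is_inj[OF bij_idx_of])

lemma to_of_idx [simp]: "to_idx (of_idx w) = w"
  by (simp add: of_idx_def to_idx_def vec_eq_iff f_inv_into_f[of _ idx_of UNIV] bij_is_surj[OF bij_idx_of])

lemma linear_to_idx: "linear to_idx" and linear_of_idx: "linear of_idx"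
  by (auto intro!: linearI simp: to_idx_def of_idx_def vec_eq_iff)

lemma bounded_linear_to_idx: "bounded_linear (to_idx :: real ^ 'n \<Rightarrow> _)"
  and bounded_linear_of_idx: "bounded_linear (of_idx :: _ \<Rightarrow> real ^ 'n)"
  using linear_to_idx linear_of_idx by (simp_all add: linear_conv_bounded_linear)

lemma continuous_of_idx: "continuous_on S (of_idx :: _ \<Rightarrow> real ^ 'n)"
  using bounded_linear_of_idx by (auto intro: linear_continuous_on)

lemma norm_of_idx [simp]: "norm (of_idx w :: real ^ 'n) = norm w"
  unfolding norm_vec_def L2_set_def of_idx_def
  using sum.reindex_bij_betw[OF bij_idx_of, of "\<lambda>i. (norm (w $ i))\<^sup>2"] by simp

lemma negligible_of_idx:
  assumes "negligible (S :: (real ^ 'n idx) set)" shows "negligible (of_idx ` S :: (real ^ 'n) set)"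
proof (rule negligible_locally_Lipschitz_image[OF _ assms])
  show "DIM(real ^ 'n idx) \<le> DIM(real ^ 'n)" by simp
  fix x
  show "\<exists>T B. open T \<and> x \<in> T \<and> (\<forall>y\<in>S \<inter> T. norm (of_idx y - of_idx x :: real ^ 'n) \<le> B * norm (y - x))"
    by (rule exI[of _ UNIV], rule exI[of _ 1]) (simp flip: linear_diff[OF linear_of_idx])
qed

text \<open>Renaming coordinates maps boxes to boxes with the same side lengths.\<close>

lemma lborel_distr_of_idx: "distr lborel borel of_idx = (lborel :: (real ^ 'n) measure)"
proof (rule lborel_eqI[symmetric])
  show "emeasure (distr lborel borel of_idx) (box l u) = (\<Prod>b\<in>Basis. (u - l) \<bullet> b)"
    if le: "\<And>b. b \<in> Basis \<Longrightarrow> l \<bullet> b \<le> u \<bullet> b" for l u :: "real ^ 'n"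
  proof -
    have m: "(of_idx :: _ \<Rightarrow> real ^ 'n) \<in> borel_measurable borel"
      by (intro borel_measurable_continuous_onI continuous_of_idx)
    have "of_idx -` box l u = box (to_idx l) (to_idx u)"
    proof -
      have "(\<forall>i. l $ i < x $ idx_of i \<and> x $ idx_of i < u $ i) \<longleftrightarrow>
          (\<forall>j. l $ inv_into UNIV idx_of j < x $ j \<and> x $ j < u $ inv_into UNIV idx_of j)" for x :: "real ^ 'n idx"
        by (metis bij_idx_of bij_is_inj bij_is_surj f_inv_into_f inv_into_f_f UNIV_I)
      then show ?thesis by (auto simp: box_def Basis_vec_def inner_axis of_idx_def to_idx_def)
    qed
    then have "emeasure (distr lborel borel of_idx) (box l u) = emeasure lborel (box (to_idx l) (to_idx u))"
      using m by (simp add: emeasure_distr)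
    also have "\<dots> = (\<Prod>b\<in>Basis. (to_idx u - to_idx l) \<bullet> b)"
    proof (rule emeasure_lborel_box)
      fix b :: "real ^ 'n idx" assume "b \<in> Basis"
      then obtain i where "b = axis i 1" by (auto simp: Basis_vec_def)
      then show "to_idx l \<bullet> b \<le> to_idx u \<bullet> b"
        using le[of "axis (inv_into UNIV idx_of i) 1"] by (simp add: inner_axis to_idx_def)
    qed
    also have "(\<Prod>b\<in>Basis. (to_idx u - to_idx l) \<bullet> b) = (\<Prod>i\<in>UNIV. (to_idx u - to_idx l) $ i)"
    proof -
      have "(\<Prod>b\<in>Basis. (to_idx u - to_idx l) \<bullet> b) = (\<Prod>b\<in>range (\<lambda>i. axis i 1). (to_idx u - to_idx l) \<bullet> b)"
        by (intro prod.cong) (auto simp: Basis_vec_def)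
      also have "\<dots> = (\<Prod>i\<in>UNIV. (to_idx u - to_idx l) $ i)"
        by (subst prod.reindex) (auto simp: inj_on_def axis_eq_axis inner_axis)
      finally show ?thesis .
    qed
    also have "\<dots> = (\<Prod>i\<in>UNIV. (to_idx u - to_idx l) $ idx_of i)"
      by (rule prod.reindex_bij_betw[symmetric, OF bij_idx_of])
    also have "\<dots> = (\<Prod>i\<in>UNIV. (u - l) $ i)"
      by (intro prod.cong) (auto simp: to_idx_def bij_is_inj[OF bij_idx_of])
    also have "\<dots> = (\<Prod>b\<in>range (\<lambda>i. axis i 1). (u - l) \<bullet> b)"
      by (subst prod.reindex) (auto simp: inj_on_def axis_eq_axis inner_axis)
    also have "\<dots> = (\<Prod>b\<in>Basis. (u - l) \<bullet> b)"
      by (intro prod.cong) (auto simp: Basis_vec_def)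
    finally show ?thesis .
  qed
qed simp

lemma borel_measurable_of_idx [measurable]: "(of_idx :: _ \<Rightarrow> real ^ 'n) \<in> borel \<rightarrow>\<^sub>M borel"
  by (intro borel_measurable_continuous_onI continuous_of_idx)

lemma distr_lebesgue_lborel_of_idx: "distr lebesgue lborel of_idx = (lborel :: (real ^ 'n) measure)"
proof -
  have "distr lebesgue lborel of_idx = distr lborel lborel (of_idx :: _ \<Rightarrow> real ^ 'n)"
    by (rule distr_completion) simp
  also have "\<dots> = distr lborel borel of_idx" by (rule distr_cong) auto
  finally show ?thesis using lborel_distr_of_idx by simp
qed

lemma measurable_of_idx: "(of_idx :: _ \<Rightarrow> real ^ 'n) \<in> lebesgue \<rightarrow>\<^sub>M lebesgue"
  by (rule completion.measurable_completion2)
     (auto simp: distr_lebesgue_lborel_of_idx intro: measurable_completion)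

lemma distr_lebesgue_of_idx: "distr lebesgue lebesgue of_idx = (lebesgue :: (real ^ 'n) measure)"
  using completion.completion_distr_eq[of of_idx lborel "lborel :: (real ^ 'n) measure"]
  by (simp add: distr_lebesgue_lborel_of_idx measurable_completion)

lemma measurable_to_idx: "(to_idx :: real ^ 'n \<Rightarrow> _) \<in> lebesgue \<rightarrow>\<^sub>M lebesgue"
proof (rule measurableI)
  fix A :: "(real ^ 'n idx) set" assume A: "A \<in> sets lebesgue"
  have "to_idx -` A \<inter> space lebesgue = (of_idx ` A :: (real ^ 'n) set)"
    by (auto simp: image_iff) (metis of_to_idx)
  moreover have "of_idx ` A \<in> sets (lebesgue :: (real ^ 'n) measure)"
    by (rule differentiable_image_in_sets_lebesgue[OF A])
       (auto intro!: linear_imp_differentiable_on linear_of_idx)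
  ultimately show "to_idx -` A \<inter> space lebesgue \<in> sets (lebesgue :: (real ^ 'n) measure)" by simp
qed simp

lemma measurable_of_idx_iff:
  "(\<lambda>w. h (of_idx w)) \<in> borel_measurable lebesgue \<longleftrightarrow> h \<in> borel_measurable (lebesgue :: (real ^ 'n) measure)"
proof
  assume "(\<lambda>w. h (of_idx w)) \<in> borel_measurable lebesgue"
  from measurable_compose[OF measurable_to_idx this] show "h \<in> borel_measurable lebesgue" by simp
qed (rule measurable_compose[OF measurable_of_idx])

lemma integrable_of_idx:
  fixes h :: "real ^ 'n \<Rightarrow> real"
  shows "integrable lebesgue (\<lambda>w. h (of_idx w)) \<longleftrightarrow> integrable lebesgue h"
proof (cases "h \<in> borel_measurable lebesgue")
  case True
  then show ?thesis
    using integrable_distr_eq[OF measurable_of_idx True] by (simp add: distr_lebesgue_of_idx)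
next
  case False
  then show ?thesis using measurable_of_idx_iff[of h] by (auto dest: borel_measurable_integrable)
qed

text \<open>No measurability has to be assumed: without integrability both integrals are 0.\<close>

lemma integral_of_idx:
  fixes h :: "real ^ 'n \<Rightarrow> real"
  shows "(LINT w|lebesgue. h (of_idx w)) = (LINT v|lebesgue. h v)"
proof (cases "h \<in> borel_measurable lebesgue")
  case True
  then show ?thesis
    using integral_distr[OF measurable_of_idx True] by (simp add: distr_lebesgue_of_idx)
next
  case False
  then have "\<not> integrable lebesgue h" by (auto dest: borel_measurable_integrable)
  then show ?thesis using integrable_of_idx[of h] by (simp add: not_integrable_integral_eq)
qed

definition matrix_to_idx :: "real ^ 'n ^ 'n \<Rightarrow> real ^ 'n idx ^ 'n idx" where
  "matrix_to_idx A = (\<chi> i j. A $ inv_into UNIV idx_of i $ inv_into UNIV idx_of j)"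

lemma inv_idx_of [simp]: "inv_into UNIV idx_of (idx_of i) = (i :: 'n::finite)"
  by (simp add: bij_is_inj[OF bij_idx_of])

lemma idx_of_inv [simp]: "idx_of (inv_into UNIV idx_of j :: 'n::finite) = j"
  by (simp add: f_inv_into_f bij_is_surj[OF bij_idx_of])

lemma inv_idx_of_eq: "inv_into UNIV idx_of j = (i :: 'n::finite) \<longleftrightarrow> j = idx_of i"
  by (metis inv_idx_of idx_of_inv)

lemma det_swap_matrix:
  fixes m n :: "'n::finite"
  assumes "m \<noteq> n"
  shows "det (\<chi> i j. mat 1 $ i $ Transposition.transpose m n j :: real^'n^'n) = -1"
proof -
  have "det (\<chi> i j. mat 1 $ i $ Transposition.transpose m n j :: real^'n^'n) =
      of_int (sign (Transposition.transpose m n)) * det (mat 1 :: real^'n^'n)"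
    by (rule det_permute_columns) (simp add: permutes_swap_id)
  then show ?thesis using assms by (simp add: sign_swap_id)
qed

text \<open>Renaming respects products and keeps the type of an elementary matrix, so the elementary
  factorisation avoids a reindexing of the permutations in the definition of
  \<open>det\<close>.\<close>

lemma det_matrix_to_idx: "det (matrix_to_idx A) = det (A :: real ^ 'n ^ 'n)"
proof (induction A rule: induct_matrix_elementary)
  case (1 A B)
  have "matrix_to_idx (A ** B) = matrix_to_idx A ** matrix_to_idx B"
  proof -
    have "(\<Sum>k\<in>UNIV. A $ i $ k * B $ k $ j) =
        (\<Sum>k\<in>UNIV. A $ i $ inv_into UNIV idx_of k * B $ inv_into UNIV idx_of k $ j)" for i j
      using sum.reindex_bij_betw[OF bij_idx_of, of "\<lambda>k. A $ i $ inv_into UNIV idx_of k * B $ inv_into UNIV idx_of k $ j"]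
      by simp
    then show ?thesis by (simp add: matrix_to_idx_def matrix_matrix_mult_def vec_eq_iff)
  qed
  then show ?case using 1 by (simp add: det_mul)
next
  case (2 A i)
  then have "row (idx_of i) (matrix_to_idx A) = 0"
    by (auto simp: row_def matrix_to_idx_def vec_eq_iff)
  then show ?case using 2 by (simp add: det_zero_row)
next
  case (3 A)
  have "det (matrix_to_idx A) = (\<Prod>i\<in>UNIV. matrix_to_idx A $ i $ i)"
    using 3 by (intro det_diagonal) (simp add: matrix_to_idx_def inv_idx_of_eq)
  also have "\<dots> = (\<Prod>i\<in>UNIV. matrix_to_idx A $ idx_of i $ idx_of i)"
    by (rule prod.reindex_bij_betw[symmetric, OF bij_idx_of])
  also have "\<dots> = det A" using 3 by (simp add: det_diagonal matrix_to_idx_def)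
  finally show ?case .
next
  case (4 m n)
  have "matrix_to_idx (\<chi> i j. mat 1 $ i $ Transposition.transpose m n j :: real^'n^'n) =
      (\<chi> i j. mat 1 $ i $ Transposition.transpose (idx_of m) (idx_of n) j)"
    by (auto simp: matrix_to_idx_def vec_eq_iff mat_def Transposition.transpose_def inv_idx_of_eq)
  moreover have "idx_of m \<noteq> idx_of n" using 4 by (metis inv_idx_of)
  ultimately show ?case using 4 by (simp only: det_swap_matrix simp_thms)
next
  case (5 m n c)
  have "matrix_to_idx (\<chi> i j. if i = m \<and> j = n then c else of_bool (i = j) :: real^'n^'n) =
      (\<chi> i j. if i = idx_of m \<and> j = idx_of n then c else of_bool (i = j))"
    by (auto simp: matrix_to_idx_def vec_eq_iff inv_idx_of_eq)
  moreover have "idx_of m \<noteq> idx_of n" using 5 by (metis inv_idx_of)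
  ultimately show ?case using 5 by (simp only: det_idplus simp_thms)
qed

lemma matrix_conjugate_idx:
  fixes A :: "real ^ 'n \<Rightarrow> real ^ 'n"
  assumes "linear A"
  shows "matrix (\<lambda>w. to_idx (A (of_idx w))) = matrix_to_idx (matrix A)"
proof -
  have "of_idx (axis j 1) = (axis (inv_into UNIV idx_of j) 1 :: real ^ 'n)" for j
    by (auto simp: of_idx_def axis_def vec_eq_iff)
  then show ?thesis by (simp add: matrix_def matrix_to_idx_def to_idx_def)
qed

lemma has_derivative_conjugate_idx:
  assumes "(g has_derivative g') (at x within S)"
  shows "((\<lambda>w. to_idx (g (of_idx w))) has_derivative (\<lambda>w. to_idx (g' (of_idx w)))) (at (to_idx x) within to_idx ` S)"
proof -
  have S: "of_idx ` to_idx ` S = S" by (simp add: image_image)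
  have 1: "(of_idx has_derivative of_idx) (at (to_idx x) within to_idx ` S)"
    by (rule bounded_linear_imp_has_derivative[OF bounded_linear_of_idx])
  have 2: "(g has_derivative g') (at (of_idx (to_idx x)) within of_idx ` to_idx ` S)"
    using assms by (simp add: S)
  from bounded_linear.has_derivative[OF bounded_linear_to_idx has_derivative_in_compose[OF 1 2]]
  show ?thesis .
qed

section \<open>Sard's theorem and the area formula for arbitrary finite index types\<close>

lemma Sard:
  fixes f :: "real ^ 'n \<Rightarrow> real ^ 'n"
  assumes der: "\<And>x. x \<in> S \<Longrightarrow> (f has_derivative f' x) (at x)"
    and det: "\<And>x. x \<in> S \<Longrightarrow> det (matrix (f' x)) = 0"
  shows "negligible (f ` S)"
proof -
  let ?F = "\<lambda>w. to_idx (f (of_idx w))" and ?F' = "\<lambda>w h. to_idx (f' (of_idx w) (of_idx h))"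
  have "negligible (?F ` to_idx ` S)"
  proof (rule baby_Sard[where f'="?F'"])
    fix w assume "w \<in> to_idx ` S"
    then obtain x where x: "x \<in> S" "w = to_idx x" by blast
    have "(f has_derivative f' x) (at x within S)" using der[OF x(1)] by (rule has_derivative_at_withinI)
    from has_derivative_conjugate_idx[OF this] show "(?F has_derivative ?F' w) (at w within to_idx ` S)"
      by (simp add: x(2))
    have "linear (f' x)" using der[OF x(1)] by (rule has_derivative_linear)
    then have "det (matrix (?F' w)) = 0"
      using det[OF x(1)] by (simp add: x(2) matrix_conjugate_idx det_matrix_to_idx)
    then have "\<not> inj ((*v) (matrix (?F' w)))"
      using invertible_det_nz[of "matrix (?F' w)"]
        invertible_left_inverse[of "matrix (?F' w)"] matrix_left_invertible_injective[of "matrix (?F' w)"] by blast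
    then have "rank (matrix (?F' w)) \<noteq> CARD('n idx)" using full_rank_injective[of "matrix (?F' w)"] by simp
    then show "rank (matrix (?F' w)) < CARD('n idx)"
      using rank_bound[of "matrix (?F' w)"] by simp
  qed simp
  then have "negligible (of_idx ` ?F ` to_idx ` S :: (real ^ 'n) set)" by (rule negligible_of_idx)
  moreover have "of_idx ` ?F ` to_idx ` S = f ` S" by (simp add: image_image)
  ultimately show ?thesis by simp
qed

text \<open>Scalar functions enter the vector-valued formula as functions into
  \<open>real ^ 1\<close>. The two integrabilities are equivalent; when they fail, both integrals
  are 0 and the equation persists.\<close>

lemma change_of_variables:
  fixes g :: "real ^ 'n \<Rightarrow> real ^ 'n" and f :: "real ^ 'n \<Rightarrow> real"
  assumes S: "S \<in> sets lebesgue"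
    and der: "\<And>x. x \<in> S \<Longrightarrow> (g has_derivative g' x) (at x)"
    and inj: "inj_on g S"
  shows "integrable lebesgue (\<lambda>x. indicator S x * (\<bar>det (matrix (g' x))\<bar> * f (g x))) \<longleftrightarrow>
           integrable lebesgue (\<lambda>x. indicator (g ` S) x * f x)" (is ?int)
    and "(LINT x|lebesgue. indicator S x * (\<bar>det (matrix (g' x))\<bar> * f (g x))) =
           (LINT x|lebesgue. indicator (g ` S) x * f x)" (is ?eq)
proof -
  let ?S = "to_idx ` S"
  let ?G = "\<lambda>w. to_idx (g (of_idx w))" and ?G' = "\<lambda>w h. to_idx (g' (of_idx w) (of_idx h))"
  let ?f = "\<lambda>w. f (of_idx w)"
  have S': "?S \<in> sets lebesgue"
    by (rule differentiable_image_in_sets_lebesgue[OF S])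
       (auto intro!: linear_imp_differentiable_on linear_to_idx)
  have der': "(?G has_derivative ?G' w) (at w within ?S)" if w: "w \<in> ?S" for w
  proof -
    obtain x where x: "x \<in> S" "w = to_idx x" using w by blast
    have "(g has_derivative g' x) (at x within S)" using der[OF x(1)] by (rule has_derivative_at_withinI)
    from has_derivative_conjugate_idx[OF this] show ?thesis by (simp add: x(2))
  qed
  have inj': "inj_on ?G ?S"
  proof (rule inj_onI, clarify)
    fix x y assume "x \<in> S" "y \<in> S" "?G (to_idx x) = ?G (to_idx y)"
    then have "g x = g y" by (metis of_to_idx)
    then show "to_idx x = to_idx y" using inj \<open>x \<in> S\<close> \<open>y \<in> S\<close> by (auto dest: inj_onD)
  qed
  let ?L = "\<lambda>w. \<bar>det (matrix (?G' w))\<bar> * ?f (?G w)"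
  have cov: "?L absolutely_integrable_on ?S \<and> integral ?S ?L = c \<longleftrightarrow>
      ?f absolutely_integrable_on ?G ` ?S \<and> integral (?G ` ?S) ?f = c" for c
  proof -
    have "(\<lambda>w. \<bar>det (matrix (?G' w))\<bar> *\<^sub>R vec (?f (?G w)) :: real ^ 1) absolutely_integrable_on ?S \<and>
        integral ?S (\<lambda>w. \<bar>det (matrix (?G' w))\<bar> *\<^sub>R vec (?f (?G w))) = (vec c :: real ^ 1) \<longleftrightarrow>
        (\<lambda>w. vec (?f w) :: real ^ 1) absolutely_integrable_on ?G ` ?S \<and>
        integral (?G ` ?S) (\<lambda>w. vec (?f w)) = (vec c :: real ^ 1)"
      by (rule has_absolute_integral_change_of_variables[OF S' der' inj'])
    moreover have "(\<lambda>w. \<bar>det (matrix (?G' w))\<bar> *\<^sub>R vec (?f (?G w)) :: real ^ 1) = (\<lambda>w. vec (?L w))"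
      by (simp add: fun_eq_iff vec_eq_iff)
    ultimately show ?thesis by (simp only: absolutely_integrable_on_1_iff integral_on_1_eq) (simp add: vec_eq_iff)
  qed
  have iff: "?L absolutely_integrable_on ?S \<longleftrightarrow> ?f absolutely_integrable_on ?G ` ?S"
    and eq: "?L absolutely_integrable_on ?S \<Longrightarrow> integral ?S ?L = integral (?G ` ?S) ?f"
    using cov[of "integral ?S ?L"] cov[of "integral (?G ` ?S) ?f"] by auto
  have lin: "linear (g' x)" if "x \<in> S" for x using der[OF that] by (rule has_derivative_linear)
  have mem: "w \<in> ?S \<longleftrightarrow> of_idx w \<in> S" for w by (metis image_iff of_to_idx to_of_idx)
  have mem': "w \<in> ?G ` ?S \<longleftrightarrow> of_idx w \<in> g ` S" for w
    unfolding image_image by (simp add: image_iff) (metis of_to_idx to_of_idx)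
  have L: "indicator ?S w *\<^sub>R ?L w = indicator S (of_idx w) * (\<bar>det (matrix (g' (of_idx w)))\<bar> * f (g (of_idx w)))" for w
    using lin[of "of_idx w"] mem[of w] by (auto simp: indicator_def matrix_conjugate_idx det_matrix_to_idx)
  have R: "indicator (?G ` ?S) w *\<^sub>R ?f w = indicator (g ` S) (of_idx w) * f (of_idx w)" for w
    using mem'[of w] by (auto simp: indicator_def)
  have iL: "?L absolutely_integrable_on ?S \<longleftrightarrow> integrable lebesgue (\<lambda>x. indicator S x * (\<bar>det (matrix (g' x))\<bar> * f (g x)))"
    unfolding set_integrable_def L
    by (rule integrable_of_idx[of "\<lambda>x. indicator S x * (\<bar>det (matrix (g' x))\<bar> * f (g x))"])
  have iR: "?f absolutely_integrable_on ?G ` ?S \<longleftrightarrow> integrable lebesgue (\<lambda>x. indicator (g ` S) x * f x)"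
    unfolding set_integrable_def R by (rule integrable_of_idx[of "\<lambda>x. indicator (g ` S) x * f x"])
  show ?int using iff iL iR by blast
  show ?eq
  proof (cases "?L absolutely_integrable_on ?S")
    case True
    have "(LINT x|lebesgue. indicator S x * (\<bar>det (matrix (g' x))\<bar> * f (g x))) = (LINT w : ?S|lebesgue. ?L w)"
      unfolding set_lebesgue_integral_def L
      by (rule integral_of_idx[symmetric, of "\<lambda>x. indicator S x * (\<bar>det (matrix (g' x))\<bar> * f (g x))"])
    also have "\<dots> = integral ?S ?L" using True by (rule set_lebesgue_integral_eq_integral(2))
    also have "\<dots> = integral (?G ` ?S) ?f" using True by (rule eq)
    also have "\<dots> = (LINT w : ?G ` ?S|lebesgue. ?f w)"
      using True iff by (intro set_lebesgue_integral_eq_integral(2)[symmetric]) blast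
    also have "\<dots> = (LINT x|lebesgue. indicator (g ` S) x * f x)"
      unfolding set_lebesgue_integral_def R by (rule integral_of_idx[of "\<lambda>x. indicator (g ` S) x * f x"])
    finally show ?thesis .
  next
    case False
    then show ?thesis using iff iL iR by (simp add: not_integrable_integral_eq)
  qed
qed

section \<open>The implicit Euler scheme\<close>

locale one_sided_field =
  fixes T :: real and b :: "real \<Rightarrow> 'a::euclidean_space \<Rightarrow> 'a" and C0 C1 :: "real \<Rightarrow> real"
  assumes T_pos: "T > 0"
    and meas: "(\<lambda>(t, x). b t x) \<in> borel_measurable (lebesgue_on ({0..T} \<times> UNIV))"
    and C0_nonneg: "\<And>t. t \<in> {0..T} \<Longrightarrow> 0 \<le> C0 t"
    and C1_nonneg: "\<And>t. t \<in> {0..T} \<Longrightarrow> 0 \<le> C1 t"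
    and C0_int: "integrable (lebesgue_on {0..T}) C0"
    and C1_int: "integrable (lebesgue_on {0..T}) C1"
    and growth: "\<And>t x. t \<in> {0..T} \<Longrightarrow> norm (b t x) \<le> C0 t * (1 + norm x)"
    and one_sided: "\<And>t x y. t \<in> {0..T} \<Longrightarrow> (b t x - b t y) \<bullet> (x - y) \<ge> - C1 t * (norm (x - y))\<^sup>2"
begin

text \<open>The points at which \<open>b\<close> can be averaged in time. Joint Lebesgue
  measurability does not control individual slices, so this need not be the whole space.\<close>

definition good :: "'a set" where
  "good = {x. (\<lambda>t. b t x) \<in> borel_measurable (lebesgue_on {0..T})}"

text \<open>Each component agrees with a Borel function off a null set. By Fubini the section of
  this set at almost every \<open>x\<close> is null, and a function that equals a Borel function
  almost everywhere is Lebesgue measurable.\<close>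

lemma AE_good: "AE x in lborel. x \<in> good"
proof -
  have comp: "AE x in lborel. (\<lambda>t. b t x \<bullet> i) \<in> borel_measurable (lebesgue_on {0..T})" if i: "i \<in> Basis" for i
  proof -
    define f where "f = (\<lambda>z :: real \<times> 'a. if z \<in> {0..T} \<times> UNIV then b (fst z) (snd z) \<bullet> i else 0)"
    have S: "{0..T} \<times> (UNIV :: 'a set) \<in> sets lebesgue"
    proof -
      have "closed ({0..T} \<times> (UNIV :: 'a set))" by (rule closed_Times) auto
      then show ?thesis by (auto intro: borel_closed)
    qed
    have "(\<lambda>z. b (fst z) (snd z) \<bullet> i) \<in> borel_measurable (lebesgue_on ({0..T} \<times> UNIV))"
      using meas by (intro borel_measurable_inner) (auto simp: case_prod_unfold)
    then have "f \<in> borel_measurable (completion lborel)"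
      unfolding f_def using S by (simp add: borel_measurable_if)
    then obtain f' where f': "f' \<in> borel_measurable lborel" "AE z in lborel. f z = f' z"
      using completion_ex_borel_measurable_real by blast
    from f'(2) obtain N where N: "{z \<in> space lborel. f z \<noteq> f' z} \<subseteq> N" "N \<in> null_sets lborel"
      unfolding eventually_ae_filter by blast
    have N'[measurable]: "N \<in> sets (lborel \<Otimes>\<^sub>M lborel)" and N0: "emeasure (lborel \<Otimes>\<^sub>M lborel) N = 0"
      unfolding lborel_prod using N(2) by auto
    have "(\<integral>\<^sup>+x. (\<integral>\<^sup>+t. indicator N (t, x) \<partial>lborel) \<partial>lborel) = integral\<^sup>N (lborel \<Otimes>\<^sub>M lborel) (indicator N)"
      by (rule lborel_pair.nn_integral_snd) measurable
    also have "\<dots> = 0" by (simp only: nn_integral_indicator[OF N'] N0)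
    finally have "AE x in lborel. (\<integral>\<^sup>+t. indicator N (t, x) \<partial>lborel) = 0"
      by (subst (asm) nn_integral_0_iff_AE) auto
    then show ?thesis
    proof eventually_elim
      case (elim x)
      have sec: "{t. (t, x) \<in> N} \<in> sets (borel :: real measure)"
        using measurable_sets[OF measurable_Pair2'[of x "lborel :: 'a measure" "lborel :: real measure"] N'] by (simp add: vimage_def)
      have "AE t in lborel. indicator N (t, x) = (0 :: ennreal)"
        using elim sec by (subst (asm) nn_integral_0_iff_AE) (auto simp: indicator_def intro!: borel_measurable_indicator' measurable_If)
      then have "AE t in lborel. f (t, x) = f' (t, x)"
        by eventually_elim (use N(1) in \<open>auto simp: indicator_def split: if_splits\<close>)
      then have ae: "AE t in lebesgue. f' (t, x) = f (t, x)" by (intro AE_completion) (auto elim: eventually_mono)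
      have "(\<lambda>t. f' (t, x)) \<in> borel_measurable lborel"
      proof -
        have "(\<lambda>t :: real. (t, x)) \<in> borel \<rightarrow>\<^sub>M borel"
          by (intro borel_measurable_continuous_onI continuous_intros)
        from measurable_compose[OF this, of f' borel] f'(1) show ?thesis by simp
      qed
      then have ml: "(\<lambda>t. f' (t, x)) \<in> borel_measurable lebesgue" by (rule measurable_completion)
      have "(\<lambda>t. f (t, x)) \<in> borel_measurable lebesgue" by (rule borel_measurable_AE[OF ml ae])
      moreover have "(\<lambda>t. f (t, x)) = (\<lambda>t. if t \<in> {0..T} then b t x \<bullet> i else 0)"
        by (auto simp: f_def)
      ultimately have "(\<lambda>t. if t \<in> {0..T} then b t x \<bullet> i else 0) \<in> borel_measurable lebesgue" by simp
      then show ?case by (rule iffD1[OF borel_measurable_if, rotated]) simp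
    qed
  qed
  have "AE x in lborel. \<forall>i\<in>Basis. (\<lambda>t. b t x \<bullet> i) \<in> borel_measurable (lebesgue_on {0..T})"
    using comp by (intro AE_finite_allI) auto
  then show ?thesis
    unfolding good_def by eventually_elim (auto simp: borel_measurable_euclidean_space[of "\<lambda>t. b t _"])
qed

lemma good_dense: "closure good = UNIV"
proof -
  have "negligible (- closure good)"
    by (rule negligible_subset[OF negligible_of_AE_lborel[OF AE_good]]) (use closure_subset in auto)
  then have "- closure good = {}" using open_not_negligible[of "- closure good"] by (auto simp: open_Compl)
  then show ?thesis by blast
qed

lemma b_integrable:
  assumes x: "x \<in> good" and st: "0 \<le> s" "t \<le> T"
  shows "(\<lambda>\<tau>. b \<tau> x) absolutely_integrable_on {s..t}" "(\<lambda>\<tau>. b \<tau> x) integrable_on {s..t}"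
proof -
  have "integrable (lebesgue_on {0..T}) (\<lambda>\<tau>. b \<tau> x)"
  proof (rule Bochner_Integration.integrable_bound)
    show "integrable (lebesgue_on {0..T}) (\<lambda>\<tau>. C0 \<tau> * (1 + norm x))" using C0_int by simp
    show "(\<lambda>\<tau>. b \<tau> x) \<in> borel_measurable (lebesgue_on {0..T})" using x by (simp add: good_def)
    show "AE \<tau> in lebesgue_on {0..T}. norm (b \<tau> x) \<le> norm (C0 \<tau> * (1 + norm x))"
      using growth C0_nonneg by (intro AE_I2) (auto simp: space_restrict_space)
  qed
  then have "(\<lambda>\<tau>. b \<tau> x) absolutely_integrable_on {0..T}"
    by (simp add: set_integrable_def integrable_restrict_space)
  then show "(\<lambda>\<tau>. b \<tau> x) absolutely_integrable_on {s..t}"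
    by (rule absolutely_integrable_on_subinterval) (use st in auto)
  then show "(\<lambda>\<tau>. b \<tau> x) integrable_on {s..t}" by (rule absolutely_integrable_on_def[THEN iffD1, THEN conjunct1])
qed

lemma C_integrable:
  assumes "0 \<le> s" "t \<le> T" shows "C0 integrable_on {s..t}" "C1 integrable_on {s..t}"
  using integrable_on_lebesgue_on[OF C0_int] integrable_on_lebesgue_on[OF C1_int] assms
  by (auto intro!: integrable_on_subinterval[of _ "{0..T}"])

definition C :: "real \<Rightarrow> real" where "C t = 1 + C0 t + C1 t"

text \<open>The clock of the problem: both the growth constant and the one-sided constant of the
  field integrated over \<open>{s..t}\<close> are at most \<open>m t - m s\<close>, so no bound on
  \<open>C0\<close> or \<open>C1\<close> at single times is used.\<close>

definition m :: "real \<Rightarrow> real" where "m t = integral {0..t} C"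

lemma C_pos: "t \<in> {0..T} \<Longrightarrow> 0 < C t" using C0_nonneg[of t] C1_nonneg[of t] by (simp add: C_def)

lemma C_nonneg: "t \<in> {0..T} \<Longrightarrow> 0 \<le> C t" using C_pos by fastforce

lemma C_int: "integrable (lebesgue_on {0..T}) C"
  unfolding C_def[abs_def] using C0_int C1_int by simp

lemma C_integrable_on: assumes "0 \<le> s" "t \<le> T" shows "C integrable_on {s..t}"
  unfolding C_def[abs_def] using C_integrable[OF assms] by (intro integrable_add integrable_const_ivl) auto

lemma m_diff: assumes "0 \<le> s" "s \<le> t" "t \<le> T" shows "m t - m s = integral {s..t} C"
  using Henstock_Kurzweil_Integration.integral_combine[of 0 s t C] assms C_integrable_on[of 0 t] by (simp add: m_def)

lemma m_mono: assumes "0 \<le> s" "s \<le> t" "t \<le> T" shows "m s \<le> m t"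
proof -
  have "0 \<le> integral {s..t} C"
    using assms C_nonneg by (intro Henstock_Kurzweil_Integration.integral_nonneg C_integrable_on) auto
  then show ?thesis using m_diff[OF assms] by simp
qed

lemma m_0 [simp]: "m 0 = 0" by (simp add: m_def)

lemma m_continuous: "continuous_on {0..T} m"
  unfolding m_def using C_integrable_on by (intro indefinite_integral_continuous_1) auto

lemma m_absolutely_cont: "absolutely_cont_on 0 T m"
  unfolding m_def by (intro absolutely_cont_on_integral C_int C_nonneg)

lemma C01_le_m:
  assumes "0 \<le> s" "s \<le> t" "t \<le> T"
  shows "integral {s..t} C0 \<le> m t - m s" "integral {s..t} C1 \<le> m t - m s"
    "0 \<le> integral {s..t} C0" "0 \<le> integral {s..t} C1"
proof -
  note i = C_integrable[OF assms(1,3)] C_integrable_on[OF assms(1,3)]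
  have "0 \<le> C0 \<tau>" "0 \<le> C1 \<tau>" if "\<tau> \<in> {s..t}" for \<tau>
    using that assms C0_nonneg[of \<tau>] C1_nonneg[of \<tau>] by auto
  then have le: "C0 \<tau> \<le> C \<tau>" "C1 \<tau> \<le> C \<tau>" "0 \<le> C0 \<tau>" "0 \<le> C1 \<tau>" if "\<tau> \<in> {s..t}" for \<tau>
    using that by (force simp: C_def)+
  show "integral {s..t} C0 \<le> m t - m s" "integral {s..t} C1 \<le> m t - m s"
    unfolding m_diff[OF assms] using integral_le[OF i(1,3)] integral_le[OF i(2,3)] le by auto
  show "0 \<le> integral {s..t} C0" "0 \<le> integral {s..t} C1"
    using Henstock_Kurzweil_Integration.integral_nonneg[OF i(1)] Henstock_Kurzweil_Integration.integral_nonneg[OF i(2)] le by auto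
qed

definition B :: "real \<Rightarrow> real \<Rightarrow> 'a \<Rightarrow> 'a" where "B s t x = integral {s..t} (\<lambda>\<tau>. b \<tau> x)"

lemma B_growth:
  assumes "0 \<le> s" "s \<le> t" "t \<le> T" "x \<in> good"
  shows "norm (B s t x) \<le> (m t - m s) * (1 + norm x)"
proof -
  have "norm (B s t x) \<le> integral {s..t} (\<lambda>\<tau>. C0 \<tau> * (1 + norm x))"
    unfolding B_def using assms growth
    by (intro integral_norm_bound_integral b_integrable integrable_on_mult_left C_integrable) auto
  also have "\<dots> = integral {s..t} C0 * (1 + norm x)" by simp
  also have "\<dots> \<le> (m t - m s) * (1 + norm x)" using C01_le_m[OF assms(1-3)] by (intro mult_right_mono) auto
  finally show ?thesis .
qed

lemma B_one_sided:
  assumes "0 \<le> s" "s \<le> t" "t \<le> T" "x \<in> good" "y \<in> good"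
  shows "(B s t x - B s t y) \<bullet> (x - y) \<ge> - integral {s..t} C1 * (norm (x - y))\<^sup>2"
proof -
  have bi: "(\<lambda>\<tau>. b \<tau> x) integrable_on {s..t}" "(\<lambda>\<tau>. b \<tau> y) integrable_on {s..t}"
    using assms by (auto intro: b_integrable)
  have "- integral {s..t} C1 * (norm (x - y))\<^sup>2 = integral {s..t} (\<lambda>\<tau>. - C1 \<tau> * (norm (x - y))\<^sup>2)" by simp
  also have "\<dots> \<le> integral {s..t} (\<lambda>\<tau>. (b \<tau> x - b \<tau> y) \<bullet> (x - y))"
  proof (rule integral_le)
    show "(\<lambda>\<tau>. - C1 \<tau> * (norm (x - y))\<^sup>2) integrable_on {s..t}"
      using assms by (intro integrable_on_mult_left integrable_neg C_integrable)
    show "(\<lambda>\<tau>. (b \<tau> x - b \<tau> y) \<bullet> (x - y)) integrable_on {s..t}"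
      using integrable_component[OF integrable_diff[OF bi]]
      by (intro integrable_linear[OF integrable_diff[OF bi] bounded_linear_inner_left, unfolded o_def])
    show "- C1 \<tau> * (norm (x - y))\<^sup>2 \<le> (b \<tau> x - b \<tau> y) \<bullet> (x - y)" if "\<tau> \<in> {s..t}" for \<tau>
      using one_sided that assms by auto
  qed
  also have "\<dots> = (B s t x - B s t y) \<bullet> (x - y)"
    using integral_linear[OF integrable_diff[OF bi] bounded_linear_inner_left[of "x - y"]]
    by (simp add: o_def B_def Henstock_Kurzweil_Integration.integral_diff[OF bi])
  finally show ?thesis .
qed

text \<open>The increment \<open>w\<close> of an implicit Euler step from time \<open>t\<close> back to time \<open>s\<close>. Being a one-sided
  value at the new point \<open>z\<close> replaces \<open>w = B s t z\<close>, which may have no solution for discontinuous \<open>b\<close>.\<close>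

definition step_rel :: "real \<Rightarrow> real \<Rightarrow> 'a \<Rightarrow> 'a \<Rightarrow> bool" where
  "step_rel s t z w \<longleftrightarrow> one_sided_value good (B s t) (integral {s..t} C1) z w"

definition step :: "real \<Rightarrow> real \<Rightarrow> 'a \<Rightarrow> 'a" where
  "step s t x = (SOME z. step_rel s t z (x - z))"

section \<open>A single implicit step over a short time\<close>

context
  fixes s t :: real
  assumes st: "0 \<le> s" "s \<le> t" "t \<le> T" and small: "m t - m s \<le> 1/2"
begin

lemma m_nonneg_diff: "0 \<le> m t - m s" using m_mono[OF st] by simp

lemma C1_le_half: "integral {s..t} C1 \<le> m t - m s" "0 \<le> integral {s..t} C1"
  using C01_le_m[OF st] by auto

lemma step_bound: "step_rel s t z w \<Longrightarrow> norm w \<le> (m t - m s) * (1 + norm z)"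
  unfolding step_rel_def
  using one_sided_value_bound[OF good_dense B_growth[OF st] m_nonneg_diff] by blast

lemma step_exists: obtains w where "step_rel s t z w"
  unfolding step_rel_def
  using one_sided_value_exists[OF good_dense B_growth[OF st] m_nonneg_diff B_one_sided[OF st]] by blast

lemma step_resolvent: obtains z where "step_rel s t z (x - z)"
  unfolding step_rel_def
  using resolvent_exists[OF good_dense B_growth[OF st] m_nonneg_diff B_one_sided[OF st] C1_le_half(2) small] by blast

lemma step_lip:
  "step_rel s t z (x - z) \<Longrightarrow> step_rel s t z' (x' - z') \<Longrightarrow> (1 - integral {s..t} C1) * norm (z - z') \<le> norm (x - x')"
  unfolding step_rel_def
  using resolvent_lipschitz[OF good_dense B_growth[OF st] m_nonneg_diff] by blast

lemma step_rel: "step_rel s t (step s t x) (x - step s t x)"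
  unfolding step_def by (rule someI_ex) (use step_resolvent[of x] in blast)

text \<open>Bounds \<open>1 / (1 - u)\<close> by \<open>exp (2 * u)\<close> for
  \<open>0 \<le> u \<le> 1/2\<close>. Resolvent estimates thereby become exponential factors that
  multiply along the scheme; this is where the 2 in \<open>exp (2 * m T)\<close> comes from.\<close>

lemma exp_factor: "0 \<le> u \<Longrightarrow> u \<le> 1/2 \<Longrightarrow> 1 \<le> (1 - u) * exp (2 * u)" for u :: real
proof -
  assume u: "0 \<le> u" "u \<le> 1/2"
  have "1 + u * (1 - 2 * u) = (1 - u) * (1 + 2 * u)" by (simp add: algebra_simps)
  then have "1 \<le> (1 - u) * (1 + 2 * u)" using mult_nonneg_nonneg[of u "1 - 2 * u"] u by linarith
  also have "\<dots> \<le> (1 - u) * exp (2 * u)" using u exp_ge_add_one_self[of "2 * u"] by (intro mult_left_mono) auto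
  finally show ?thesis .
qed

lemma step_lipschitz: "norm (step s t x - step s t y) \<le> exp (2 * (m t - m s)) * norm (x - y)"
proof -
  let ?c = "integral {s..t} C1" and ?u = "m t - m s"
  have "(1 - ?u) * norm (step s t x - step s t y) \<le> (1 - ?c) * norm (step s t x - step s t y)"
    using C1_le_half by (intro mult_right_mono) auto
  also have "\<dots> \<le> norm (x - y)" by (rule step_lip[OF step_rel step_rel])
  finally have 1: "(1 - ?u) * norm (step s t x - step s t y) \<le> norm (x - y)" .
  have "norm (step s t x - step s t y) \<le> (1 - ?u) * exp (2 * ?u) * norm (step s t x - step s t y)"
    using mult_right_mono[OF exp_factor[OF m_nonneg_diff small] norm_ge_zero[of "step s t x - step s t y"]] by simp
  also have "\<dots> = exp (2 * ?u) * ((1 - ?u) * norm (step s t x - step s t y))" by simp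
  also have "\<dots> \<le> exp (2 * ?u) * norm (x - y)" using 1 by (intro mult_left_mono) auto
  finally show ?thesis .
qed

lemma step_displacement: "norm (x - step s t x) \<le> (m t - m s) * (1 + norm (step s t x))"
  by (rule step_bound[OF step_rel])

lemma step_growth: "1 + norm (step s t x) \<le> exp (2 * (m t - m s)) * (1 + norm x)"
proof -
  let ?z = "step s t x" and ?u = "m t - m s"
  have "norm ?z \<le> norm x + norm (x - ?z)" using norm_triangle_sub[of ?z x] by (simp add: norm_minus_commute)
  then have 1: "(1 - ?u) * (1 + norm ?z) \<le> 1 + norm x" using step_displacement[of x] by (simp add: algebra_simps)
  have "1 + norm ?z \<le> (1 - ?u) * exp (2 * ?u) * (1 + norm ?z)"
    using mult_right_mono[OF exp_factor[OF m_nonneg_diff small], of "1 + norm ?z"] by simp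
  also have "\<dots> = exp (2 * ?u) * ((1 - ?u) * (1 + norm ?z))" by simp
  also have "\<dots> \<le> exp (2 * ?u) * (1 + norm x)" using 1 by (intro mult_left_mono) auto
  finally show ?thesis .
qed

text \<open>The estimate opposite to growth: a bounded image forces a bounded starting point, which
  is the compactness needed for preimages.\<close>

lemma step_proper: "1 + norm x \<le> exp (2 * (m t - m s)) * (1 + norm (step s t x))"
proof -
  let ?z = "step s t x" and ?u = "m t - m s"
  have "1 + norm x \<le> (1 + ?u) * (1 + norm ?z)"
    using norm_triangle_sub[of x ?z] step_displacement[of x] by (simp add: algebra_simps)
  also have "\<dots> \<le> exp (2 * ?u) * (1 + norm ?z)"
  proof (rule mult_right_mono)
    show "1 + ?u \<le> exp (2 * ?u)"     proof -
      have "1 + u \<le> exp (2 * u)" if "0 \<le> u" for u :: real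
        using exp_ge_add_one_self[of "2 * u"] that by linarith
      then show ?thesis using m_nonneg_diff by blast
    qed
  qed simp
  finally show ?thesis .
qed

lemma step_continuous: "continuous_on S (step s t)"
proof -
  have "(exp (2 * (m t - m s)))-lipschitz_on S (step s t)"
    using step_lipschitz by (auto simp: lipschitz_on_def dist_norm)
  then show ?thesis by (rule lipschitz_on_continuous_on)
qed

lemma step_unique:
  assumes "step_rel s t z (x - z)" shows "step s t x = z"
proof -
  have "(1 - integral {s..t} C1) * norm (step s t x - z) \<le> norm (x - x)" by (rule step_lip[OF step_rel assms])
  moreover have "1 - integral {s..t} C1 > 0" using C1_le_half small by linarith
  ultimately show ?thesis by (simp add: mult_le_0_iff)
qed

text \<open>The fibre over \<open>z\<close> is a translate of the set of values at \<open>z\<close>.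
  Existence of values therefore means that the step is onto, and their convexity that its fibres are
  connected.\<close>

lemma step_fibre: "step s t -` {z} = (\<lambda>w. z + w) ` {w. step_rel s t z w}"
proof
  show "step s t -` {z} \<subseteq> (\<lambda>w. z + w) ` {w. step_rel s t z w}"
  proof
    fix x assume "x \<in> step s t -` {z}"
    then have "step_rel s t z (x - z)" using step_rel[of x] by auto
    then show "x \<in> (\<lambda>w. z + w) ` {w. step_rel s t z w}" by (intro image_eqI[of _ _ "x - z"]) auto
  qed
  show "(\<lambda>w. z + w) ` {w. step_rel s t z w} \<subseteq> step s t -` {z}"
    using step_unique[of z "z + _"] by auto
qed

lemma step_surj: "surj (step s t)"
  unfolding surj_def
proof
  fix z
  obtain w where "step_rel s t z w" by (rule step_exists)
  then have "step s t (z + w) = z" by (intro step_unique) simp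
  then show "\<exists>x. z = step s t x" by metis
qed

lemma step_fibre_connected: "connected (step s t -` {z})"
  unfolding step_fibre step_rel_def
  by (intro convex_connected convex_translation one_sided_value_convex)

text \<open>Starting points with convergent images are bounded by \<open>step_proper\<close>, so a
  subsequence converges to a preimage of the limit.\<close>

lemma step_closed_map:
  assumes "closed S" shows "closed (step s t ` S)"
  unfolding closed_sequential_limits
proof (intro allI impI, elim conjE)
  fix z l assume z: "\<forall>n. z n \<in> step s t ` S" "z \<longlonglongrightarrow> l"
  then obtain x where x: "\<And>n. x n \<in> S" "\<And>n. z n = step s t (x n)" by (auto simp: image_iff) metis
  obtain L where L: "\<And>n. norm (z n) \<le> L" using convergent_imp_bounded[OF z(2)] by (auto simp: bounded_iff)
  have "norm (x n) \<le> exp (2 * (m t - m s)) * (1 + L)" for n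
  proof -
    have "1 + norm (x n) \<le> exp (2 * (m t - m s)) * (1 + norm (z n))" using step_proper[of "x n"] x(2) by simp
    also have "\<dots> \<le> exp (2 * (m t - m s)) * (1 + L)" using L[of n] by (intro mult_left_mono) auto
    finally show ?thesis by simp
  qed
  then have "bounded (range x)" by (auto simp: bounded_iff)
  then obtain a r where r: "strict_mono (r :: nat \<Rightarrow> nat)" "(x \<circ> r) \<longlonglongrightarrow> a"
    using bounded_imp_convergent_subsequence by blast
  have "a \<in> S" by (rule closed_sequentially[OF assms _ r(2)]) (simp add: x(1))
  moreover have "(\<lambda>n. step s t ((x \<circ> r) n)) \<longlonglongrightarrow> step s t a"
    by (rule continuous_on_tendsto_compose[OF step_continuous[of UNIV] r(2)]) auto
  then have "(z \<circ> r) \<longlonglongrightarrow> step s t a" by (simp add: x(2) o_def)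
  then have "l = step s t a" using LIMSEQ_unique LIMSEQ_subseq_LIMSEQ[OF z(2) r(1)] by blast
  ultimately show "l \<in> step s t ` S" by blast
qed

text \<open>A closed continuous surjection with connected fibres pulls connected sets back to
  connected sets. In contrast to connectedness of fibres alone, this property is evidently preserved
  by composition.\<close>

lemma step_connected_vimage:
  assumes "connected S" shows "connected (step s t -` S)"
  using connected_closed_monotone_preimage[of UNIV "step s t" UNIV S]
    step_continuous step_surj step_closed_map step_fibre_connected assms
  by (simp flip: closed_closedin)

end

end

section \<open>The scheme on dyadic grids and its interpolation in time\<close>

context one_sided_field
begin

definition grid :: "(real \<Rightarrow> real) \<Rightarrow> nat \<Rightarrow> nat \<Rightarrow> real" where
  "grid \<theta> n k = \<theta> (real k / 2 ^ n)"

primrec back_steps :: "(real \<Rightarrow> real) \<Rightarrow> nat \<Rightarrow> nat \<Rightarrow> 'a \<Rightarrow> 'a" where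
  "back_steps \<theta> n 0 x = x"
| "back_steps \<theta> n (Suc i) x = step (grid \<theta> n (2 ^ n - Suc i)) (grid \<theta> n (2 ^ n - i)) (back_steps \<theta> n i x)"

text \<open>The scheme starts from \<open>x\<close> at time \<open>T\<close> and runs backwards, but
  \<open>k\<close> numbers the grid points forwards in time: \<open>Y \<theta> n k x\<close> is the
  position at \<open>grid \<theta> n k\<close>.\<close>

definition Y :: "(real \<Rightarrow> real) \<Rightarrow> nat \<Rightarrow> nat \<Rightarrow> 'a \<Rightarrow> 'a" where
  "Y \<theta> n k = back_steps \<theta> n (2 ^ n - k)"

lemma Y_top [simp]: "Y \<theta> n (2 ^ n) x = x"
  by (simp add: Y_def)

lemma Y_step:
  assumes "k < 2 ^ n"
  shows "Y \<theta> n k x = step (grid \<theta> n k) (grid \<theta> n (Suc k)) (Y \<theta> n (Suc k) x)"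
proof -
  have "2 ^ n - k = Suc (2 ^ n - Suc k)" "2 ^ n - Suc (2 ^ n - Suc k) = k" "2 ^ n - (2 ^ n - Suc k) = Suc k"
    using assms by auto
  then show ?thesis by (simp add: Y_def)
qed

text \<open>Share of the \<open>k\<close>-th time step lying after \<open>t\<close>, measured by \<open>m\<close>; the quotient is \<open>0\<close> for a
  degenerate step, which is harmless because such a step does not move points.\<close>

definition weight :: "(real \<Rightarrow> real) \<Rightarrow> nat \<Rightarrow> nat \<Rightarrow> real \<Rightarrow> real" where
  "weight \<theta> n k t = (m (grid \<theta> n (Suc k)) - m (max (grid \<theta> n k) (min (grid \<theta> n (Suc k)) t))) /
     (m (grid \<theta> n (Suc k)) - m (grid \<theta> n k))"

text \<open>Piecewise affine with respect to the clock \<open>m\<close> instead of \<open>t\<close>,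
  so that displacements in time are bounded by increments of \<open>m\<close> whatever the
  grid.\<close>

definition interp :: "(real \<Rightarrow> real) \<Rightarrow> nat \<Rightarrow> real \<Rightarrow> 'a \<Rightarrow> 'a" where
  "interp \<theta> n t x = x - (\<Sum>k<2 ^ n. weight \<theta> n k t *\<^sub>R (Y \<theta> n (Suc k) x - Y \<theta> n k x))"

context
  fixes \<theta> :: "real \<Rightarrow> real"
  assumes \<theta>_cont: "continuous_on {0..1} \<theta>"
    and \<theta>_mono: "\<And>r s. 0 \<le> r \<Longrightarrow> r \<le> s \<Longrightarrow> s \<le> 1 \<Longrightarrow> \<theta> r \<le> \<theta> s"
    and \<theta>_0: "\<theta> 0 = 0" and \<theta>_1: "\<theta> 1 = T"
begin

lemma \<theta>_range: "0 \<le> r \<Longrightarrow> r \<le> 1 \<Longrightarrow> 0 \<le> \<theta> r \<and> \<theta> r \<le> T"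
  using \<theta>_mono[of 0 r] \<theta>_mono[of r 1] \<theta>_0 \<theta>_1 by auto

lemma grid_0 [simp]: "grid \<theta> n 0 = 0" and grid_top [simp]: "grid \<theta> n (2 ^ n) = T"
  using \<theta>_0 \<theta>_1 by (simp_all add: grid_def)

lemma frac_le: "k \<le> 2 ^ n \<Longrightarrow> real k / 2 ^ n \<le> 1"
  by (simp add: divide_le_eq)

lemma grid_mono: "j \<le> k \<Longrightarrow> k \<le> 2 ^ n \<Longrightarrow> grid \<theta> n j \<le> grid \<theta> n k"
  unfolding grid_def by (intro \<theta>_mono frac_le) (auto simp: divide_right_mono)

lemma grid_range: "k \<le> 2 ^ n \<Longrightarrow> 0 \<le> grid \<theta> n k \<and> grid \<theta> n k \<le> T"
  unfolding grid_def by (intro \<theta>_range frac_le) auto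

lemma m_grid_mono: "j \<le> k \<Longrightarrow> k \<le> 2 ^ n \<Longrightarrow> m (grid \<theta> n j) \<le> m (grid \<theta> n k)"
  using grid_mono[of j k n] grid_range[of j n] grid_range[of k n] by (intro m_mono) auto

lemma m_range: "0 \<le> t \<Longrightarrow> t \<le> T \<Longrightarrow> 0 \<le> m t \<and> m t \<le> m T"
  using m_mono[of 0 t] m_mono[of t T] by auto

text \<open>The composition of \<open>m\<close> with \<open>\<theta>\<close> is uniformly continuous
  on the unit interval, so the cells become short when measured by \<open>m\<close>.\<close>

lemma mesh:
  assumes "e > 0"
  obtains n0 where "\<And>n k. n \<ge> n0 \<Longrightarrow> k < 2 ^ n \<Longrightarrow> m (grid \<theta> n (Suc k)) - m (grid \<theta> n k) \<le> e"
proof -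
  have "continuous_on {0..1} (\<lambda>r. m (\<theta> r))"
    by (rule continuous_on_compose2[OF m_continuous \<theta>_cont]) (use \<theta>_range in auto)
  then have "uniformly_continuous_on {0..1} (\<lambda>r. m (\<theta> r))" by (rule compact_uniformly_continuous) auto
  then obtain d where d: "d > 0" "\<And>r s. r \<in> {0..1} \<Longrightarrow> s \<in> {0..1} \<Longrightarrow> dist s r < d \<Longrightarrow> dist (m (\<theta> s)) (m (\<theta> r)) < e"
    using assms unfolding uniformly_continuous_on_def by metis
  obtain n0 where n0: "(1/2) ^ n0 < d" using d(1) real_arch_pow_inv[of d "1/2"] by auto
  show thesis
  proof (rule that)
    fix n k :: nat assume n: "n \<ge> n0" "k < 2 ^ n"
    have "dist (real (Suc k) / 2 ^ n) (real k / 2 ^ n) = (1/2) ^ n"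
      by (simp add: dist_real_def diff_divide_distrib[symmetric] power_one_over)
    also have "\<dots> \<le> (1/2) ^ n0" using n by (intro power_decreasing) auto
    finally have "dist (m (grid \<theta> n (Suc k))) (m (grid \<theta> n k)) < e"
      unfolding grid_def using n0 n frac_le[of k n] frac_le[of "Suc k" n] by (intro d(2)) auto
    then show "m (grid \<theta> n (Suc k)) - m (grid \<theta> n k) \<le> e" by (simp add: dist_real_def)
  qed
qed

lemma grid_locate:
  assumes "0 \<le> t" "t \<le> T"
  obtains k where "k < 2 ^ n" "grid \<theta> n k \<le> t" "t \<le> grid \<theta> n (Suc k)"
proof -
  define P where "P = (\<lambda>i. i \<le> 2 ^ n \<and> t \<le> grid \<theta> n i)"
  have ex: "P (2 ^ n)" using assms by (simp add: P_def)
  define i where "i = (LEAST i. P i)"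
  have Pi: "P i" unfolding i_def using ex by (rule LeastI)
  show thesis
  proof (cases i)
    case 0
    then have "t = 0" using Pi assms by (simp add: P_def)
    then show thesis using that[of 0] grid_range[of "Suc 0" n] by simp
  next
    case (Suc k)
    then have "\<not> P k" using not_less_Least[of k P] by (simp add: i_def)
    then show thesis using that[of k] Pi Suc by (auto simp: P_def)
  qed
qed

context
  fixes n :: nat
  assumes fine: "\<And>k. k < 2 ^ n \<Longrightarrow> m (grid \<theta> n (Suc k)) - m (grid \<theta> n k) \<le> 1/2"
begin

abbreviation g where "g \<equiv> grid \<theta> n"

lemma g_step:
  assumes "k < 2 ^ n" shows "0 \<le> g k" "g k \<le> g (Suc k)" "g (Suc k) \<le> T" "m (g (Suc k)) - m (g k) \<le> 1/2"
  using assms grid_range[of k n] grid_range[of "Suc k" n] grid_mono[of k "Suc k" n] fine[of k] by auto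

text \<open>The comparison holds between any two grid times and not only with time \<open>T\<close>.
  In the limit it says that trajectories that have met stay together at all earlier times, which the
  degree argument relies on.\<close>

lemma Y_lipschitz:
  assumes "j \<le> k" "k \<le> 2 ^ n"
  shows "norm (Y \<theta> n j x - Y \<theta> n j x') \<le> exp (2 * (m (g k) - m (g j))) * norm (Y \<theta> n k x - Y \<theta> n k x')"
  using assms
proof (induction rule: inc_induct)
  case (step i)
  then have i: "i < 2 ^ n" by simp
  have "norm (Y \<theta> n i x - Y \<theta> n i x') \<le> exp (2 * (m (g (Suc i)) - m (g i))) * norm (Y \<theta> n (Suc i) x - Y \<theta> n (Suc i) x')"
    unfolding Y_step[OF i] by (rule step_lipschitz[OF g_step[OF i]])
  also have "\<dots> \<le> exp (2 * (m (g (Suc i)) - m (g i))) * (exp (2 * (m (g k) - m (g (Suc i)))) * norm (Y \<theta> n k x - Y \<theta> n k x'))"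
    using step by (intro mult_left_mono) auto
  also have "\<dots> = exp (2 * (m (g k) - m (g i))) * norm (Y \<theta> n k x - Y \<theta> n k x')"
    by (simp add: mult.assoc[symmetric] flip: exp_add)
  finally show ?case .
qed simp

lemma exp_m_le: "0 \<le> s \<Longrightarrow> s \<le> T \<Longrightarrow> 0 \<le> t \<Longrightarrow> t \<le> T \<Longrightarrow> exp (2 * (m t - m s)) \<le> exp (2 * m T)"
  using m_range[of s] m_range[of t] by simp

lemma Y_lipschitz':
  assumes "j \<le> k" "k \<le> 2 ^ n"
  shows "norm (Y \<theta> n j x - Y \<theta> n j x') \<le> exp (2 * m T) * norm (Y \<theta> n k x - Y \<theta> n k x')"
proof -
  have "exp (2 * (m (g k) - m (g j))) \<le> exp (2 * m T)"
    using assms grid_range[of j n] grid_range[of k n] by (intro exp_m_le) auto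
  then show ?thesis using Y_lipschitz[OF assms, of x x'] by (meson mult_right_mono norm_ge_zero order_trans)
qed

lemma Y_growth0:
  assumes "k \<le> 2 ^ n" shows "1 + norm (Y \<theta> n k x) \<le> exp (2 * (m T - m (g k))) * (1 + norm x)"
  using assms
proof (induction rule: inc_induct)
  case (step i)
  then have i: "i < 2 ^ n" by simp
  have "1 + norm (Y \<theta> n i x) \<le> exp (2 * (m (g (Suc i)) - m (g i))) * (1 + norm (Y \<theta> n (Suc i) x))"
    unfolding Y_step[OF i] by (rule step_growth[OF g_step[OF i]])
  also have "\<dots> \<le> exp (2 * (m (g (Suc i)) - m (g i))) * (exp (2 * (m T - m (g (Suc i)))) * (1 + norm x))"
    using step by (intro mult_left_mono) auto
  also have "\<dots> = exp (2 * (m T - m (g i))) * (1 + norm x)"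
    by (simp add: mult.assoc[symmetric] flip: exp_add)
  finally show ?case .
qed simp

lemma Y_growth: "k \<le> 2 ^ n \<Longrightarrow> 1 + norm (Y \<theta> n k x) \<le> exp (2 * m T) * (1 + norm x)"
proof -
  assume k: "k \<le> 2 ^ n"
  have "exp (2 * (m T - m (g k))) \<le> exp (2 * m T)"
    using grid_range[OF k] T_pos by (intro exp_m_le) auto
  then show ?thesis using Y_growth0[OF k, of x] by (smt (verit) mult_right_mono norm_ge_zero)
qed

lemma Y_proper0:
  assumes "k \<le> 2 ^ n" shows "1 + norm x \<le> exp (2 * (m T - m (g k))) * (1 + norm (Y \<theta> n k x))"
  using assms
proof (induction rule: inc_induct)
  case (step i)
  then have i: "i < 2 ^ n" by simp
  have "1 + norm x \<le> exp (2 * (m T - m (g (Suc i)))) * (1 + norm (Y \<theta> n (Suc i) x))" using step by simp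
  also have "\<dots> \<le> exp (2 * (m T - m (g (Suc i)))) * (exp (2 * (m (g (Suc i)) - m (g i))) * (1 + norm (Y \<theta> n i x)))"
    unfolding Y_step[OF i] by (intro mult_left_mono step_proper[OF g_step[OF i]]) auto
  also have "\<dots> = exp (2 * (m T - m (g i))) * (1 + norm (Y \<theta> n i x))"
    by (simp add: mult.assoc[symmetric] flip: exp_add)
  finally show ?case .
qed simp

lemma Y_proper: "k \<le> 2 ^ n \<Longrightarrow> 1 + norm x \<le> exp (2 * m T) * (1 + norm (Y \<theta> n k x))"
proof -
  assume k: "k \<le> 2 ^ n"
  have "exp (2 * (m T - m (g k))) \<le> exp (2 * m T)"
    using grid_range[OF k] T_pos by (intro exp_m_le) auto
  then show ?thesis using Y_proper0[OF k, of x] by (smt (verit) mult_right_mono norm_ge_zero)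
qed

lemma Y_surj: "k \<le> 2 ^ n \<Longrightarrow> \<exists>x. Y \<theta> n k x = z"
proof (induction k arbitrary: z rule: inc_induct)
  case (step i)
  then have i: "i < 2 ^ n" by simp
  obtain z' where z': "step (g i) (g (Suc i)) z' = z" using step_surj[OF g_step[OF i]] by (metis surjD)
  obtain x where "Y \<theta> n (Suc i) x = z'" using step.IH by blast
  then have "Y \<theta> n i x = z" using z' by (simp add: Y_step[OF i])
  then show ?case by blast
qed auto

lemma Y_connected_vimage: "k \<le> 2 ^ n \<Longrightarrow> connected S \<Longrightarrow> connected (Y \<theta> n k -` S)"
proof (induction k arbitrary: S rule: inc_induct)
  case (step i)
  then have i: "i < 2 ^ n" by simp
  have "Y \<theta> n i -` S = Y \<theta> n (Suc i) -` (step (g i) (g (Suc i)) -` S)"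
    using Y_step[OF i] by auto
  then show ?case using step.IH step_connected_vimage[OF g_step[OF i] step.prems] by simp
qed (simp add: vimage_def)

lemma Y_displacement:
  assumes "k < 2 ^ n"
  shows "norm (Y \<theta> n (Suc k) x - Y \<theta> n k x) \<le> (m (g (Suc k)) - m (g k)) * (exp (2 * m T) * (1 + norm x))"
proof -
  have "norm (Y \<theta> n (Suc k) x - Y \<theta> n k x) \<le> (m (g (Suc k)) - m (g k)) * (1 + norm (Y \<theta> n k x))"
    unfolding Y_step[OF assms] by (rule step_displacement[OF g_step[OF assms]])
  also have "\<dots> \<le> (m (g (Suc k)) - m (g k)) * (exp (2 * m T) * (1 + norm x))"
    using m_grid_mono[of k "Suc k" n] assms by (intro mult_left_mono Y_growth) auto
  finally show ?thesis .
qed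

text \<open>Cells before the \<open>k\<close>-th have weight 0. Later ones have weight 1 or, if
  degenerate, no displacement; their increments telescope to
  \<open>x - Y \<theta> n (Suc k) x\<close>.\<close>

lemma interp_local:
  assumes k: "k < 2 ^ n" and t: "g k \<le> t" "t \<le> g (Suc k)"
  shows "interp \<theta> n t x = (1 - weight \<theta> n k t) *\<^sub>R Y \<theta> n (Suc k) x + weight \<theta> n k t *\<^sub>R Y \<theta> n k x"
proof -
  let ?D = "\<lambda>i. Y \<theta> n (Suc i) x - Y \<theta> n i x"
  have early: "weight \<theta> n i t *\<^sub>R ?D i = 0" if "i < k" for i
  proof -
    have "g (Suc i) \<le> g k" using that k by (intro grid_mono) auto
    then have "max (g i) (min (g (Suc i)) t) = g (Suc i)" using t grid_mono[of i "Suc i" n] that k by auto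
    then show ?thesis by (simp add: weight_def)
  qed
  have late: "weight \<theta> n i t *\<^sub>R ?D i = ?D i" if "k < i" "i < 2 ^ n" for i
  proof (cases "m (g (Suc i)) = m (g i)")
    case True
    then show ?thesis using Y_displacement[OF that(2), of x] by simp
  next
    case False
    have "g (Suc k) \<le> g i" using that k by (intro grid_mono) auto
    then have "max (g i) (min (g (Suc i)) t) = g i" using t by auto
    then show ?thesis using False by (simp add: weight_def)
  qed
  have "(\<Sum>i<2 ^ n. weight \<theta> n i t *\<^sub>R ?D i) = (\<Sum>i\<in>{k..<2 ^ n}. weight \<theta> n i t *\<^sub>R ?D i)"
  proof (rule sum.mono_neutral_right)
    show "\<forall>i\<in>{..<2 ^ n} - {k..<2 ^ n}. weight \<theta> n i t *\<^sub>R ?D i = 0" by (intro ballI early) auto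
  qed auto
  also have "{k..<2 ^ n} = insert k {Suc k..<2 ^ n}" using k by auto
  also have "(\<Sum>i\<in>insert k {Suc k..<2 ^ n}. weight \<theta> n i t *\<^sub>R ?D i) =
      weight \<theta> n k t *\<^sub>R ?D k + (\<Sum>i\<in>{Suc k..<2 ^ n}. weight \<theta> n i t *\<^sub>R ?D i)"
    by simp
  also have "(\<Sum>i\<in>{Suc k..<2 ^ n}. weight \<theta> n i t *\<^sub>R ?D i) = (\<Sum>i\<in>{Suc k..<2 ^ n}. ?D i)"
    using late by (intro sum.cong) auto
  also have "\<dots> = x - Y \<theta> n (Suc k) x"
    using sum_Suc_diff'[of "Suc k" "2 ^ n" "\<lambda>i. Y \<theta> n i x"] k by simp
  finally show ?thesis by (simp add: interp_def algebra_simps)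
qed

lemma weight_range:
  assumes "k < 2 ^ n" shows "0 \<le> weight \<theta> n k t" "weight \<theta> n k t \<le> 1"
proof -
  let ?c = "max (g k) (min (g (Suc k)) t)"
  have c: "g k \<le> ?c" "?c \<le> g (Suc k)" using g_step[OF assms] by auto
  have "m (g k) \<le> m ?c" "m ?c \<le> m (g (Suc k))" using c g_step[OF assms] by (intro m_mono; linarith)+
  then show "0 \<le> weight \<theta> n k t" "weight \<theta> n k t \<le> 1"
    by (auto simp: weight_def divide_nonneg_nonneg divide_le_eq_1)
qed

lemma interp_lipschitz_x:
  assumes "0 \<le> t" "t \<le> T"
  shows "norm (interp \<theta> n t x - interp \<theta> n t x') \<le> exp (2 * m T) * norm (x - x')"
proof -
  obtain k where k: "k < 2 ^ n" "g k \<le> t" "t \<le> g (Suc k)" using grid_locate[OF assms] by blast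
  let ?w = "weight \<theta> n k t"
  have eq: "interp \<theta> n t x - interp \<theta> n t x' =
      (1 - ?w) *\<^sub>R (Y \<theta> n (Suc k) x - Y \<theta> n (Suc k) x') + ?w *\<^sub>R (Y \<theta> n k x - Y \<theta> n k x')"
    by (simp add: interp_local[OF k] algebra_simps)
  have "norm (interp \<theta> n t x - interp \<theta> n t x') \<le>
      (1 - ?w) * norm (Y \<theta> n (Suc k) x - Y \<theta> n (Suc k) x') + ?w * norm (Y \<theta> n k x - Y \<theta> n k x')"
    unfolding eq using weight_range[OF k(1), of t] by (intro norm_triangle_le) auto
  also have "\<dots> \<le> (1 - ?w) * (exp (2 * m T) * norm (x - x')) + ?w * (exp (2 * m T) * norm (x - x'))"
  proof -
    have "norm (Y \<theta> n (Suc k) x - Y \<theta> n (Suc k) x') \<le> exp (2 * m T) * norm (x - x')"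
      "norm (Y \<theta> n k x - Y \<theta> n k x') \<le> exp (2 * m T) * norm (x - x')"
      using Y_lipschitz'[of "Suc k" "2 ^ n" x x'] Y_lipschitz'[of k "2 ^ n" x x'] k(1) by auto
    moreover have "0 \<le> 1 - ?w" "0 \<le> ?w" using weight_range[OF k(1), of t] by auto
    ultimately show ?thesis by (meson add_mono mult_left_mono)
  qed
  also have "\<dots> = exp (2 * m T) * norm (x - x')" by (simp add: algebra_simps)
  finally show ?thesis .
qed

lemma interp_grid:
  assumes "j \<le> 2 ^ n" shows "interp \<theta> n (g j) x = Y \<theta> n j x"
proof (cases "j = 2 ^ n")
  case True
  have "weight \<theta> n k (g j) = 0" if "k < 2 ^ n" for k
  proof -
    have "max (g k) (min (g (Suc k)) (g j)) = g (Suc k)" using g_step[OF that] True by auto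
    then show ?thesis by (simp add: weight_def)
  qed
  then show ?thesis using True by (simp add: interp_def)
next
  case False
  then have j: "j < 2 ^ n" using assms by simp
  have "(1 - weight \<theta> n j (g j)) *\<^sub>R (Y \<theta> n (Suc j) x - Y \<theta> n j x) = 0"
  proof (cases "m (g (Suc j)) = m (g j)")
    case True
    then show ?thesis using Y_displacement[OF j, of x] by simp
  next
    case False
    then show ?thesis using g_step[OF j] by (simp add: weight_def)
  qed
  moreover have "interp \<theta> n (g j) x - Y \<theta> n j x = (1 - weight \<theta> n j (g j)) *\<^sub>R (Y \<theta> n (Suc j) x - Y \<theta> n j x)"
    unfolding interp_local[OF j order_refl g_step(2)[OF j], of x] by (simp add: algebra_simps)
  ultimately have "interp \<theta> n (g j) x - Y \<theta> n j x = 0" by metis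
  then show ?thesis by simp
qed

text \<open>Clamping \<open>t\<close> to the successive cells cuts \<open>{0..t}\<close> into
  pieces, whose lengths for the clock add up.\<close>

lemma telescope_m:
  assumes "i \<le> 2 ^ n" "0 \<le> t" "t \<le> T"
  shows "(\<Sum>k<i. m (max (g k) (min (g (Suc k)) t)) - m (g k)) = m (min t (g i))"
  using assms(1)
proof (induction i)
  case 0
  then show ?case using assms by simp
next
  case (Suc i)
  have "g i \<le> g (Suc i)" using Suc.prems by (intro grid_mono) auto
  then have "m (max (g i) (min (g (Suc i)) t)) - m (g i) = m (min t (g (Suc i))) - m (min t (g i))"
  proof -
    consider "t \<le> g i" | "g i < t" "t \<le> g (Suc i)" | "g (Suc i) < t" by linarith
    then show ?thesis
    proof cases
      case 1
      then have "max (g i) (min (g (Suc i)) t) = g i" "min t (g (Suc i)) = t" "min t (g i) = t"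
        using \<open>g i \<le> g (Suc i)\<close> by auto
      then show ?thesis by simp
    next
      case 2
      then have "max (g i) (min (g (Suc i)) t) = t" "min t (g (Suc i)) = t" "min t (g i) = g i" by auto
      then show ?thesis by simp
    next
      case 3
      then have "max (g i) (min (g (Suc i)) t) = g (Suc i)" "min t (g (Suc i)) = g (Suc i)" "min t (g i) = g i"
        using \<open>g i \<le> g (Suc i)\<close> by auto
      then show ?thesis by simp
    qed
  qed
  then show ?case using Suc by simp
qed

lemma interp_lipschitz_t:
  assumes st: "0 \<le> s" "s \<le> t" "t \<le> T"
  shows "norm (interp \<theta> n t x - interp \<theta> n s x) \<le> exp (2 * m T) * (1 + norm x) * (m t - m s)"
proof -
  let ?K = "exp (2 * m T) * (1 + norm x)"
  let ?c = "\<lambda>k t. max (g k) (min (g (Suc k)) t)"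
  have "norm (interp \<theta> n t x - interp \<theta> n s x) =
      norm (\<Sum>k<2 ^ n. (weight \<theta> n k s - weight \<theta> n k t) *\<^sub>R (Y \<theta> n (Suc k) x - Y \<theta> n k x))"
    by (simp add: interp_def sum_subtractf scaleR_diff_left)
  also have "\<dots> \<le> (\<Sum>k<2 ^ n. (m (?c k t) - m (?c k s)) * ?K)"
  proof (rule sum_norm_le)
    fix k :: nat assume "k \<in> {..<2 ^ n}"
    then have k: "k < (2::nat) ^ n" by simp
    have c: "g k \<le> ?c k s" "?c k s \<le> ?c k t" "?c k t \<le> g (Suc k)" using st g_step[OF k] by auto
    have mc: "m (?c k s) \<le> m (?c k t)" using c g_step[OF k] by (intro m_mono) auto
    let ?\<delta> = "m (g (Suc k)) - m (g k)"
    have \<delta>: "?\<delta> \<ge> 0" using m_grid_mono[of k "Suc k" n] k by simp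
    have w: "weight \<theta> n k s - weight \<theta> n k t = (m (?c k t) - m (?c k s)) / ?\<delta>"
      by (simp add: weight_def diff_divide_distrib)
    have "norm ((weight \<theta> n k s - weight \<theta> n k t) *\<^sub>R (Y \<theta> n (Suc k) x - Y \<theta> n k x)) =
        (m (?c k t) - m (?c k s)) / ?\<delta> * norm (Y \<theta> n (Suc k) x - Y \<theta> n k x)"
      unfolding w using mc \<delta> by simp
    also have "\<dots> \<le> (m (?c k t) - m (?c k s)) / ?\<delta> * (?\<delta> * ?K)"
      using mc \<delta> Y_displacement[OF k, of x] by (intro mult_left_mono) auto
    \<comment> \<open>Equality unless the cell is degenerate; then the quotient is 0 by
      convention.\<close>
    also have "\<dots> \<le> (m (?c k t) - m (?c k s)) * ?K"
      using mc by (cases "?\<delta> = 0") (auto intro!: mult_nonneg_nonneg)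
    finally show "norm ((weight \<theta> n k s - weight \<theta> n k t) *\<^sub>R (Y \<theta> n (Suc k) x - Y \<theta> n k x)) \<le> (m (?c k t) - m (?c k s)) * ?K" .
  qed
  also have "\<dots> = (\<Sum>k<2 ^ n. m (?c k t) - m (?c k s)) * ?K" by (simp only: sum_distrib_right)
  also have "(\<Sum>k<2 ^ n. m (?c k t) - m (?c k s)) =
      (\<Sum>k<2 ^ n. m (?c k t) - m (g k)) - (\<Sum>k<2 ^ n. m (?c k s) - m (g k))"
    by (simp add: sum_subtractf)
  also have "\<dots> = m t - m s"
    using st by (simp add: telescope_m)
  finally show ?thesis by (simp add: mult.commute)
qed

lemma interp_top: "interp \<theta> n T x = x"
  using interp_grid[of "2 ^ n" x] by simp

text \<open>The squared distance to \<open>y\<close> is expanded around the new point. The square of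
  the increment has a favourable sign, the benefit of an implicit scheme, and the one-sided
  inequality tested at \<open>y\<close> bounds the mixed term from below.\<close>

lemma energy_step:
  assumes k: "k < 2 ^ n" and y: "y \<in> good"
  shows "(norm (Y \<theta> n (Suc k) x - y))\<^sup>2 / 2 - (norm (Y \<theta> n k x - y))\<^sup>2 / 2 \<ge>
    B (g k) (g (Suc k)) y \<bullet> (Y \<theta> n k x - y) - integral {g k..g (Suc k)} C1 * (norm (Y \<theta> n k x - y))\<^sup>2"
proof -
  let ?z = "Y \<theta> n k x" and ?w = "Y \<theta> n (Suc k) x - Y \<theta> n k x"
  have "step_rel (g k) (g (Suc k)) ?z ?w"
    unfolding Y_step[OF k, of \<theta> x] by (rule step_rel[OF g_step[OF k]])
  then have 1: "(?w - B (g k) (g (Suc k)) y) \<bullet> (?z - y) \<ge> - integral {g k..g (Suc k)} C1 * (norm (?z - y))\<^sup>2"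
    using y by (simp add: step_rel_def one_sided_value_def)
  have sq: "(norm (p + q))\<^sup>2 = (norm p)\<^sup>2 + 2 * (q \<bullet> p) + (norm q)\<^sup>2" for p q :: 'a
    by (simp add: power2_norm_eq_inner inner_add_left inner_add_right inner_commute)
  have "(norm (Y \<theta> n (Suc k) x - y))\<^sup>2 = (norm (?z - y))\<^sup>2 + 2 * (?w \<bullet> (?z - y)) + (norm ?w)\<^sup>2"
    using sq[of "?z - y" ?w] by simp
  moreover have "(norm ?w)\<^sup>2 \<ge> 0" by simp
  moreover have "(?w - B (g k) (g (Suc k)) y) \<bullet> (?z - y) = ?w \<bullet> (?z - y) - B (g k) (g (Suc k)) y \<bullet> (?z - y)"
    by (rule inner_diff_left)
  ultimately show ?thesis using 1 by linarith
qed

end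

end

end

section \<open>Filippov curves\<close>

context one_sided_field
begin

text \<open>Limit points of the field inherit the inequality, and the inequality is preserved by
  convex combinations.\<close>

lemma one_sided_value_hull:
  assumes t: "t \<in> {0..T}" and v: "v \<in> filippov_hull b t x"
  shows "one_sided_value UNIV (b t) (C1 t) x v"
proof -
  let ?S = "{z. \<exists>y :: nat \<Rightarrow> 'a. (\<forall>n. y n \<noteq> x) \<and> y \<longlonglongrightarrow> x \<and> (\<lambda>n. b t (y n)) \<longlonglongrightarrow> z}"
  have "?S \<subseteq> {w. one_sided_value UNIV (b t) (C1 t) x w}"
  proof clarify
    fix z and y :: "nat \<Rightarrow> 'a" assume y: "y \<longlonglongrightarrow> x" "(\<lambda>n. b t (y n)) \<longlonglongrightarrow> z"
    show "one_sided_value UNIV (b t) (C1 t) x z"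
      by (rule one_sided_value_limit[OF _ growth[OF t] C0_nonneg[OF t] one_sided[OF t] _ y]) auto
  qed
  then have "convex hull ?S \<subseteq> {w. one_sided_value UNIV (b t) (C1 t) x w}"
    by (rule hull_minimal) (rule one_sided_value_convex)
  then show ?thesis using v by (auto simp: filippov_hull_def)
qed

text \<open>A value outside of the hull is separated from it by a hyperplane; approaching \<open>x\<close> along the
  normal of the hyperplane contradicts the one-sided inequality.\<close>

lemma filippov_hullI:
  assumes t: "t \<in> {0..T}" and Q: "closure Q = UNIV" and v: "one_sided_value Q (b t) (C1 t) x v"
  shows "v \<in> filippov_hull b t x"
proof (rule ccontr)
  define S where "S = {z. \<exists>y :: nat \<Rightarrow> 'a. (\<forall>n. y n \<noteq> x) \<and> y \<longlonglongrightarrow> x \<and> (\<lambda>n. b t (y n)) \<longlonglongrightarrow> z}"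
  assume nv: "v \<notin> filippov_hull b t x"
  \<comment> \<open>The formulation with a single tolerance makes closedness of the set of limit
    points a triangle inequality instead of a diagonal sequence.\<close>
  have S_iff: "z \<in> S \<longleftrightarrow> (\<forall>e>0. \<exists>y. y \<noteq> x \<and> dist y x < e \<and> dist (b t y) z < e)" for z
  proof
    assume "z \<in> S"
    then obtain y where y: "\<And>n::nat. y n \<noteq> x" "y \<longlonglongrightarrow> x" "(\<lambda>n. b t (y n)) \<longlonglongrightarrow> z" unfolding S_def by blast
    show "\<forall>e>0. \<exists>y. y \<noteq> x \<and> dist y x < e \<and> dist (b t y) z < e"
    proof (intro allI impI)
      fix e :: real assume "e > 0"
      from eventually_conj[OF tendstoD[OF y(2) this] tendstoD[OF y(3) this]]
      obtain n where "dist (y n) x < e" "dist (b t (y n)) z < e" by (auto simp: eventually_sequentially)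
      then show "\<exists>y. y \<noteq> x \<and> dist y x < e \<and> dist (b t y) z < e" using y(1) by blast
    qed
  next
    assume A: "\<forall>e>0. \<exists>y. y \<noteq> x \<and> dist y x < e \<and> dist (b t y) z < e"
    have "\<exists>y. y \<noteq> x \<and> dist y x < inverse (real (Suc n)) \<and> dist (b t y) z < inverse (real (Suc n))" for n
      using A[rule_format, of "inverse (real (Suc n))"] by simp
    then obtain y where y: "\<And>n. y n \<noteq> x" "\<And>n. dist (y n) x < inverse (real (Suc n))"
      "\<And>n. dist (b t (y n)) z < inverse (real (Suc n))" by metis
    have "y \<longlonglongrightarrow> x"
      by (rule metric_tendsto_imp_tendsto[OF LIMSEQ_inverse_real_of_nat])
        (use y(2) in \<open>auto intro!: always_eventually less_imp_le simp: dist_real_def\<close>)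
    moreover have "(\<lambda>n. b t (y n)) \<longlonglongrightarrow> z"
      by (rule metric_tendsto_imp_tendsto[OF LIMSEQ_inverse_real_of_nat])
        (use y(3) in \<open>auto intro!: always_eventually less_imp_le simp: dist_real_def\<close>)
    ultimately show "z \<in> S" using y(1) unfolding S_def by blast
  qed
  have "closed S"
    unfolding closed_sequential_limits
  proof (intro allI impI, elim conjE)
    fix w z assume w: "\<forall>n. w n \<in> S" "w \<longlonglongrightarrow> z"
    show "z \<in> S"
      unfolding S_iff
    proof (intro allI impI)
      fix e :: real assume e: "e > 0"
      then obtain k where k: "dist (w k) z < e / 2" using tendstoD[OF w(2), of "e / 2"] by (auto simp: eventually_sequentially)
      obtain y where y: "y \<noteq> x" "dist y x < e / 2" "dist (b t y) (w k) < e / 2"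
        using w(1) e unfolding S_iff by (metis half_gt_zero)
      have "dist (b t y) z < e" using y(3) k dist_triangle[of "b t y" z "w k"] by linarith
      then show "\<exists>y. y \<noteq> x \<and> dist y x < e \<and> dist (b t y) z < e" using y e by (intro exI[of _ y]) auto
    qed
  qed
  moreover have "bounded S"
    unfolding bounded_iff
  proof (intro exI ballI)
    fix z assume "z \<in> S"
    then obtain y where y: "y \<longlonglongrightarrow> x" "(\<lambda>n. b t (y n)) \<longlonglongrightarrow> z" unfolding S_def by blast
    have "(\<lambda>n. C0 t * (1 + norm (y n))) \<longlonglongrightarrow> C0 t * (1 + norm x)" by (intro tendsto_intros y)
    moreover have "(\<lambda>n. norm (b t (y n))) \<longlonglongrightarrow> norm z" by (intro tendsto_intros y)
    ultimately show "norm z \<le> C0 t * (1 + norm x)" using LIMSEQ_le growth[OF t] by blast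
  qed
  ultimately have "compact (convex hull S)" by (intro compact_convex_hull) (simp add: compact_eq_bounded_closed)
  then obtain a d where ad: "a \<bullet> v < d" "\<And>w. w \<in> convex hull S \<Longrightarrow> a \<bullet> w > d"
    using separating_hyperplane_closed_point[of "convex hull S" v] nv
    by (auto simp: filippov_hull_def S_def[symmetric] compact_imp_closed)
  have approach: "\<exists>w\<in>S. v \<bullet> e \<le> w \<bullet> e" if e: "e \<noteq> 0" for e
  proof -
    obtain y h where y: "\<And>n. y n \<in> Q" "\<And>n. y n \<noteq> x" and h: "\<And>n. h n > 0" "h \<longlonglongrightarrow> (0::real)"
      and yx: "y \<longlonglongrightarrow> x" and lim: "(\<lambda>n. (y n - x) /\<^sub>R h n) \<longlonglongrightarrow> e" by (rule dense_direction[OF Q e, of x]) blast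
    obtain K where "\<And>n. norm (b t (y n)) \<le> K"
      by (rule bounded_along_sequence[where G=UNIV and B="b t" and ?c0.0="C0 t" and y=y and z=x])
        (use growth[OF t] C0_nonneg[OF t] yx in auto)
    then have "bounded (range (\<lambda>n. b t (y n)))" by (auto simp: bounded_iff)
    then obtain w r where r: "strict_mono (r :: nat \<Rightarrow> nat)" "((\<lambda>n. b t (y n)) \<circ> r) \<longlonglongrightarrow> w"
      using bounded_imp_convergent_subsequence by blast
    have yr: "(y \<circ> r) \<longlonglongrightarrow> x" using LIMSEQ_subseq_LIMSEQ[OF yx r(1)] .
    have "w \<in> S" unfolding S_def using y(2) yr r(2) by (auto simp: o_def intro!: exI[of _ "\<lambda>n. y (r n)"])
    let ?E = "\<lambda>n. (y (r n) - x) /\<^sub>R h (r n)"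
    have limr: "?E \<longlonglongrightarrow> e" using LIMSEQ_subseq_LIMSEQ[OF lim r(1)] by (simp add: o_def)
    have hr: "(\<lambda>n. h (r n)) \<longlonglongrightarrow> 0" using LIMSEQ_subseq_LIMSEQ[OF h(2) r(1)] by (simp add: o_def)
    have "(v - b t (y (r n))) \<bullet> ?E n \<le> C1 t * h (r n) * (norm (?E n))\<^sup>2" for n
    proof -
      have "(v - b t (y (r n))) \<bullet> (x - y (r n)) \<ge> - C1 t * (norm (x - y (r n)))\<^sup>2"
        using v y(1) by (simp add: one_sided_value_def)
      moreover obtain E where E: "E = ?E n" by blast
      then have zy: "x - y (r n) = - (h (r n) *\<^sub>R E)" using h(1)[of "r n"] by simp
      ultimately have "h (r n) * ((v - b t (y (r n))) \<bullet> E) \<le> C1 t * (h (r n) * norm E)\<^sup>2"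
        using h(1)[of "r n"] unfolding zy by simp
      also have "\<dots> = h (r n) * (C1 t * h (r n) * (norm E)\<^sup>2)" by (simp add: power_mult_distrib power2_eq_square)
      finally show ?thesis using h(1)[of "r n"] unfolding E[symmetric] by simp
    qed
    moreover have "(\<lambda>n. (v - b t (y (r n))) \<bullet> ?E n) \<longlonglongrightarrow> (v - w) \<bullet> e"
      using r(2) by (intro tendsto_intros limr) (simp add: o_def)
    moreover have "(\<lambda>n. C1 t * h (r n) * (norm (?E n))\<^sup>2) \<longlonglongrightarrow> C1 t * 0 * (norm e)\<^sup>2"
      by (intro tendsto_intros limr hr)
    ultimately have "(v - w) \<bullet> e \<le> 0" using LIMSEQ_le by fastforce
    then show ?thesis using \<open>w \<in> S\<close> by (auto simp: inner_diff_left)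
  qed
  \<comment> \<open>The set of limit points must be known to be nonempty: separation from an empty
    hull would allow \<open>a = 0\<close>, which gives no direction to approach from.\<close>
  obtain e0 :: 'a where "e0 \<in> Basis" using nonempty_Basis by blast
  then obtain w0 where "w0 \<in> S" using approach[of e0] nonzero_Basis[OF \<open>e0 \<in> Basis\<close>] by blast
  then have "a \<noteq> 0" using ad(1) ad(2)[OF hull_inc] by fastforce
  then obtain w where "w \<in> S" "v \<bullet> (- a) \<le> w \<bullet> (- a)" using approach[of "- a"] by auto
  then show False using ad(1) ad(2)[OF hull_inc, of w] by (simp add: inner_commute)
qed

lemma filippov_curve_AE:
  assumes "filippov_curve b T x \<gamma>"
  obtains N where "negligible N"
    "\<And>t. t \<in> {0..T} - N \<Longrightarrow> \<exists>v\<in>filippov_hull b t (\<gamma> t). (\<gamma> has_vector_derivative v) (at t)"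
proof -
  have "AE t in lebesgue. t \<in> {0..T} \<longrightarrow> (\<exists>v\<in>filippov_hull b t (\<gamma> t). (\<gamma> has_vector_derivative v) (at t))"
    using assms unfolding filippov_curve_def by (subst (asm) AE_restrict_space_iff) auto
  then obtain N where "{t \<in> space lebesgue. \<not> (t \<in> {0..T} \<longrightarrow> (\<exists>v\<in>filippov_hull b t (\<gamma> t). (\<gamma> has_vector_derivative v) (at t)))} \<subseteq> N"
    "N \<in> null_sets lebesgue"
    unfolding eventually_ae_filter by blast
  then show thesis using that[of N] by (auto simp: negligible_iff_null_sets)
qed

lemma m_has_derivative_AE:
  obtains N where "negligible N" "\<And>t. t \<in> {0<..<T} - N \<Longrightarrow> (m has_vector_derivative C t) (at t)"
proof -
  define G where "G = (\<lambda>t. if t \<in> {0..T} then C t else 0)"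
  have Gi: "G integrable_on {u..v}" for u v
  proof -
    have "G integrable_on UNIV"
      unfolding G_def using C_integrable_on[of 0 T] by (simp only: integrable_restrict_UNIV)
    then show ?thesis by (rule integrable_on_subinterval) simp
  qed
  obtain N where N: "negligible N" "\<And>a x. x \<notin> N \<Longrightarrow> a < x \<Longrightarrow> ((\<lambda>t. integral {a..t} G) has_vector_derivative G x) (at x)"
    by (rule lebesgue_differentiation_real[OF Gi]) blast
  have "(m has_vector_derivative C t) (at t)" if t: "t \<in> {0<..<T} - N" for t
  proof -
    have "((\<lambda>t. integral {0..t} G) has_vector_derivative G t) (at t)" using N(2)[of t 0] t by auto
    moreover have "integral {0..s} G = m s" if "s \<in> {0<..<T}" for s
      unfolding m_def using that by (intro Henstock_Kurzweil_Integration.integral_cong) (auto simp: G_def)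
    ultimately have "(m has_vector_derivative G t) (at t)"
      using t by (intro has_vector_derivative_transform_within_open[where S="{0<..<T}" and f="\<lambda>t. integral {0..t} G" and g=m]) auto
    then show ?thesis using t by (simp add: G_def)
  qed
  then show thesis using that N(1) by blast
qed

text \<open>The one-sided bound prevents the squared distance of two curves from decreasing faster
  than at the rate \<open>2 * C1\<close>. Weighted with \<open>exp (2 * m t)\<close> it is
  nondecreasing in time, and as it vanishes at \<open>T\<close> it vanishes before.\<close>

lemma filippov_unique:
  assumes \<gamma>1: "filippov_curve b T x \<gamma>1" and \<gamma>2: "filippov_curve b T x \<gamma>2" and t0: "t0 \<in> {0..T}"
  shows "\<gamma>1 t0 = \<gamma>2 t0"
proof -
  define d where "d = (\<lambda>t. \<gamma>1 t - \<gamma>2 t)"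
  define H where "H = (\<lambda>t. (norm (d t))\<^sup>2 * exp (2 * m t))"
  have ac: "absolutely_cont_on 0 T \<gamma>1" "absolutely_cont_on 0 T \<gamma>2" and top: "\<gamma>1 T = x" "\<gamma>2 T = x"
    using \<gamma>1 \<gamma>2 by (auto simp: filippov_curve_def)
  have acd: "absolutely_cont_on 0 T d"
    by (rule absolutely_cont_on_dominated[OF ac, of 1])
      (auto simp: d_def algebra_simps intro!: order_trans[OF _ norm_triangle_ineq4[of "\<gamma>1 _ - \<gamma>1 _" "\<gamma>2 _ - \<gamma>2 _"]])
  have "compact (d ` {0..T})"
    by (intro compact_continuous_image absolutely_cont_on_imp_continuous_on acd) auto
  then obtain K where K: "\<And>t. t \<in> {0..T} \<Longrightarrow> norm (d t) \<le> K" "K \<ge> 0"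
    using T_pos by (force dest!: compact_imp_bounded simp: bounded_iff intro: order_trans[OF norm_ge_zero])
  define L where "L = exp (2 * m T)"
  have mr: "0 \<le> m t \<and> m t \<le> m T" if "t \<in> {0..T}" for t using m_mono[of 0 t] m_mono[of t T] that by auto
  have L: "exp (2 * m t) \<le> L" "L > 0" if "t \<in> {0..T}" for t using mr[OF that] by (auto simp: L_def)
  have acH: "absolutely_cont_on 0 T H"
  proof (rule absolutely_cont_on_dominated[OF acd m_absolutely_cont])
    show "0 \<le> 2 * K * L + K\<^sup>2 * (2 * L)" using K L[of 0] T_pos by auto
    fix l r :: real assume lr: "0 \<le> l" "l \<le> r" "r \<le> T"
    then have l: "l \<in> {0..T}" and r: "r \<in> {0..T}" by auto
    have 1: "\<bar>(norm (d r))\<^sup>2 - (norm (d l))\<^sup>2\<bar> \<le> 2 * K * norm (d r - d l)"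
    proof -
      have "\<bar>(norm (d r))\<^sup>2 - (norm (d l))\<^sup>2\<bar> = (norm (d r) + norm (d l)) * \<bar>norm (d r) - norm (d l)\<bar>"
        by (simp add: power2_eq_square square_diff_square_factored abs_mult)
      also have "\<dots> \<le> (2 * K) * norm (d r - d l)"
        using K(1)[OF l] K(1)[OF r] K(2) norm_triangle_ineq3[of "d r" "d l"] by (intro mult_mono) auto
      finally show ?thesis .
    qed
    have 2: "\<bar>exp (2 * m r) - exp (2 * m l)\<bar> \<le> 2 * L * \<bar>m r - m l\<bar>"
    proof -
      have ml: "m l \<le> m r" using lr by (intro m_mono) auto
      have "1 - exp (- (2 * (m r - m l))) \<le> 2 * (m r - m l)"
        using exp_ge_add_one_self[of "- (2 * (m r - m l))"] by linarith
      then have "exp (2 * m r) * (1 - exp (- (2 * (m r - m l)))) \<le> L * (2 * (m r - m l))"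
        using L[OF r] ml by (intro mult_mono) auto
      moreover have "exp (2 * m r) * (1 - exp (- (2 * (m r - m l)))) = exp (2 * m r) - exp (2 * m l)"
        by (simp add: right_diff_distrib flip: exp_add)
      ultimately show ?thesis using ml by (simp add: algebra_simps)
    qed
    have "H r - H l = ((norm (d r))\<^sup>2 - (norm (d l))\<^sup>2) * exp (2 * m r) + (norm (d l))\<^sup>2 * (exp (2 * m r) - exp (2 * m l))"
      by (simp add: H_def algebra_simps)
    then have "norm (H r - H l) \<le> \<bar>(norm (d r))\<^sup>2 - (norm (d l))\<^sup>2\<bar> * exp (2 * m r) + (norm (d l))\<^sup>2 * \<bar>exp (2 * m r) - exp (2 * m l)\<bar>"
      by (metis abs_exp_cancel abs_mult abs_power2 abs_triangle_ineq real_norm_def)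
    also have "\<dots> \<le> (2 * K * norm (d r - d l)) * L + K\<^sup>2 * (2 * L * \<bar>m r - m l\<bar>)"
    proof (rule add_mono)
      show "\<bar>(norm (d r))\<^sup>2 - (norm (d l))\<^sup>2\<bar> * exp (2 * m r) \<le> (2 * K * norm (d r - d l)) * L"
        by (rule mult_mono[OF 1 L(1)[OF r]]) (use K(2) in auto)
      have "(norm (d l))\<^sup>2 \<le> K\<^sup>2" using K(1)[OF l] by (rule power_mono) simp
      then show "(norm (d l))\<^sup>2 * \<bar>exp (2 * m r) - exp (2 * m l)\<bar> \<le> K\<^sup>2 * (2 * L * \<bar>m r - m l\<bar>)"
        by (rule mult_mono[OF _ 2]) auto
    qed
    also have "\<dots> \<le> (2 * K * L + K\<^sup>2 * (2 * L)) * (norm (d r - d l) + norm (m r - m l))"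
      using K L[OF r] by (simp add: algebra_simps)
    finally show "norm (H r - H l) \<le> (2 * K * L + K\<^sup>2 * (2 * L)) * (norm (d r - d l) + norm (m r - m l))" .
  qed
  obtain N1 where N1: "negligible N1" "\<And>t. t \<in> {0..T} - N1 \<Longrightarrow> \<exists>v\<in>filippov_hull b t (\<gamma>1 t). (\<gamma>1 has_vector_derivative v) (at t)"
    using filippov_curve_AE[OF \<gamma>1] by blast
  obtain N2 where N2: "negligible N2" "\<And>t. t \<in> {0..T} - N2 \<Longrightarrow> \<exists>v\<in>filippov_hull b t (\<gamma>2 t). (\<gamma>2 has_vector_derivative v) (at t)"
    using filippov_curve_AE[OF \<gamma>2] by blast
  obtain N3 where N3: "negligible N3" "\<And>t. t \<in> {0<..<T} - N3 \<Longrightarrow> (m has_vector_derivative C t) (at t)"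
    using m_has_derivative_AE by blast
  have "H t0 \<le> H T"
  proof (rule absolutely_cont_on_nondecreasing[where H=H and N="N1 \<union> N2 \<union> N3 \<union> {0, T}"])
    show "t0 \<le> T" using t0 by simp
    show "absolutely_cont_on t0 T H" using acH by (rule absolutely_cont_on_mono_arg) (use t0 in auto)
    show "negligible (N1 \<union> N2 \<union> N3 \<union> {0, T})" using N1(1) N2(1) N3(1) by simp
    fix t assume "t \<in> {t0..T} - (N1 \<union> N2 \<union> N3 \<union> {0, T})"
    then have t: "t \<in> {0..T} - N1" "t \<in> {0..T} - N2" "t \<in> {0<..<T} - N3" "t \<in> {0..T}" using t0 by auto
    obtain v1 where v1: "v1 \<in> filippov_hull b t (\<gamma>1 t)" "(\<gamma>1 has_vector_derivative v1) (at t)" using N1(2)[OF t(1)] by blast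
    obtain v2 where v2: "v2 \<in> filippov_hull b t (\<gamma>2 t)" "(\<gamma>2 has_vector_derivative v2) (at t)" using N2(2)[OF t(2)] by blast
    have mt: "(m has_real_derivative C t) (at t)"
      using N3(2)[OF t(3)] by (simp add: has_real_derivative_iff_has_vector_derivative)
    have dd: "(d has_vector_derivative (v1 - v2)) (at t)" unfolding d_def by (intro derivative_intros v1 v2)
    have osv: "(v1 - v2) \<bullet> d t \<ge> - C1 t * (norm (d t))\<^sup>2"
      unfolding d_def
      using one_sided_value_mono[OF closure_UNIV growth[OF t(4)] C0_nonneg[OF t(4)] one_sided_value_hull[OF t(4) v1(1)] one_sided_value_hull[OF t(4) v2(1)]]
      by simp
    have "((\<lambda>t. d t \<bullet> d t) has_real_derivative 2 * ((v1 - v2) \<bullet> d t)) (at t)"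
      using bounded_bilinear.has_vector_derivative[OF bounded_bilinear_inner dd dd]
      by (simp add: inner_commute has_real_derivative_iff_has_vector_derivative)
    then have sq: "((\<lambda>t. (norm (d t))\<^sup>2) has_real_derivative 2 * ((v1 - v2) \<bullet> d t)) (at t)"
      by (simp add: power2_norm_eq_inner)
    have ex: "((\<lambda>t. exp (2 * m t)) has_real_derivative exp (2 * m t) * (2 * C t)) (at t)"
      by (rule derivative_eq_intros mt | simp)+
    have "(H has_real_derivative (2 * ((v1 - v2) \<bullet> d t) * exp (2 * m t) + exp (2 * m t) * (2 * C t) * (norm (d t))\<^sup>2)) (at t)"
      unfolding H_def using DERIV_mult[OF sq ex] by simp
    moreover have "2 * ((v1 - v2) \<bullet> d t) * exp (2 * m t) + exp (2 * m t) * (2 * C t) * (norm (d t))\<^sup>2 \<ge> 0"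
    proof -
      have "C t * (norm (d t))\<^sup>2 \<ge> C1 t * (norm (d t))\<^sup>2"
        using C0_nonneg[OF t(4)] by (intro mult_right_mono) (auto simp: C_def)
      then have "2 * ((v1 - v2) \<bullet> d t + C t * (norm (d t))\<^sup>2) \<ge> 0" using osv by (simp only: mult_minus_left zero_le_mult_iff) simp
      then have "exp (2 * m t) * (2 * ((v1 - v2) \<bullet> d t + C t * (norm (d t))\<^sup>2)) \<ge> 0" by (intro mult_nonneg_nonneg) auto
      then show ?thesis by (simp add: algebra_simps)
    qed
    ultimately show "\<exists>v\<ge>0. (H has_vector_derivative v) (at t)"
      using has_real_derivative_iff_has_vector_derivative by blast
  qed
  also have "H T = 0" by (simp add: H_def d_def top)
  finally have "(norm (d t0))\<^sup>2 \<le> 0" by (simp add: H_def mult_le_0_iff)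
  then show ?thesis by (simp add: d_def)
qed

text \<open>Uniqueness evaluates the definite description, so one curve ending at \<open>x\<close>,
  however constructed, computes the flow.\<close>

lemma filippov_flow_eq:
  assumes "filippov_curve b T x \<gamma>" "t \<in> {0..T}"
  shows "filippov_flow b t T x = \<gamma> t"
  unfolding filippov_flow_def using assms filippov_unique by (intro the_equality) blast+

end

section \<open>Compactness of the Euler scheme\<close>

context one_sided_field
begin

context
  fixes \<theta> :: "real \<Rightarrow> real"
  assumes \<theta>_cont: "continuous_on {0..1} \<theta>"
    and \<theta>_mono: "\<And>r s. 0 \<le> r \<Longrightarrow> r \<le> s \<Longrightarrow> s \<le> 1 \<Longrightarrow> \<theta> r \<le> \<theta> s"
    and \<theta>_0: "\<theta> 0 = 0" and \<theta>_1: "\<theta> 1 = T"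
begin

definition fine_mesh :: "nat \<Rightarrow> bool" where
  "fine_mesh n \<longleftrightarrow> (\<forall>k<2 ^ n. m (grid \<theta> n (Suc k)) - m (grid \<theta> n k) \<le> 1/2)"

text \<open>\<open>\<nu>\<close> selects the subsequence; of its growth only
  \<open>n \<le> \<nu> n\<close> is recorded, which suffices for the mesh to vanish. Fineness of
  every selected mesh makes the estimates for steps available without an initial cut-off.\<close>

definition uniform_limit_of_interp :: "real \<Rightarrow> (nat \<Rightarrow> nat) \<Rightarrow> (real \<times> 'a \<Rightarrow> 'a) \<Rightarrow> bool" where
  "uniform_limit_of_interp R \<nu> G \<longleftrightarrow> continuous_on ({0..T} \<times> cball 0 R) G \<and>
     (\<forall>n. fine_mesh (\<nu> n) \<and> n \<le> \<nu> n) \<and>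
     (\<forall>e>0. \<exists>N. \<forall>n\<ge>N. \<forall>t\<in>{0..T}. \<forall>x\<in>cball 0 R. norm (interp \<theta> (\<nu> n) t x - G (t, x)) < e)"

text \<open>Arzela-Ascoli in time and space together: the interpolants have a common Lipschitz
  constant in \<open>x\<close>, and in time a modulus of continuity inherited from
  \<open>m\<close>.\<close>

lemma uniform_limit_exists:
  assumes "R \<ge> 0"
  shows "\<exists>\<nu> G. uniform_limit_of_interp R \<nu> G"
proof -
  obtain n0 where n0: "\<And>n k. n \<ge> n0 \<Longrightarrow> k < 2 ^ n \<Longrightarrow> m (grid \<theta> n (Suc k)) - m (grid \<theta> n k) \<le> 1/2"
    using mesh[OF \<theta>_cont \<theta>_mono \<theta>_0 \<theta>_1, of "1/2"] by auto
  \<comment> \<open>The shift by \<open>n0\<close> keeps only grids whose cells are short enough for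
    the implicit steps.\<close>
  define F where "F = (\<lambda>n z. interp \<theta> (n + n0) (fst z) (snd z))"
  define E where "E = exp (2 * m T)"
  let ?S = "{0..T} \<times> cball (0::'a) R"
  have lt: "norm (interp \<theta> (n + n0) t x - interp \<theta> (n + n0) s x) \<le> E * (1 + R) * \<bar>m t - m s\<bar>"
    if "s \<in> {0..T}" "t \<in> {0..T}" "x \<in> cball 0 R" for n s t x
  proof -
    have *: "norm (interp \<theta> (n + n0) t x - interp \<theta> (n + n0) s x) \<le> E * (1 + R) * (m t - m s)"
      if "0 \<le> s" "s \<le> t" "t \<le> T" for s t
    proof -
      have "norm (interp \<theta> (n + n0) t x - interp \<theta> (n + n0) s x) \<le> E * (1 + norm x) * (m t - m s)"
        unfolding E_def by (rule interp_lipschitz_t[OF \<theta>_cont \<theta>_mono \<theta>_0 \<theta>_1 _ that]) (use n0 in auto)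
      also have "\<dots> \<le> E * (1 + R) * (m t - m s)"
        using \<open>x \<in> cball 0 R\<close> m_mono[OF that] by (intro mult_right_mono mult_left_mono) (auto simp: E_def)
      finally show ?thesis .
    qed
    show ?thesis
      using *[of s t] *[of t s] m_mono[of s t] m_mono[of t s] that by (cases "s \<le> t") (auto simp: norm_minus_commute)
  qed
  have lx: "norm (interp \<theta> (n + n0) t x - interp \<theta> (n + n0) t x') \<le> E * norm (x - x')" if "t \<in> {0..T}" for n t x x'
    unfolding E_def using that by (intro interp_lipschitz_x[OF \<theta>_cont \<theta>_mono \<theta>_0 \<theta>_1]) (use n0 in auto)
  have top: "interp \<theta> (n + n0) T x = x" for n x
    by (rule interp_top[OF \<theta>_cont \<theta>_mono \<theta>_0 \<theta>_1]) (use n0 in auto)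
  have E0: "E > 0" by (simp add: E_def)
  obtain G k where G: "continuous_on ?S G" "strict_mono (k :: nat \<Rightarrow> nat)"
    "\<And>e. 0 < e \<Longrightarrow> \<exists>N. \<forall>n x. n \<ge> N \<and> x \<in> ?S \<longrightarrow> norm (F (k n) x - G x) < e"
  proof (rule Arzela_Ascoli[of ?S F "R + E * (1 + R) * m T"])
    show "compact ?S" by (intro compact_Times) auto
    show "norm (F n z) \<le> R + E * (1 + R) * m T" if z: "z \<in> ?S" for n z
    proof -
      obtain t x where tx: "z = (t, x)" "t \<in> {0..T}" "x \<in> cball 0 R" using z by auto
      have "norm (interp \<theta> (n + n0) t x - x) \<le> E * (1 + R) * \<bar>m t - m T\<bar>"
        using lt[of T t x n] tx T_pos by (simp add: top)
      also have "\<dots> \<le> E * (1 + R) * m T"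
        using m_mono[of 0 t] m_mono[of t T] tx assms E0 by (intro mult_left_mono) auto
      finally show ?thesis using tx norm_triangle_sub[of "interp \<theta> (n + n0) t x" x] by (auto simp: F_def)
    qed
    show "\<exists>d>0. \<forall>n y. y \<in> ?S \<and> norm (z - y) < d \<longrightarrow> norm (F n z - F n y) < e" if z: "z \<in> ?S" and e: "0 < e" for z e
    proof -
      obtain t x where tx: "z = (t, x)" "t \<in> {0..T}" "x \<in> cball 0 R" using z by auto
      have "e / (2 * (E * (1 + R))) > 0" using e E0 assms by simp
      then obtain d1 where d1: "d1 > 0" "\<And>s. s \<in> {0..T} \<Longrightarrow> dist s t < d1 \<Longrightarrow> dist (m s) (m t) < e / (2 * (E * (1 + R)))"
        using m_continuous tx(2) unfolding continuous_on_iff by meson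
      define d where "d = min d1 (e / (2 * E))"
      have "norm (F n z - F n y) < e" if y: "y \<in> ?S" "norm (z - y) < d" for n y
      proof -
        obtain s x' where sx: "y = (s, x')" "s \<in> {0..T}" "x' \<in> cball 0 R" using y(1) by auto
        have "\<bar>t - s\<bar> \<le> norm (z - y)" "norm (x - x') \<le> norm (z - y)"
          using norm_fst_le[of "t - s" "x - x'"] norm_snd_le[of "x - x'" "t - s"] by (auto simp: tx sx)
        then have ds: "dist s t < d1" and dx: "norm (x - x') < e / (2 * E)"
          using y(2) by (auto simp: d_def dist_real_def)
        have "norm (interp \<theta> (n + n0) t x - interp \<theta> (n + n0) s x) \<le> E * (1 + R) * \<bar>m t - m s\<bar>" using sx tx by (intro lt) auto
        also have "\<dots> < E * (1 + R) * (e / (2 * (E * (1 + R))))"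
          using d1(2)[OF sx(2) ds] E0 assms by (intro mult_strict_left_mono) (auto simp: dist_real_def)
        also have "\<dots> = e / 2" using E0 assms by simp
        finally have 1: "norm (interp \<theta> (n + n0) t x - interp \<theta> (n + n0) s x) < e / 2" .
        have "norm (interp \<theta> (n + n0) s x - interp \<theta> (n + n0) s x') \<le> E * norm (x - x')" using sx by (intro lx) auto
        also have "\<dots> < E * (e / (2 * E))" using dx E0 by (intro mult_strict_left_mono)
        also have "\<dots> = e / 2" using E0 by simp
        finally have 2: "norm (interp \<theta> (n + n0) s x - interp \<theta> (n + n0) s x') < e / 2" .
        show ?thesis using norm_triangle_lt[of "interp \<theta> (n + n0) t x - interp \<theta> (n + n0) s x" "interp \<theta> (n + n0) s x - interp \<theta> (n + n0) s x'" e] 1 2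
          by (simp add: F_def tx(1) sx(1))
      qed
      moreover have "d > 0" using d1(1) e E0 by (simp add: d_def)
      ultimately show ?thesis by blast
    qed
  qed auto
  have "uniform_limit_of_interp R (\<lambda>n. k n + n0) G"
    unfolding uniform_limit_of_interp_def
  proof (intro conjI allI impI)
    show "continuous_on ?S G" by (rule G(1))
    show "fine_mesh (k n + n0)" for n using n0 by (auto simp: fine_mesh_def)
    show "n \<le> k n + n0" for n using seq_suble[OF G(2), of n] by simp
    fix e :: real assume "e > 0"
    then obtain N where "\<And>n x. n \<ge> N \<Longrightarrow> x \<in> ?S \<Longrightarrow> norm (F (k n) x - G x) < e" using G(3) by blast
    then show "\<exists>N. \<forall>n\<ge>N. \<forall>t\<in>{0..T}. \<forall>x\<in>cball 0 R. norm (interp \<theta> (k n + n0) t x - G (t, x)) < e"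
      by (intro exI[of _ N]) (auto simp: F_def)
  qed
  then show ?thesis by blast
qed

section \<open>Estimates inherited by a uniform limit of the scheme\<close>

context
  fixes R :: real and \<nu> :: "nat \<Rightarrow> nat" and G :: "real \<times> 'a \<Rightarrow> 'a"
  assumes lim: "uniform_limit_of_interp R \<nu> G"
begin

lemma fine_\<nu>: "k < 2 ^ \<nu> n \<Longrightarrow> m (grid \<theta> (\<nu> n) (Suc k)) - m (grid \<theta> (\<nu> n) k) \<le> 1/2"
  using lim by (auto simp: uniform_limit_of_interp_def fine_mesh_def)

lemma \<nu>_ge: "n \<le> \<nu> n" using lim by (auto simp: uniform_limit_of_interp_def)

lemma G_unif:
  assumes "e > 0" obtains N where "\<And>n t x. n \<ge> N \<Longrightarrow> t \<in> {0..T} \<Longrightarrow> x \<in> cball 0 R \<Longrightarrow> norm (interp \<theta> (\<nu> n) t x - G (t, x)) < e"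
  using lim assms unfolding uniform_limit_of_interp_def by meson

lemma G_lim:
  assumes "t \<in> {0..T}" "x \<in> cball 0 R" shows "(\<lambda>n. interp \<theta> (\<nu> n) t x) \<longlonglongrightarrow> G (t, x)"
proof (rule LIMSEQ_I)
  fix e :: real assume "e > 0"
  then obtain N where "\<And>n t x. n \<ge> N \<Longrightarrow> t \<in> {0..T} \<Longrightarrow> x \<in> cball 0 R \<Longrightarrow> norm (interp \<theta> (\<nu> n) t x - G (t, x)) < e"
    using G_unif by metis
  then show "\<exists>N. \<forall>n\<ge>N. norm (interp \<theta> (\<nu> n) t x - G (t, x)) < e" using assms by blast
qed

lemmas facts = \<theta>_cont \<theta>_mono \<theta>_0 \<theta>_1 fine_\<nu>

lemma G_top: "x \<in> cball 0 R \<Longrightarrow> G (T, x) = x"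
  using G_lim[of T x] T_pos interp_top[OF facts] by (auto simp: LIMSEQ_const_iff)

lemma G_lipschitz_t:
  assumes "x \<in> cball 0 R" "0 \<le> s" "s \<le> t" "t \<le> T"
  shows "norm (G (t, x) - G (s, x)) \<le> exp (2 * m T) * (1 + norm x) * (m t - m s)"
proof (rule LIMSEQ_le_const2)
  show "(\<lambda>n. norm (interp \<theta> (\<nu> n) t x - interp \<theta> (\<nu> n) s x)) \<longlonglongrightarrow> norm (G (t, x) - G (s, x))"
    using assms by (intro tendsto_intros G_lim) auto
  show "\<exists>N. \<forall>n\<ge>N. norm (interp \<theta> (\<nu> n) t x - interp \<theta> (\<nu> n) s x) \<le> exp (2 * m T) * (1 + norm x) * (m t - m s)"
    using interp_lipschitz_t[OF facts assms(2-4)] by blast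
qed

text \<open>A right inverse of \<open>\<theta>\<close>, which may be constant on intervals;
  whichever preimages are chosen, the result is monotone.\<close>

definition par :: "real \<Rightarrow> real" where
  "par t = (SOME r. r \<in> {0..1} \<and> \<theta> r = t)"

lemma par: assumes "t \<in> {0..T}" shows "par t \<in> {0..1}" "\<theta> (par t) = t"
proof -
  have "\<exists>r\<ge>0. r \<le> 1 \<and> \<theta> r = t"
    by (rule IVT') (use assms \<theta>_0 \<theta>_1 \<theta>_cont in auto)
  then have "par t \<in> {0..1} \<and> \<theta> (par t) = t"
    unfolding par_def by (intro someI_ex[of "\<lambda>r. r \<in> {0..1} \<and> \<theta> r = t"]) (simp only: atLeastAtMost_iff, blast)
  then show "par t \<in> {0..1}" "\<theta> (par t) = t" by (rule conjunct1, rule conjunct2)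
qed

lemma par_mono: assumes "s \<in> {0..T}" "t \<in> {0..T}" "s \<le> t" shows "par s \<le> par t"
proof (rule ccontr)
  assume "\<not> par s \<le> par t"
  then have "\<theta> (par t) \<le> \<theta> (par s)" using par[OF assms(1)] par[OF assms(2)] by (intro \<theta>_mono) auto
  then have "s = t" using par[OF assms(1)] par[OF assms(2)] assms(3) by simp
  then show False using \<open>\<not> par s \<le> par t\<close> by simp
qed

text \<open>The index of a grid point whose time converges to \<open>t\<close>; rounding down
  preserves the order of times.\<close>

definition idx :: "nat \<Rightarrow> real \<Rightarrow> nat" where
  "idx n t = nat \<lfloor>par t * 2 ^ \<nu> n\<rfloor>"

lemma idx_le: assumes "t \<in> {0..T}" shows "idx n t \<le> 2 ^ \<nu> n"
proof -
  have "real (idx n t) \<le> par t * 2 ^ \<nu> n" unfolding idx_def using par[OF assms] by (intro of_nat_floor) simp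
  also have "\<dots> \<le> 1 * 2 ^ \<nu> n" using par[OF assms] by (intro mult_right_mono) auto
  finally have "real (idx n t) \<le> real (2 ^ \<nu> n)" by simp
  then show ?thesis by (simp only: of_nat_le_iff)
qed

lemma idx_mono: assumes "s \<in> {0..T}" "t \<in> {0..T}" "s \<le> t" shows "idx n s \<le> idx n t"
  unfolding idx_def using par_mono[OF assms] by (intro nat_mono floor_mono mult_right_mono) auto

abbreviation gr where "gr n t \<equiv> grid \<theta> (\<nu> n) (idx n t)"

lemma gr_range: "t \<in> {0..T} \<Longrightarrow> gr n t \<in> {0..T}"
  using grid_range[OF \<theta>_cont \<theta>_mono \<theta>_0 \<theta>_1 idx_le] by auto

lemma gr_lim: assumes t: "t \<in> {0..T}" shows "(\<lambda>n. gr n t) \<longlonglongrightarrow> t"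
proof -
  have "(\<lambda>n. real (idx n t) / 2 ^ \<nu> n) \<longlonglongrightarrow> par t"
  proof (rule LIM_zero_cancel, rule Lim_null_comparison)
    show "\<forall>\<^sub>F n in sequentially. norm (real (idx n t) / 2 ^ \<nu> n - par t) \<le> (1/2) ^ n"
    proof (rule always_eventually, rule allI)
      fix n
      have p: "par t * 2 ^ \<nu> n \<ge> 0" using par[OF t] by simp
      have "\<bar>real (idx n t) - par t * 2 ^ \<nu> n\<bar> \<le> 1"
        unfolding idx_def using p by (simp add: abs_if) linarith
      moreover have "real (idx n t) / 2 ^ \<nu> n - par t = (real (idx n t) - par t * 2 ^ \<nu> n) / 2 ^ \<nu> n"
        by (simp add: diff_divide_distrib)
      ultimately have "\<bar>real (idx n t) / 2 ^ \<nu> n - par t\<bar> \<le> 1 / 2 ^ \<nu> n"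
        by (simp add: abs_divide divide_right_mono)
      also have "\<dots> \<le> 1 / 2 ^ n" using \<nu>_ge[of n] by (intro divide_left_mono power_increasing) auto
      finally show "norm (real (idx n t) / 2 ^ \<nu> n - par t) \<le> (1/2) ^ n" by (simp add: power_one_over)
    qed
    show "(\<lambda>n. (1/2::real) ^ n) \<longlonglongrightarrow> 0" by (rule LIMSEQ_power_zero) simp
  qed
  from continuous_on_tendsto_compose[OF \<theta>_cont this par(1)[OF t]]
  have "(\<lambda>n. \<theta> (real (idx n t) / 2 ^ \<nu> n)) \<longlonglongrightarrow> \<theta> (par t)"
    using idx_le[OF t] frac_le[OF \<theta>_cont \<theta>_mono \<theta>_0 \<theta>_1] by auto
  then show ?thesis by (simp add: grid_def par(2)[OF t])
qed

lemma Y_near: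
  assumes t: "t \<in> {0..T}"
  shows "norm (Y \<theta> (\<nu> n) (idx n t) x - interp \<theta> (\<nu> n) t x) \<le> exp (2 * m T) * (1 + norm x) * \<bar>m (gr n t) - m t\<bar>"
proof -
  have Yi: "Y \<theta> (\<nu> n) (idx n t) x = interp \<theta> (\<nu> n) (gr n t) x"
    by (rule interp_grid[OF facts idx_le[OF t], symmetric])
  have r: "gr n t \<in> {0..T}" by (rule gr_range[OF t])
  show ?thesis
  proof (cases "gr n t \<le> t")
    case True
    have "norm (interp \<theta> (\<nu> n) t x - interp \<theta> (\<nu> n) (gr n t) x) \<le> exp (2 * m T) * (1 + norm x) * (m t - m (gr n t))"
      by (rule interp_lipschitz_t[OF facts]) (use r t True in auto)
    then show ?thesis using m_mono[of "gr n t" t] r t True by (simp add: Yi norm_minus_commute)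
  next
    case False
    have "norm (interp \<theta> (\<nu> n) (gr n t) x - interp \<theta> (\<nu> n) t x) \<le> exp (2 * m T) * (1 + norm x) * (m (gr n t) - m t)"
      by (rule interp_lipschitz_t[OF facts]) (use r t False in auto)
    then show ?thesis using m_mono[of t "gr n t"] r t False by (simp add: Yi)
  qed
qed

lemma m_gr_lim: assumes t: "t \<in> {0..T}" shows "(\<lambda>n. m (gr n t)) \<longlonglongrightarrow> m t"
  using gr_range[OF t] by (intro continuous_on_tendsto_compose[OF m_continuous gr_lim[OF t] t]) auto

text \<open>At grid times the scheme is a composition of steps, to which the comparison of two
  times, surjectivity and connectedness of preimages apply. Limits are therefore taken along
  \<open>Y\<close> and not along the interpolants.\<close>

lemma Y_unif:
  assumes t: "t \<in> {0..T}" and R: "R \<ge> 0" and e: "e > 0"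
  obtains N where "\<And>n x. n \<ge> N \<Longrightarrow> x \<in> cball 0 R \<Longrightarrow> norm (Y \<theta> (\<nu> n) (idx n t) x - G (t, x)) < e"
proof -
  let ?K = "exp (2 * m T) * (1 + R)"
  have K: "?K > 0" using R by simp
  obtain N1 where N1: "\<And>n t x. n \<ge> N1 \<Longrightarrow> t \<in> {0..T} \<Longrightarrow> x \<in> cball 0 R \<Longrightarrow> norm (interp \<theta> (\<nu> n) t x - G (t, x)) < e / 2"
    using G_unif[of "e / 2"] e by auto
  have "e / (2 * ?K) > 0" using e K by (intro divide_pos_pos) auto
  from tendstoD[OF m_gr_lim[OF t] this] obtain N2 where N2: "\<And>n. n \<ge> N2 \<Longrightarrow> \<bar>m (gr n t) - m t\<bar> < e / (2 * ?K)"
    unfolding eventually_sequentially dist_real_def by blast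
  show thesis
  proof (rule that[of "max N1 N2"])
    fix n and x :: 'a assume n: "n \<ge> max N1 N2" and x: "x \<in> cball 0 R"
    have "norm (Y \<theta> (\<nu> n) (idx n t) x - interp \<theta> (\<nu> n) t x) \<le> exp (2 * m T) * (1 + norm x) * \<bar>m (gr n t) - m t\<bar>"
      by (rule Y_near[OF t])
    also have "\<dots> \<le> ?K * \<bar>m (gr n t) - m t\<bar>" using x by (intro mult_right_mono mult_left_mono) auto
    also have "\<dots> < ?K * (e / (2 * ?K))" using N2[of n] n K by (intro mult_strict_left_mono) auto
    also have "\<dots> = e / 2" using K by (simp add: field_simps)
    finally have 1: "norm (Y \<theta> (\<nu> n) (idx n t) x - interp \<theta> (\<nu> n) t x) < e / 2" .
    have 2: "norm (interp \<theta> (\<nu> n) t x - G (t, x)) < e / 2" using n by (intro N1 t x) auto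
    show "norm (Y \<theta> (\<nu> n) (idx n t) x - G (t, x)) < e"
      using norm_triangle_lt[of "Y \<theta> (\<nu> n) (idx n t) x - interp \<theta> (\<nu> n) t x" "interp \<theta> (\<nu> n) t x - G (t, x)" e] 1 2 by simp
  qed
qed

lemma Y_lim:
  assumes t: "t \<in> {0..T}" and x: "x \<in> cball 0 R"
  shows "(\<lambda>n. Y \<theta> (\<nu> n) (idx n t) x) \<longlonglongrightarrow> G (t, x)"
proof (rule LIMSEQ_I)
  fix e :: real assume "e > 0"
  have "R \<ge> 0" using x norm_ge_zero[of x] by (simp del: norm_ge_zero)
  then obtain N where "\<And>n x. n \<ge> N \<Longrightarrow> x \<in> cball 0 R \<Longrightarrow> norm (Y \<theta> (\<nu> n) (idx n t) x - G (t, x)) < e"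
    using Y_unif[OF t _ \<open>e > 0\<close>] by blast
  then show "\<exists>N. \<forall>n\<ge>N. norm (Y \<theta> (\<nu> n) (idx n t) x - G (t, x)) < e" using x by blast
qed

lemma G_lipschitz_x:
  assumes "x \<in> cball 0 R" "x' \<in> cball 0 R" "s \<in> {0..T}" "t \<in> {0..T}" "s \<le> t"
  shows "norm (G (s, x) - G (s, x')) \<le> exp (2 * m T) * norm (G (t, x) - G (t, x'))"
proof (rule LIMSEQ_le)
  show "(\<lambda>n. norm (Y \<theta> (\<nu> n) (idx n s) x - Y \<theta> (\<nu> n) (idx n s) x')) \<longlonglongrightarrow> norm (G (s, x) - G (s, x'))"
    using assms by (intro tendsto_intros Y_lim)
  show "(\<lambda>n. exp (2 * m T) * norm (Y \<theta> (\<nu> n) (idx n t) x - Y \<theta> (\<nu> n) (idx n t) x')) \<longlonglongrightarrow>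
      exp (2 * m T) * norm (G (t, x) - G (t, x'))"
    using assms by (intro tendsto_intros Y_lim)
  show "\<exists>N. \<forall>n\<ge>N. norm (Y \<theta> (\<nu> n) (idx n s) x - Y \<theta> (\<nu> n) (idx n s) x') \<le>
      exp (2 * m T) * norm (Y \<theta> (\<nu> n) (idx n t) x - Y \<theta> (\<nu> n) (idx n t) x')"
    using Y_lipschitz'[OF facts idx_mono[OF assms(3-5)] idx_le[OF assms(4)]] by blast
qed

lemma G_growth:
  assumes "t \<in> {0..T}" "x \<in> cball 0 R" shows "1 + norm (G (t, x)) \<le> exp (2 * m T) * (1 + norm x)"
proof (rule LIMSEQ_le_const2)
  show "(\<lambda>n. 1 + norm (Y \<theta> (\<nu> n) (idx n t) x)) \<longlonglongrightarrow> 1 + norm (G (t, x))"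
    using assms by (intro tendsto_intros Y_lim)
  show "\<exists>N. \<forall>n\<ge>N. 1 + norm (Y \<theta> (\<nu> n) (idx n t) x) \<le> exp (2 * m T) * (1 + norm x)"
    using Y_growth[OF facts idx_le[OF assms(1)]] by blast
qed

lemma G_proper:
  assumes "t \<in> {0..T}" "x \<in> cball 0 R" shows "1 + norm x \<le> exp (2 * m T) * (1 + norm (G (t, x)))"
proof (rule LIMSEQ_le_const)
  show "(\<lambda>n. exp (2 * m T) * (1 + norm (Y \<theta> (\<nu> n) (idx n t) x))) \<longlonglongrightarrow> exp (2 * m T) * (1 + norm (G (t, x)))"
    using assms by (intro tendsto_intros Y_lim)
  show "\<exists>N. \<forall>n\<ge>N. 1 + norm x \<le> exp (2 * m T) * (1 + norm (Y \<theta> (\<nu> n) (idx n t) x))"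
    using Y_proper[OF facts idx_le[OF assms(1)]] by blast
qed

end

end

end

section \<open>The limit of the scheme solves the differential inclusion\<close>

context one_sided_field
begin

context
  fixes \<theta> :: "real \<Rightarrow> real"
  assumes \<theta>_cont: "continuous_on {0..1} \<theta>"
    and \<theta>_mono: "\<And>r s. 0 \<le> r \<Longrightarrow> r \<le> s \<Longrightarrow> s \<le> 1 \<Longrightarrow> \<theta> r \<le> \<theta> s"
    and \<theta>_0: "\<theta> 0 = 0" and \<theta>_1: "\<theta> 1 = T"
begin

context
  fixes R :: real and \<nu> :: "nat \<Rightarrow> nat" and G :: "real \<times> 'a \<Rightarrow> 'a"
  assumes lim: "uniform_limit_of_interp \<theta> R \<nu> G"
begin

lemmas limit_facts = \<theta>_cont \<theta>_mono \<theta>_0 \<theta>_1 lim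
lemmas grid_facts = \<theta>_cont \<theta>_mono \<theta>_0 \<theta>_1
lemmas fine_facts = \<theta>_cont \<theta>_mono \<theta>_0 \<theta>_1 fine_\<nu>[OF limit_facts]

text \<open>The expected lower bound for the time derivative of half the squared distance from
  \<open>G (\<tau>, x)\<close> to the test point \<open>y\<close>, that is, the integrand obtained
  from \<open>energy_step\<close> in the limit.\<close>

definition energy_rate :: "'a \<Rightarrow> 'a \<Rightarrow> real \<Rightarrow> real" where
  "energy_rate x y \<tau> = b \<tau> y \<bullet> (G (\<tau>, x) - y) - C1 \<tau> * (norm (G (\<tau>, x) - y))\<^sup>2"

lemma G_curve_continuous:
  assumes "x \<in> cball 0 R" shows "continuous_on {0..T} (\<lambda>\<tau>. G (\<tau>, x))"
proof -
  have "continuous_on ({0..T} \<times> cball 0 R) G" using lim by (simp add: uniform_limit_of_interp_def[OF grid_facts])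
  then show ?thesis by (rule continuous_on_compose2) (use assms in \<open>auto intro!: continuous_intros\<close>)
qed

lemma energy_rate_integrable:
  assumes x: "x \<in> cball 0 R" and y: "y \<in> good" and "0 \<le> s" "t \<le> T"
  shows "energy_rate x y integrable_on {s..t}"
proof -
  have ce: "continuous_on {0..T} (\<lambda>\<tau>. G (\<tau>, x) - y)" by (intro continuous_intros G_curve_continuous x)
  have bd: "bounded ((\<lambda>\<tau>. G (\<tau>, x) - y) ` {0..T})" by (intro compact_imp_bounded compact_continuous_image ce) simp
  have ms: "(\<lambda>\<tau>. G (\<tau>, x) - y) \<in> borel_measurable (lebesgue_on {0..T})"
    by (rule continuous_imp_measurable_on_sets_lebesgue[OF ce]) simp
  have cq: "continuous_on {0..T} (\<lambda>\<tau>. (norm (G (\<tau>, x) - y))\<^sup>2)" by (intro continuous_intros ce)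
  have bq: "bounded ((\<lambda>\<tau>. (norm (G (\<tau>, x) - y))\<^sup>2) ` {0..T})" by (intro compact_imp_bounded compact_continuous_image cq) simp
  have mq: "(\<lambda>\<tau>. (norm (G (\<tau>, x) - y))\<^sup>2) \<in> borel_measurable (lebesgue_on {0..T})"
    by (rule continuous_imp_measurable_on_sets_lebesgue[OF cq]) simp
  have C1a: "C1 absolutely_integrable_on {0..T}"
    using C1_int by (simp add: set_integrable_def integrable_restrict_space)
  have 1: "(\<lambda>\<tau>. (G (\<tau>, x) - y) \<bullet> b \<tau> y) absolutely_integrable_on {0..T}"
    using absolutely_integrable_bounded_measurable_product[OF bilinear_conv_bounded_bilinear[THEN iffD2, OF bounded_bilinear_inner] ms _ bd b_integrable(1)[OF y order_refl order_refl]]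
    by simp
  have 2: "(\<lambda>\<tau>. (norm (G (\<tau>, x) - y))\<^sup>2 * C1 \<tau>) absolutely_integrable_on {0..T}"
    using absolutely_integrable_bounded_measurable_product_real[OF mq _ bq C1a] by simp
  have "(\<lambda>\<tau>. (G (\<tau>, x) - y) \<bullet> b \<tau> y - (norm (G (\<tau>, x) - y))\<^sup>2 * C1 \<tau>) integrable_on {0..T}"
    using 1 2 by (intro integrable_diff) (auto simp: absolutely_integrable_on_def)
  then have "energy_rate x y integrable_on {0..T}"
    by (rule integrable_eq) (simp add: energy_rate_def inner_commute mult.commute)
  then show ?thesis by (rule integrable_on_subinterval) (use assms in auto)
qed

text \<open>Replacing the position frozen at the grid point by \<open>G (\<tau>, x)\<close> costs at
  most \<open>M * \<eta> * C \<tau>\<close> per unit time. \<open>M\<close> dominates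
  \<open>1 + norm y\<close>, which bounds the field at \<open>y\<close>, and the sum of the two
  distances to \<open>y\<close>, which bounds the difference of their squares.\<close>

lemma energy_step_rate:
  assumes x: "x \<in> cball 0 R" and y: "y \<in> good" and k: "k < 2 ^ \<nu> n"
    and near: "\<And>\<tau>. grid \<theta> (\<nu> n) k \<le> \<tau> \<Longrightarrow> \<tau> \<le> grid \<theta> (\<nu> n) (Suc k) \<Longrightarrow> norm (Y \<theta> (\<nu> n) k x - G (\<tau>, x)) \<le> \<eta>"
    and M: "M \<ge> 1 + 2 * (exp (2 * m T) * (1 + norm x)) + 2 * norm y"
  shows "(norm (Y \<theta> (\<nu> n) (Suc k) x - y))\<^sup>2 / 2 - (norm (Y \<theta> (\<nu> n) k x - y))\<^sup>2 / 2 \<ge>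
    integral {grid \<theta> (\<nu> n) k..grid \<theta> (\<nu> n) (Suc k)} (energy_rate x y)
      - M * \<eta> * (m (grid \<theta> (\<nu> n) (Suc k)) - m (grid \<theta> (\<nu> n) k))"
proof -
  let ?g = "grid \<theta> (\<nu> n) k" and ?g' = "grid \<theta> (\<nu> n) (Suc k)"
  define z where "z = Y \<theta> (\<nu> n) k x"
  have g: "0 \<le> ?g" "?g \<le> ?g'" "?g' \<le> T"
    using g_step[OF fine_facts k] by auto
  have bi: "(\<lambda>\<tau>. b \<tau> y) integrable_on {?g..?g'}" using b_integrable(2)[OF y] g by simp
  have Ci: "C integrable_on {?g..?g'}" "C1 integrable_on {?g..?g'}" using C_integrable_on C_integrable g by auto
  have ei: "energy_rate x y integrable_on {?g..?g'}" using energy_rate_integrable[OF x y] g by simp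
  have zn: "norm z \<le> exp (2 * m T) * (1 + norm x)"
    using Y_growth[OF fine_facts less_imp_le[OF k], of x] by (simp add: z_def)
  have "integral {?g..?g'} (\<lambda>\<tau>. energy_rate x y \<tau> - M * \<eta> * C \<tau>) \<le> integral {?g..?g'} (\<lambda>\<tau>. b \<tau> y \<bullet> (z - y) - C1 \<tau> * (norm (z - y))\<^sup>2)"
  proof (rule integral_le)
    show "(\<lambda>\<tau>. energy_rate x y \<tau> - M * \<eta> * C \<tau>) integrable_on {?g..?g'}"
      by (intro integrable_diff integrable_on_mult_right ei Ci)
    show "(\<lambda>\<tau>. b \<tau> y \<bullet> (z - y) - C1 \<tau> * (norm (z - y))\<^sup>2) integrable_on {?g..?g'}"
      using integrable_linear[OF bi bounded_linear_inner_left[of "z - y"]]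
      by (intro integrable_diff integrable_on_mult_left Ci) (simp add: o_def)
    fix \<tau> assume \<tau>: "\<tau> \<in> {?g..?g'}"
    define p where "p = G (\<tau>, x)"
    have \<tau>T: "\<tau> \<in> {0..T}" using \<tau> g by auto
    have pn: "norm p \<le> exp (2 * m T) * (1 + norm x)"
      using G_growth[OF limit_facts \<tau>T x] by (simp add: p_def)
    have zp: "norm (z - p) \<le> \<eta>" using near[of \<tau>] \<tau> by (simp add: z_def p_def)
    then have \<eta>: "\<eta> \<ge> 0" using norm_ge_zero order_trans by blast
    have "norm (b \<tau> y) \<le> C0 \<tau> * (1 + norm y)" by (rule growth[OF \<tau>T])
    also have "\<dots> \<le> C0 \<tau> * M"
    proof (rule mult_left_mono)
      have "0 \<le> exp (2 * m T) * (1 + norm x)" by simp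
      then show "1 + norm y \<le> M" using M norm_ge_zero[of y] by linarith
    qed (rule C0_nonneg[OF \<tau>T])
    finally have bM: "norm (b \<tau> y) \<le> C0 \<tau> * M" .
    have 1: "b \<tau> y \<bullet> (p - y) - b \<tau> y \<bullet> (z - y) \<le> C0 \<tau> * M * \<eta>"
    proof -
      have "b \<tau> y \<bullet> (p - y) - b \<tau> y \<bullet> (z - y) = b \<tau> y \<bullet> (p - z)" by (simp add: inner_diff_right)
      also have "\<dots> \<le> norm (b \<tau> y) * norm (p - z)" by (rule norm_cauchy_schwarz)
      also have "\<dots> \<le> C0 \<tau> * M * \<eta>"
        using bM zp order_trans[OF norm_ge_zero bM] by (intro mult_mono) (auto simp: norm_minus_commute)
      finally show ?thesis .
    qed
    have 2: "C1 \<tau> * (norm (z - y))\<^sup>2 - C1 \<tau> * (norm (p - y))\<^sup>2 \<le> C1 \<tau> * (M * \<eta>)"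
    proof -
      have a: "norm (z - y) + norm (p - y) \<le> M" using M zn pn norm_triangle_ineq4[of z y] norm_triangle_ineq4[of p y] by linarith
      have "(norm (z - y))\<^sup>2 - (norm (p - y))\<^sup>2 = (norm (z - y) + norm (p - y)) * (norm (z - y) - norm (p - y))"
        by (simp add: power2_eq_square algebra_simps)
      also have "\<dots> \<le> (norm (z - y) + norm (p - y)) * \<eta>"
        using zp norm_triangle_ineq2[of "z - y" "p - y"] by (intro mult_left_mono) auto
      also have "\<dots> \<le> M * \<eta>" using a \<eta> by (intro mult_right_mono)
      finally have "C1 \<tau> * ((norm (z - y))\<^sup>2 - (norm (p - y))\<^sup>2) \<le> C1 \<tau> * (M * \<eta>)"
        by (rule mult_left_mono) (rule C1_nonneg[OF \<tau>T])
      then show ?thesis by (simp only: right_diff_distrib)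
    qed
    have "0 \<le> exp (2 * m T) * (1 + norm x)" by simp
    then have "0 \<le> M" using M norm_ge_zero[of y] by linarith
    then have "M * \<eta> * C \<tau> \<ge> C0 \<tau> * M * \<eta> + C1 \<tau> * (M * \<eta>)"
      using \<eta> by (simp add: C_def algebra_simps)
    then show "energy_rate x y \<tau> - M * \<eta> * C \<tau> \<le> b \<tau> y \<bullet> (z - y) - C1 \<tau> * (norm (z - y))\<^sup>2"
      unfolding energy_rate_def p_def[symmetric] using 1 2 by linarith
  qed
  moreover have "integral {?g..?g'} (\<lambda>\<tau>. energy_rate x y \<tau> - M * \<eta> * C \<tau>) = integral {?g..?g'} (energy_rate x y) - M * \<eta> * (m ?g' - m ?g)"
    using m_diff[OF g] by (simp add: integral_diff[OF ei integrable_on_mult_right[OF Ci(1)]])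
  moreover have "integral {?g..?g'} (\<lambda>\<tau>. b \<tau> y \<bullet> (z - y) - C1 \<tau> * (norm (z - y))\<^sup>2)
      = B ?g ?g' y \<bullet> (z - y) - integral {?g..?g'} C1 * (norm (z - y))\<^sup>2"
  proof -
    have "(\<lambda>\<tau>. b \<tau> y \<bullet> (z - y)) integrable_on {?g..?g'}" "integral {?g..?g'} (\<lambda>\<tau>. b \<tau> y \<bullet> (z - y)) = B ?g ?g' y \<bullet> (z - y)"
      using integrable_linear[OF bi bounded_linear_inner_left[of "z - y"]] integral_linear[OF bi bounded_linear_inner_left[of "z - y"]]
      by (auto simp: o_def B_def)
    then show ?thesis using Ci(2) by (simp add: integral_diff integrable_on_mult_left)
  qed
  ultimately show ?thesis using energy_step[OF fine_facts k y, of x] unfolding z_def by linarith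
qed

text \<open>Adding \<open>M * \<eta>\<close> times the clock compensates the error of each cell, so
  a quantity is nondecreasing along the grid indices. This passes to the limit of the scheme;
  afterwards \<open>\<eta>\<close> tends to 0.\<close>

lemma energy_inequality:
  assumes x: "x \<in> cball 0 R" and y: "y \<in> good" and st: "0 \<le> s" "s \<le> t" "t \<le> T"
  shows "(norm (G (t, x) - y))\<^sup>2 / 2 - (norm (G (s, x) - y))\<^sup>2 / 2 \<ge> integral {s..t} (energy_rate x y)"
proof -
  let ?K = "exp (2 * m T) * (1 + norm x)"
  define M where "M = 1 + 2 * ?K + 2 * norm y"
  have K: "?K > 0" by (simp add: add_pos_nonneg)
  have M: "M > 0" using K norm_ge_zero[of y] unfolding M_def by linarith
  define P where "P = (\<lambda>t. integral {0..t} (energy_rate x y))"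
  have Pd: "P v - P u = integral {u..v} (energy_rate x y)" if "0 \<le> u" "u \<le> v" "v \<le> T" for u v
    unfolding P_def using Henstock_Kurzweil_Integration.integral_combine[OF that(1,2) energy_rate_integrable[OF x y order_refl that(3)]] by simp
  have Pc: "continuous_on {0..T} P"
    unfolding P_def by (intro indefinite_integral_continuous_1 energy_rate_integrable[OF x y]) auto
  define E where "E = (\<lambda>z. (norm (z - y))\<^sup>2 / 2)"
  have s: "s \<in> {0..T}" and t: "t \<in> {0..T}" using st by auto
  have mT: "m T \<ge> 0" using m_mono[of 0 T] T_pos by simp
  have main: "E (G (s, x)) - P s \<le> E (G (t, x)) - P t + M * \<eta> * m T" if \<eta>: "\<eta> > 0" for \<eta>
  proof -
    \<comment> \<open>Half of \<open>\<eta>\<close> covers the error of the scheme at the grid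
      point, the other half the motion of \<open>G\<close> within one cell.\<close>
    define \<epsilon> where "\<epsilon> = \<eta> / (2 * (1 + ?K))"
    have \<epsilon>: "\<epsilon> > 0" "\<epsilon> \<le> \<eta> / 2" "?K * \<epsilon> \<le> \<eta> / 2"
      using \<eta> K by (auto simp: \<epsilon>_def field_simps)
    obtain N1 where N1: "\<And>n t x. n \<ge> N1 \<Longrightarrow> t \<in> {0..T} \<Longrightarrow> x \<in> cball 0 R \<Longrightarrow> norm (interp \<theta> (\<nu> n) t x - G (t, x)) < \<epsilon>"
      using G_unif[OF limit_facts \<epsilon>(1)] by blast
    obtain N2 where N2: "\<And>n k. n \<ge> N2 \<Longrightarrow> k < 2 ^ n \<Longrightarrow> m (grid \<theta> n (Suc k)) - m (grid \<theta> n k) \<le> \<epsilon>"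
      using mesh[OF grid_facts \<epsilon>(1)] by auto
    have step: "E (Y \<theta> (\<nu> n) (idx \<theta> \<nu> n s) x) - P (grid \<theta> (\<nu> n) (idx \<theta> \<nu> n s)) + M * \<eta> * m (grid \<theta> (\<nu> n) (idx \<theta> \<nu> n s))
        \<le> E (Y \<theta> (\<nu> n) (idx \<theta> \<nu> n t) x) - P (grid \<theta> (\<nu> n) (idx \<theta> \<nu> n t)) + M * \<eta> * m (grid \<theta> (\<nu> n) (idx \<theta> \<nu> n t))"
      if n: "n \<ge> max N1 N2" for n
    proof -
      let ?D = "\<lambda>k. E (Y \<theta> (\<nu> n) k x) - P (grid \<theta> (\<nu> n) k) + M * \<eta> * m (grid \<theta> (\<nu> n) k)"
      have inc: "?D k \<le> ?D (Suc k)" if k: "k < 2 ^ \<nu> n" for k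
      proof -
        let ?g = "grid \<theta> (\<nu> n) k" and ?g' = "grid \<theta> (\<nu> n) (Suc k)"
        have g: "0 \<le> ?g" "?g \<le> ?g'" "?g' \<le> T" using g_step[OF fine_facts k] by auto
        have "norm (Y \<theta> (\<nu> n) k x - G (\<tau>, x)) \<le> \<eta>" if \<tau>: "?g \<le> \<tau>" "\<tau> \<le> ?g'" for \<tau>
        proof -
          have a: "norm (Y \<theta> (\<nu> n) k x - G (?g, x)) \<le> \<epsilon>"
            using N1[of n ?g x] n g x interp_grid[OF fine_facts less_imp_le[OF k], of x] by simp
          have "norm (G (\<tau>, x) - G (?g, x)) \<le> ?K * (m \<tau> - m ?g)"
            by (rule G_lipschitz_t[OF limit_facts x]) (use g \<tau> in auto)
          also have "\<dots> \<le> ?K * \<epsilon>"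
          proof (rule mult_left_mono)
            have "m \<tau> \<le> m ?g'" using g \<tau> by (intro m_mono) auto
            then show "m \<tau> - m ?g \<le> \<epsilon>" using N2[of "\<nu> n" k] k n \<nu>_ge[OF limit_facts, of n] by simp
          qed (use K in simp)
          finally have "norm (G (\<tau>, x) - G (?g, x)) \<le> \<eta> / 2" using \<epsilon>(3) by simp
          then show ?thesis using a \<epsilon>(2) norm_triangle_ineq4[of "Y \<theta> (\<nu> n) k x - G (?g, x)" "G (\<tau>, x) - G (?g, x)"] by simp
        qed
        from energy_step_rate[OF x y k this, of M] show ?thesis
          using Pd[OF g] by (simp add: M_def[symmetric] E_def right_diff_distrib)
      qed
      have "?D i \<le> ?D k" if "i \<le> k" "k \<le> 2 ^ \<nu> n" for i k
        using that
      proof (induction k rule: dec_induct)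
        case (step k)
        then show ?case using inc[of k] by linarith
      qed simp
      then show ?thesis using idx_mono[OF limit_facts s t st(2)] idx_le[OF limit_facts t] by blast
    qed
    have "E (G (s, x)) - P s + M * \<eta> * m s \<le> E (G (t, x)) - P t + M * \<eta> * m t"
    proof (rule LIMSEQ_le)
      have *: "(\<lambda>n. E (Y \<theta> (\<nu> n) (idx \<theta> \<nu> n r) x) - P (grid \<theta> (\<nu> n) (idx \<theta> \<nu> n r)) + M * \<eta> * m (grid \<theta> (\<nu> n) (idx \<theta> \<nu> n r)))
          \<longlonglongrightarrow> E (G (r, x)) - P r + M * \<eta> * m r" if r: "r \<in> {0..T}" for r
      proof -
        have "(\<lambda>n. P (grid \<theta> (\<nu> n) (idx \<theta> \<nu> n r))) \<longlonglongrightarrow> P r"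
          using gr_range[OF limit_facts r] by (intro continuous_on_tendsto_compose[OF Pc gr_lim[OF limit_facts r] r]) auto
        then show ?thesis
          unfolding E_def by (intro tendsto_intros Y_lim[OF limit_facts r x] m_gr_lim[OF limit_facts r]) auto
      qed
      show "(\<lambda>n. E (Y \<theta> (\<nu> n) (idx \<theta> \<nu> n s) x) - P (grid \<theta> (\<nu> n) (idx \<theta> \<nu> n s)) + M * \<eta> * m (grid \<theta> (\<nu> n) (idx \<theta> \<nu> n s)))
          \<longlonglongrightarrow> E (G (s, x)) - P s + M * \<eta> * m s" by (rule *[OF s])
      show "(\<lambda>n. E (Y \<theta> (\<nu> n) (idx \<theta> \<nu> n t) x) - P (grid \<theta> (\<nu> n) (idx \<theta> \<nu> n t)) + M * \<eta> * m (grid \<theta> (\<nu> n) (idx \<theta> \<nu> n t)))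
          \<longlonglongrightarrow> E (G (t, x)) - P t + M * \<eta> * m t" by (rule *[OF t])
    qed (use step in blast)
    moreover have "M * \<eta> * m t \<le> M * \<eta> * m T" "0 \<le> M * \<eta> * m s"
      using M \<eta> m_mono[of t T] m_mono[of 0 s] st by (auto intro!: mult_left_mono mult_nonneg_nonneg)
    ultimately show ?thesis by linarith
  qed
  have "E (G (s, x)) - P s \<le> E (G (t, x)) - P t"
  proof (rule field_le_epsilon)
    fix e :: real assume e: "e > 0"
    have "e / (1 + M * m T) > 0" using e M mT by (simp add: add_pos_nonneg)
    from main[OF this] have "E (G (s, x)) - P s \<le> E (G (t, x)) - P t + e * (M * m T / (1 + M * m T))" by (simp add: mult.commute mult.left_commute)
    also have "\<dots> \<le> E (G (t, x)) - P t + e * 1"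
      using e M mT by (intro add_left_mono mult_left_mono) (auto simp: divide_le_eq add_pos_nonneg)
    finally show "E (G (s, x)) - P s \<le> E (G (t, x)) - P t + e" by simp
  qed
  then show ?thesis using Pd[OF st] by (simp add: E_def)
qed

text \<open>Differentiating the energy inequality shows that the derivative of the curve is a
  one-sided value with respect to the test points, at almost every time. A dense set of test points
  suffices to place it in the Filippov hull.\<close>

lemma G_filippov_curve:
  assumes x: "x \<in> cball 0 R"
  shows "filippov_curve b T x (\<lambda>t. G (t, x))"
proof -
  let ?K = "exp (2 * m T) * (1 + norm x)"
  define \<gamma> where "\<gamma> = (\<lambda>t. G (t, x))"
  have K: "?K \<ge> 0" by simp
  have lip: "norm (\<gamma> t - \<gamma> s) \<le> ?K * (m t - m s)" if "0 \<le> s" "s \<le> t" "t \<le> T" for s t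
    unfolding \<gamma>_def by (rule G_lipschitz_t[OF limit_facts x that])
  have ac: "absolutely_cont_on 0 T \<gamma>"
  proof (rule absolutely_cont_on_dominated[OF m_absolutely_cont m_absolutely_cont K])
    fix l r assume lr: "0 \<le> l" "l \<le> r" "r \<le> T"
    have "?K * (m r - m l) \<le> ?K * (norm (m r - m l) + norm (m r - m l))"
      using m_mono[OF lr] by (intro mult_left_mono K) simp
    then show "norm (\<gamma> r - \<gamma> l) \<le> ?K * (norm (m r - m l) + norm (m r - m l))" using lip[OF lr] by linarith
  qed
  obtain N0 where N0: "negligible N0" "\<And>t. t \<in> {0<..<T} - N0 \<Longrightarrow> \<gamma> differentiable (at t)"
  proof (rule dominated_differentiable[OF T_pos, where \<gamma>=\<gamma> and g="\<lambda>t. ?K * C t"])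
    show "integrable (lebesgue_on {0..T}) (\<lambda>t. ?K * C t)" using C_int by simp
    show "0 \<le> ?K * C t" if "t \<in> {0..T}" for t using C_nonneg[OF that] by simp
    show "norm (\<gamma> t - \<gamma> s) \<le> integral {s..t} (\<lambda>t. ?K * C t)" if "0 \<le> s" "s \<le> t" "t \<le> T" for s t
      using lip[OF that] m_diff[OF that] by simp
  qed blast
  \<comment> \<open>Countability allows the exceptional null sets of times to be united; lying in
    \<open>good\<close> makes the energy rates integrable.\<close>
  obtain Q :: "'a set" where Q: "countable Q" "Q \<subseteq> good" "good \<subseteq> closure Q" by (rule separable)
  have Qd: "closure Q = UNIV" using closure_minimal[OF Q(3)] good_dense by auto
  have "\<exists>N. negligible N \<and> (\<forall>t\<in>{0<..<T} - N. ((\<lambda>t. integral {0..t} (energy_rate x y)) has_real_derivative energy_rate x y t) (at t))"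
    if y: "y \<in> Q" for y
  proof -
    define H where "H = (\<lambda>t. if t \<in> {0..T} then energy_rate x y t else 0)"
    have ei: "energy_rate x y integrable_on {0..T}" using energy_rate_integrable[OF x] y Q(2) by auto
    have "H integrable_on UNIV" unfolding H_def using ei by (simp only: integrable_restrict_UNIV)
    then have Hi: "H integrable_on {u..v}" for u v by (rule integrable_on_subinterval) simp
    obtain N where N: "negligible N" "\<And>a x. x \<notin> N \<Longrightarrow> a < x \<Longrightarrow> ((\<lambda>t. integral {a..t} H) has_vector_derivative H x) (at x)"
      by (rule lebesgue_differentiation_real[OF Hi]) blast
    have "((\<lambda>t. integral {0..t} (energy_rate x y)) has_real_derivative energy_rate x y t) (at t)" if t: "t \<in> {0<..<T} - N" for t
    proof -
      have A: "((\<lambda>t. integral {0..t} H) has_vector_derivative H t) (at t)" using N(2)[of t 0] t by auto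
      have B: "integral {0..s} H = integral {0..s} (energy_rate x y)" if "s \<in> {0<..<T}" for s
        using that by (intro Henstock_Kurzweil_Integration.integral_cong) (auto simp: H_def)
      have "((\<lambda>t. integral {0..t} (energy_rate x y)) has_vector_derivative H t) (at t)"
        by (rule has_vector_derivative_transform_within_open[OF A open_greaterThanLessThan _ B]) (use t in auto)
      then show ?thesis using t by (simp add: H_def has_real_derivative_iff_has_vector_derivative)
    qed
    then show ?thesis using N(1) by blast
  qed
  then obtain NQ where NQ: "\<And>y. y \<in> Q \<Longrightarrow> negligible (NQ y)"
    "\<And>y t. y \<in> Q \<Longrightarrow> t \<in> {0<..<T} - NQ y \<Longrightarrow> ((\<lambda>t. integral {0..t} (energy_rate x y)) has_real_derivative energy_rate x y t) (at t)"
    using bchoice[of Q "\<lambda>y N. negligible N \<and> (\<forall>t\<in>{0<..<T} - N. ((\<lambda>t. integral {0..t} (energy_rate x y)) has_real_derivative energy_rate x y t) (at t))"]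
    by blast
  define N where "N = N0 \<union> (\<Union>y\<in>Q. NQ y) \<union> {0, T}"
  have "negligible (\<Union>(NQ ` Q))" using Q(1) NQ(1) by (intro negligible_countable_Union) auto
  then have Nneg: "negligible N" unfolding N_def using N0(1) by simp
  have val: "\<exists>v\<in>filippov_hull b t (\<gamma> t). (\<gamma> has_vector_derivative v) (at t)" if t: "t \<in> {0..T}" "t \<notin> N" for t
  proof -
    have t': "t \<in> {0<..<T}" using t by (auto simp: N_def)
    then have "\<gamma> differentiable (at t)" using N0(2)[of t] t by (auto simp: N_def)
    then obtain v where v: "(\<gamma> has_vector_derivative v) (at t)" by (auto simp: vector_derivative_works)
    have "one_sided_value Q (b t) (C1 t) (\<gamma> t) v"
      unfolding one_sided_value_def
    proof
      fix y assume y: "y \<in> Q"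
      have dd: "((\<lambda>t. \<gamma> t - y) has_vector_derivative v) (at t)" using has_vector_derivative_diff[OF v has_vector_derivative_const[of y]] by simp
      have "((\<lambda>t. (\<gamma> t - y) \<bullet> (\<gamma> t - y)) has_real_derivative 2 * (v \<bullet> (\<gamma> t - y))) (at t)"
        using bounded_bilinear.has_vector_derivative[OF bounded_bilinear_inner dd dd]
        by (simp add: inner_commute has_real_derivative_iff_has_vector_derivative)
      then have sq: "((\<lambda>t. (norm (\<gamma> t - y))\<^sup>2) has_real_derivative 2 * (v \<bullet> (\<gamma> t - y))) (at t)"
        by (simp add: power2_norm_eq_inner)
      have "((\<lambda>t. (norm (\<gamma> t - y))\<^sup>2 / 2 - integral {0..t} (energy_rate x y)) has_real_derivative (2 * (v \<bullet> (\<gamma> t - y))) / 2 - energy_rate x y t) (at t)"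
        using NQ(2)[OF y, of t] t t' y by (intro DERIV_diff DERIV_cdivide sq) (auto simp: N_def)
      moreover have "mono_on {0..T} (\<lambda>t. (norm (\<gamma> t - y))\<^sup>2 / 2 - integral {0..t} (energy_rate x y))"
      proof (rule mono_onI)
        fix r s assume rs: "r \<in> {0..T}" "s \<in> {0..T}" "r \<le> s"
        have yg: "y \<in> good" using y Q(2) by auto
        have "integral {0..r} (energy_rate x y) + integral {r..s} (energy_rate x y) = integral {0..s} (energy_rate x y)"
          using rs by (intro Henstock_Kurzweil_Integration.integral_combine energy_rate_integrable[OF x yg]) auto
        then show "(norm (\<gamma> r - y))\<^sup>2 / 2 - integral {0..r} (energy_rate x y) \<le> (norm (\<gamma> s - y))\<^sup>2 / 2 - integral {0..s} (energy_rate x y)"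
          using energy_inequality[OF x yg _ rs(3)] rs by (simp add: \<gamma>_def)
      qed
      ultimately have "(2 * (v \<bullet> (\<gamma> t - y))) / 2 - energy_rate x y t \<ge> 0"
        using t' by (intro mono_on_imp_deriv_nonneg[where A="{0..T}"]) auto
      then show "- C1 t * (norm (\<gamma> t - y))\<^sup>2 \<le> (v - b t y) \<bullet> (\<gamma> t - y)"
        by (simp add: energy_rate_def \<gamma>_def inner_diff_left)
    qed
    then show ?thesis using filippov_hullI[OF t(1) Qd] v by blast
  qed
  have "AE t in lebesgue. t \<in> {0..T} \<longrightarrow> (\<exists>v\<in>filippov_hull b t (\<gamma> t). (\<gamma> has_vector_derivative v) (at t))"
    by (rule AE_I'[of N]) (use Nneg val in \<open>auto simp: negligible_iff_null_sets\<close>)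
  then have "AE t in lebesgue_on {0..T}. \<exists>v\<in>filippov_hull b t (\<gamma> t). (\<gamma> has_vector_derivative v) (at t)"
    by (subst AE_restrict_space_iff) auto
  moreover have "\<gamma> T = x" unfolding \<gamma>_def by (rule G_top[OF limit_facts x])
  ultimately show ?thesis unfolding filippov_curve_def \<gamma>_def[symmetric] using ac by blast
qed

end

end

end

section \<open>The backward flow\<close>

context one_sided_field
begin

abbreviation flow :: "real \<Rightarrow> 'a \<Rightarrow> 'a" where "flow t \<equiv> filippov_flow b t T"

definition L :: real where "L = exp (2 * m T)"

lemma L_ge_1: "L \<ge> 1" using m_mono[of 0 T] T_pos by (simp add: L_def)

lemma linear_time:
  "continuous_on {0..1} (\<lambda>r. r * T)" "\<And>r s. 0 \<le> r \<Longrightarrow> r \<le> s \<Longrightarrow> s \<le> 1 \<Longrightarrow> r * T \<le> s * T"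
  "0 * T = 0" "1 * T = T"
  using T_pos by (auto intro!: continuous_intros mult_right_mono)

text \<open>\<open>\<nu>\<close> and \<open>G\<close> depend on the radius, but by uniqueness of
  Filippov curves all these limits are restrictions of one flow.\<close>

lemma flow_approximation:
  assumes "R \<ge> 0"
  obtains \<nu> G where "uniform_limit_of_interp (\<lambda>r. r * T) R \<nu> G"
    "\<And>t x. t \<in> {0..T} \<Longrightarrow> x \<in> cball 0 R \<Longrightarrow> flow t x = G (t, x)"
proof -
  obtain \<nu> G where G: "uniform_limit_of_interp (\<lambda>r. r * T) R \<nu> G"
    using uniform_limit_exists[OF linear_time assms] by blast
  then show thesis
    using that filippov_flow_eq[OF G_filippov_curve[OF linear_time G]] by blast
qed

lemma flow_T [simp]: "flow T x = x"
proof -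
  obtain \<nu> G where G: "uniform_limit_of_interp (\<lambda>r. r * T) (norm x) \<nu> G"
    and eq: "\<And>t x'. t \<in> {0..T} \<Longrightarrow> x' \<in> cball 0 (norm x) \<Longrightarrow> flow t x' = G (t, x')"
    by (rule flow_approximation[of "norm x"]) auto
  show ?thesis using eq[of T x] G_top[OF linear_time G, of x] T_pos by simp
qed

lemma flow_lipschitz:
  assumes "s \<in> {0..T}" "t \<in> {0..T}" "s \<le> t"
  shows "norm (flow s x - flow s x') \<le> L * norm (flow t x - flow t x')"
proof -
  let ?R = "max (norm x) (norm x')"
  obtain \<nu> G where G: "uniform_limit_of_interp (\<lambda>r. r * T) ?R \<nu> G"
    and eq: "\<And>t x'. t \<in> {0..T} \<Longrightarrow> x' \<in> cball 0 ?R \<Longrightarrow> flow t x' = G (t, x')"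
    by (rule flow_approximation[of ?R]) (auto simp: le_max_iff_disj)
  show ?thesis using G_lipschitz_x[OF linear_time G _ _ assms, of x x'] eq assms by (simp add: L_def)
qed

lemma flow_lipschitz': "t \<in> {0..T} \<Longrightarrow> norm (flow t x - flow t x') \<le> L * norm (x - x')"
  using flow_lipschitz[of t T x x'] T_pos by simp

lemma flow_growth: "t \<in> {0..T} \<Longrightarrow> 1 + norm (flow t x) \<le> L * (1 + norm x)"
  and flow_proper: "t \<in> {0..T} \<Longrightarrow> 1 + norm x \<le> L * (1 + norm (flow t x))"
proof -
  assume t: "t \<in> {0..T}"
  obtain \<nu> G where G: "uniform_limit_of_interp (\<lambda>r. r * T) (norm x) \<nu> G"
    and eq: "\<And>t x'. t \<in> {0..T} \<Longrightarrow> x' \<in> cball 0 (norm x) \<Longrightarrow> flow t x' = G (t, x')"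
    by (rule flow_approximation[of "norm x"]) auto
  show "1 + norm (flow t x) \<le> L * (1 + norm x)" "1 + norm x \<le> L * (1 + norm (flow t x))"
    using G_growth[OF linear_time G t, of x] G_proper[OF linear_time G t, of x] eq[OF t, of x] by (simp_all add: L_def)
qed

lemma flow_continuous: "continuous_on ({0..T} \<times> UNIV) (\<lambda>(t, x). flow t x)"
  unfolding continuous_on_eq_continuous_within
proof clarify
  fix t :: real and x :: 'a assume t: "t \<in> {0..T}"
  let ?R = "norm x + 1" and ?f = "\<lambda>(t, x). flow t x"
  obtain \<nu> G where G: "uniform_limit_of_interp (\<lambda>r. r * T) ?R \<nu> G"
    and eq: "\<And>t x'. t \<in> {0..T} \<Longrightarrow> x' \<in> cball 0 ?R \<Longrightarrow> flow t x' = G (t, x')"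
    by (rule flow_approximation[of ?R]) auto
  have "continuous_on ({0..T} \<times> cball 0 ?R) G" using G by (simp add: uniform_limit_of_interp_def[OF linear_time])
  then have "continuous_on ({0..T} \<times> cball 0 ?R) ?f"
    by (rule continuous_on_eq) (auto simp: eq)
  then have "continuous (at (t, x) within ({0..T} \<times> cball 0 ?R)) ?f"
    using t by (simp add: continuous_on_eq_continuous_within)
  moreover have "at (t, x) within ({0..T} \<times> cball 0 ?R) = at (t, x) within ({0..T} \<times> UNIV)"
    by (rule at_within_nhd[of _ "UNIV \<times> ball 0 ?R"]) (auto intro!: open_Times)
  ultimately show "continuous (at (t, x) within ({0..T} \<times> UNIV)) ?f" by simp
qed

text \<open>Collects what the fibres of the flow inherit from the approximations: surjectivity,
  connected preimages, and a bound on preimages that does not depend on \<open>e\<close>.\<close>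

lemma flow_approximation_at:
  assumes t: "t \<in> {0..T}" and "R \<ge> 0" and e: "e > 0"
  obtains g where "\<And>x. x \<in> cball 0 R \<Longrightarrow> norm (g x - flow t x) < e" "\<And>z. \<exists>x. g x = z"
    "\<And>S. connected S \<Longrightarrow> connected (g -` S)" "\<And>x. 1 + norm x \<le> L * (1 + norm (g x))"
proof -
  obtain \<nu> G where G: "uniform_limit_of_interp (\<lambda>r. r * T) R \<nu> G"
    and eq: "\<And>t x'. t \<in> {0..T} \<Longrightarrow> x' \<in> cball 0 R \<Longrightarrow> flow t x' = G (t, x')"
    by (rule flow_approximation[OF \<open>R \<ge> 0\<close>]) auto
  note ff = linear_time fine_\<nu>[OF linear_time G]
  obtain N where N: "\<And>n x. n \<ge> N \<Longrightarrow> x \<in> cball 0 R \<Longrightarrow>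
      norm (Y (\<lambda>r. r * T) (\<nu> n) (idx (\<lambda>r. r * T) \<nu> n t) x - G (t, x)) < e"
    using Y_unif[OF linear_time G t \<open>R \<ge> 0\<close> e] by blast
  note le = idx_le[OF linear_time G t, of N]
  show thesis
  proof (rule that)
    show "norm (Y (\<lambda>r. r * T) (\<nu> N) (idx (\<lambda>r. r * T) \<nu> N t) x - flow t x) < e" if "x \<in> cball 0 R" for x
      using N[of N x] that eq[OF t that] by simp
    show "\<exists>x. Y (\<lambda>r. r * T) (\<nu> N) (idx (\<lambda>r. r * T) \<nu> N t) x = z" for z by (rule Y_surj[OF ff le])
    show "connected (Y (\<lambda>r. r * T) (\<nu> N) (idx (\<lambda>r. r * T) \<nu> N t) -` S)" if "connected S" for S
      by (rule Y_connected_vimage[OF ff le that])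
    show "1 + norm x \<le> L * (1 + norm (Y (\<lambda>r. r * T) (\<nu> N) (idx (\<lambda>r. r * T) \<nu> N t) x))" for x
      unfolding L_def by (rule Y_proper[OF ff le])
  qed
qed

lemma flow_continuous_x: "t \<in> {0..T} \<Longrightarrow> continuous_on S (flow t)"
  by (rule lipschitz_on_continuous_on[of L])
    (use flow_lipschitz' L_ge_1 in \<open>auto simp: lipschitz_on_def dist_norm\<close>)

text \<open>Properness confines the preimages of \<open>z\<close> under all approximations to one
  ball, whose image under the flow is compact and thus contains \<open>z\<close>.\<close>

lemma flow_surj:
  assumes t: "t \<in> {0..T}" shows "\<exists>x. flow t x = z"
proof -
  define R where "R = L * (1 + norm z)"
  have R: "R \<ge> 0" using L_ge_1 by (simp add: R_def)
  have "z \<in> closure (flow t ` cball 0 R)"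
    unfolding closure_approachable
  proof (intro allI impI)
    fix e :: real assume "e > 0"
    then obtain g where g: "\<And>x. x \<in> cball 0 R \<Longrightarrow> norm (g x - flow t x) < e" "\<And>z. \<exists>x. g x = z"
      "\<And>x. 1 + norm x \<le> L * (1 + norm (g x))"
      using flow_approximation_at[OF t R] by metis
    obtain x where x: "g x = z" using g(2) by blast
    have "x \<in> cball 0 R" using g(3)[of x] by (simp add: x R_def)
    then show "\<exists>y\<in>flow t ` cball 0 R. dist y z < e"
      using g(1)[of x] x by (auto simp: dist_norm norm_minus_commute)
  qed
  moreover have "closed (flow t ` cball 0 R)"
    by (intro compact_imp_closed compact_continuous_image flow_continuous_x t) simp
  ultimately show ?thesis by (auto simp: closure_closed)
qed

text \<open>The fibre is a limit of the preimages of small balls under the approximations, which are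
  connected; a separation of the fibre would leave a point of each of these preimages on the
  hypersurface equidistant to its two parts.\<close>

lemma flow_connected_fibre:
  assumes t: "t \<in> {0..T}" shows "connected {x. flow t x = z}"
proof -
  let ?F = "{x. flow t x = z}"
  have clF: "closed ?F" using continuous_closed_preimage_constant[OF flow_continuous_x[OF t] closed_UNIV, of z] by simp
  show ?thesis
    unfolding connected_closed_set[OF clF]
  proof (rule notI, elim exE conjE)
    fix A B assume AB: "closed A" "closed B" "A \<noteq> {}" "B \<noteq> {}" "A \<union> B = ?F" "A \<inter> B = {}"
    define \<rho> where "\<rho> = (\<lambda>x. infdist x A - infdist x B)"
    have \<rho>c: "continuous_on S \<rho>" for S unfolding \<rho>_def by (intro continuous_intros)
    have posA: "\<rho> a < 0" if "a \<in> A" for a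
    proof -
      have "a \<notin> B" using that AB by auto
      then have "infdist a B > 0" using AB infdist_pos_not_in_closed[of B a] by simp
      then show ?thesis using that by (simp add: \<rho>_def)
    qed
    have posB: "\<rho> a > 0" if "a \<in> B" for a
    proof -
      have "a \<notin> A" using that AB by auto
      then have "infdist a A > 0" using AB infdist_pos_not_in_closed[of A a] by simp
      then show ?thesis using that by (simp add: \<rho>_def)
    qed
    \<comment> \<open>Large enough for the fibre itself and for the preimages of balls around
      \<open>z\<close> of radius at most 1 under the approximations.\<close>
    define R where "R = L * (2 + norm z)"
    have R: "R \<ge> 0" using L_ge_1 by (simp add: R_def)
    define Z where "Z = cball 0 R \<inter> {x. \<rho> x = 0}"
    have cZ: "compact Z"
      unfolding Z_def using continuous_closed_preimage_constant[OF \<rho>c closed_UNIV, of 0] by (intro compact_Int_closed) auto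
    obtain \<delta> where \<delta>: "\<delta> > 0" "\<And>x. x \<in> Z \<Longrightarrow> norm (flow t x - z) \<ge> \<delta>"
    proof (cases "Z = {}")
      case False
      have "continuous_on Z (\<lambda>x. norm (flow t x - z))" by (intro continuous_intros flow_continuous_x t)
      from continuous_attains_inf[OF cZ False this] obtain x0 where x0: "x0 \<in> Z" "\<And>x. x \<in> Z \<Longrightarrow> norm (flow t x0 - z) \<le> norm (flow t x - z)"
        by blast
      have "flow t x0 \<noteq> z"
      proof
        assume "flow t x0 = z"
        then have "x0 \<in> A \<union> B" using AB(5) by simp
        then show False using posA[of x0] posB[of x0] x0(1) by (auto simp: Z_def)
      qed
      then show ?thesis using that[of "norm (flow t x0 - z)"] x0(2) by simp
    qed (use that[of 1] in auto)
    \<comment> \<open>A point of the approximate preimage has flow image within \<open>2 * e\<close>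
      of \<open>z\<close>, which must be less than \<open>\<delta>\<close>.\<close>
    define e where "e = min (\<delta> / 3) 1"
    have e: "e > 0" "e \<le> 1" "3 * e \<le> \<delta>" using \<delta>(1) by (auto simp: e_def)
    obtain g where g: "\<And>x. x \<in> cball 0 R \<Longrightarrow> norm (g x - flow t x) < e"
      "\<And>S. connected S \<Longrightarrow> connected (g -` S)" "\<And>x. 1 + norm x \<le> L * (1 + norm (g x))"
      using flow_approximation_at[OF t R e(1)] by metis
    define S where "S = g -` cball z e"
    have conS: "connected S" unfolding S_def by (rule g(2)) simp
    have SR: "x \<in> cball 0 R" if "x \<in> S" for x
    proof -
      have "norm (g x) \<le> norm z + e" using that norm_triangle_sub[of "g x" z] by (simp add: S_def dist_norm norm_minus_commute)
      then have "1 + norm x \<le> L * (1 + (norm z + e))" using g(3)[of x] L_ge_1 by (smt (verit) mult_left_mono)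
      also have "\<dots> \<le> R" unfolding R_def using e(2) L_ge_1 by (intro mult_left_mono) auto
      finally show ?thesis by simp
    qed
    have FS: "x \<in> S" if "flow t x = z" for x
    proof -
      have "1 + norm x \<le> L * (1 + norm z)" using flow_proper[OF t, of x] that by simp
      also have "\<dots> \<le> R" unfolding R_def using L_ge_1 by (intro mult_left_mono) auto
      finally have "x \<in> cball 0 R" by simp
      then show ?thesis using g(1)[of x] that by (simp add: S_def dist_norm norm_minus_commute)
    qed
    obtain a c where ac: "a \<in> A" "c \<in> B" using AB(3,4) by blast
    then have "a \<in> S" "c \<in> S" using AB(5) by (auto intro!: FS)
    have "connected (\<rho> ` S)" by (intro connected_continuous_image \<rho>c conS)
    then have "0 \<in> \<rho> ` S"
      using connectedD_interval[of "\<rho> ` S" "\<rho> a" "\<rho> c" 0] \<open>a \<in> S\<close> \<open>c \<in> S\<close> posA[OF ac(1)] posB[OF ac(2)] by auto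
    then obtain x where x: "x \<in> S" "\<rho> x = 0" by auto
    then have "x \<in> Z" using SR by (simp add: Z_def)
    moreover have "norm (flow t x - z) \<le> e + e"
      using norm_triangle_ineq4[of "g x - z" "g x - flow t x"] g(1)[OF SR[OF x(1)]] x(1)
      by (simp add: S_def dist_norm norm_minus_commute)
    ultimately show False using \<delta>(2)[of x] e by simp
  qed
qed

end

section \<open>Inverting the flow almost everywhere\<close>

text \<open>Completeness of Lebesgue measure transfers measurability along equality almost
  everywhere, so nothing is assumed of \<open>f\<close> and \<open>g\<close>.\<close>

lemma lebesgue_integral_AE_cong:
  fixes f g :: "'a::euclidean_space \<Rightarrow> real"
  assumes "AE x in lebesgue. f x = g x"
  shows "integrable lebesgue f \<longleftrightarrow> integrable lebesgue g" "integral\<^sup>L lebesgue f = integral\<^sup>L lebesgue g"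
proof -
  have eq: "AE x in lebesgue. g x = f x" using assms by (auto elim: eventually_mono)
  have m: "f \<in> borel_measurable lebesgue \<longleftrightarrow> g \<in> borel_measurable lebesgue"
    using borel_measurable_AE[OF _ assms] borel_measurable_AE[OF _ eq] by blast
  show int: "integrable lebesgue f \<longleftrightarrow> integrable lebesgue g"
  proof (cases "f \<in> borel_measurable lebesgue")
    case True
    then show ?thesis using m integrable_cong_AE[OF True _ assms] by blast
  next
    case False
    then show ?thesis using m borel_measurable_integrable by blast
  qed
  show "integral\<^sup>L lebesgue f = integral\<^sup>L lebesgue g"
  proof (cases "f \<in> borel_measurable lebesgue")
    case True
    then show ?thesis using m integral_cong_AE[OF True _ assms] by blast
  next
    case False
    then have "\<not> integrable lebesgue f" using borel_measurable_integrable by blast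
    then show ?thesis using int by (simp add: not_integrable_integral_eq)
  qed
qed

lemma AE_lebesgue_not_in:
  "negligible N \<Longrightarrow> AE x in lebesgue. x \<notin> N"
  by (rule AE_I'[of N]) (auto simp: negligible_iff_null_sets)

lemma negligible_of_AE_lebesgue:
  assumes "AE x in lebesgue. P x" obtains N where "negligible N" "\<And>x. x \<notin> N \<Longrightarrow> P x"
proof -
  obtain N where "{x \<in> space lebesgue. \<not> P x} \<subseteq> N" "N \<in> null_sets lebesgue"
    using assms unfolding eventually_ae_filter by blast
  then show thesis using that[of N] by (auto simp: negligible_iff_null_sets)
qed

lemma abs_det_le:
  fixes A :: "real ^ 'n ^ 'n"
  assumes "\<And>i j. \<bar>A $ i $ j\<bar> \<le> K"
  shows "\<bar>det A\<bar> \<le> fact CARD('n) * K ^ CARD('n)"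
proof -
  have "\<bar>det A\<bar> \<le> (\<Sum>p\<in>{p. p permutes (UNIV :: 'n set)}. \<bar>of_int (sign p) * (\<Prod>i\<in>UNIV. A $ i $ p i)\<bar>)"
    unfolding det_def by (rule sum_abs)
  also have "\<dots> \<le> (\<Sum>p\<in>{p. p permutes (UNIV :: 'n set)}. K ^ CARD('n))"
  proof (rule sum_mono)
    fix p :: "'n \<Rightarrow> 'n"
    have "(\<Prod>i\<in>UNIV. \<bar>A $ i $ p i\<bar>) \<le> (\<Prod>i\<in>(UNIV :: 'n set). K)" by (rule prod_mono) (auto simp: assms)
    then show "\<bar>of_int (sign p) * (\<Prod>i\<in>UNIV. A $ i $ p i)\<bar> \<le> K ^ CARD('n)"
      by (simp add: abs_mult abs_prod sign_def)
  qed
  also have "\<dots> = fact CARD('n) * K ^ CARD('n)" by (simp add: card_permutations[OF refl])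
  finally show ?thesis .
qed

lemma jacobian_entry_limit:
  fixes f :: "real ^ 'n \<Rightarrow> real ^ 'n"
  assumes "f differentiable (at x)"
  shows "(\<lambda>k. (f (x + inverse (real (Suc k)) *\<^sub>R axis j 1) - f x) $ i / inverse (real (Suc k))) \<longlonglongrightarrow> jacobian f (at x) $ i $ j"
proof -
  let ?v = "axis j 1 :: real ^ 'n"
  have "(f has_derivative (\<lambda>h. jacobian f (at x) *v h)) (at (x + 0 *\<^sub>R ?v))" using assms by (simp add: jacobian_works)
  moreover have "((\<lambda>s. x + s *\<^sub>R ?v) has_derivative (\<lambda>s. s *\<^sub>R ?v)) (at 0)" by (auto intro!: derivative_eq_intros)
  ultimately have "((\<lambda>s. f (x + s *\<^sub>R ?v)) has_derivative (\<lambda>s. jacobian f (at x) *v (s *\<^sub>R ?v))) (at 0)"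
    using has_derivative_compose[of "\<lambda>s. x + s *\<^sub>R ?v" "\<lambda>s. s *\<^sub>R ?v" 0 UNIV f] by simp
  from bounded_linear.has_derivative[OF bounded_linear_vec_nth this]
  have "((\<lambda>s. f (x + s *\<^sub>R ?v) $ i) has_derivative (\<lambda>s. (jacobian f (at x) *v (s *\<^sub>R ?v)) $ i)) (at 0)" .
  moreover have "(\<lambda>s. (jacobian f (at x) *v (s *\<^sub>R ?v)) $ i) = (\<lambda>s. jacobian f (at x) $ i $ j * s)"
    by (simp add: fun_eq_iff matrix_vector_mult_scaleR matrix_vector_mult_basis column_def)
  ultimately have "((\<lambda>s. f (x + s *\<^sub>R ?v) $ i) has_field_derivative jacobian f (at x) $ i $ j) (at 0)"
    by (simp add: has_field_derivative_def)
  then have "((\<lambda>h. (f (x + h *\<^sub>R ?v) $ i - f x $ i) / h) \<longlongrightarrow> jacobian f (at x) $ i $ j) (at 0)"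
    by (simp add: DERIV_def)
  moreover have "filterlim (\<lambda>k. inverse (real (Suc k))) (at 0) sequentially"
    using LIMSEQ_inverse_real_of_nat by (auto simp: filterlim_at)
  ultimately have "((\<lambda>k. (f (x + inverse (real (Suc k)) *\<^sub>R ?v) $ i - f x $ i) / inverse (real (Suc k))) \<longlongrightarrow> jacobian f (at x) $ i $ j) sequentially"
    by (rule filterlim_compose)
  then show ?thesis by simp
qed

lemma jacobian_entry_le:
  fixes f :: "real ^ 'n \<Rightarrow> real ^ 'n"
  assumes "f differentiable (at x)" and lip: "\<And>x y. norm (f x - f y) \<le> K * norm (x - y)"
  shows "\<bar>jacobian f (at x) $ i $ j\<bar> \<le> K"
proof (rule LIMSEQ_le_const2)
  show "(\<lambda>k. \<bar>(f (x + inverse (real (Suc k)) *\<^sub>R axis j 1) - f x) $ i / inverse (real (Suc k))\<bar>) \<longlonglongrightarrow> \<bar>jacobian f (at x) $ i $ j\<bar>"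
    by (intro tendsto_intros jacobian_entry_limit assms)
  have "\<bar>(f (x + inverse (real (Suc k)) *\<^sub>R axis j 1) - f x) $ i / inverse (real (Suc k))\<bar> \<le> K" for k
  proof -
    have "\<bar>(f (x + inverse (real (Suc k)) *\<^sub>R axis j 1) - f x) $ i\<bar> \<le> norm (f (x + inverse (real (Suc k)) *\<^sub>R axis j 1) - f x)"
      by (rule component_le_norm_cart)
    also have "\<dots> \<le> K * inverse (real (Suc k))" using lip[of "x + inverse (real (Suc k)) *\<^sub>R axis j 1" x] by simp
    finally have le: "\<bar>(f (x + inverse (real (Suc k)) *\<^sub>R axis j 1) - f x) $ i\<bar> \<le> K * inverse (real (Suc k))" .
    have "\<bar>a / h\<bar> \<le> K" if "\<bar>a\<bar> \<le> K * h" "h > 0" for a h :: real using that by (simp add: abs_divide pos_divide_le_eq)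
    from this[OF le] show ?thesis by simp
  qed
  then show "\<exists>N. \<forall>k\<ge>N. \<bar>(f (x + inverse (real (Suc k)) *\<^sub>R axis j 1) - f x) $ i / inverse (real (Suc k))\<bar> \<le> K" by blast
qed

text \<open>The entries of the Jacobian are pointwise limits of continuous difference
  quotients.\<close>

lemma det_jacobian_measurable:
  fixes f :: "real ^ 'n \<Rightarrow> real ^ 'n"
  assumes f: "continuous_on UNIV f" and D: "D \<in> sets lebesgue" "\<And>x. x \<in> D \<Longrightarrow> f differentiable (at x)"
  shows "(\<lambda>x. det (jacobian f (at x))) \<in> borel_measurable (lebesgue_on D)"
proof -
  have "(\<lambda>x. jacobian f (at x) $ i $ j) \<in> borel_measurable (lebesgue_on D)" for i j
  proof (rule borel_measurable_LIMSEQ_real)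
    show "(\<lambda>k. (f (x + inverse (real (Suc k)) *\<^sub>R axis j 1) - f x) $ i / inverse (real (Suc k))) \<longlonglongrightarrow> jacobian f (at x) $ i $ j"
      if "x \<in> space (lebesgue_on D)" for x
      by (rule jacobian_entry_limit) (use that D(2) in \<open>simp add: space_restrict_space\<close>)
    fix k
    have "continuous_on UNIV (\<lambda>x. (f (x + inverse (real (Suc k)) *\<^sub>R axis j 1) - f x) $ i / inverse (real (Suc k)))"
      by (intro continuous_intros continuous_on_compose2[OF f]) auto
    then show "(\<lambda>x. (f (x + inverse (real (Suc k)) *\<^sub>R axis j 1) - f x) $ i / inverse (real (Suc k))) \<in> borel_measurable (lebesgue_on D)"
      by (intro continuous_imp_measurable_on_sets_lebesgue[OF _ D(1)]) (auto intro: continuous_on_subset)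
  qed
  then show ?thesis unfolding det_def by (intro borel_measurable_sum borel_measurable_times borel_measurable_prod borel_measurable_const)
qed

section \<open>A backward flow and its almost everywhere defined inverse\<close>

locale backward_flow =
  fixes T L :: real and \<Phi> :: "real \<Rightarrow> real ^ 'n \<Rightarrow> real ^ 'n"
  assumes T_pos: "T > 0" and L_ge_1: "L \<ge> 1"
    and cont: "continuous_on ({0..T} \<times> UNIV) (\<lambda>(t, x). \<Phi> t x)"
    and top: "\<And>x. \<Phi> T x = x"
    and lip: "\<And>s t x x'. s \<in> {0..T} \<Longrightarrow> t \<in> {0..T} \<Longrightarrow> s \<le> t \<Longrightarrow> norm (\<Phi> s x - \<Phi> s x') \<le> L * norm (\<Phi> t x - \<Phi> t x')"
    and growth: "\<And>t x. t \<in> {0..T} \<Longrightarrow> 1 + norm (\<Phi> t x) \<le> L * (1 + norm x)"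
    and proper: "\<And>t x. t \<in> {0..T} \<Longrightarrow> 1 + norm x \<le> L * (1 + norm (\<Phi> t x))"
    and surj: "\<And>t z. t \<in> {0..T} \<Longrightarrow> \<exists>x. \<Phi> t x = z"
    and connected_fibre: "\<And>t z. t \<in> {0..T} \<Longrightarrow> connected {x. \<Phi> t x = z}"
begin

definition J :: "real \<Rightarrow> real ^ 'n \<Rightarrow> real" where "J t x = det (jacobian (\<Phi> t) (at x))"

definition regular :: "real \<Rightarrow> (real ^ 'n) set" where
  "regular t = {x. \<Phi> t differentiable (at x) \<and> J t x \<noteq> 0}"

text \<open>An arbitrary choice of preimages. Only off \<open>crit t\<close> is it forced, and no
  measurability of \<open>\<psi> t\<close> is built in.\<close>

definition \<psi> :: "real \<Rightarrow> real ^ 'n \<Rightarrow> real ^ 'n" where "\<psi> t = inv_into UNIV (\<Phi> t)"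

definition crit :: "real \<Rightarrow> (real ^ 'n) set" where "crit t = \<Phi> t ` (- regular t)"

context
  fixes t :: real
  assumes t: "t \<in> {0..T}"
begin

lemma lip': "norm (\<Phi> t x - \<Phi> t x') \<le> L * norm (x - x')"
  using lip[OF t _ _, of T x x'] t top by simp

lemma \<Phi>_continuous: "continuous_on S (\<Phi> t)"
  by (rule lipschitz_on_continuous_on[of L]) (use lip' L_ge_1 in \<open>auto simp: lipschitz_on_def dist_norm\<close>)

lemma \<Phi>_\<psi> [simp]: "\<Phi> t (\<psi> t z) = z"
  unfolding \<psi>_def by (rule f_inv_into_f) (use surj[OF t, of z] in auto)

lemma derivative_bounds:
  assumes x: "x \<in> regular t"
  obtains d B where "d > 0" "B > 0" "\<And>h. B * norm h \<le> norm (jacobian (\<Phi> t) (at x) *v h)"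
    "\<And>y. norm (y - x) < d \<Longrightarrow> norm (\<Phi> t y - \<Phi> t x - jacobian (\<Phi> t) (at x) *v (y - x)) \<le> B / 2 * norm (y - x)"
proof -
  let ?A = "jacobian (\<Phi> t) (at x)"
  have der: "(\<Phi> t has_derivative (\<lambda>h. ?A *v h)) (at x)" using x by (simp add: regular_def jacobian_works)
  have "inj ((*v) ?A)" using x by (simp add: regular_def J_def inj_matrix_vector_mult invertible_det_nz)
  then obtain B where B: "B > 0" "\<And>h. B * norm h \<le> norm (?A *v h)"
    using linear_inj_bounded_below_pos[OF matrix_vector_mul_linear] by blast
  obtain d where "d > 0" "\<And>y. norm (y - x) < d \<Longrightarrow> norm (\<Phi> t y - \<Phi> t x - ?A *v (y - x)) \<le> B / 2 * norm (y - x)"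
    using der B(1) unfolding has_derivative_at_alt by (meson half_gt_zero)
  then show thesis using that B by blast
qed

text \<open>A regular point is isolated in its fibre, which is connected.\<close>

lemma fibre_regular:
  assumes x: "x \<in> regular t" and y: "\<Phi> t y = \<Phi> t x"
  shows "y = x"
proof -
  let ?F = "{y. \<Phi> t y = \<Phi> t x}"
  obtain d B where d: "d > 0" "B > 0" "\<And>h. B * norm h \<le> norm (jacobian (\<Phi> t) (at x) *v h)"
    "\<And>y. norm (y - x) < d \<Longrightarrow> norm (\<Phi> t y - \<Phi> t x - jacobian (\<Phi> t) (at x) *v (y - x)) \<le> B / 2 * norm (y - x)"
    using derivative_bounds[OF x] by blast
  have iso: "z = x" if "\<Phi> t z = \<Phi> t x" "norm (z - x) < d" for z
  proof -
    have "B * norm (z - x) \<le> B / 2 * norm (z - x)" using d(3)[of "z - x"] d(4)[OF that(2)] that(1) by simp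
    then have "norm (z - x) \<le> 0" using d(2) by (simp add: mult_le_cancel_right)
    then show ?thesis by simp
  qed
  have "{x} = ?F \<inter> ball x d" using iso d(1) by (auto simp: dist_norm norm_minus_commute)
  then have "openin (top_of_set ?F) {x}" unfolding openin_open using open_ball by blast
  moreover have "closedin (top_of_set ?F) {x}" by (rule closed_subset) auto
  ultimately have "{x} = ?F" using connected_fibre[OF t, of "\<Phi> t x"] unfolding connected_clopen by blast
  then show ?thesis using y by blast
qed

text \<open>Rescaled increments of the flow on a small sphere are deformed in two stages: the time
  first runs from \<open>T\<close>, where the increment is the identity, down to \<open>t\<close>,
  and then the increment at time \<open>t\<close> is interpolated linearly with the derivative. A
  zero in the first stage would force \<open>\<Phi> t\<close> to identify \<open>x\<close> with
  another point; in the second stage the derivative dominates the error.\<close>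

lemma J_pos:
  assumes x: "x \<in> regular t" shows "J t x > 0"
proof -
  let ?A = "jacobian (\<Phi> t) (at x)"
  obtain d B where d: "d > 0" "B > 0" "\<And>h. B * norm h \<le> norm (?A *v h)"
    "\<And>y. norm (y - x) < d \<Longrightarrow> norm (\<Phi> t y - \<Phi> t x - ?A *v (y - x)) \<le> B / 2 * norm (y - x)"
    using derivative_bounds[OF x] by blast
  define r where "r = d / 2"
  have r: "r > 0" "r < d" using d(1) by (auto simp: r_def)
  define q where "q = (\<lambda>s v. (\<Phi> s (x + r *\<^sub>R v) - \<Phi> s x) /\<^sub>R r)"
  \<comment> \<open>Time \<open>T\<close> at \<open>u = 0\<close>, time \<open>t\<close> from
    \<open>u = 1 / 2\<close> on; the interpolation coefficient in \<open>H\<close> is positive only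
    after that.\<close>
  define \<sigma> where "\<sigma> = (\<lambda>u. max t (T - 2 * u * (T - t)))"
  define H where "H = (\<lambda>u v. q (\<sigma> u) v + max 0 (2 * u - 1) *\<^sub>R (?A *v v - q t v))"
  have \<sigma>: "\<sigma> u \<in> {t..T}" if "u \<in> {0..1}" for u using t that by (auto simp: \<sigma>_def intro!: mult_nonneg_nonneg)
  have near: "norm (q t v - ?A *v v) \<le> B / 2" if v: "norm v = 1" for v
  proof -
    have "norm (\<Phi> t (x + r *\<^sub>R v) - \<Phi> t x - r *\<^sub>R (?A *v v)) \<le> B / 2 * r"
      using d(4)[of "x + r *\<^sub>R v"] r v by (simp add: matrix_vector_mult_scaleR)
    moreover have "q t v - ?A *v v = (\<Phi> t (x + r *\<^sub>R v) - \<Phi> t x - r *\<^sub>R (?A *v v)) /\<^sub>R r"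
      using r by (simp add: q_def scaleR_right_diff_distrib)
    moreover have "norm (X /\<^sub>R r) \<le> B / 2" if "norm X \<le> B / 2 * r" for X :: "real ^ 'n"
    proof -
      have "norm (X /\<^sub>R r) = norm X / r" using r by (simp add: divide_inverse mult.commute)
      then show ?thesis using that r by (simp only: pos_divide_le_eq)
    qed
    ultimately show ?thesis by simp
  qed
  have "det ?A > 0"
  proof (rule det_pos_of_homotopic_id[of H])
    have c: "continuous_on ({0..1} \<times> sphere 0 1) (\<lambda>z. \<Phi> (\<sigma> (fst z)) (f z))" if "continuous_on ({0..1} \<times> sphere 0 1) f" for f :: "real \<times> (real ^ 'n) \<Rightarrow> real ^ 'n"
    proof -
      have "continuous_on ({0..1} \<times> sphere 0 1) (\<lambda>z. (\<sigma> (fst z), f z))" unfolding \<sigma>_def by (intro continuous_intros that)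
      from continuous_on_compose2[OF cont this] show ?thesis using \<sigma> t by (force simp: image_subset_iff)
    qed
    show "continuous_on ({0..1} \<times> sphere 0 1) (\<lambda>(u, v). H u v)"
      unfolding H_def q_def case_prod_unfold
      by (intro continuous_intros c continuous_on_compose2[OF \<Phi>_continuous[of UNIV]] linear_continuous_on_compose[OF _ matrix_vector_mul_linear]) auto
    show "H u v \<noteq> 0" if u: "u \<in> {0..1}" and v: "norm v = 1" for u v
    proof (cases "u \<le> 1 / 2")
      case True
      have "r *\<^sub>R v \<noteq> 0" using r v by auto
      then have "\<Phi> t (x + r *\<^sub>R v) \<noteq> \<Phi> t x" using fibre_regular[OF x, of "x + r *\<^sub>R v"] by auto
      then have "\<Phi> (\<sigma> u) (x + r *\<^sub>R v) \<noteq> \<Phi> (\<sigma> u) x"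
        using lip[OF t, of "\<sigma> u" "x + r *\<^sub>R v" x] \<sigma>[OF u] t by auto
      then show ?thesis using True r by (simp add: H_def q_def)
    next
      case False
      have "T - 2 * u * (T - t) \<le> t"
      proof -
        have "1 * (T - t) \<le> 2 * u * (T - t)" using False t by (intro mult_right_mono) auto
        then show ?thesis by simp
      qed
      then have "H u v = q t v + (2 * u - 1) *\<^sub>R (?A *v v - q t v)"
        using False by (simp add: H_def \<sigma>_def max_absorb1 max_absorb2)
      moreover have "p + c *\<^sub>R (a - p) = a + (1 - c) *\<^sub>R (p - a)" for p a :: "real ^ 'n" and c
        by (simp add: algebra_simps)
      ultimately have "H u v = ?A *v v + (2 - 2 * u) *\<^sub>R (q t v - ?A *v v)" by (metis diff_diff_eq2 one_add_one)
      moreover have "norm ((2 - 2 * u) *\<^sub>R (q t v - ?A *v v)) \<le> 1 * (B / 2)"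
        using False u near[OF v] unfolding norm_scaleR by (intro mult_mono) auto
      moreover have "norm (?A *v v) \<ge> B" using d(3)[of v] v by simp
      ultimately show ?thesis using d(2) by (smt (verit) field_sum_of_halves norm_minus_cancel add_eq_0_iff)
    qed
    show "H 0 = (\<lambda>v. v)" using r t by (auto simp: H_def q_def \<sigma>_def top fun_eq_iff)
    show "H 1 = (*v) ?A" using t by (auto simp: H_def q_def \<sigma>_def fun_eq_iff max_def)
    show "det ?A \<noteq> 0" using x by (simp add: regular_def J_def)
  qed
  then show ?thesis by (simp add: J_def)
qed

lemma null_image: "negligible M \<Longrightarrow> negligible (\<Phi> t ` M)"
  by (rule negligible_locally_Lipschitz_image) (use lip' in blast)+

lemma not_differentiable_null: "negligible {x. \<not> \<Phi> t differentiable (at x)}"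
proof -
  obtain N where "negligible N" "\<And>x. x \<notin> N \<Longrightarrow> \<Phi> t differentiable (at x)" using Rademacher[OF lip'] by blast
  then show ?thesis by (auto intro: negligible_subset[of N])
qed

lemma crit_null: "negligible (crit t)"
proof -
  let ?Z = "{x. \<Phi> t differentiable (at x) \<and> J t x = 0}"
  have "negligible (\<Phi> t ` ?Z)"
  proof (rule Sard[where f'="\<lambda>x h. jacobian (\<Phi> t) (at x) *v h"])
    fix x assume "x \<in> ?Z"
    then show "(\<Phi> t has_derivative (\<lambda>h. jacobian (\<Phi> t) (at x) *v h)) (at x)" "det (matrix (\<lambda>h. jacobian (\<Phi> t) (at x) *v h)) = 0"
      by (auto simp: jacobian_works J_def)
  qed
  moreover have "negligible (\<Phi> t ` {x. \<not> \<Phi> t differentiable (at x)})" by (rule null_image[OF not_differentiable_null])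
  moreover have "crit t = \<Phi> t ` ?Z \<union> \<Phi> t ` {x. \<not> \<Phi> t differentiable (at x)}" by (auto simp: crit_def regular_def)
  ultimately show ?thesis by simp
qed

lemma \<psi>_regular: "z \<notin> crit t \<Longrightarrow> \<psi> t z \<in> regular t"
  using \<Phi>_\<psi>[of z] unfolding crit_def by (metis ComplI imageI)

lemma \<psi>_unique: "z \<notin> crit t \<Longrightarrow> \<Phi> t x = z \<Longrightarrow> x = \<psi> t z"
  using fibre_regular[OF \<psi>_regular, of z x] by simp

lemma AE_not_crit: "AE z in lebesgue. z \<notin> crit t" by (rule AE_lebesgue_not_in[OF crit_null])

text \<open>If \<open>\<psi> t z\<close> lies in a null set, then \<open>z\<close> lies in its image
  under \<open>\<Phi> t\<close>, which is null because \<open>\<Phi> t\<close> is Lipschitz.\<close>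

lemma AE_\<psi>:
  assumes "AE x in lebesgue. Q x" shows "AE z in lebesgue. Q (\<psi> t z)"
proof -
  obtain N where N: "negligible N" "\<And>x. x \<notin> N \<Longrightarrow> Q x" using negligible_of_AE_lebesgue[OF assms] by blast
  have "AE z in lebesgue. z \<notin> \<Phi> t ` N" by (rule AE_lebesgue_not_in[OF null_image[OF N(1)]])
  then show ?thesis by eventually_elim (use N(2) \<Phi>_\<psi> in \<open>metis imageI\<close>)
qed

lemma differentiable_sets: "{x. \<Phi> t differentiable (at x)} \<in> sets lebesgue"
proof -
  have "space lebesgue - {x. \<not> \<Phi> t differentiable (at x)} \<in> sets lebesgue"
    by (intro sets.compl_sets negligible_imp_sets not_differentiable_null)
  moreover have "space lebesgue - {x. \<not> \<Phi> t differentiable (at x)} = {x. \<Phi> t differentiable (at x)}" by auto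
  ultimately show ?thesis by simp
qed

lemma J_measurable_on: "J t \<in> borel_measurable (lebesgue_on {x. \<Phi> t differentiable (at x)})"
  unfolding J_def[abs_def] by (rule det_jacobian_measurable[OF \<Phi>_continuous differentiable_sets]) simp

lemma J_measurable: "J t \<in> borel_measurable lebesgue"
proof -
  have "(\<lambda>x. if x \<in> {x. \<Phi> t differentiable (at x)} then J t x else 0) \<in> borel_measurable lebesgue"
    by (rule borel_measurable_if_I[OF J_measurable_on differentiable_sets])
  moreover have "AE x in lebesgue. (if x \<in> {x. \<Phi> t differentiable (at x)} then J t x else 0) = J t x"
    using AE_lebesgue_not_in[OF not_differentiable_null] by eventually_elim auto
  ultimately show ?thesis by (rule borel_measurable_AE)
qed

lemma regular_sets: "regular t \<in> sets lebesgue"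
proof -
  have "{x \<in> space lebesgue. J t x \<noteq> 0} \<in> sets lebesgue" using J_measurable by measurable
  then have "{x. \<Phi> t differentiable (at x)} \<inter> {x. J t x \<noteq> 0} \<in> sets lebesgue"
    by (intro sets.Int differentiable_sets) simp
  then show ?thesis by (simp add: regular_def Collect_conj_eq)
qed

lemma AE_regular: "AE x in lebesgue. x \<notin> regular t \<longrightarrow> J t x = 0"
  using AE_lebesgue_not_in[OF not_differentiable_null] by eventually_elim (auto simp: regular_def)

lemma J_bound: "AE x in lebesgue. 0 \<le> J t x \<and> J t x \<le> fact CARD('n) * L ^ CARD('n)"
  using AE_lebesgue_not_in[OF not_differentiable_null]
proof eventually_elim
  case (elim x)
  then have d: "\<Phi> t differentiable (at x)" by simp
  have "\<bar>J t x\<bar> \<le> fact CARD('n) * L ^ CARD('n)"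
    unfolding J_def by (rule abs_det_le) (rule jacobian_entry_le[OF d lip'])
  moreover have "J t x \<ge> 0" using J_pos[of x] d by (cases "J t x = 0") (auto simp: regular_def)
  ultimately show ?case by simp
qed

text \<open>On the regular set the map is injective with positive Jacobian, so the area formula
  needs no absolute value. The rest is invisible: \<open>J t\<close> vanishes almost everywhere off
  the regular set, whose image has null complement. Nothing is assumed of \<open>w\<close> and
  \<open>f\<close>, so the identity can be used with \<open>\<beta> \<circ> w\<close> as it
  stands.\<close>

lemma flow_change_of_variables:
  fixes w f :: "real ^ 'n \<Rightarrow> real"
  shows "integrable lebesgue (\<lambda>x. w x * (f (\<Phi> t x) * J t x)) \<longleftrightarrow> integrable lebesgue (\<lambda>z. w (\<psi> t z) * f z)"
    and "(LINT x|lebesgue. w x * (f (\<Phi> t x) * J t x)) = (LINT z|lebesgue. w (\<psi> t z) * f z)"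
proof -
  have der: "(\<Phi> t has_derivative (\<lambda>h. jacobian (\<Phi> t) (at x) *v h)) (at x)" if "x \<in> regular t" for x
    using that by (simp add: regular_def jacobian_works)
  have inj: "inj_on (\<Phi> t) (regular t)" by (rule inj_onI) (metis fibre_regular)
  note cv = change_of_variables[OF regular_sets der inj, of "\<lambda>z. w (\<psi> t z) * f z"]
  have \<psi>: "\<psi> t (\<Phi> t x) = x" if "x \<in> regular t" for x using fibre_regular[OF that] \<Phi>_\<psi> by blast
  have 1: "AE x in lebesgue. indicator (regular t) x * (\<bar>det (matrix (\<lambda>h. jacobian (\<Phi> t) (at x) *v h))\<bar> * (w (\<psi> t (\<Phi> t x)) * f (\<Phi> t x))) = w x * (f (\<Phi> t x) * J t x)"
    using AE_regular
  proof eventually_elim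
    case (elim x)
    then show ?case using J_pos[of x] \<psi>[of x] by (cases "x \<in> regular t") (auto simp: J_def)
  qed
  have 2: "AE z in lebesgue. indicator (\<Phi> t ` regular t) z * (w (\<psi> t z) * f z) = w (\<psi> t z) * f z"
    using AE_not_crit
  proof eventually_elim
    case (elim z)
    then have "z \<in> \<Phi> t ` regular t" using \<psi>_regular[of z] \<Phi>_\<psi>[of z] by (metis imageI)
    then show ?case by simp
  qed
  show "integrable lebesgue (\<lambda>x. w x * (f (\<Phi> t x) * J t x)) \<longleftrightarrow> integrable lebesgue (\<lambda>z. w (\<psi> t z) * f z)"
    using cv(1) lebesgue_integral_AE_cong(1)[OF 1] lebesgue_integral_AE_cong(1)[OF 2] by simp
  show "(LINT x|lebesgue. w x * (f (\<Phi> t x) * J t x)) = (LINT z|lebesgue. w (\<psi> t z) * f z)"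
    using cv(2) lebesgue_integral_AE_cong(2)[OF 1] lebesgue_integral_AE_cong(2)[OF 2] by simp
qed

end

end

section \<open>Weak continuity\<close>

lemma continuous_on_uniform_approximation:
  fixes F :: "real \<Rightarrow> real"
  assumes "\<And>e. e > 0 \<Longrightarrow> \<exists>h. continuous_on S h \<and> (\<forall>t\<in>S. \<bar>F t - h t\<bar> \<le> e)"
  shows "continuous_on S F"
  unfolding continuous_on_iff
proof (intro ballI allI impI)
  fix t e :: real assume t: "t \<in> S" and e: "e > 0"
  have "e / 3 > 0" using e by simp
  from assms[OF \<open>e / 3 > 0\<close>] obtain h where h: "continuous_on S h" "\<And>t. t \<in> S \<Longrightarrow> \<bar>F t - h t\<bar> \<le> e / 3" by blast
  obtain d where d: "d > 0" "\<And>s. s \<in> S \<Longrightarrow> dist s t < d \<Longrightarrow> dist (h s) (h t) < e / 3"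
    using h(1)[unfolded continuous_on_iff, rule_format, OF t \<open>e / 3 > 0\<close>] by blast
  have "dist (F s) (F t) < e" if "s \<in> S" "dist s t < d" for s
    using d(2)[OF that] h(2)[OF that(1)] h(2)[OF t] unfolding dist_real_def by linarith
  then show "\<exists>d>0. \<forall>s\<in>S. dist s t < d \<longrightarrow> dist (F s) (F t) < e" using d(1) by blast
qed

lemma continuous_imp_lebesgue_measurable:
  fixes w :: "'a::euclidean_space \<Rightarrow> real"
  assumes "continuous_on UNIV w" shows "w \<in> borel_measurable lebesgue"
  by (rule measurable_completion) (use borel_measurable_continuous_onI[OF assms] in simp)

lemma lebesgue_limit_of_continuous:
  fixes w :: "'a::euclidean_space \<Rightarrow> real"
  assumes "w \<in> borel_measurable lebesgue"
  obtains W where "\<And>k::nat. continuous_on UNIV (W k)" "AE x in lebesgue. (\<lambda>k. W k x) \<longlonglongrightarrow> w x"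
proof -
  have "w measurable_on UNIV" by (rule lebesgue_measurable_imp_measurable_on_real[OF assms]) simp
  then obtain N W where W: "negligible N" "\<And>k::nat. continuous_on UNIV (W k)" "\<And>x. x \<notin> N \<Longrightarrow> (\<lambda>k. W k x) \<longlonglongrightarrow> w x"
    unfolding measurable_on_def by auto
  have "AE x in lebesgue. (\<lambda>k. W k x) \<longlonglongrightarrow> w x"
    using AE_lebesgue_not_in[OF W(1)] by eventually_elim (rule W(3))
  then show thesis using that W(2) by blast
qed

lemma integrable_indicator_compact:
  fixes K :: "'a::euclidean_space set" and w :: "'a \<Rightarrow> real"
  assumes K: "compact K" and w: "w \<in> borel_measurable lebesgue" and B: "AE x in lebesgue. x \<in> K \<longrightarrow> \<bar>w x\<bar> \<le> B"
  shows "integrable lebesgue (\<lambda>x. indicator K x * w x)"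
proof (rule Bochner_Integration.integrable_bound)
  have K': "K \<in> sets lebesgue" "emeasure lebesgue K < \<infinity>"
    using lmeasurable_compact[OF K] by (auto simp: fmeasurable_def)
  then show "integrable lebesgue (\<lambda>x. indicator K x * B)"
    by (intro integrable_mult_left) (simp add: integrable_indicator_iff)
  show "(\<lambda>x. indicator K x * w x) \<in> borel_measurable lebesgue" using K'(1) w by simp
  show "AE x in lebesgue. norm (indicator K x * w x) \<le> norm (indicator K x * B)"
    using B by eventually_elim (auto simp: indicator_def)
qed

section \<open>Composition with the inverse flow\<close>

context backward_flow
begin

definition cJ :: real where "cJ = fact CARD('n) * L ^ CARD('n)"

lemma cJ_pos: "cJ > 0" using L_ge_1 by (simp add: cJ_def)

text \<open>A ball containing the preimages of \<open>cball 0 r\<close> under the flow at all times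
  simultaneously.\<close>

abbreviation W :: "real \<Rightarrow> (real ^ 'n) set" where "W r \<equiv> cball 0 (L * (1 + r))"

lemma preimage_bound:
  assumes "t \<in> {0..T}" "\<Phi> t x \<in> cball 0 r" shows "x \<in> W r"
proof -
  have "1 + norm x \<le> L * (1 + norm (\<Phi> t x))" by (rule proper[OF assms(1)])
  also have "\<dots> \<le> L * (1 + r)" using assms(2) L_ge_1 by (intro mult_left_mono) auto
  finally show ?thesis by simp
qed

lemma \<psi>_bound: "t \<in> {0..T} \<Longrightarrow> z \<in> cball 0 r \<Longrightarrow> \<psi> t z \<in> W r"
  by (rule preimage_bound) auto

context
  fixes t :: real
  assumes t: "t \<in> {0..T}"
begin

lemma indicator_\<Phi>_measurable: "(\<lambda>x. indicator (cball 0 r) (\<Phi> t x) :: real) \<in> borel_measurable lebesgue"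
proof -
  have "closed (\<Phi> t -` cball 0 r)" using continuous_closed_vimage[of "cball 0 r" "\<Phi> t"] \<Phi>_continuous[OF t, of UNIV] by (simp add: continuous_on_eq_continuous_at)
  then have "\<Phi> t -` cball 0 r \<in> sets lebesgue" by (auto intro: borel_closed)
  then have "(indicator (\<Phi> t -` cball 0 r) :: _ \<Rightarrow> real) \<in> borel_measurable lebesgue" by simp
  moreover have "(\<lambda>x. indicator (cball 0 r) (\<Phi> t x) :: real) = indicator (\<Phi> t -` cball 0 r)"
    by (auto simp: indicator_def fun_eq_iff)
  ultimately show ?thesis by simp
qed

text \<open>The change of variables with the indicator of a ball in place of \<open>f\<close>: the
  Jacobian is at most \<open>cJ\<close>, and only the values of \<open>w\<close> on
  \<open>W r\<close> enter.\<close>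

lemma composition_integrable:
  fixes w :: "real ^ 'n \<Rightarrow> real"
  assumes w: "integrable lebesgue (\<lambda>x. indicator (W r) x * w x)"
  shows "integrable lebesgue (\<lambda>z. w (\<psi> t z) * indicator (cball 0 r) z)"
    and "(LINT z|lebesgue. \<bar>w (\<psi> t z)\<bar> * indicator (cball 0 r) z) \<le> cJ * (LINT x|lebesgue. indicator (W r) x * \<bar>w x\<bar>)"
proof -
  let ?i = "indicator (cball 0 r) :: real ^ 'n \<Rightarrow> real"
  have eq: "v x * (?i (\<Phi> t x) * J t x) = (indicator (W r) x * v x) * (?i (\<Phi> t x) * J t x)" for x and v :: "real ^ 'n \<Rightarrow> real"
    using preimage_bound[OF t, of x r] by (auto simp: indicator_def)
  have bd: "AE x in lebesgue. \<bar>v x * (?i (\<Phi> t x) * J t x)\<bar> \<le> cJ * (indicator (W r) x * \<bar>v x\<bar>)" for v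
    using J_bound[OF t]
  proof eventually_elim
    case (elim x)
    have "\<bar>?i (\<Phi> t x) * J t x\<bar> \<le> cJ" using elim cJ_pos by (auto simp: indicator_def cJ_def)
    then have "\<bar>indicator (W r) x * v x\<bar> * \<bar>?i (\<Phi> t x) * J t x\<bar> \<le> \<bar>indicator (W r) x * v x\<bar> * cJ" by (rule mult_left_mono) simp
    then show ?case unfolding eq[of v x] by (simp add: abs_mult mult.commute)
  qed
  have int: "integrable lebesgue (\<lambda>x. v x * (?i (\<Phi> t x) * J t x))" if v: "integrable lebesgue (\<lambda>x. indicator (W r) x * v x)" for v
  proof (rule Bochner_Integration.integrable_bound)
    show "integrable lebesgue (\<lambda>x. cJ * (indicator (W r) x * v x))" using v by simp
    show "(\<lambda>x. v x * (?i (\<Phi> t x) * J t x)) \<in> borel_measurable lebesgue"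
      unfolding eq[of v] by (intro borel_measurable_times borel_measurable_integrable[OF v] indicator_\<Phi>_measurable J_measurable t)
    show "AE x in lebesgue. norm (v x * (?i (\<Phi> t x) * J t x)) \<le> norm (cJ * (indicator (W r) x * v x))"
      using bd[of v] cJ_pos by (simp add: abs_mult)
  qed
  show "integrable lebesgue (\<lambda>z. w (\<psi> t z) * ?i z)"
    using int[OF w] flow_change_of_variables(1)[OF t, of w ?i] by simp
  have aw: "integrable lebesgue (\<lambda>x. indicator (W r) x * \<bar>w x\<bar>)"
    using integrable_abs[OF w] by (simp add: abs_mult)
  have "(LINT z|lebesgue. \<bar>w (\<psi> t z)\<bar> * ?i z) = (LINT x|lebesgue. \<bar>w x\<bar> * (?i (\<Phi> t x) * J t x))"
    by (rule flow_change_of_variables(2)[OF t, symmetric])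
  also have "\<dots> \<le> (LINT x|lebesgue. cJ * (indicator (W r) x * \<bar>w x\<bar>))"
    by (rule integral_mono_AE[OF int[OF aw]]) (use aw bd[of "\<lambda>x. \<bar>w x\<bar>"] in auto)
  finally show "(LINT z|lebesgue. \<bar>w (\<psi> t z)\<bar> * ?i z) \<le> cJ * (LINT x|lebesgue. indicator (W r) x * \<bar>w x\<bar>)" by simp
qed

text \<open>Integrability is the only access to measurability of the composition. The function is
  made bounded by \<open>arctan\<close> and cut off to balls, so that integrability is available,
  and afterwards \<open>arctan\<close> is inverted.\<close>

lemma composition_measurable:
  fixes w :: "real ^ 'n \<Rightarrow> real"
  assumes w: "w \<in> borel_measurable lebesgue"
  shows "(\<lambda>z. w (\<psi> t z)) \<in> borel_measurable lebesgue"
proof -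
  have arctan_m: "(\<lambda>x. arctan (w x)) \<in> borel_measurable lebesgue"
    by (rule borel_measurable_continuous_on[OF _ w]) (intro continuous_intros)
  have "(\<lambda>z. arctan (w (\<psi> t z))) \<in> borel_measurable lebesgue"
  proof (rule borel_measurable_LIMSEQ_real)
    fix n :: nat
    have "integrable lebesgue (\<lambda>x. indicator (W (real n)) x * arctan (w x))"
    proof (rule integrable_indicator_compact)
      have "\<bar>arctan y\<bar> \<le> pi / 2" for y using arctan_bounded[of y] by linarith
      then show "AE x in lebesgue. x \<in> W (real n) \<longrightarrow> \<bar>arctan (w x)\<bar> \<le> pi / 2" by simp
    qed (use arctan_m in auto)
    from composition_integrable(1)[OF this] show "(\<lambda>z. arctan (w (\<psi> t z)) * indicator (cball 0 (real n)) z) \<in> borel_measurable lebesgue"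
      by (rule borel_measurable_integrable)
  next
    fix z :: "real ^ 'n"
    obtain n0 :: nat where "norm z \<le> real n0" using real_arch_simple by blast
    then have "eventually (\<lambda>n. arctan (w (\<psi> t z)) * indicator (cball 0 (real n)) z = arctan (w (\<psi> t z))) sequentially"
      unfolding eventually_sequentially by (intro exI[of _ n0]) (auto simp: indicator_def)
    then show "(\<lambda>n. arctan (w (\<psi> t z)) * indicator (cball 0 (real n)) z) \<longlonglongrightarrow> arctan (w (\<psi> t z))"
      by (rule tendsto_eventually)
  qed
  then have "(\<lambda>z. sin (arctan (w (\<psi> t z))) / cos (arctan (w (\<psi> t z)))) \<in> borel_measurable lebesgue"
    by (intro borel_measurable_divide borel_measurable_continuous_on[OF continuous_on_sin[OF continuous_on_id, simplified]]
        borel_measurable_continuous_on[OF continuous_on_cos[OF continuous_on_id, simplified]]) auto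
  moreover have "sin (arctan y) / cos (arctan y) = y" for y using tan_arctan[of y] by (simp only: tan_def)
  ultimately show ?thesis by simp
qed

end

text \<open>All preimages of \<open>z\<close> lie in one compact ball. Away from the single preimage
  at time \<open>t\<close> the value of \<open>\<Phi> t\<close> keeps a positive distance from
  \<open>z\<close>, whereas \<open>\<Phi> (s n)\<close> is uniformly close to
  \<open>\<Phi> t\<close> on the ball.\<close>

lemma \<psi>_tendsto:
  assumes t: "t \<in> {0..T}" and s: "\<And>n. s n \<in> {0..T}" "s \<longlonglongrightarrow> t" and z: "z \<notin> crit t"
  shows "(\<lambda>n. \<psi> (s n) z) \<longlonglongrightarrow> \<psi> t z"
proof (rule tendstoI)
  fix e :: real assume e: "e > 0"
  let ?K = "W (norm z)"
  define Z where "Z = ?K - ball (\<psi> t z) e"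
  have cZ: "compact Z" unfolding Z_def by (intro compact_diff) auto
  obtain \<delta> where \<delta>: "\<delta> > 0" "\<And>x. x \<in> Z \<Longrightarrow> norm (\<Phi> t x - z) \<ge> \<delta>"
  proof (cases "Z = {}")
    case False
    have "continuous_on Z (\<lambda>x. norm (\<Phi> t x - z))" by (intro continuous_intros \<Phi>_continuous t)
    from continuous_attains_inf[OF cZ False this] obtain x0 where x0: "x0 \<in> Z" "\<And>x. x \<in> Z \<Longrightarrow> norm (\<Phi> t x0 - z) \<le> norm (\<Phi> t x - z)"
      by blast
    have "\<Phi> t x0 \<noteq> z" using \<psi>_unique[OF t z, of x0] x0(1) e by (auto simp: Z_def)
    then show ?thesis using that[of "norm (\<Phi> t x0 - z)"] x0(2) by simp
  qed (use that[of 1] in auto)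
  have "uniformly_continuous_on ({0..T} \<times> ?K) (\<lambda>(t, x). \<Phi> t x)"
    by (intro compact_uniformly_continuous compact_Times continuous_on_subset[OF cont]) auto
  then obtain d where d: "d > 0" "\<And>y y'. y \<in> {0..T} \<times> ?K \<Longrightarrow> y' \<in> {0..T} \<times> ?K \<Longrightarrow> dist y' y < d \<Longrightarrow>
      dist (case y' of (t, x) \<Rightarrow> \<Phi> t x) (case y of (t, x) \<Rightarrow> \<Phi> t x) < \<delta>"
    using \<delta>(1) unfolding uniformly_continuous_on_def by meson
  from tendstoD[OF s(2) d(1)] show "\<forall>\<^sub>F n in sequentially. dist (\<psi> (s n) z) (\<psi> t z) < e"
  proof eventually_elim
    case (elim n)
    have K: "\<psi> (s n) z \<in> ?K" by (rule \<psi>_bound[OF s(1)]) simp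
    have "dist (\<Phi> (s n) (\<psi> (s n) z)) (\<Phi> t (\<psi> (s n) z)) < \<delta>"
      using d(2)[of "(t, \<psi> (s n) z)" "(s n, \<psi> (s n) z)"] K t s(1)[of n] elim by (simp add: dist_Pair_Pair)
    then have "norm (\<Phi> t (\<psi> (s n) z) - z) < \<delta>" using \<Phi>_\<psi>[OF s(1)[of n], of z] by (simp add: dist_norm norm_minus_commute)
    then have "\<psi> (s n) z \<notin> Z" using \<delta>(2) by fastforce
    then show ?case using K by (simp add: Z_def dist_commute)
  qed
qed

lemma weak_continuity_continuous:
  fixes w g :: "real ^ 'n \<Rightarrow> real"
  assumes w: "continuous_on UNIV w" "\<And>x. \<bar>w x\<bar> \<le> B" and g: "integrable lebesgue g"
  shows "continuous_on {0..T} (\<lambda>t. LINT z|lebesgue. w (\<psi> t z) * g z)"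
  unfolding continuous_on_sequentially o_def
proof (intro allI impI ballI, elim conjE)
  fix s t assume t: "t \<in> {0..T}" and s: "\<forall>n. s n \<in> {0..T}" "s \<longlonglongrightarrow> t"
  have wm: "w \<in> borel_measurable lebesgue" by (rule continuous_imp_lebesgue_measurable[OF w(1)])
  have B: "B \<ge> 0" using w(2)[of 0] by linarith
  show "(\<lambda>n. LINT z|lebesgue. w (\<psi> (s n) z) * g z) \<longlonglongrightarrow> (LINT z|lebesgue. w (\<psi> t z) * g z)"
  proof (rule integral_dominated_convergence[where w="\<lambda>z. B * \<bar>g z\<bar>"])
    show "(\<lambda>z. w (\<psi> t z) * g z) \<in> borel_measurable lebesgue" "(\<lambda>z. w (\<psi> (s n) z) * g z) \<in> borel_measurable lebesgue" for n
      using s(1) t g by (auto intro!: borel_measurable_times composition_measurable[OF _ wm])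
    show "integrable lebesgue (\<lambda>z. B * \<bar>g z\<bar>)" using g by simp
    show "AE z in lebesgue. norm (w (\<psi> (s n) z) * g z) \<le> B * \<bar>g z\<bar>" for n
      using w(2) by (intro AE_I2) (auto simp: abs_mult intro!: mult_right_mono)
    show "AE z in lebesgue. (\<lambda>n. w (\<psi> (s n) z) * g z) \<longlonglongrightarrow> w (\<psi> t z) * g z"
      using AE_not_crit[OF t]
    proof eventually_elim
      case (elim z)
      have "(\<lambda>n. \<psi> (s n) z) \<longlonglongrightarrow> \<psi> t z" using s by (intro \<psi>_tendsto[OF t _ _ elim]) auto
      from continuous_on_tendsto_compose[OF w(1) this] have "(\<lambda>n. w (\<psi> (s n) z)) \<longlonglongrightarrow> w (\<psi> t z)" by simp
      then show ?case by (intro tendsto_intros)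
    qed
  qed
qed

text \<open>Without continuity of \<open>w\<close>, pointwise convergence of \<open>\<psi>\<close>
  is of no direct use. \<open>w\<close> is replaced by bounded continuous functions; the bound
  \<open>cJ\<close> on the Jacobian makes the error uniform in \<open>t\<close>, so continuity
  survives.\<close>

lemma weak_continuity:
  fixes w g :: "real ^ 'n \<Rightarrow> real"
  assumes w: "w \<in> borel_measurable lebesgue" and B: "AE x in lebesgue. x \<in> W r \<longrightarrow> \<bar>w x\<bar> \<le> B"
    and g: "integrable lebesgue g" "\<And>z. z \<notin> cball 0 r \<Longrightarrow> g z = 0"
  shows "continuous_on {0..T} (\<lambda>t. LINT z|lebesgue. w (\<psi> t z) * g z)"
proof (rule continuous_on_uniform_approximation)
  fix e :: real assume e: "e > 0"
  define B' where "B' = max B 0"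
  have B': "B' \<ge> 0" "AE x in lebesgue. x \<in> W r \<longrightarrow> \<bar>w x\<bar> \<le> B'"
    using B by (auto simp: B'_def elim!: eventually_mono)
  obtain V0 where V0: "\<And>k::nat. continuous_on UNIV (V0 k)" "AE x in lebesgue. (\<lambda>k. V0 k x) \<longlonglongrightarrow> w x"
    using lebesgue_limit_of_continuous[OF w] by blast
  define V where "V = (\<lambda>k x. max (- B') (min B' (V0 k x)))"
  have V: "continuous_on UNIV (V k)" "\<bar>V k x\<bar> \<le> B'" for k x
    using V0(1) B'(1) by (auto simp: V_def intro!: continuous_intros)
  have Vm: "V k \<in> borel_measurable lebesgue" for k by (rule continuous_imp_lebesgue_measurable[OF V(1)])
  have Vlim: "AE x in lebesgue. x \<in> W r \<longrightarrow> (\<lambda>k. V k x) \<longlonglongrightarrow> w x"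
    using V0(2) B'(2)
  proof eventually_elim
    case (elim x)
    show ?case
    proof
      assume "x \<in> W r"
      then have "w x = max (- B') (min B' (w x))" using elim(2) by (auto simp: max_def min_def)
      moreover have "(\<lambda>k. V k x) \<longlonglongrightarrow> max (- B') (min B' (w x))" unfolding V_def by (intro tendsto_intros elim(1))
      ultimately show "(\<lambda>k. V k x) \<longlonglongrightarrow> w x" by simp
    qed
  qed
  \<comment> \<open>Truncating \<open>g\<close> separates the two errors: the mean distance of
    \<open>w\<close> and \<open>V k\<close> is multiplied by the height \<open>M\<close> only, and
    the remainder of \<open>g\<close> by the uniform bound \<open>2 * B'\<close>.\<close>
  define gM where "gM = (\<lambda>M::nat. \<lambda>z. max (- real M) (min (real M) (g z)))"
  have gm: "g \<in> borel_measurable lebesgue" using g(1) by simp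
  have gMm: "gM M \<in> borel_measurable lebesgue" for M unfolding gM_def using gm by simp
  have gM_le: "\<bar>g z - gM M z\<bar> \<le> \<bar>g z\<bar>" "\<bar>g z\<bar> \<le> real M + \<bar>g z - gM M z\<bar>" for M z
    by (auto simp: gM_def max_def min_def abs_if)
  have gd: "integrable lebesgue (\<lambda>z. \<bar>g z - gM M z\<bar>)" for M
    by (rule Bochner_Integration.integrable_bound[OF g(1)]) (use gm gMm gM_le in auto)
  have "(\<lambda>M. LINT z|lebesgue. \<bar>g z - gM M z\<bar>) \<longlonglongrightarrow> (LINT z|(lebesgue :: (real ^ 'n) measure). 0)"
  proof (rule integral_dominated_convergence[where w="\<lambda>z. \<bar>g z\<bar>"])
    have "(\<lambda>M. \<bar>g z - gM M z\<bar>) \<longlonglongrightarrow> 0" for z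
    proof (rule tendsto_eventually)
      obtain n0 :: nat where "\<bar>g z\<bar> \<le> real n0" using real_arch_simple by blast
      then show "\<forall>\<^sub>F M in sequentially. \<bar>g z - gM M z\<bar> = 0"
        unfolding eventually_sequentially gM_def by (intro exI[of _ n0]) (auto simp: max_def min_def)
    qed
    then show "AE z in lebesgue. (\<lambda>M. \<bar>g z - gM M z\<bar>) \<longlonglongrightarrow> 0" by simp
  qed (use g(1) gm gMm gM_le in auto)
  then have "(\<lambda>M. 2 * B' * (LINT z|lebesgue. \<bar>g z - gM M z\<bar>)) \<longlonglongrightarrow> 2 * B' * 0" by (intro tendsto_intros) simp
  from order_tendstoD(2)[OF this, of "e / 2"] obtain M where M: "2 * B' * (LINT z|lebesgue. \<bar>g z - gM M z\<bar>) < e / 2"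
    using e by (auto simp: eventually_sequentially)
  have iw: "integrable lebesgue (\<lambda>x. indicator (W r) x * (w x - V k x))" for k
  proof (rule integrable_indicator_compact)
    show "AE x in lebesgue. x \<in> W r \<longrightarrow> \<bar>w x - V k x\<bar> \<le> 2 * B'"
      using B'(2) by eventually_elim (use V(2)[of k] in \<open>smt (verit)\<close>)
  qed (use w Vm in auto)
  have "(\<lambda>k. LINT x|lebesgue. indicator (W r) x * \<bar>w x - V k x\<bar>) \<longlonglongrightarrow> (LINT x|(lebesgue :: (real ^ 'n) measure). 0)"
  proof (rule integral_dominated_convergence[where w="\<lambda>x. indicator (W r) x * (2 * B')"])
    show "integrable lebesgue (\<lambda>x. indicator (W r) x * (2 * B'))"
      by (rule integrable_indicator_compact[where B="2 * B'"]) (use B'(1) in auto)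
    show "AE x in lebesgue. (\<lambda>k. indicator (W r) x * \<bar>w x - V k x\<bar>) \<longlonglongrightarrow> 0"
      using Vlim
    proof eventually_elim
      case (elim x)
      have "(\<lambda>k. \<bar>w x - V k x\<bar>) \<longlonglongrightarrow> \<bar>w x - w x\<bar>" if "x \<in> W r" using elim that by (intro tendsto_intros) blast
      then show ?case by (auto simp: indicator_def)
    qed
    show "AE x in lebesgue. norm (indicator (W r) x * \<bar>w x - V k x\<bar>) \<le> indicator (W r) x * (2 * B')" for k
      using B'(2)
    proof eventually_elim
      case (elim x)
      then show ?case using V(2)[of k x] by (auto simp: indicator_def)
    qed
    show "(\<lambda>x. indicator (W r) x * \<bar>w x - V k x\<bar>) \<in> borel_measurable lebesgue" for k
      using w Vm by (intro borel_measurable_times borel_measurable_abs borel_measurable_diff borel_measurable_indicator) auto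
  qed auto
  then have "(\<lambda>k. real M * (cJ * (LINT x|lebesgue. indicator (W r) x * \<bar>w x - V k x\<bar>))) \<longlonglongrightarrow> real M * (cJ * 0)"
    by (intro tendsto_intros) simp
  from order_tendstoD(2)[OF this, of "e / 2"] obtain k where k: "real M * (cJ * (LINT x|lebesgue. indicator (W r) x * \<bar>w x - V k x\<bar>)) < e / 2"
    using e by (auto simp: eventually_sequentially)
  have "\<bar>(LINT z|lebesgue. w (\<psi> t z) * g z) - (LINT z|lebesgue. V k (\<psi> t z) * g z)\<bar> \<le> e" if t: "t \<in> {0..T}" for t
  proof -
    have wb: "AE z in lebesgue. z \<in> cball 0 r \<longrightarrow> \<bar>w (\<psi> t z)\<bar> \<le> B'"
      using AE_\<psi>[OF t B'(2)] by eventually_elim (use \<psi>_bound[OF t] in blast)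
    have bound: "integrable lebesgue (\<lambda>z. v (\<psi> t z) * g z)"
      if "v \<in> borel_measurable lebesgue" "AE z in lebesgue. z \<in> cball 0 r \<longrightarrow> \<bar>v (\<psi> t z)\<bar> \<le> B'" for v
    proof (rule Bochner_Integration.integrable_bound)
      show "integrable lebesgue (\<lambda>z. B' * g z)" using g(1) by simp
      show "(\<lambda>z. v (\<psi> t z) * g z) \<in> borel_measurable lebesgue" by (intro borel_measurable_times composition_measurable[OF t] that gm)
      show "AE z in lebesgue. norm (v (\<psi> t z) * g z) \<le> norm (B' * g z)"
        using that(2)
      proof eventually_elim
        case (elim z)
        then show ?case using g(2)[of z] B'(1) by (cases "z \<in> cball 0 r") (auto simp: abs_mult intro!: mult_right_mono)
      qed
    qed
    have i1: "integrable lebesgue (\<lambda>z. w (\<psi> t z) * g z)" by (rule bound[OF w wb])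
    have i2: "integrable lebesgue (\<lambda>z. V k (\<psi> t z) * g z)" by (rule bound[OF Vm]) (use V(2) in auto)
    note ci = composition_integrable[OF t iw[of k]]
    have i3: "integrable lebesgue (\<lambda>z. \<bar>w (\<psi> t z) - V k (\<psi> t z)\<bar> * indicator (cball 0 r) z)"
      using integrable_abs[OF ci(1)] by (simp add: abs_mult)
    have "\<bar>(LINT z|lebesgue. w (\<psi> t z) * g z) - (LINT z|lebesgue. V k (\<psi> t z) * g z)\<bar>
        = \<bar>LINT z|lebesgue. w (\<psi> t z) * g z - V k (\<psi> t z) * g z\<bar>" using i1 i2 by simp
    also have "\<dots> \<le> (LINT z|lebesgue. \<bar>w (\<psi> t z) * g z - V k (\<psi> t z) * g z\<bar>)" by (rule integral_abs_bound)
    also have "\<dots> \<le> (LINT z|lebesgue. real M * (\<bar>w (\<psi> t z) - V k (\<psi> t z)\<bar> * indicator (cball 0 r) z) + 2 * B' * \<bar>g z - gM M z\<bar>)"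
    proof (rule integral_mono_AE)
      show "integrable lebesgue (\<lambda>z. \<bar>w (\<psi> t z) * g z - V k (\<psi> t z) * g z\<bar>)" using i1 i2 by simp
      show "integrable lebesgue (\<lambda>z. real M * (\<bar>w (\<psi> t z) - V k (\<psi> t z)\<bar> * indicator (cball 0 r) z) + 2 * B' * \<bar>g z - gM M z\<bar>)"
        using i3 gd by simp
      show "AE z in lebesgue. \<bar>w (\<psi> t z) * g z - V k (\<psi> t z) * g z\<bar> \<le> real M * (\<bar>w (\<psi> t z) - V k (\<psi> t z)\<bar> * indicator (cball 0 r) z) + 2 * B' * \<bar>g z - gM M z\<bar>"
        using wb
      proof eventually_elim
        case (elim z)
        show ?case
        proof (cases "z \<in> cball 0 r")
          case True
          define D where "D = \<bar>w (\<psi> t z) - V k (\<psi> t z)\<bar>"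
          have D: "0 \<le> D" "D \<le> 2 * B'" using elim True V(2)[of k "\<psi> t z"] by (auto simp: D_def)
          have "\<bar>w (\<psi> t z) * g z - V k (\<psi> t z) * g z\<bar> = D * \<bar>g z\<bar>" by (simp add: D_def left_diff_distrib[symmetric] abs_mult)
          also have "\<dots> \<le> D * (real M + \<bar>g z - gM M z\<bar>)" using D gM_le(2) by (intro mult_left_mono) auto
          also have "\<dots> \<le> real M * D + 2 * B' * \<bar>g z - gM M z\<bar>"
            using mult_right_mono[OF D(2), of "\<bar>g z - gM M z\<bar>"] by (simp add: distrib_left mult.commute)
          finally show ?thesis using True by (simp add: D_def)
        next
          case False
          then show ?thesis using g(2)[OF False] B'(1) by simp
        qed
      qed
    qed
    also have "\<dots> = real M * (LINT z|lebesgue. \<bar>w (\<psi> t z) - V k (\<psi> t z)\<bar> * indicator (cball 0 r) z) + 2 * B' * (LINT z|lebesgue. \<bar>g z - gM M z\<bar>)"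
      using i3 gd by simp
    also have "\<dots> \<le> real M * (cJ * (LINT x|lebesgue. indicator (W r) x * \<bar>w x - V k x\<bar>)) + 2 * B' * (LINT z|lebesgue. \<bar>g z - gM M z\<bar>)"
      by (intro add_right_mono mult_left_mono ci(2)) auto
    finally show ?thesis using M k by linarith
  qed
  then show "\<exists>h. continuous_on {0..T} h \<and> (\<forall>t\<in>{0..T}. \<bar>(LINT z|lebesgue. w (\<psi> t z) * g z) - h t\<bar> \<le> e)"
    using weak_continuity_continuous[OF V g(1)] by blast
qed

end

section \<open>Lebesgue spaces and renormalisation\<close>

lemma powr_abs_add_le:
  fixes a b P :: real
  assumes "P \<ge> 0" shows "\<bar>a + b\<bar> powr P \<le> 2 powr P * (\<bar>a\<bar> powr P + \<bar>b\<bar> powr P)"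
proof -
  have "\<bar>a + b\<bar> powr P \<le> (2 * max \<bar>a\<bar> \<bar>b\<bar>) powr P" using assms by (intro powr_mono2) auto
  also have "\<dots> = 2 powr P * (max \<bar>a\<bar> \<bar>b\<bar>) powr P" by (simp add: powr_mult)
  also have "\<dots> \<le> 2 powr P * (\<bar>a\<bar> powr P + \<bar>b\<bar> powr P)" by (intro mult_left_mono) (auto simp: max_def)
  finally show ?thesis .
qed

lemma tendsto_of_sub_subsequences:
  fixes X :: "nat \<Rightarrow> real"
  assumes nonneg: "\<And>n. X n \<ge> 0"
    and sub: "\<And>r. strict_mono (r :: nat \<Rightarrow> nat) \<Longrightarrow> \<exists>r'. strict_mono (r' :: nat \<Rightarrow> nat) \<and> (\<lambda>n. X (r (r' n))) \<longlonglongrightarrow> 0"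
  shows "X \<longlonglongrightarrow> 0"
proof (rule ccontr)
  assume "\<not> X \<longlonglongrightarrow> 0"
  then obtain e where e: "e > 0" "\<And>N. \<exists>n\<ge>N. X n \<ge> e"
    unfolding LIMSEQ_iff using nonneg by (auto simp: not_less)
  have "infinite {n. X n \<ge> e}" unfolding infinite_nat_iff_unbounded_le using e(2) by auto
  then obtain r where r: "strict_mono r" "\<And>n::nat. X (r n) \<ge> e" using infinite_enumerate by blast
  obtain r' where "strict_mono (r' :: nat \<Rightarrow> nat)" "(\<lambda>n. X (r (r' n))) \<longlonglongrightarrow> 0" using sub[OF r(1)] by blast
  then have "e \<le> 0" using r(2) by (intro LIMSEQ_le_const) auto
  then show False using e(1) by simp
qed

lemma growth_powr_le:
  fixes \<beta> :: "real \<Rightarrow> real"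
  assumes \<beta>: "\<And>r. \<bar>\<beta> r\<bar> \<le> 1 + \<bar>r\<bar> powr \<alpha>" and q: "q \<ge> 0"
  shows "\<bar>\<beta> a\<bar> powr q \<le> 2 powr q * (1 + \<bar>a\<bar> powr (\<alpha> * q))"
proof -
  have "\<bar>\<beta> a\<bar> powr q \<le> \<bar>1 + \<bar>a\<bar> powr \<alpha>\<bar> powr q" using \<beta>[of a] q by (intro powr_mono2) auto
  also have "\<dots> \<le> 2 powr q * (\<bar>1\<bar> powr q + \<bar>\<bar>a\<bar> powr \<alpha>\<bar> powr q)" by (rule powr_abs_add_le[OF q])
  also have "\<dots> = 2 powr q * (1 + \<bar>a\<bar> powr (\<alpha> * q))" by (simp add: powr_powr)
  finally show ?thesis .
qed

text \<open>Along a subsequence the functions converge almost everywhere. The part of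
  \<open>\<bar>\<beta> (v n) - \<beta> v0\<bar> powr q\<close> exceeding a fixed integrable function is controlled by
  \<open>\<bar>v n - v0\<bar> powr P\<close>, the rest by dominated convergence.\<close>

lemma nemytskii:
  fixes v :: "nat \<Rightarrow> 'a \<Rightarrow> real" and \<beta> :: "real \<Rightarrow> real"
  assumes \<beta>: "continuous_on UNIV \<beta>" "\<And>r. \<bar>\<beta> r\<bar> \<le> 1 + \<bar>r\<bar> powr \<alpha>" and \<alpha>: "\<alpha> > 0" and q: "q > 0"
    and fin: "integrable M (\<lambda>x. 1 :: real)"
    and v: "\<And>n. v n \<in> borel_measurable M" "\<And>n. integrable M (\<lambda>x. \<bar>v n x\<bar> powr (\<alpha> * q))"
    and v0: "v0 \<in> borel_measurable M" "integrable M (\<lambda>x. \<bar>v0 x\<bar> powr (\<alpha> * q))"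
    and lim: "(\<lambda>n. LINT x|M. \<bar>v n x - v0 x\<bar> powr (\<alpha> * q)) \<longlonglongrightarrow> 0"
  shows "(\<lambda>n. LINT x|M. \<bar>\<beta> (v n x) - \<beta> (v0 x)\<bar> powr q) \<longlonglongrightarrow> 0"
proof -
  define P where "P = \<alpha> * q"
  have P: "P > 0" using \<alpha> q by (simp add: P_def)
  define d where "d = (\<lambda>n x. \<bar>v n x - v0 x\<bar> powr P)"
  define h where "h = (\<lambda>n x. \<bar>\<beta> (v n x) - \<beta> (v0 x)\<bar> powr q)"
  define Q where "Q = 2 powr q * 2 powr q"
  define R where "R = 2 powr P"
  \<comment> \<open>In \<open>Q\<close> one factor comes from splitting the difference of the values
    of \<open>\<beta>\<close> and one from the growth of \<open>\<beta>\<close>; \<open>R\<close>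
    comes from writing \<open>v n\<close> as \<open>v0\<close> plus the difference. \<open>A\<close>
    collects all terms that do not depend on \<open>n\<close>.\<close>
  define A where "A = (\<lambda>x. Q * (2 + (R + 1) * \<bar>v0 x\<bar> powr P))"
  have QR: "Q \<ge> 0" "R \<ge> 0" by (auto simp: Q_def R_def)
  have A0: "A x \<ge> 0" for x using QR by (auto simp: A_def intro!: mult_nonneg_nonneg add_nonneg_nonneg)
  have h_le: "h n x \<le> A x + Q * R * d n x" for n x
  proof -
    let ?a = "\<bar>v n x\<bar> powr P" and ?b = "\<bar>v0 x\<bar> powr P"
    have q': "q \<ge> 0" using q by simp
    have "h n x \<le> 2 powr q * (\<bar>\<beta> (v n x)\<bar> powr q + \<bar>\<beta> (v0 x)\<bar> powr q)"
      using powr_abs_add_le[OF q', of "\<beta> (v n x)" "- \<beta> (v0 x)"] by (simp add: h_def)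
    also have "\<dots> \<le> 2 powr q * (2 powr q * (1 + ?a) + 2 powr q * (1 + ?b))"
      unfolding P_def by (intro mult_left_mono add_mono growth_powr_le[OF \<beta>(2) q']) auto
    also have "\<dots> = Q * (2 + ?b + ?a)" by (simp add: Q_def algebra_simps)
    also have "\<dots> \<le> Q * (2 + ?b + R * (?b + d n x))"
      using powr_abs_add_le[of P "v0 x" "v n x - v0 x"] P QR by (intro mult_left_mono add_left_mono) (auto simp: d_def R_def)
    also have "\<dots> = A x + Q * R * d n x" by (simp add: A_def algebra_simps)
    finally show ?thesis .
  qed
  have \<beta>m: "(\<lambda>x. \<beta> (f x)) \<in> borel_measurable M" if "f \<in> borel_measurable M" for f
    by (rule borel_measurable_continuous_on[OF \<beta>(1) that])
  have dm: "d n \<in> borel_measurable M" for n unfolding d_def using v(1)[of n] v0(1) by measurable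
  have hm: "h n \<in> borel_measurable M" for n unfolding h_def using \<beta>m[OF v(1)[of n]] \<beta>m[OF v0(1)] by measurable
  have di: "integrable M (d n)" for n
  proof (rule Bochner_Integration.integrable_bound)
    show "integrable M (\<lambda>x. 2 powr P * (\<bar>v n x\<bar> powr P + \<bar>v0 x\<bar> powr P))"
      unfolding P_def by (rule integrable_mult_right[OF Bochner_Integration.integrable_add[OF v(2) v0(2)]])
    have "\<bar>v n x + - v0 x\<bar> powr P \<le> 2 powr P * (\<bar>v n x\<bar> powr P + \<bar>- v0 x\<bar> powr P)" for x
      by (rule powr_abs_add_le) (use P in simp)
    then have "norm (d n x) \<le> norm (2 powr P * (\<bar>v n x\<bar> powr P + \<bar>v0 x\<bar> powr P))" for x
      by (simp add: d_def)
    then show "AE x in M. norm (d n x) \<le> norm (2 powr P * (\<bar>v n x\<bar> powr P + \<bar>v0 x\<bar> powr P))" by (intro AE_I2)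
  qed (rule dm)
  have "integrable M (\<lambda>x. Q * (2 * 1 + (R + 1) * \<bar>v0 x\<bar> powr P))"
    unfolding P_def by (rule integrable_mult_right[OF Bochner_Integration.integrable_add[OF integrable_mult_right[OF fin] integrable_mult_right[OF v0(2)]]])
  then have Ai: "integrable M A" by (simp add: A_def[abs_def])
  have Am: "A \<in> borel_measurable M" using Ai by simp
  have h0: "h n x \<ge> 0" "d n x \<ge> 0" for n x by (auto simp: h_def d_def)
  have hi: "integrable M (h n)" for n
  proof (rule Bochner_Integration.integrable_bound)
    show "integrable M (\<lambda>x. A x + Q * R * d n x)" using Ai di by simp
    show "AE x in M. norm (h n x) \<le> norm (A x + Q * R * d n x)"
      using h_le h0 by (intro AE_I2) (simp add: order_trans[OF _ abs_ge_self])
  qed (rule hm)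
  have powr_lim: "(\<lambda>n. \<bar>y n\<bar> powr c) \<longlonglongrightarrow> 0" if "y \<longlonglongrightarrow> 0" "c > 0" for y :: "nat \<Rightarrow> real" and c
  proof -
    have "(\<lambda>n. \<bar>y n\<bar> powr c) \<longlonglongrightarrow> \<bar>0\<bar> powr c" using that by (intro tendsto_powr2 tendsto_intros) auto
    then show ?thesis by simp
  qed
  have "(\<lambda>n. LINT x|M. h n x) \<longlonglongrightarrow> 0"
  proof (rule tendsto_of_sub_subsequences)
    show "(LINT x|M. h n x) \<ge> 0" for n using h0 by (intro Bochner_Integration.integral_nonneg) auto
    fix r :: "nat \<Rightarrow> nat" assume r: "strict_mono r"
    have limd: "(\<lambda>n. LINT x|M. d n x) \<longlonglongrightarrow> 0" using lim by (simp add: d_def P_def)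
    have "(\<lambda>n. LINT x|M. norm (d (r n) x)) \<longlonglongrightarrow> 0"
      using LIMSEQ_subseq_LIMSEQ[OF limd r] h0 by (simp add: o_def)
    from tendsto_L1_AE_subseq[OF di this] obtain r' where r': "strict_mono r'" "AE x in M. (\<lambda>n. d (r (r' n)) x) \<longlonglongrightarrow> 0" by blast
    have rr: "strict_mono (r \<circ> r')" using r r'(1) by (rule strict_mono_o)
    have "(\<lambda>n. LINT x|M. min (h (r (r' n)) x) (A x)) \<longlonglongrightarrow> (LINT x|M. 0)"
    proof (rule integral_dominated_convergence[where w=A])
      show "AE x in M. (\<lambda>n. min (h (r (r' n)) x) (A x)) \<longlonglongrightarrow> 0"
        using r'(2)
      proof eventually_elim
        case (elim x)
        have "(\<lambda>n. \<bar>d (r (r' n)) x\<bar> powr (1 / P)) \<longlonglongrightarrow> 0" by (rule powr_lim[OF elim]) (use P in simp)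
        then have "(\<lambda>n. \<bar>v (r (r' n)) x - v0 x\<bar>) \<longlonglongrightarrow> 0" using P by (simp add: d_def powr_powr)
        then have "(\<lambda>n. v (r (r' n)) x) \<longlonglongrightarrow> v0 x" using LIM_zero_cancel tendsto_rabs_zero_iff by blast
        then have "(\<lambda>n. \<beta> (v (r (r' n)) x)) \<longlonglongrightarrow> \<beta> (v0 x)"
          by (rule continuous_on_tendsto_compose[OF \<beta>(1)]) auto
        then have "(\<lambda>n. h (r (r' n)) x) \<longlonglongrightarrow> 0" unfolding h_def using q by (intro powr_lim LIM_zero)
        then have "(\<lambda>n. min (h (r (r' n)) x) (A x)) \<longlonglongrightarrow> min 0 (A x)" by (intro tendsto_intros)
        then show ?case using A0[of x] by simp
      qed
      show "AE x in M. norm (min (h (r (r' n)) x) (A x)) \<le> A x" for n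
        using A0 h0 by (intro AE_I2) auto
    qed (use Am hm Ai in auto)
    moreover have "(\<lambda>n. LINT x|M. d (r (r' n)) x) \<longlonglongrightarrow> 0" using LIMSEQ_subseq_LIMSEQ[OF limd rr] by (simp add: o_def)
    ultimately have up: "(\<lambda>n. (LINT x|M. min (h (r (r' n)) x) (A x)) + Q * R * (LINT x|M. d (r (r' n)) x)) \<longlonglongrightarrow> (LINT x|M. 0) + Q * R * 0"
      by (intro tendsto_intros)
    \<comment> \<open>Where \<open>h n\<close> exceeds \<open>A\<close>, the excess is at most
      \<open>Q * R * d n\<close>.\<close>
    have "(LINT x|M. h n x) \<le> (LINT x|M. min (h n x) (A x)) + Q * R * (LINT x|M. d n x)" for n
    proof -
      have mi: "integrable M (\<lambda>x. min (h n x) (A x))" using hi Ai by (rule integrable_min)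
      have "(LINT x|M. h n x) \<le> (LINT x|M. min (h n x) (A x) + Q * R * d n x)"
      proof (rule integral_mono)
        show "h n x \<le> min (h n x) (A x) + Q * R * d n x" for x
          using h_le[of n x] h0(2)[of n x] QR by (auto simp: min_def)
      qed (use hi mi di in auto)
      then show ?thesis using mi di by simp
    qed
    then have "norm (LINT x|M. h (r (r' n)) x) \<le> (LINT x|M. min (h (r (r' n)) x) (A x)) + Q * R * (LINT x|M. d (r (r' n)) x)" for n
      using Bochner_Integration.integral_nonneg[of M "h (r (r' n))"] h0(1) by simp
    then have "\<forall>\<^sub>F n in sequentially. norm (LINT x|M. h (r (r' n)) x) \<le> (LINT x|M. min (h (r (r' n)) x) (A x)) + Q * R * (LINT x|M. d (r (r' n)) x)"
      by (intro always_eventually allI)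
    then have "(\<lambda>n. LINT x|M. h (r (r' n)) x) \<longlonglongrightarrow> 0"
      by (rule Lim_null_comparison) (use up in simp)
    then show "\<exists>r'. strict_mono r' \<and> (\<lambda>n. LINT x|M. h (r (r' n)) x) \<longlonglongrightarrow> 0" using r'(1) by blast
  qed
  then show ?thesis by (simp add: h_def)
qed

lemma compact_lebesgue_on:
  fixes K :: "'a::euclidean_space set"
  assumes "compact K"
  shows "K \<in> sets lebesgue" "integrable (lebesgue_on K) (\<lambda>x. c :: real)"
proof -
  show K: "K \<in> sets lebesgue" using lmeasurable_compact[OF assms] by (simp add: fmeasurable_def)
  have "finite_measure (lebesgue_on K)" by (rule finite_measure_lebesgue_on[OF lmeasurable_compact[OF assms]])
  then show "integrable (lebesgue_on K) (\<lambda>x. c :: real)" by (rule finite_measure.integrable_const)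
qed

section \<open>Local Lebesgue spaces under composition, and test functions\<close>

lemma mem_Lp_loc_measurable:
  assumes "mem_Lp_loc p f" shows "f \<in> borel_measurable lebesgue"
proof (rule borel_measurable_LIMSEQ_real)
  fix n :: nat
  have "f \<in> borel_measurable (lebesgue_on (cball 0 (real n)))" using assms by (simp add: mem_Lp_loc_def mem_Lp_def)
  then show "(\<lambda>x. if x \<in> cball 0 (real n) then f x else 0) \<in> borel_measurable lebesgue"
    by (rule borel_measurable_if_I) simp
next
  fix x :: 'a
  obtain n0 :: nat where "norm x \<le> real n0" using real_arch_simple by blast
  then show "(\<lambda>n. if x \<in> cball 0 (real n) then f x else 0) \<longlonglongrightarrow> f x"
    by (intro tendsto_eventually eventually_sequentiallyI[of n0]) auto
qed

lemma mem_Lp_loc_bound: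
  assumes "mem_Lp_loc \<infinity> f" "compact K"
  obtains B where "AE x in lebesgue. x \<in> K \<longrightarrow> \<bar>f x\<bar> \<le> B"
proof -
  obtain B where "AE x in lebesgue_on K. \<bar>f x\<bar> \<le> B" using assms by (auto simp: mem_Lp_loc_def mem_Lp_def)
  then have "AE x in lebesgue. x \<in> K \<longrightarrow> \<bar>f x\<bar> \<le> B"
    using compact_lebesgue_on(1)[OF assms(2)] by (subst (asm) AE_restrict_space_iff) auto
  then show thesis by (rule that)
qed

lemma one_le_enn2real: "1 \<le> p \<Longrightarrow> p \<noteq> \<infinity> \<Longrightarrow> 1 \<le> enn2real p"
  using enn2real_mono[of 1 p] by (simp add: less_top)

text \<open>For finite exponents
  \<open>\<bar>f x\<bar> \<le> 1 + \<bar>f x\<bar> powr enn2real p\<close>, and constants are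
  integrable on compact sets.\<close>

lemma mem_Lp_loc_integrable:
  fixes f :: "'a::euclidean_space \<Rightarrow> real"
  assumes f: "mem_Lp_loc p f" and p: "1 \<le> p" and K: "compact K"
  shows "integrable lebesgue (\<lambda>x. indicator K x * f x)"
proof (cases "p = \<infinity>")
  case True
  obtain B where "AE x in lebesgue. x \<in> K \<longrightarrow> \<bar>f x\<bar> \<le> B" using mem_Lp_loc_bound[of f K] f K True by auto
  then show ?thesis by (rule integrable_indicator_compact[OF K mem_Lp_loc_measurable[OF f]])
next
  case False
  have fK: "f \<in> borel_measurable (lebesgue_on K)" "integrable (lebesgue_on K) (\<lambda>x. \<bar>f x\<bar> powr enn2real p)"
    using f K False by (auto simp: mem_Lp_loc_def mem_Lp_def)
  have "integrable (lebesgue_on K) f"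
  proof (rule Bochner_Integration.integrable_bound)
    show "integrable (lebesgue_on K) (\<lambda>x. 1 + \<bar>f x\<bar> powr enn2real p)"
      using fK(2) compact_lebesgue_on(2)[OF K] by (rule Bochner_Integration.integrable_add[rotated])
    have "\<bar>f x\<bar> \<le> 1 + \<bar>f x\<bar> powr enn2real p" for x
    proof (cases "\<bar>f x\<bar> \<le> 1")
      case False
      then have "\<bar>f x\<bar> powr 1 \<le> \<bar>f x\<bar> powr enn2real p" using one_le_enn2real[OF p \<open>p \<noteq> \<infinity>\<close>] by (intro powr_mono) auto
      then show ?thesis using False by simp
    qed (simp add: add_increasing2)
    then show "AE x in lebesgue_on K. norm (f x) \<le> norm (1 + \<bar>f x\<bar> powr enn2real p)" by (intro AE_I2) simp
  qed (rule fK(1))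
  then show ?thesis using compact_lebesgue_on(1)[OF K] by (simp add: integrable_restrict_space)
qed

text \<open>Bounded functions of compact support are admissible in the duality identity whatever the
  conjugate exponent is.\<close>

lemma mem_Lp_bounded:
  fixes f :: "'a::euclidean_space \<Rightarrow> real"
  assumes f: "f \<in> borel_measurable lebesgue" "\<And>x. \<bar>f x\<bar> \<le> 1" and K: "compact K" "\<And>x. x \<notin> K \<Longrightarrow> f x = 0"
  shows "mem_Lp q lebesgue f"
proof -
  have "integrable lebesgue (\<lambda>x. \<bar>f x\<bar> powr enn2real q)"
  proof (rule Bochner_Integration.integrable_bound)
    show "integrable lebesgue (\<lambda>x. indicator K x * (1 :: real))"
      by (rule integrable_indicator_compact[OF K(1), where B=1]) auto
    have "\<bar>f x\<bar> powr enn2real q \<le> 1" for x using powr_mono2[of "enn2real q" "\<bar>f x\<bar>" 1] f(2) by simp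
    then show "AE x in lebesgue. norm (\<bar>f x\<bar> powr enn2real q) \<le> norm (indicator K x * (1 :: real))"
      using K(2) by (intro AE_I2) (auto simp: indicator_def)
    show "(\<lambda>x. \<bar>f x\<bar> powr enn2real q) \<in> borel_measurable lebesgue" using f(1) by simp
  qed
  then show ?thesis using f by (auto simp: mem_Lp_def)
qed

text \<open>The test function is the sign of the difference, cut off to a ball.\<close>

lemma AE_eq_of_tests:
  fixes v w :: "'a::euclidean_space \<Rightarrow> real"
  assumes v: "v \<in> borel_measurable lebesgue" "\<And>K. compact K \<Longrightarrow> integrable lebesgue (\<lambda>x. indicator K x * v x)"
    and w: "w \<in> borel_measurable lebesgue" "\<And>K. compact K \<Longrightarrow> integrable lebesgue (\<lambda>x. indicator K x * w x)"
    and test: "\<And>f r. f \<in> borel_measurable lebesgue \<Longrightarrow> (\<And>x. \<bar>f x\<bar> \<le> 1) \<Longrightarrow> (\<And>x. x \<notin> cball 0 r \<Longrightarrow> f x = 0) \<Longrightarrow>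
      (LINT x|lebesgue. v x * f x) = (LINT x|lebesgue. w x * f x)"
  shows "AE x in lebesgue. v x = w x"
proof -
  have loc: "AE x in lebesgue. indicator (cball 0 (real n)) x * \<bar>v x - w x\<bar> = 0" for n
  proof -
    let ?K = "cball (0 :: 'a) (real n)"
    define f where "f = (\<lambda>x. indicator ?K x * sgn (v x - w x))"
    have fm: "f \<in> borel_measurable lebesgue" unfolding f_def using v(1) w(1) by (intro borel_measurable_times borel_measurable_indicator) auto
    have fb: "\<bar>f x\<bar> \<le> 1" "x \<notin> ?K \<Longrightarrow> f x = 0" for x by (auto simp: f_def indicator_def abs_sgn_eq)
    have int: "integrable lebesgue (\<lambda>x. u x * f x)" if u: "u \<in> borel_measurable lebesgue" "integrable lebesgue (\<lambda>x. indicator ?K x * u x)" for u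
      by (rule Bochner_Integration.integrable_bound[OF u(2)])
        (use u(1) fm fb in \<open>auto simp: f_def indicator_def abs_mult abs_sgn_eq\<close>)
    have "(LINT x|lebesgue. indicator ?K x * \<bar>v x - w x\<bar>) = (LINT x|lebesgue. v x * f x - w x * f x)"
      by (intro Bochner_Integration.integral_cong refl)
        (auto simp: f_def indicator_def abs_sgn algebra_simps)
    also have "\<dots> = 0"
      using test[OF fm fb] int[OF v(1) v(2)] int[OF w(1) w(2)] by simp
    finally have z: "(LINT x|lebesgue. indicator ?K x * \<bar>v x - w x\<bar>) = 0" .
    have "integrable lebesgue (\<lambda>x. indicator ?K x * \<bar>v x - w x\<bar>)"
      using integrable_abs[OF Bochner_Integration.integrable_diff[OF v(2)[of ?K] w(2)[of ?K]]]
      by (simp add: right_diff_distrib[symmetric] abs_mult)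
    from integral_nonneg_eq_0_iff_AE[OF this] z show ?thesis by auto
  qed
  have "AE x in lebesgue. \<forall>n. indicator (cball 0 (real n)) x * \<bar>v x - w x\<bar> = 0"
    by (rule AE_all_countable[THEN iffD2, OF allI]) (rule loc)
  then show ?thesis
  proof eventually_elim
    case (elim x)
    obtain n0 :: nat where "norm x \<le> real n0" using real_arch_simple by blast
    then show ?case using elim[rule_format, of n0] by simp
  qed
qed

text \<open>The conventions \<open>1 / 0 = \<infinity>\<close> and
  \<open>1 / \<infinity> = 0\<close> make \<open>1 / (1 - 1 / p)\<close> correct at both
  endpoints.\<close>

lemma conjugate_exponent_exists:
  assumes "1 \<le> (p :: ennreal)" obtains q where "1 / p + 1 / q = 1"
proof
  have inv: "inverse (inverse x) = x" for x :: ennreal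
    by (cases x; cases "x = 0") (auto simp: inverse_ennreal less_le)
  have "inverse p \<le> 1"
  proof (cases p)
    case (real r)
    then have "r \<ge> 1" using assms by simp
    then show ?thesis using real by (simp add: inverse_ennreal inverse_le_1_iff)
  qed simp
  then show "1 / p + 1 / (1 / (1 - 1 / p)) = 1"
    by (simp add: divide_ennreal_def inv add_diff_inverse_ennreal)
qed

lemma smooth_real_continuous: "smooth_real \<beta> \<Longrightarrow> continuous_on UNIV \<beta>"
  unfolding smooth_real_def
  by (metis continuous_at_imp_continuous_on differentiable_imp_continuous_within funpow_0)

lemma divide_ennreal_top: "\<infinity> / ennreal \<alpha> = \<infinity>"
  by (simp add: divide_ennreal_def ennreal_top_mult)

lemma finite_exponent:
  assumes "p \<noteq> \<infinity>" "\<alpha> > 0"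
  shows "p / ennreal \<alpha> \<noteq> \<infinity>" "enn2real p = \<alpha> * enn2real (p / ennreal \<alpha>)"
proof -
  obtain P where P: "p = ennreal P" "P \<ge> 0" using assms(1) by (cases p) auto
  then have "p / ennreal \<alpha> = ennreal (P / \<alpha>)" using assms(2) by (simp add: divide_ennreal)
  then show "p / ennreal \<alpha> \<noteq> \<infinity>" "enn2real p = \<alpha> * enn2real (p / ennreal \<alpha>)" using P assms(2) by auto
qed

lemma mem_Lp_loc_composition:
  fixes \<beta> :: "real \<Rightarrow> real"
  assumes f: "mem_Lp_loc p f" and \<alpha>: "\<alpha> > 0"
    and \<beta>: "continuous_on UNIV \<beta>" "\<And>r. \<bar>\<beta> r\<bar> \<le> 1 + \<bar>r\<bar> powr \<alpha>"
  shows "mem_Lp_loc (p / ennreal \<alpha>) (\<beta> \<circ> f)"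
  unfolding mem_Lp_loc_def
proof (intro allI impI)
  fix K :: "'a set" assume K: "compact K"
  have fK: "mem_Lp p (lebesgue_on K) f" using f K by (simp add: mem_Lp_loc_def)
  then have fm: "f \<in> borel_measurable (lebesgue_on K)" by (simp add: mem_Lp_def)
  have m: "\<beta> \<circ> f \<in> borel_measurable (lebesgue_on K)"
    using borel_measurable_continuous_on[OF \<beta>(1) fm] by (simp add: o_def)
  show "mem_Lp (p / ennreal \<alpha>) (lebesgue_on K) (\<beta> \<circ> f)"
  proof (cases "p = \<infinity>")
    case True
    then obtain B where B: "AE x in lebesgue_on K. \<bar>f x\<bar> \<le> B" using fK by (auto simp: mem_Lp_def)
    have "AE x in lebesgue_on K. \<bar>(\<beta> \<circ> f) x\<bar> \<le> 1 + B powr \<alpha>"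
      using B
    proof eventually_elim
      case (elim x)
      have "\<bar>f x\<bar> powr \<alpha> \<le> B powr \<alpha>" using elim \<alpha> by (intro powr_mono2) auto
      then show ?case using \<beta>(2)[of "f x"] by simp
    qed
    then show ?thesis using m True by (auto simp: mem_Lp_def divide_ennreal_top[simplified])
  next
    case False
    define q where "q = enn2real (p / ennreal \<alpha>)"
    have "integrable (lebesgue_on K) (\<lambda>x. \<bar>(\<beta> \<circ> f) x\<bar> powr q)"
    proof (rule Bochner_Integration.integrable_bound)
      have "integrable (lebesgue_on K) (\<lambda>x. \<bar>f x\<bar> powr (\<alpha> * q))"
        using fK False finite_exponent(2)[OF False \<alpha>] by (simp add: mem_Lp_def q_def)
      from integrable_mult_right[OF Bochner_Integration.integrable_add[OF compact_lebesgue_on(2)[OF K] this]]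
      show "integrable (lebesgue_on K) (\<lambda>x. 2 powr q * (1 + \<bar>f x\<bar> powr (\<alpha> * q)))" .
      show "(\<lambda>x. \<bar>(\<beta> \<circ> f) x\<bar> powr q) \<in> borel_measurable (lebesgue_on K)" using m by measurable
      have "q \<ge> 0" by (simp add: q_def)
      from growth_powr_le[OF \<beta>(2) this]
      have "norm (\<bar>(\<beta> \<circ> f) x\<bar> powr q) \<le> norm (2 powr q * (1 + \<bar>f x\<bar> powr (\<alpha> * q)))" for x
        by (simp add: order_trans[OF _ abs_ge_self])
      then show "AE x in lebesgue_on K. norm (\<bar>(\<beta> \<circ> f) x\<bar> powr q) \<le> norm (2 powr q * (1 + \<bar>f x\<bar> powr (\<alpha> * q)))"
        by (intro AE_I2)
    qed
    then show ?thesis using m finite_exponent(1)[OF False \<alpha>] by (simp add: mem_Lp_def q_def)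
  qed
qed

text \<open>For finite exponents continuity in time is sequential convergence in mean on compact
  sets, to which \<open>nemytskii\<close> applies because
  \<open>enn2real p = \<alpha> * q\<close>.\<close>

lemma cont_Lp_loc_composition:
  fixes u :: "real \<Rightarrow> 'a::euclidean_space \<Rightarrow> real" and \<beta> :: "real \<Rightarrow> real"
  assumes u: "cont_Lp_loc T p u" and p: "p \<noteq> \<infinity>" "1 \<le> p / ennreal \<alpha>" and \<alpha>: "\<alpha> > 0"
    and \<beta>: "continuous_on UNIV \<beta>" "\<And>r. \<bar>\<beta> r\<bar> \<le> 1 + \<bar>r\<bar> powr \<alpha>"
  shows "cont_Lp_loc T (p / ennreal \<alpha>) (\<lambda>t. \<beta> \<circ> u t)"
proof -
  define q where "q = enn2real (p / ennreal \<alpha>)"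
  have q: "q > 0" "enn2real p = \<alpha> * q" "p / ennreal \<alpha> \<noteq> \<infinity>"
    using one_le_enn2real[OF p(2)] finite_exponent[OF p(1) \<alpha>] by (auto simp: q_def)
  have ul: "mem_Lp_loc p (u t)" if "t \<in> {0..T}" for t using u that by (simp add: cont_Lp_loc_def)
  have "((\<lambda>s. LINT x|lebesgue_on K. \<bar>\<beta> (u s x) - \<beta> (u t x)\<bar> powr q) \<longlongrightarrow> 0) (at t within {0..T})"
    if t: "t \<in> {0..T}" and K: "compact K" for t K
    unfolding tendsto_at_iff_sequentially o_def
  proof (intro allI impI)
    fix X :: "nat \<Rightarrow> real" assume X: "\<forall>i. X i \<in> {0..T} - {t}" "X \<longlonglongrightarrow> t"
    have "((\<lambda>s. LINT x|lebesgue_on K. \<bar>u s x - u t x\<bar> powr (\<alpha> * q)) \<longlongrightarrow> 0) (at t within {0..T})"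
      using u t K p(1) by (simp add: cont_Lp_loc_def q(2))
    then have lim: "(\<lambda>n. LINT x|lebesgue_on K. \<bar>u (X n) x - u t x\<bar> powr (\<alpha> * q)) \<longlonglongrightarrow> 0"
      using X unfolding tendsto_at_iff_sequentially o_def by blast
    have mem: "u s \<in> borel_measurable (lebesgue_on K)" "integrable (lebesgue_on K) (\<lambda>x. \<bar>u s x\<bar> powr (\<alpha> * q))"
      if "s \<in> {0..T}" for s
      using ul[OF that] K p(1) by (auto simp: mem_Lp_loc_def mem_Lp_def q(2))
    show "(\<lambda>n. LINT x|lebesgue_on K. \<bar>\<beta> (u (X n) x) - \<beta> (u t x)\<bar> powr q) \<longlonglongrightarrow> 0"
      by (rule nemytskii[OF \<beta> \<alpha> q(1) compact_lebesgue_on(2)[OF K] _ _ _ _ lim]) (use X(1) t mem in auto)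
  qed
  then show ?thesis
    using q(3) mem_Lp_loc_composition[OF ul \<alpha> \<beta>] by (simp add: cont_Lp_loc_def q_def[symmetric])
qed

lemma compact_subset_cball_0:
  fixes K :: "'a::real_normed_vector set"
  assumes "compact K" obtains r where "K \<subseteq> cball 0 r"
proof -
  obtain r where "\<And>x. x \<in> K \<Longrightarrow> norm x \<le> r" using compact_imp_bounded[OF assms] unfolding bounded_iff by blast
  then have "K \<subseteq> cball 0 r" by (auto simp: mem_cball_0)
  then show thesis by (rule that)
qed

section \<open>From duality to composition with the inverse flow, and back\<close>

context backward_flow
begin

lemma composition_loc_integrable:
  fixes w :: "real ^ 'n \<Rightarrow> real"
  assumes t: "t \<in> {0..T}" and w: "w \<in> borel_measurable lebesgue" "\<And>K. compact K \<Longrightarrow> integrable lebesgue (\<lambda>x. indicator K x * w x)"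
    and K: "compact K"
  shows "integrable lebesgue (\<lambda>z. indicator K z * w (\<psi> t z))"
proof -
  obtain r where r: "K \<subseteq> cball 0 r" by (rule compact_subset_cball_0[OF K])
  have "integrable lebesgue (\<lambda>z. w (\<psi> t z) * indicator (cball 0 r) z)"
    by (rule composition_integrable(1)[OF t]) (rule w(2), simp)
  then show ?thesis
  proof (rule Bochner_Integration.integrable_bound)
    show "(\<lambda>z. indicator K z * w (\<psi> t z)) \<in> borel_measurable lebesgue"
      by (intro borel_measurable_times borel_measurable_indicator compact_lebesgue_on(1)[OF K] composition_measurable[OF t w(1)])
    show "AE z in lebesgue. norm (indicator K z * w (\<psi> t z)) \<le> norm (w (\<psi> t z) * indicator (cball 0 r) z)"
      using r by (intro AE_I2) (auto simp: indicator_def)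
  qed
qed

text \<open>The change of variables turns the right-hand side of the duality identity into a pairing
  of \<open>w \<circ> \<psi> t\<close> with \<open>f\<close>; bounded test functions of compact
  support then determine \<open>v\<close>.\<close>

lemma duality_identification:
  assumes t: "t \<in> {0..T}" and p: "1 \<le> p" and w: "mem_Lp_loc p w" and v: "mem_Lp_loc p v"
    and dual: "\<And>q f. 1 / p + 1 / q = 1 \<Longrightarrow> mem_Lp q lebesgue f \<Longrightarrow> compactly_supported f \<Longrightarrow>
      (LINT x|lebesgue. v x * f x) = (LINT x|lebesgue. w x * (f (\<Phi> t x) * J t x))"
  shows "AE x in lebesgue. v x = w (\<psi> t x)"
proof (rule AE_eq_of_tests)
  note wm = mem_Lp_loc_measurable[OF w] and wi = mem_Lp_loc_integrable[OF w p]
  show "v \<in> borel_measurable lebesgue" by (rule mem_Lp_loc_measurable[OF v])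
  show "integrable lebesgue (\<lambda>x. indicator K x * v x)" if "compact K" for K by (rule mem_Lp_loc_integrable[OF v p that])
  show "(\<lambda>x. w (\<psi> t x)) \<in> borel_measurable lebesgue" by (rule composition_measurable[OF t wm])
  show "integrable lebesgue (\<lambda>x. indicator K x * w (\<psi> t x))" if "compact K" for K
    by (rule composition_loc_integrable[OF t wm wi that])
  fix f :: "real ^ 'n \<Rightarrow> real" and r
  assume f: "f \<in> borel_measurable lebesgue" "\<And>x. \<bar>f x\<bar> \<le> 1" "\<And>x. x \<notin> cball 0 r \<Longrightarrow> f x = 0"
  obtain q where q: "1 / p + 1 / q = 1" using conjugate_exponent_exists[OF p] by blast
  have "mem_Lp q lebesgue f" by (rule mem_Lp_bounded[OF f(1,2) compact_cball f(3)])
  moreover have "compactly_supported f" using f(3) compact_cball unfolding compactly_supported_def by blast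
  ultimately show "(LINT x|lebesgue. v x * f x) = (LINT x|lebesgue. w (\<psi> t x) * f x)"
    using dual[OF q] flow_change_of_variables(2)[OF t, of w f] by simp
qed

lemma \<psi>_T [simp]: "\<psi> T z = z"
  using \<Phi>_\<psi>[of T z] T_pos by (simp add: top)

lemma weak_continuity_L_infinity:
  fixes g :: "real ^ 'n \<Rightarrow> real"
  assumes w: "mem_Lp_loc \<infinity> w" and g: "mem_Lp 1 lebesgue g" "compactly_supported g"
  shows "continuous_on {0..T} (\<lambda>t. LINT z|lebesgue. w (\<psi> t z) * g z)"
proof -
  obtain K where K: "compact K" "\<And>x. x \<notin> K \<Longrightarrow> g x = 0" using g(2) by (auto simp: compactly_supported_def)
  obtain r where r: "K \<subseteq> cball 0 r" by (rule compact_subset_cball_0[OF K(1)])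
  obtain B where B: "AE x in lebesgue. x \<in> W r \<longrightarrow> \<bar>w x\<bar> \<le> B" by (rule mem_Lp_loc_bound[OF w compact_cball])
  have "g \<in> borel_measurable lebesgue" "integrable lebesgue (\<lambda>x. \<bar>g x\<bar>)" using g(1) by (auto simp: mem_Lp_def)
  then have gi: "integrable lebesgue g" by (rule integrable_abs_cancel[rotated])
  have "g z = 0" if "z \<notin> cball 0 r" for z using that K(2) r by blast
  then show ?thesis by (rule weak_continuity[OF mem_Lp_loc_measurable[OF w] B gi])
qed

text \<open>The duality identity is required before \<open>T\<close> only. At \<open>T\<close> the
  equality is recovered from weak-star continuity of both sides, since \<open>\<psi> T\<close> is
  the identity.\<close>

lemma terminal_identification:
  assumes w: "mem_Lp_loc \<infinity> w" and u: "cont_Lp_loc T \<infinity> u"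
    and eq: "\<And>t. t \<in> {0..<T} \<Longrightarrow> AE x in lebesgue. u t x = w (\<psi> t x)"
  shows "AE x in lebesgue. u T x = w x"
proof (rule AE_eq_of_tests)
  have uT: "mem_Lp_loc \<infinity> (u T)" using u T_pos by (simp add: cont_Lp_loc_def)
  show "u T \<in> borel_measurable lebesgue" "w \<in> borel_measurable lebesgue" using uT w by (auto intro: mem_Lp_loc_measurable)
  show "integrable lebesgue (\<lambda>x. indicator K x * u T x)" "integrable lebesgue (\<lambda>x. indicator K x * w x)" if "compact K" for K
    using mem_Lp_loc_integrable[OF uT _ that] mem_Lp_loc_integrable[OF w _ that] by auto
  fix g :: "real ^ 'n \<Rightarrow> real" and r
  assume g: "g \<in> borel_measurable lebesgue" "\<And>x. \<bar>g x\<bar> \<le> 1" "\<And>x. x \<notin> cball 0 r \<Longrightarrow> g x = 0"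
  have g1: "mem_Lp 1 lebesgue g" by (rule mem_Lp_bounded[OF g(1,2) compact_cball g(3)])
  have gc: "compactly_supported g" using g(3) compact_cball unfolding compactly_supported_def by blast
  let ?F = "\<lambda>t. (LINT x|lebesgue. u t x * g x) - (LINT x|lebesgue. w (\<psi> t x) * g x)"
  have "continuous_on {0..T} (\<lambda>t. LINT x|lebesgue. u t x * g x)" using u g1 gc by (simp add: cont_Lp_loc_def)
  then have "continuous_on (closure {0..<T}) ?F"
    using weak_continuity_L_infinity[OF w g1 gc] T_pos by (simp add: continuous_on_diff)
  moreover have "?F t = 0" if "t \<in> {0..<T}" for t
  proof -
    have "AE x in lebesgue. u t x * g x = w (\<psi> t x) * g x" using eq[OF that] by eventually_elim simp
    from lebesgue_integral_AE_cong(2)[OF this] show ?thesis by simp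
  qed
  moreover have "T \<in> closure {0..<T}" using T_pos by simp
  ultimately have "?F T = 0" by (rule continuous_constant_on_closure)
  then show "(LINT x|lebesgue. u T x * g x) = (LINT x|lebesgue. w x * g x)" by simp
qed

text \<open>The representation of \<open>u s\<close> through \<open>\<psi> s\<close> persists under
  \<open>\<beta>\<close>, and reading the change of variables backwards gives the identity for every
  \<open>f\<close>, so exponents conjugate to \<open>p / ennreal \<alpha>\<close> never have to be
  examined. For \<open>p = \<infinity>\<close> continuity is obtained by exchanging
  \<open>\<beta> \<circ> u t\<close> for \<open>(\<beta> \<circ> w) \<circ> \<psi> t\<close> at
  every time.\<close>

lemma renormalized_duality:
  fixes \<beta> :: "real \<Rightarrow> real" and u :: "real \<Rightarrow> real ^ 'n \<Rightarrow> real"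
  assumes p: "1 \<le> p" "1 \<le> p / ennreal \<alpha>" and \<alpha>: "\<alpha> > 0"
    and \<beta>: "continuous_on UNIV \<beta>" "\<And>r. \<bar>\<beta> r\<bar> \<le> 1 + \<bar>r\<bar> powr \<alpha>"
    and w: "mem_Lp_loc p w" and u: "cont_Lp_loc T p u"
    and dual: "\<And>s q f. s \<in> {0..<T} \<Longrightarrow> 1 / p + 1 / q = 1 \<Longrightarrow> mem_Lp q lebesgue f \<Longrightarrow> compactly_supported f \<Longrightarrow>
      (LINT x|lebesgue. u s x * f x) = (LINT x|lebesgue. w x * (f (\<Phi> s x) * J s x))"
  shows "cont_Lp_loc T (p / ennreal \<alpha>) (\<lambda>t. \<beta> \<circ> u t)"
    and "s \<in> {0..<T} \<Longrightarrow> (LINT x|lebesgue. (\<beta> \<circ> u s) x * f x) = (LINT x|lebesgue. (\<beta> \<circ> w) x * (f (\<Phi> s x) * J s x))"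
proof -
  have ul: "mem_Lp_loc p (u t)" if "t \<in> {0..T}" for t using u that by (simp add: cont_Lp_loc_def)
  have eq: "AE x in lebesgue. u s x = w (\<psi> s x)" if s: "s \<in> {0..<T}" for s
    by (rule duality_identification[OF _ p(1) w]) (use s ul dual in auto)
  show "(LINT x|lebesgue. (\<beta> \<circ> u s) x * f x) = (LINT x|lebesgue. (\<beta> \<circ> w) x * (f (\<Phi> s x) * J s x))"
    if s: "s \<in> {0..<T}" for s f
  proof -
    have "AE x in lebesgue. (\<beta> \<circ> u s) x * f x = (\<beta> \<circ> w) (\<psi> s x) * f x" using eq[OF s] by eventually_elim simp
    from lebesgue_integral_AE_cong(2)[OF this] show ?thesis
      using flow_change_of_variables(2)[of s "\<beta> \<circ> w" f] s by simp
  qed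
  show "cont_Lp_loc T (p / ennreal \<alpha>) (\<lambda>t. \<beta> \<circ> u t)"
  proof (cases "p = \<infinity>")
    case False
    then show ?thesis by (rule cont_Lp_loc_composition[OF u _ p(2) \<alpha> \<beta>])
  next
    case True
    have w_inf: "mem_Lp_loc \<infinity> w" and u_inf: "cont_Lp_loc T \<infinity> u" using w u True by auto
    have \<beta>w: "mem_Lp_loc \<infinity> (\<beta> \<circ> w)" using mem_Lp_loc_composition[OF w_inf \<alpha> \<beta>] by (simp only: divide_ennreal_top)
    have \<beta>u: "mem_Lp_loc \<infinity> (\<beta> \<circ> u t)" if "t \<in> {0..T}" for t
      using mem_Lp_loc_composition[OF ul[OF that] \<alpha> \<beta>] True by (simp only: divide_ennreal_top)
    have eq': "AE x in lebesgue. u t x = w (\<psi> t x)" if "t \<in> {0..T}" for t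
      using eq[of t] terminal_identification[OF w_inf u_inf eq] that by (cases "t = T") auto
    have "continuous_on {0..T} (\<lambda>t. LINT x|lebesgue. (\<beta> \<circ> u t) x * g x)"
      if g: "mem_Lp 1 lebesgue g" "compactly_supported g" for g
    proof -
      have same: "(LINT x|lebesgue. (\<beta> \<circ> w) (\<psi> t x) * g x) = (LINT x|lebesgue. (\<beta> \<circ> u t) x * g x)" if "t \<in> {0..T}" for t
      proof (rule lebesgue_integral_AE_cong(2))
        show "AE x in lebesgue. (\<beta> \<circ> w) (\<psi> t x) * g x = (\<beta> \<circ> u t) x * g x" using eq'[OF that] by eventually_elim simp
      qed
      show ?thesis by (rule continuous_on_eq[OF weak_continuity_L_infinity[OF \<beta>w g] same])
    qed
    then have "cont_Lp_loc T \<infinity> (\<lambda>t. \<beta> \<circ> u t)" using \<beta>u by (simp add: cont_Lp_loc_def)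
    then show ?thesis by (simp only: True divide_ennreal_top)
  qed
qed

end

theorem theorem4p5:
  fixes T \<alpha> :: real
    and b :: "real \<Rightarrow> real ^ 'n \<Rightarrow> real ^ 'n"
    and C\<^sub>0 C\<^sub>1 :: "real \<Rightarrow> real"
    and p :: ennreal
    and u\<^sub>T :: "real ^ 'n \<Rightarrow> real"
    and u :: "real \<Rightarrow> real ^ 'n \<Rightarrow> real"
    and \<beta> :: "real \<Rightarrow> real"
  assumes "T > 0"
    and "(\<lambda>(t, x). b t x) \<in> borel_measurable (lebesgue_on ({0..T} \<times> UNIV))"
    and "\<And>t. t \<in> {0..T} \<Longrightarrow> 0 \<le> C\<^sub>0 t"
    and "\<And>t. t \<in> {0..T} \<Longrightarrow> 0 \<le> C\<^sub>1 t"
    and "integrable (lebesgue_on {0..T}) C\<^sub>0"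
    and "integrable (lebesgue_on {0..T}) C\<^sub>1"
    and "\<And>t x. t \<in> {0..T} \<Longrightarrow> norm (b t x) \<le> C\<^sub>0 t * (1 + norm x)"
    and "\<And>t x y. t \<in> {0..T} \<Longrightarrow> (b t x - b t y) \<bullet> (x - y) \<ge> - C\<^sub>1 t * (norm (x - y))\<^sup>2"
    and "1 \<le> p"
    and "mem_Lp_loc p u\<^sub>T"
    and "is_duality_solution T b p u\<^sub>T u"
    and "smooth_real \<beta>"
    and "\<alpha> > 0"
    and "p / ennreal \<alpha> \<ge> 1"
    and "\<And>r. \<bar>\<beta> r\<bar> \<le> 1 + \<bar>r\<bar> powr \<alpha>"
  shows "is_duality_solution T b (p / ennreal \<alpha>) (\<beta> \<circ> u\<^sub>T) (\<lambda>t. \<beta> \<circ> u t)"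
proof -
  interpret field: one_sided_field T b C\<^sub>0 C\<^sub>1 by unfold_locales (fact assms)+
  interpret flow: backward_flow T field.L "\<lambda>t. filippov_flow b t T"
    by unfold_locales
      (use assms(1) field.L_ge_1 field.flow_continuous field.flow_T field.flow_lipschitz field.flow_growth
        field.flow_proper field.flow_surj field.flow_connected_fibre in auto)
  \<comment> \<open>The Jacobian in the good solution is that of the flow from \<open>T\<close> back
    to \<open>s\<close>, with its sign; this is exactly the \<open>J\<close> of the interpreted
    locale.\<close>
  have J: "good_solution b s f T x = f (filippov_flow b s T x) * flow.J s x" for s f x
    by (simp add: good_solution_def flow_jacobian_def flow.J_def)
  note \<beta> = smooth_real_continuous[OF assms(12)] assms(15)
  have u: "cont_Lp_loc T p u" and dual: "\<And>s q f. s \<in> {0..<T} \<Longrightarrow> 1 / p + 1 / q = 1 \<Longrightarrow> mem_Lp q lebesgue f \<Longrightarrow>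
      compactly_supported f \<Longrightarrow> (LINT x|lebesgue. u s x * f x) =
        (LINT x|lebesgue. u\<^sub>T x * (f (filippov_flow b s T x) * flow.J s x))"
    using assms(11) unfolding is_duality_solution_def J by blast+
  note renormalized = flow.renormalized_duality[OF assms(9,14,13) \<beta> assms(10) u]
  have "cont_Lp_loc T (p / ennreal \<alpha>) (\<lambda>t. \<beta> \<circ> u t)"
    by (rule renormalized(1), rule dual, assumption+)
  moreover have "(LINT x|lebesgue. (\<beta> \<circ> u s) x * f x) =
      (LINT x|lebesgue. (\<beta> \<circ> u\<^sub>T) x * (f (filippov_flow b s T x) * flow.J s x))" if "s \<in> {0..<T}" for s f
    by (rule renormalized(2)[OF _ that], rule dual, assumption+)
  ultimately show ?thesis
    unfolding is_duality_solution_def J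
    using mem_Lp_loc_composition[OF assms(10,13) \<beta>] by blast
qed

end
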